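(* Let $G$ be a planar graph. The following conditions are equivalent: (i) $G$ is a Laman graph; (ii) generically, $G$ is minimally rigid; (iii) $G$ can be embedded as a pointed pseudo-triangulation.
   Context: Graphs are finite and simple, with $n\ge 2$ vertices. A Laman graph is a graph with $n$ vertices and exactly $2n-3$ edges such that every subset of $k\ge 2$ vertices spans at most $2k-3$ edges. $G$ is generically minimally rigid if, on a generic set of points $p_1,\dots,p_n\in\mathbb{R}^2$, the bar framework with bars $p_ip_j$ ($ij\in E$) is infinitesimally rigid in the plane, and the removal of any edge destroys this property. An embedding $G(P)$ of $G=(V,E)$, $V=\{1,\dots,n\}$, on a set of points $P=\{p_1,\dots,p_n\}\subset\mathbb{R}^2$ maps vertex $i$ to $p_i$ (distinct points) and each edge $ij$ to the straight line segment $p_ip_j$. It is non-crossing if segments of edges without a common endpoint are disjoint and segments of two edges sharing an endpoint meet only there. A graph is planar if it has a non-crossing embedding. A vertex is pointed in a non-crossing embedding if some angle at it, between two (circularly) consecutive incident edges, is larger than $\pi$ (a vertex of degree one has a single angle $2\pi$). A pseudo-triangle is a simple polygon with exactly three convex vertices (interior angle less than $\pi$). A pseudo-triangulation is a non-crossing embedded graph $G(P)$ whose outer face is convex (the edges incident to the outer face form the boundary of the convex hull of $P$) and all of whose interior faces are pseudo-triangles. It is a pointed pseudo-triangulation if all its vertices are pointed. *)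

theory Defs
  imports "HOL-Analysis.Analysis" "HOL-Library.Poly_Mapping"
begin

text \<open>
  The Euclidean plane is the type \<^typ>\<open>complex\<close>, with its library inner product
  \<open>x \<bullet> y = Re x * Re y + Im x * Im y\<close>. A graph is given by a vertex set \<open>V\<close> and a set \<open>E\<close> of
  two-element subsets of \<open>V\<close>.
\<close>

definition simple_graph :: "'a set \<Rightarrow> 'a set set \<Rightarrow> bool" where
  "simple_graph V E \<longleftrightarrow> finite V \<and> card V \<ge> 2 \<and> (\<forall>e\<in>E. e \<subseteq> V \<and> card e = 2)"

definition laman :: "'a set \<Rightarrow> 'a set set \<Rightarrow> bool" where
  "laman V E \<longleftrightarrow> card E = 2 * card V - 3 \<and>
     (\<forall>W\<subseteq>V. card W \<ge> 2 \<longrightarrow> card {e\<in>E. e \<subseteq> W} \<le> 2 * card W - 3)"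


section \<open>Rigidity\<close>

definition infinitesimal_motion :: "'a set set \<Rightarrow> ('a \<Rightarrow> complex) \<Rightarrow> ('a \<Rightarrow> complex) \<Rightarrow> bool" where
  "infinitesimal_motion E p v \<longleftrightarrow> (\<forall>i j. {i, j} \<in> E \<longrightarrow> (p i - p j) \<bullet> (v i - v j) = 0)"

text \<open>
  The velocity fields of the rigid motions of the plane: a translation with velocity \<open>a\<close> plus a
  rotation with angular velocity \<open>\<omega>\<close> (multiplication by \<open>\<i>\<close> is the rotation by \<open>pi / 2\<close>).
\<close>
definition trivial_motion :: "'a set \<Rightarrow> ('a \<Rightarrow> complex) \<Rightarrow> ('a \<Rightarrow> complex) \<Rightarrow> bool" where
  "trivial_motion V p v \<longleftrightarrow> (\<exists>a \<omega>. \<forall>i\<in>V. v i = a + complex_of_real \<omega> * \<i> * p i)"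

definition infinitesimally_rigid :: "'a set \<Rightarrow> 'a set set \<Rightarrow> ('a \<Rightarrow> complex) \<Rightarrow> bool" where
  "infinitesimally_rigid V E p \<longleftrightarrow>
     (\<forall>v. infinitesimal_motion E p v \<longrightarrow> trivial_motion V p v)"

text \<open>
  A polynomial in variables of type \<open>'x\<close> with rational coefficients is a finitely supported map
  from monomials to coefficients, a monomial being a finitely supported map from variables to
  exponents.
\<close>
definition eval_poly_rat :: "(('x \<Rightarrow>\<^sub>0 nat) \<Rightarrow>\<^sub>0 rat) \<Rightarrow> ('x \<Rightarrow> real) \<Rightarrow> real" where
  "eval_poly_rat q x = (\<Sum>m\<in>Poly_Mapping.keys q. of_rat (Poly_Mapping.lookup q m) *
     (\<Prod>i\<in>Poly_Mapping.keys m. x i ^ Poly_Mapping.lookup m i))"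

definition algebraically_independent_rat :: "'x set \<Rightarrow> ('x \<Rightarrow> real) \<Rightarrow> bool" where
  "algebraically_independent_rat I x \<longleftrightarrow>
     (\<forall>q :: ('x \<Rightarrow>\<^sub>0 nat) \<Rightarrow>\<^sub>0 rat.
        q \<noteq> 0 \<and> (\<forall>m\<in>Poly_Mapping.keys q. Poly_Mapping.keys m \<subseteq> I) \<longrightarrow> eval_poly_rat q x \<noteq> 0)"

text \<open>Genericity: the \<open>2 * card V\<close> coordinates are algebraically independent over the rationals.\<close>
definition generic_points :: "'a set \<Rightarrow> ('a \<Rightarrow> complex) \<Rightarrow> bool" where
  "generic_points V p \<longleftrightarrow>
     algebraically_independent_rat (V <+> V) (case_sum (\<lambda>i. Re (p i)) (\<lambda>i. Im (p i)))"

definition generically_minimally_rigid :: "'a set \<Rightarrow> 'a set set \<Rightarrow> bool" where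
  "generically_minimally_rigid V E \<longleftrightarrow>
     (\<forall>p. generic_points V p \<longrightarrow>
        infinitesimally_rigid V E p \<and> (\<forall>e\<in>E. \<not> infinitesimally_rigid V (E - {e}) p))"


section \<open>Straight-line embeddings\<close>

text \<open>
  \<open>convex hull (p ` e)\<close> is the segment that represents the edge \<open>e\<close>; for edges \<open>e \<noteq> f\<close> the
  set \<open>p ` (e \<inter> f)\<close> is empty or consists of the image of the common endpoint.
\<close>
definition noncrossing_embedding :: "'a set \<Rightarrow> 'a set set \<Rightarrow> ('a \<Rightarrow> complex) \<Rightarrow> bool" where
  "noncrossing_embedding V E p \<longleftrightarrow> inj_on p V \<and>
     (\<forall>e\<in>E. \<forall>f\<in>E. e \<noteq> f \<longrightarrow> convex hull (p ` e) \<inter> convex hull (p ` f) = p ` (e \<inter> f))"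

definition planar_graph :: "'a set \<Rightarrow> 'a set set \<Rightarrow> bool" where
  "planar_graph V E \<longleftrightarrow> (\<exists>p. noncrossing_embedding V E p)"

definition drawing :: "'a set \<Rightarrow> 'a set set \<Rightarrow> ('a \<Rightarrow> complex) \<Rightarrow> complex set" where
  "drawing V E p = p ` V \<union> (\<Union>e\<in>E. convex hull (p ` e))"

text \<open>
  The counterclockwise angle from direction \<open>u\<close> to direction \<open>w\<close> (both nonzero), normalised to lie
  in \<open>{0<..2 * pi}\<close>; in particular the angle from a direction to itself is the full turn.
\<close>
definition ccw_angle :: "complex \<Rightarrow> complex \<Rightarrow> real" where
  "ccw_angle u w = (if Arg2pi (w / u) = 0 then 2 * pi else Arg2pi (w / u))"

text \<open>
  The edge \<open>{v, k}\<close> is the first one met when turning counterclockwise around \<open>v\<close> from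
  \<open>{v, j}\<close>. At a vertex of degree one this holds with \<open>j = k\<close>, and the angle is \<open>2 * pi\<close>.
\<close>
definition consecutive_at :: "'a set set \<Rightarrow> ('a \<Rightarrow> complex) \<Rightarrow> 'a \<Rightarrow> 'a \<Rightarrow> 'a \<Rightarrow> bool" where
  "consecutive_at E p v j k \<longleftrightarrow> {v, j} \<in> E \<and> {v, k} \<in> E \<and>
     (\<forall>l. {v, l} \<in> E \<longrightarrow>
        ccw_angle (p j - p v) (p k - p v) \<le> ccw_angle (p j - p v) (p l - p v))"

definition pointed_at :: "'a set set \<Rightarrow> ('a \<Rightarrow> complex) \<Rightarrow> 'a \<Rightarrow> bool" where
  "pointed_at E p v \<longleftrightarrow>
     (\<exists>j k. consecutive_at E p v j k \<and> ccw_angle (p j - p v) (p k - p v) > pi)"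


section \<open>Pseudo-triangulations\<close>

text \<open>
  A polygon with vertices \<open>x 0, \<dots>, x (k - 1)\<close> (in this cyclic order) is the drawing of the
  cycle on \<open>{..<k}\<close>; it is simple when this drawing is non-crossing.
\<close>
definition cycle_edges :: "nat \<Rightarrow> nat set set" where
  "cycle_edges k = (\<lambda>i. {i, (i + 1) mod k}) ` {..<k}"

definition simple_polygon :: "nat \<Rightarrow> (nat \<Rightarrow> complex) \<Rightarrow> bool" where
  "simple_polygon k x \<longleftrightarrow> k \<ge> 3 \<and> noncrossing_embedding {..<k} (cycle_edges k) x"

definition polygon_interior :: "nat \<Rightarrow> (nat \<Rightarrow> complex) \<Rightarrow> complex set" where
  "polygon_interior k x = inside (drawing {..<k} (cycle_edges k) x)"

text \<open>
  The two sides at \<open>x i\<close> bound two angles, \<open>\<theta>\<close> and \<open>2 * pi - \<theta>\<close>. The interior angle is the one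
  whose bisector starts out into the interior of the polygon; \<open>a * cis (\<theta> / 2)\<close> is the direction
  of the bisector of the angle \<open>\<theta>\<close>. No orientation of the polygon is assumed.
\<close>
definition interior_angle :: "nat \<Rightarrow> (nat \<Rightarrow> complex) \<Rightarrow> nat \<Rightarrow> real" where
  "interior_angle k x i =
     (let a = x ((i + 1) mod k) - x i;
          b = x ((i + k - 1) mod k) - x i;
          \<theta> = ccw_angle a b
      in if \<forall>\<^sub>F t in at_right 0. x i + complex_of_real t * (a * cis (\<theta> / 2)) \<in> polygon_interior k x
         then \<theta> else 2 * pi - \<theta>)"

text \<open>Here a pseudo-triangle is represented by its open interior region.\<close>
definition pseudo_triangle :: "complex set \<Rightarrow> bool" where
  "pseudo_triangle F \<longleftrightarrow>
     (\<exists>k x. simple_polygon k x \<and> F = polygon_interior k x \<and>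
        card {i. i < k \<and> interior_angle k x i < pi} = 3)"

definition interior_faces :: "'a set \<Rightarrow> 'a set set \<Rightarrow> ('a \<Rightarrow> complex) \<Rightarrow> complex set set" where
  "interior_faces V E p = {F \<in> components (- drawing V E p). bounded F}"

text \<open>For a finite graph this is the unique unbounded component of the complement of the drawing.\<close>
definition outer_face :: "'a set \<Rightarrow> 'a set set \<Rightarrow> ('a \<Rightarrow> complex) \<Rightarrow> complex set" where
  "outer_face V E p = outside (drawing V E p)"

definition outer_edges :: "'a set \<Rightarrow> 'a set set \<Rightarrow> ('a \<Rightarrow> complex) \<Rightarrow> 'a set set" where
  "outer_edges V E p = {e\<in>E. convex hull (p ` e) \<subseteq> frontier (outer_face V E p)}"

text \<open>
  If all points are collinear, the frontier of their convex hull is the hull itself. So the drawing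
  of the single edge on two vertices counts as a pseudo-triangulation (without interior faces).
\<close>
definition pseudo_triangulation :: "'a set \<Rightarrow> 'a set set \<Rightarrow> ('a \<Rightarrow> complex) \<Rightarrow> bool" where
  "pseudo_triangulation V E p \<longleftrightarrow> noncrossing_embedding V E p \<and>
     (\<Union>e\<in>outer_edges V E p. convex hull (p ` e)) = frontier (convex hull (p ` V)) \<and>
     (\<forall>F\<in>interior_faces V E p. pseudo_triangle F)"

definition pointed_pseudo_triangulation :: "'a set \<Rightarrow> 'a set set \<Rightarrow> ('a \<Rightarrow> complex) \<Rightarrow> bool" where
  "pointed_pseudo_triangulation V E p \<longleftrightarrow>
     pseudo_triangulation V E p \<and> (\<forall>v\<in>V. pointed_at E p v)"

end

(*
 Rigidity of a Laman graph is witnessed by one stress-free placement, since full rank of the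
 rigidity matrix is the nonvanishing of a polynomial, which then holds at generic points.
 Pointed drawings are stress-free: by Maxwell and Cremona, an equilibrium stress lifts the drawing
 to a continuous piecewise linear function of bounded support, written here with winding numbers.
 At an extreme point of the set where it is maximal, pointedness gives a half-disc on which it is
 affine, so it vanishes. A planar Laman graph has a pointed drawing in general position by
 induction: the combinatorial embedding has an edge of a triangle that can be contracted to a
 smaller planar Laman graph, and the contracted vertex can be split again by a small motion.
 Pointedness leaves card (nbrs v) - 1 convex angles at each vertex v, hence 3 card V - 6 in total; each of
 the at least card V - 2 bounded faces needs three, so all of them are pseudo-triangles. The same count and
 Euler's formula turn a pointed pseudo-triangulation back into a Laman graph.
*)
theory Submission
 imports Defs
begin

section \<open>Graphs, flows and face counts\<close>

text \<open>Planarity enters the combinatorial half as a homological condition: every real flow is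
  the coboundary of a function on the orbits of the face permutation. Winding numbers provide such
  functions for a drawing and take the place of the Jordan curve theorem. Being linear, the
  condition passes to induced subgraphs and to contractions, and a comparison of dimensions yields
  the lower bound on the number of faces. The obstacle is the choice of the edge. Contracting
  \<open>ab\<close> in a facial triangle \<open>abc\<close> removes one vertex and two edges, so the
  counts can fail only at a tight set containing \<open>a\<close> and \<open>b\<close> but not
  \<open>c\<close>. A maximal such set has a connected complement, which therefore occupies a single
  face of the induced subgraph; all its other faces are faces of the whole graph, so the search can
  continue inside. For the reverse step general position, pointedness by half-planes and cyclic
  order by triples are open conditions, stable under a small move of the split vertex; the splitting
  direction is chosen for the few comparisons that degenerate when it merges with its
  partner.\<close>

lemma homogeneous_nontrivial:
 fixes a :: "'j => 'i => real"
 assumes "finite J" "finite I" "card J < card I"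
 shows "\<exists>x. (\<exists>i\<in>I. x i ~= 0) & (\<forall>j\<in>J. (\<Sum>i\<in>I. a j i * x i) = 0)"
 using assms
proof (induction J arbitrary: I a rule: finite_induct)
 case empty
 then have "I ~= {}" by auto
 then show ?case by (intro exI[of _ "%_. 1"]) auto
next
 case (insert j J)
 show ?case
 proof (cases "\<forall>i\<in>I. a j i = 0")
  case True
  have "card J < card I" using insert by auto
  from insert.IH[OF insert.prems(1) this] obtain x where
   "\<exists>i\<in>I. x i ~= 0" "\<forall>j\<in>J. (\<Sum>i\<in>I. a j i * x i) = 0" by blast
  then show ?thesis using True by (intro exI[of _ x]) auto
 next
  case False
  then obtain k where k: "k \<in> I" "a j k ~= 0" by auto
  define b where "b j' i = a j' i - a j' k * a j i / a j k" for j' i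
  have "finite (I - {k})" "card J < card (I - {k})" using insert k by auto
  from insert.IH[OF this, of b] obtain x where
   x: "\<exists>i\<in>I - {k}. x i ~= 0" "\<forall>j\<in>J. (\<Sum>i\<in>I - {k}. b j i * x i) = 0" by blast
  define s where "s = (\<Sum>i\<in>I - {k}. a j i * x i)"
  define y where "y = x(k := - s / a j k)"
  have split: "(\<Sum>i\<in>I. a j' i * y i) = a j' k * y k + (\<Sum>i\<in>I - {k}. a j' i * x i)" for j'
   using insert.prems(1) k(1) by (subst sum.remove[of I k]) (auto simp: y_def intro!: sum.cong)
  have "(\<Sum>i\<in>I. a j i * y i) = 0"
   unfolding split using k by (simp add: y_def s_def)
  moreover have "(\<Sum>i\<in>I. a j' i * y i) = 0" if "j' \<in> J" for j'
  proof -
   have "0 = (\<Sum>i\<in>I - {k}. b j' i * x i)" using x(2) that by auto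
   also have "\<dots> = (\<Sum>i\<in>I - {k}. a j' i * x i - a j' k / a j k * (a j i * x i))"
    by (rule sum.cong) (auto simp: b_def field_simps)
   also have "\<dots> = (\<Sum>i\<in>I - {k}. a j' i * x i) - a j' k / a j k * s"
    by (simp add: sum_subtractf s_def sum_distrib_left)
   finally show ?thesis unfolding split by (simp add: y_def)
  qed
  moreover have "\<exists>i\<in>I. y i ~= 0" using x(1) by (auto simp: y_def)
  ultimately show ?thesis by auto
 qed
qed

definition nbrs :: "'a set set => 'a => 'a set" where
 "nbrs E v = {j. {v, j} \<in> E}"

definition darts :: "'a set set => ('a \<times> 'a) set" where
 "darts E = {(v, j). {v, j} \<in> E}"

definition induced :: "'a set set => 'a set => 'a set set" where
 "induced E X = {e \<in> E. e <= X}"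

text \<open>Connectedness by cuts instead of paths: every use either takes an edge leaving a set of
  vertices or refutes a set that no edge leaves.\<close>

definition conn :: "'a set => 'a set set => bool" where
 "conn V E \<longleftrightarrow> (\<forall>K\<subseteq>V. K ~= {} --> K ~= V --> (\<exists>x\<in>K. \<exists>y\<in>V - K. {x, y} \<in> E))"

text \<open>The real cycle space: antisymmetric along edges, with zero divergence at every vertex.
  Values off the edges are unconstrained.\<close>

definition flow :: "'a set => 'a set set => ('a => 'a => real) => bool" where
 "flow V E \<omega> \<longleftrightarrow> (\<forall>v j. {v, j} \<in> E --> \<omega> j v = - \<omega> v j) & (\<forall>v\<in>V. (\<Sum>j\<in>nbrs E v. \<omega> v j) = 0)"

lemma mem_nbrs: "j \<in> nbrs E v \<longleftrightarrow> {v, j} \<in> E"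
 by (simp add: nbrs_def)

lemma mem_darts: "(v, j) \<in> darts E \<longleftrightarrow> {v, j} \<in> E"
 by (simp add: darts_def)

lemma darts_sym: "(v, j) \<in> darts E \<longleftrightarrow> (j, v) \<in> darts E"
 by (simp add: darts_def insert_commute)

lemma induced_nbrs: "v \<in> X ==> nbrs (induced E X) v = nbrs E v \<inter> X"
 by (auto simp: nbrs_def induced_def)

locale sgraph =
 fixes V :: "'a set" and E :: "'a set set"
 assumes finV: "finite V" and edge_sub: "e \<in> E ==> e <= V" and edge_card: "e \<in> E ==> card e = 2"
begin

lemma finE: "finite E"
 by (rule finite_subset[of _ "Pow V"]) (auto dest: edge_sub simp: finV)

lemma edgeD: "{v, j} \<in> E ==> v \<in> V & j \<in> V & v ~= j"
 using edge_sub[of "{v,j}"] edge_card[of "{v,j}"] by (auto simp: card_insert_if split: if_splits)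

lemma edge_ex: assumes "e \<in> E" obtains v j where "e = {v, j}" "v ~= j"
 using edge_card[OF assms] by (auto simp: card_2_iff)

lemma nbrs_sub: "nbrs E v <= V"
 by (auto simp: nbrs_def dest: edgeD)

lemma fin_nbrs [simp]: "finite (nbrs E v)"
 using finV nbrs_sub finite_subset by blast

lemma nbrs_irrefl: "v ~: nbrs E v"
 unfolding mem_nbrs using edgeD[of v v] by blast

lemma darts_Sigma: "darts E = Sigma V (nbrs E)"
 by (auto simp: darts_def nbrs_def dest: edgeD)

lemma fin_darts [simp]: "finite (darts E)"
 by (simp add: darts_Sigma finV)

lemma sum_darts: "(\<Sum>d\<in>darts E. g (fst d) (snd d)) = (\<Sum>v\<in>V. \<Sum>j\<in>nbrs E v. g v j)"
 unfolding darts_Sigma by (subst sum.Sigma) (auto simp: finV case_prod_beta)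

lemma sum_nbrs_cong:
 "(!!v j. {v, j} \<in> E ==> g v j = h v j) ==> (\<Sum>v\<in>V. \<Sum>j\<in>nbrs E v. g v j) = (\<Sum>v\<in>V. \<Sum>j\<in>nbrs E v. h v j)"
 by (intro sum.cong) (auto simp: mem_nbrs)

lemma sum_darts_swap: "(\<Sum>v\<in>V. \<Sum>j\<in>nbrs E v. g v j) = (\<Sum>v\<in>V. \<Sum>j\<in>nbrs E v. g j v)"
 unfolding sum_darts[symmetric]
 by (rule sum.reindex_bij_witness[of _ prod.swap prod.swap]) (auto simp: darts_sym)

lemma sum_darts_edges: "(\<Sum>v\<in>V. \<Sum>j\<in>nbrs E v. g {v, j}) = 2 * (\<Sum>e\<in>E. g e :: real)"
proof -
 have "(\<Sum>d\<in>darts E. g {fst d, snd d}) = (\<Sum>e\<in>E. \<Sum>d\<in>{d \<in> darts E. {fst d, snd d} = e}. g {fst d, snd d})"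
  by (rule sum.group[symmetric]) (auto simp: finE mem_darts)
 also have "\<dots> = (\<Sum>e\<in>E. 2 * g e)"
 proof (rule sum.cong[OF refl])
  fix e assume e: "e \<in> E"
  then obtain v j where vj: "e = {v, j}" "v ~= j" by (rule edge_ex)
  have "{d \<in> darts E. {fst d, snd d} = e} = {(v, j), (j, v)}"
   using vj e by (auto simp: darts_def doubleton_eq_iff insert_commute)
  then show "(\<Sum>d\<in>{d \<in> darts E. {fst d, snd d} = e}. g {fst d, snd d}) = 2 * g e"
   using vj by (simp add: insert_commute)
 qed
 finally show ?thesis
  using sum_darts[of "%v j. g {v, j}"] by (simp add: sum_distrib_left)
qed

lemma sum_deg: "(\<Sum>v\<in>V. card (nbrs E v)) = 2 * card E"
proof -
 have "real (\<Sum>v\<in>V. card (nbrs E v)) = real (2 * card E)"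
  using sum_darts_edges[of "%_. 1"] by simp
 then show ?thesis by (simp only: of_nat_eq_iff)
qed

lemma card_darts: "card (darts E) = 2 * card E"
 unfolding darts_Sigma by (subst card_SigmaI) (auto simp: finV sum_deg)

text \<open>Summation by parts: flows are orthogonal to gradients. The second form follows from the
  first by reversing all darts.\<close>

lemma flow_potential:
 assumes "flow V E \<omega>"
 shows "(\<Sum>v\<in>V. \<Sum>j\<in>nbrs E v. \<omega> v j * g v) = 0" "(\<Sum>v\<in>V. \<Sum>j\<in>nbrs E v. \<omega> v j * g j) = 0"
proof -
 have *: "(\<Sum>v\<in>V. \<Sum>j\<in>nbrs E v. \<omega> v j * g v) = 0" for g
  using assms by (intro sum.neutral) (auto simp: flow_def sum_distrib_right[symmetric])
 then show "(\<Sum>v\<in>V. \<Sum>j\<in>nbrs E v. \<omega> v j * g v) = 0" .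
 have "(\<Sum>v\<in>V. \<Sum>j\<in>nbrs E v. \<omega> v j * g j) = (\<Sum>v\<in>V. \<Sum>j\<in>nbrs E v. \<omega> j v * g v)"
  by (rule sum_darts_swap)
 also have "\<dots> = (\<Sum>v\<in>V. \<Sum>j\<in>nbrs E v. \<omega> v j * (- g v))"
  using assms by (intro sum.cong) (auto simp: flow_def mem_nbrs)
 finally show "(\<Sum>v\<in>V. \<Sum>j\<in>nbrs E v. \<omega> v j * g j) = 0" using * by (simp add: sum_negf)
qed

lemma sgraph_induced: "X <= V ==> sgraph X (induced E X)"
 using finV finite_subset edge_card by unfold_locales (auto simp: induced_def)

lemma tail_ex:
 obtains t :: "'a set => 'a" where "!!e. e \<in> E ==> t e \<in> e"
proof (rule that)
 show "e \<in> E ==> (SOME x. x \<in> e) \<in> e" for e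
  using edge_card[of e] by (metis card.empty some_in_eq zero_neq_numeral)
qed

text \<open>A flow orthogonal to all coboundaries of face functions vanishes when every flow is such a
 coboundary; counting unknowns and equations bounds the number of faces from below.\<close>
lemma many_faces:
 fixes f :: "'a \<times> 'a => 'f"
 assumes V: "V ~= {}" and F: "finite F"
  and cob: "!!\<omega>. flow V E \<omega> ==> \<exists>c. (\<forall>x. x ~: F --> c x = 0) & (\<forall>v j. {v, j} \<in> E --> \<omega> v j = c (f (v, j)) - c (f (j, v)))"
 shows "card E + 1 <= card F + card V"
proof (rule ccontr)
 assume "\<not> card E + 1 <= card F + card V"
 then have less: "card F + card V < card E + 1" by simp
 obtain v0 where v0: "v0 \<in> V" using V by auto
 obtain t where t: "!!e. e \<in> E ==> t e \<in> e" using tail_ex by blast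
 \<comment> \<open>Each edge is oriented away from its chosen endpoint \<open>t e\<close>;
   \<open>sg\<close> turns a function on unoriented edges into an antisymmetric one on
   darts.\<close>
 define sg where "sg v e = (if v = t e then 1 else -1 :: real)" for v and e :: "'a set"
 have sg_anti: "sg j {v, j} = - sg v {v, j}" if "{v, j} \<in> E" for v j
  using t[OF that] edgeD[OF that] by (auto simp: sg_def)
 \<comment> \<open>The equations are zero divergence at every vertex except \<open>v0\<close>, and
   orthogonality to the indicator of each face. The equation at \<open>v0\<close> is implied, since
   antisymmetry makes all divergences sum to zero; omitting it gains the \<open>+ 1\<close>.\<close>
 define a where "a r e = (case r of Inl v => if v \<in> e then sg v e else 0
   | Inr x => (\<Sum>d\<in>{d \<in> darts E. {fst d, snd d} = e}. sg (fst d) e * (if f d = x then 1 else 0)))" for r e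
 have "card ((V - {v0}) <+> F) < card E"
  using less v0 finV F V card_gt_0_iff[of V] by (subst card_Plus) auto
 then obtain x where x: "\<exists>e\<in>E. x e ~= 0" "\<forall>r\<in>(V - {v0}) <+> F. (\<Sum>e\<in>E. a r e * x e) = 0"
  using homogeneous_nontrivial[of "(V - {v0}) <+> F" E a] finE finV F by auto
 define \<omega> where "\<omega> v j = sg v {v, j} * x {v, j}" for v j
 have anti: "\<omega> j v = - \<omega> v j" if "{v, j} \<in> E" for v j
  using sg_anti[OF that] by (simp add: \<omega>_def insert_commute)
 have div: "(\<Sum>j\<in>nbrs E v. \<omega> v j) = (\<Sum>e\<in>E. a (Inl v) e * x e)" for v
 proof -
  have "(\<Sum>e\<in>E. a (Inl v) e * x e) = (\<Sum>e\<in>{e\<in>E. v \<in> e}. sg v e * x e)"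
   by (rule sum.mono_neutral_cong_right) (auto simp: finE a_def)
  also have "{e\<in>E. v \<in> e} = (%j. {v, j}) ` nbrs E v"
  proof (intro equalityI subsetI)
   fix e assume e: "e \<in> {e\<in>E. v \<in> e}"
   then obtain x y where "e = {x, y}" "x ~= y" using edge_ex[of e] by blast
   with e show "e \<in> (%j. {v, j}) ` nbrs E v" by (auto simp: mem_nbrs insert_commute)
  qed (auto simp: mem_nbrs)
  also have "(\<Sum>e\<in>(%j. {v, j}) ` nbrs E v. sg v e * x e) = (\<Sum>j\<in>nbrs E v. \<omega> v j)"
   by (subst sum.reindex) (auto simp: inj_on_def doubleton_eq_iff \<omega>_def)
  finally show ?thesis by simp
 qed
 have div0: "(\<Sum>j\<in>nbrs E v. \<omega> v j) = 0" if "v \<in> V" "v ~= v0" for v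
  using x(2) that by (auto simp: div)
 have "(\<Sum>v\<in>V. \<Sum>j\<in>nbrs E v. \<omega> v j) = (\<Sum>v\<in>V. \<Sum>j\<in>nbrs E v. \<omega> j v)"
  by (rule sum_darts_swap)
 also have "\<dots> = - (\<Sum>v\<in>V. \<Sum>j\<in>nbrs E v. \<omega> v j)"
  unfolding sum_negf[symmetric] by (intro sum.cong refl anti) (simp add: mem_nbrs)
 finally have "(\<Sum>v\<in>V. \<Sum>j\<in>nbrs E v. \<omega> v j) = 0" by simp
 then have "(\<Sum>j\<in>nbrs E v0. \<omega> v0 j) = 0"
  using v0 finV div0 by (subst (asm) sum.remove[of V v0]) auto
 then have fl: "flow V E \<omega>" using anti div0 by (auto simp: flow_def)
 from cob[OF fl] obtain c where c: "\<forall>x. x ~: F --> c x = 0"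
  "!!v j. {v, j} \<in> E ==> \<omega> v j = c (f (v, j)) - c (f (j, v))" by blast
 have orth: "(\<Sum>v\<in>V. \<Sum>j\<in>nbrs E v. \<omega> v j * (if f (v, j) = y then 1 else 0)) = 0" if "y \<in> F" for y
 proof -
  have "0 = (\<Sum>e\<in>E. a (Inr y) e * x e)" using x(2) that by auto
  also have "\<dots> = (\<Sum>e\<in>E. \<Sum>d\<in>{d \<in> darts E. {fst d, snd d} = e}. \<omega> (fst d) (snd d) * (if f d = y then 1 else 0))"
   by (auto simp: a_def sum_distrib_right \<omega>_def intro!: sum.cong)
  also have "\<dots> = (\<Sum>d\<in>darts E. \<omega> (fst d) (snd d) * (if f (fst d, snd d) = y then 1 else 0))"
   by (subst sum.group) (auto simp: finE mem_darts)
  finally show ?thesis using sum_darts[of "%v j. \<omega> v j * (if f (v, j) = y then 1 else 0)"] by simp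
 qed
 \<comment> \<open>Orthogonality to the face indicators extends linearly to \<open>c\<close>; since
   \<omega> is itself the coboundary of \<open>c\<close>, its squared norm will vanish.\<close>
 have pair: "(\<Sum>v\<in>V. \<Sum>j\<in>nbrs E v. \<omega> v j * c (f (v, j))) = 0"
 proof -
  have cf: "c z = (\<Sum>y\<in>F. c y * (if z = y then 1 else 0))" for z
   using c(1) F by (cases "z \<in> F") (auto simp: if_distrib cong: if_cong)
  have "(\<Sum>d\<in>darts E. \<omega> (fst d) (snd d) * c (f d))
    = (\<Sum>d\<in>darts E. \<Sum>y\<in>F. c y * (\<omega> (fst d) (snd d) * (if f d = y then 1 else 0)))"
   by (subst cf) (simp add: sum_distrib_left mult_ac)
  also have "\<dots> = (\<Sum>y\<in>F. c y * (\<Sum>d\<in>darts E. \<omega> (fst d) (snd d) * (if f (fst d, snd d) = y then 1 else 0)))"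
   by (subst sum.swap) (simp add: sum_distrib_left)
  also have "\<dots> = 0"
   by (intro sum.neutral) (use orth sum_darts[of "%v j. \<omega> v j * (if f (v, j) = _ then 1 else 0)"] in auto)
  finally show ?thesis using sum_darts[of "%v j. \<omega> v j * c (f (v, j))"] by simp
 qed
 have "(\<Sum>v\<in>V. \<Sum>j\<in>nbrs E v. \<omega> v j * c (f (j, v))) = (\<Sum>v\<in>V. \<Sum>j\<in>nbrs E v. \<omega> j v * c (f (v, j)))"
  by (rule sum_darts_swap)
 also have "\<dots> = (\<Sum>v\<in>V. \<Sum>j\<in>nbrs E v. - (\<omega> v j * c (f (v, j))))"
  by (intro sum.cong) (auto simp: anti mem_nbrs)
 finally have "(\<Sum>v\<in>V. \<Sum>j\<in>nbrs E v. \<omega> v j * c (f (j, v))) = 0" using pair by (simp add: sum_negf)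
 then have "(\<Sum>v\<in>V. \<Sum>j\<in>nbrs E v. \<omega> v j * (c (f (v, j)) - c (f (j, v)))) = 0"
  using pair by (simp add: algebra_simps sum_subtractf)
 moreover have "(\<Sum>v\<in>V. \<Sum>j\<in>nbrs E v. \<omega> v j * (c (f (v, j)) - c (f (j, v)))) = (\<Sum>v\<in>V. \<Sum>j\<in>nbrs E v. (\<omega> v j)\<^sup>2)"
  by (rule sum_nbrs_cong) (simp add: c(2) power2_eq_square)
 ultimately have "(\<Sum>v\<in>V. \<Sum>j\<in>nbrs E v. (\<omega> v j)\<^sup>2) = 0" by simp
 then have "\<forall>v\<in>V. \<forall>j\<in>nbrs E v. \<omega> v j = 0"
  by (subst (asm) sum_nonneg_eq_0_iff) (auto simp: finV sum_nonneg sum_nonneg_eq_0_iff)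
 then have z: "\<omega> v j = 0" if "{v, j} \<in> E" for v j
  using edgeD[OF that] that by (auto simp: mem_nbrs)
 obtain e where e: "e \<in> E" "x e ~= 0" using x(1) by auto
 obtain v j where vj: "e = {v, j}" "v ~= j" using edge_ex[OF e(1)] by blast
 with z[of v j] e show False by (simp add: \<omega>_def sg_def split: if_splits)
qed

text \<open>The dual bound: a coboundary that is at the same time a gradient has norm zero.\<close>
lemma few_faces:
 fixes f :: "'a \<times> 'a => 'f"
 assumes V: "V ~= {}" and F: "finite F"
  and fl: "!!c. flow V E (%v j. c (f (v, j)) - c (f (j, v)))"
  and inj: "!!c. (!!x. x ~: F ==> c x = 0) ==> (!!v j. {v, j} \<in> E ==> c (f (v, j)) = c (f (j, v))) ==> (\<forall>x\<in>F. c x = (0::real))"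
  and con: "conn V E"
 shows "card F + card V <= card E + 1"
proof (rule ccontr)
 assume "\<not> card F + card V <= card E + 1"
 then have less: "card E + 1 < card F + card V" by simp
 obtain v0 where v0: "v0 \<in> V" using V by auto
 obtain t where t: "!!e. e \<in> E ==> t e \<in> e" using tail_ex by blast
 have "\<exists>h. e = {t e, h}" if "e \<in> E" for e
  using t[OF that] edge_ex[OF that] by (metis insertE insert_commute singletonD)
 then obtain h where h: "!!e. e \<in> E ==> e = {t e, h e}" by metis
 \<comment> \<open>The unknowns are a face function \<open>c\<close> and a vertex potential \<pi>.
   Each edge demands that the coboundary of \<open>c\<close> equal the difference of \<pi>, and the
   row \<open>None\<close> normalises \<pi> at \<open>v0\<close>, which excludes constants.\<close>
 define a where "a r i = (case r of None => (if i = Inr v0 then 1 else 0)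
  | Some e => (case i of Inl x => (if f (t e, h e) = x then 1 else 0) - (if f (h e, t e) = x then 1 else 0)
    | Inr v => (if h e = v then 1 else 0) - (if t e = v then 1 else 0 :: real)))" for r i
 have "card (insert None (Some ` E)) < card (F <+> V)"
  using less finE F finV by (simp add: card_Plus card_image)
 then obtain x where x: "\<exists>i\<in>F <+> V. x i ~= 0" "\<forall>r\<in>insert None (Some ` E). (\<Sum>i\<in>F <+> V. a r i * x i) = 0"
  using homogeneous_nontrivial[of "insert None (Some ` E)" "F <+> V" a] finE finV F by auto
 define c where "c y = (if y \<in> F then x (Inl y) else 0)" for y
 define \<pi> where "\<pi> v = x (Inr v)" for v
 have s: "(\<Sum>i\<in>F <+> V. g i) = (\<Sum>y\<in>F. g (Inl y)) + (\<Sum>v\<in>V. g (Inr v) :: real)" for g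
  by (simp add: sum.Plus F finV)
 have \<pi>0: "\<pi> v0 = 0"
 proof -
  have "a None (Inl y) = 0" "a None (Inr v) * x (Inr v) = (if v = v0 then \<pi> v else 0)" for y v
   by (auto simp: a_def \<pi>_def)
  then show ?thesis using x(2)[rule_format, of None] v0 finV by (simp add: s)
 qed
 have eq1: "c (f (t e, h e)) - c (f (h e, t e)) + \<pi> (h e) - \<pi> (t e) = 0" if "e \<in> E" for e
 proof -
  have "t e \<in> V" "h e \<in> V" using that h[OF that] edgeD[of "t e" "h e"] by auto
  then show ?thesis
   using x(2)[rule_format, of "Some e"] that finV F
   by (simp add: s a_def c_def \<pi>_def left_diff_distrib sum_subtractf if_distrib[of "%z. z * _"] cong: if_cong)
 qed
 have eq: "c (f (v, j)) - c (f (j, v)) = \<pi> v - \<pi> j" if "{v, j} \<in> E" for v j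
 proof -
  have "(v = t {v, j} & j = h {v, j}) | (v = h {v, j} & j = t {v, j})"
   using h[OF that] by (metis doubleton_eq_iff)
  then show ?thesis using eq1[OF that] by fastforce
 qed
 \<comment> \<open>The coboundary of \<open>c\<close> is a flow, hence orthogonal to the differences
   of \<pi>, and yet equal to them.\<close>
 have "(\<Sum>v\<in>V. \<Sum>j\<in>nbrs E v. (c (f (v, j)) - c (f (j, v))) * (\<pi> v - \<pi> j)) = 0"
  using flow_potential[OF fl[of c], of \<pi>] by (simp add: right_diff_distrib sum_subtractf)
 moreover have "(\<Sum>v\<in>V. \<Sum>j\<in>nbrs E v. (c (f (v, j)) - c (f (j, v))) * (\<pi> v - \<pi> j)) = (\<Sum>v\<in>V. \<Sum>j\<in>nbrs E v. (\<pi> v - \<pi> j)\<^sup>2)"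
  by (rule sum_nbrs_cong) (simp add: eq power2_eq_square)
 ultimately have "(\<Sum>v\<in>V. \<Sum>j\<in>nbrs E v. (\<pi> v - \<pi> j)\<^sup>2) = 0" by simp
 then have "\<forall>v\<in>V. \<forall>j\<in>nbrs E v. \<pi> v = \<pi> j"
  by (subst (asm) sum_nonneg_eq_0_iff) (auto simp: finV sum_nonneg sum_nonneg_eq_0_iff)
 then have pe: "\<pi> v = \<pi> j" if "{v, j} \<in> E" for v j using edgeD[OF that] that by (auto simp: mem_nbrs)
 have "{v\<in>V. \<pi> v = 0} = V"
 proof (rule ccontr)
  assume "{v\<in>V. \<pi> v = 0} ~= V"
  moreover have "{v\<in>V. \<pi> v = 0} ~= {}" using v0 \<pi>0 by auto
  ultimately obtain y z where "y \<in> {v\<in>V. \<pi> v = 0}" "z \<in> V - {v\<in>V. \<pi> v = 0}" "{y, z} \<in> E"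
   using con[unfolded conn_def, rule_format, of "{v\<in>V. \<pi> v = 0}"] by blast
  then show False using pe by force
 qed
 moreover have "\<forall>y\<in>F. c y = 0"
  by (rule inj) (use eq pe in "force simp: c_def")+
 ultimately show False using x(1) by (auto simp: c_def \<pi>_def Plus_def)
qed

end

section \<open>Rotation systems\<close>

text \<open>Counterclockwise distance on the circle of length 1, with values in
  \<open>{0<..1}\<close> for angles in \<open>{0..<1}\<close>. From a point to itself it is a full
  turn, in agreement with \<open>ccw_angle\<close>.\<close>

definition cd :: "real => real => real" where
 "cd x y = (if x < y then y - x else y - x + 1)"

text \<open>The next neighbour counterclockwise. As \<open>cd\<close> is largest at the point
  itself, for injective angles \<open>j\<close> is its own successor only when it is alone.\<close>

definition nxt :: "'a set => ('a => real) => 'a => 'a" where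
 "nxt N f j = arg_min_on (%k. cd (f j) (f k)) N"

locale cyc =
 fixes N :: "'a set" and f :: "'a => real"
 assumes fin: "finite N" and inj: "inj_on f N" and rng: "j \<in> N ==> 0 <= f j & f j < 1"
begin

lemma nxt_in: "j \<in> N ==> nxt N f j \<in> N"
 unfolding nxt_def by (rule arg_min_if_finite) (auto simp: fin)

lemma nxt_le: "l \<in> N ==> cd (f j) (f (nxt N f j)) <= cd (f j) (f l)"
 unfolding nxt_def by (rule arg_min_least) (auto simp: fin)

lemma cd_inj: "j \<in> N ==> k \<in> N ==> l \<in> N ==> cd (f j) (f k) = cd (f j) (f l) ==> k = l"
 using rng[of j] rng[of k] rng[of l] inj by (auto simp: cd_def inj_on_def split: if_splits)

lemma nxt_eqI: "j \<in> N ==> k \<in> N ==> (!!l. l \<in> N ==> cd (f j) (f k) <= cd (f j) (f l)) ==> nxt N f j = k"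
 by (metis cd_inj nxt_in nxt_le order_antisym)

lemma nxt_between:
 assumes "j \<in> N" "l \<in> N"
 shows "if f j < f (nxt N f j) then f l <= f j | f (nxt N f j) <= f l else f (nxt N f j) <= f l & f l <= f j"
 using nxt_le[OF assms(2), of j] rng[OF assms(1)] rng[OF assms(2)] rng[OF nxt_in[OF assms(1)]]
 by (auto simp: cd_def split: if_splits)

lemma nxt_inj: "inj_on (nxt N f) N"
proof (rule inj_onI)
 fix i j assume ij: "i \<in> N" "j \<in> N" "nxt N f i = nxt N f j"
 have "f i = f j"
  using nxt_between[of i j] nxt_between[of j i] nxt_between[of i i] nxt_between[of j j] nxt_between[of i "nxt N f i"] nxt_in ij
  by (auto split: if_splits)
 then show "i = j" using inj ij by (auto simp: inj_on_def)
qed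

lemma nxt_bij: "bij_betw (nxt N f) N N"
 using nxt_inj nxt_in endo_inj_surj[OF fin _ nxt_inj] by (auto simp: bij_betw_def)

lemma below_nxt:
 assumes "j \<in> N"
 shows "{l \<in> N. f l < f (nxt N f j)} = (if f j < f (nxt N f j) then {l \<in> N. f l <= f j} else {})"
  "\<not> f j < f (nxt N f j) ==> {l \<in> N. f l <= f j} = N"
 using nxt_between[OF assms] assms nxt_in[OF assms] by (force split: if_splits)+

text \<open>The successor map is a single cycle: away from the largest angle it increases the angle,
  so every element climbs to the maximum.\<close>

lemma nxt_const:
 assumes g: "!!j. j \<in> N ==> g (nxt N f j) = g j" and "j \<in> N" "l \<in> N"
 shows "g j = g l"
proof -
 obtain m where m: "m \<in> N" "!!k. k \<in> N ==> f k <= f m"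
  using finite_has_maximal[of "f ` N"] assms(2) fin by (force simp: image_iff)
 have "g j = g m" if "j \<in> N" for j
  using that
 proof (induction "card {l\<in>N. f j < f l}" arbitrary: j rule: less_induct)
  case less
  show ?case
  proof (cases "j = m")
   case False
   then have "f j < f m" using m less.prems inj by (metis inj_onD le_less)
   then have lt: "f j < f (nxt N f j)" using nxt_between[OF less.prems m(1)] by (auto split: if_splits)
   have "{l\<in>N. f (nxt N f j) < f l} \<subset> {l\<in>N. f j < f l}" using lt nxt_in[OF less.prems] by auto
   then show ?thesis using less.hyps[OF psubset_card_mono] fin nxt_in[OF less.prems] g[OF less.prems] by auto
  qed auto
 qed
 then show ?thesis using assms by metis
qed

text \<open>Discrete integration around a vertex. The increments sum to zero because the successor
  permutes \<open>N\<close>, which makes the step from the largest angle to the smallest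
  consistent.\<close>

lemma prefix_sum:
 fixes g :: "'a => real"
 assumes g: "!!j. j \<in> N ==> g (nxt N f j) - g j = w (nxt N f j)"
 shows "\<exists>B. \<forall>j\<in>N. g j = B + (\<Sum>l | l \<in> N & f l <= f j. w l)"
proof -
 have "(\<Sum>j\<in>N. w j) = (\<Sum>j\<in>N. w (nxt N f j))"
  by (rule sum.reindex_bij_betw[OF nxt_bij, symmetric])
 also have "\<dots> = (\<Sum>j\<in>N. g (nxt N f j)) - (\<Sum>j\<in>N. g j)"
  by (simp add: g[symmetric] sum_subtractf)
 also have "\<dots> = 0" by (simp add: sum.reindex_bij_betw[OF nxt_bij])
 finally have tot: "sum w N = 0" .
 define D where "D j = g j - (\<Sum>l | l \<in> N & f l <= f j. w l)" for j
 have "D (nxt N f j) = D j" if j: "j \<in> N" for j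
 proof -
  let ?k = "nxt N f j"
  have "{l \<in> N. f l <= f ?k} = insert ?k {l \<in> N. f l < f ?k}"
   using nxt_in[OF j] inj by (auto simp: inj_on_def order.order_iff_strict)
  then have "(\<Sum>l | l \<in> N & f l <= f ?k. w l) = w ?k + (\<Sum>l | l \<in> N & f l < f ?k. w l)"
   using fin by simp
  moreover have "(\<Sum>l | l \<in> N & f l < f ?k. w l) = (\<Sum>l | l \<in> N & f l <= f j. w l)"
  proof (cases "f j < f ?k")
   case False
   then have "{l \<in> N. f l < f ?k} = {}" "{l \<in> N. f l <= f j} = N" using below_nxt[OF j] by simp_all
   then show ?thesis by (simp only: sum.empty tot)
  next
   case True
   then have "{l \<in> N. f l < f ?k} = {l \<in> N. f l <= f j}" using below_nxt(1)[OF j] by presburger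
   then show ?thesis by (simp only:)
  qed
  ultimately show ?thesis using g[OF j] by (simp add: D_def)
 qed
 then have "D j = D l" if "j \<in> N" "l \<in> N" for j l using nxt_const[of D] that by blast
 then have "g j = D (SOME l. l \<in> N) + (\<Sum>l | l \<in> N & f l <= f j. w l)" if "j \<in> N" for j
  using that D_def[of j] by (metis add.commute add_diff_cancel_left' diff_add_cancel some_in_eq empty_iff)
 then show ?thesis by blast
qed

end

text \<open>A dart \<open>(v, j)\<close> stands for the sector that follows it counterclockwise at
  \<open>v\<close>, hence for the face to the left on the way from \<open>v\<close> to
  \<open>j\<close>. The step passes to the dart on the other side of this sector, so its orbits are
  the faces. Pairs that are not darts are fixed, which makes the map injective on the whole
  type.\<close>

definition fstep :: "'a set set => ('a => 'a => real) => 'a \<times> 'a => 'a \<times> 'a" where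
 "fstep E ang d = (if d \<in> darts E then (nxt (nbrs E (fst d)) (ang (fst d)) (snd d), fst d) else d)"

definition face :: "'a set set => ('a => 'a => real) => 'a \<times> 'a => ('a \<times> 'a) set" where
 "face E ang d = range (%n. (fstep E ang ^^ n) d)"

text \<open>Including \<open>j\<close> in \<open>lsum\<close> and stopping before it in
  \<open>rsum\<close> gives the potentials of the sectors just after and just before
  \<open>j\<close>, up to a constant of \<open>v\<close>.\<close>

definition lsum :: "'a set set => ('a => 'a => real) => ('a => 'a => real) => 'a => 'a => real" where
 "lsum E ang \<omega> v j = (\<Sum>l | l \<in> nbrs E v & ang v l <= ang v j. \<omega> v l)"

definition rsum :: "'a set set => ('a => 'a => real) => ('a => 'a => real) => 'a => 'a => real" where
 "rsum E ang \<omega> v j = (\<Sum>l | l \<in> nbrs E v & ang v l < ang v j. \<omega> v l)"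

text \<open>Planarity of a rotation system: its first homology vanishes, that is, every flow is the
 coboundary of a function on faces. The value on the sector after the dart \<open>(v, j)\<close> is
 \<open>b v\<close> plus the flow of the darts at \<open>v\<close> up to \<open>j\<close>.\<close>
definition planar_rot :: "'a set => 'a set set => ('a => 'a => real) => bool" where
 "planar_rot V E ang \<longleftrightarrow> (\<forall>\<omega>. flow V E \<omega> -->
  (\<exists>b. \<forall>v j. {v, j} \<in> E --> b v + lsum E ang \<omega> v j = b j + rsum E ang \<omega> j v))"

text \<open>A facial triangle in counterclockwise order: no edge of the graph enters its three
  corners.\<close>

definition tri :: "'a set set => ('a => 'a => real) => 'a => 'a => 'a => bool" where
 "tri E ang x y z \<longleftrightarrow> {x, y} \<in> E & {y, z} \<in> E & {z, x} \<in> E &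
  nxt (nbrs E x) (ang x) y = z & nxt (nbrs E z) (ang z) x = y & nxt (nbrs E y) (ang y) z = x"

locale rsys = sgraph V E for V :: "'a set" and E +
 fixes ang :: "'a => 'a => real"
 assumes ang_inj: "inj_on (ang v) (nbrs E v)" and ang_rng: "{v, j} \<in> E ==> 0 <= ang v j & ang v j < 1"
begin

sublocale cyc: cyc "nbrs E v" "ang v" for v
 by unfold_locales (auto simp: ang_inj mem_nbrs ang_rng)

abbreviation "nx v \<equiv> nxt (nbrs E v) (ang v)"

lemma nx_edge: "{v, j} \<in> E ==> {v, nx v j} \<in> E"
 using cyc.nxt_in[of j v] by (simp add: mem_nbrs)

lemma fstep_eq: "{v, j} \<in> E ==> fstep E ang (v, j) = (nx v j, v)"
 by (simp add: fstep_def mem_darts)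

lemma fstep_darts: "d \<in> darts E ==> fstep E ang d \<in> darts E"
 using nx_edge[of "fst d" "snd d"] by (simp add: fstep_def darts_def case_prod_beta insert_commute)

lemma fstep_inj: "inj (fstep E ang)"
proof (rule injI)
 fix d d' assume eq: "fstep E ang d = fstep E ang d'"
 show "d = d'"
 proof (cases "d \<in> darts E & d' \<in> darts E")
  case True
  then show ?thesis using eq cyc.nxt_inj[of "fst d"]
   by (cases d; cases d') (auto simp: fstep_def mem_darts inj_on_def mem_nbrs)
 next
  case False
  then show ?thesis using eq fstep_darts[of d] fstep_darts[of d'] by (auto simp: fstep_def split: if_splits)
 qed
qed

lemma fstep_pow_darts: "d \<in> darts E ==> (fstep E ang ^^ n) d \<in> darts E"
 by (induction n) (auto simp: fstep_darts)

lemma face_sub: "d \<in> darts E ==> face E ang d <= darts E"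
 by (auto simp: face_def fstep_pow_darts)

lemma face_refl: "d \<in> face E ang d"
 unfolding face_def by (rule image_eqI[of _ _ 0]) auto

lemma face_period:
 assumes "d \<in> darts E"
 obtains k where "k > 0" "(fstep E ang ^^ k) d = d" "inj_on (%i. (fstep E ang ^^ i) d) {..<k}"
  "face E ang d = (%i. (fstep E ang ^^ i) d) ` {..<k}"
proof -
 have "finite {y. \<exists>n. y = (fstep E ang ^^ n) d}"
  by (rule finite_subset[of _ "darts E"]) (auto simp: fstep_pow_darts assms)
 from funpow_inj_finite[OF fstep_inj this]
 have ex: "\<exists>n. n > 0 & (fstep E ang ^^ n) d = d" by blast
 define k where "k = (LEAST n. n > 0 & (fstep E ang ^^ n) d = d)"
 have k: "k > 0" "(fstep E ang ^^ k) d = d" using LeastI_ex[OF ex] by (auto simp: k_def)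
 have least: "(fstep E ang ^^ m) d ~= d" if "0 < m" "m < k" for m
  using not_less_Least[of m "%n. n > 0 & (fstep E ang ^^ n) d = d"] that by (auto simp: k_def)
 have ij: "i = j" if "i <= j" "j < k" "(fstep E ang ^^ i) d = (fstep E ang ^^ j) d" for i j
 proof -
  have "(fstep E ang ^^ i) d = (fstep E ang ^^ i) ((fstep E ang ^^ (j - i)) d)"
   using that by (simp add: funpow_add[symmetric, THEN fun_cong, unfolded o_def])
  then have "(fstep E ang ^^ (j - i)) d = d"
   using injD[OF inj_fn[OF fstep_inj, of i]] by metis
  then show ?thesis using least[of "j - i"] that by force
 qed
 have "inj_on (%i. (fstep E ang ^^ i) d) {..<k}"
  by (rule inj_onI) (metis ij lessThan_iff nat_le_linear)
 moreover have "face E ang d = (%i. (fstep E ang ^^ i) d) ` {..<k}"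
 proof -
  have "(fstep E ang ^^ n) d = (fstep E ang ^^ (n mod k)) d" for n
   using funpow_mod_eq[OF k(2)] by simp
  then show ?thesis using k(1) by (fastforce simp: face_def)
 qed
 ultimately show ?thesis using that k by blast
qed

lemma face_eq:
 assumes "d \<in> darts E" "d' \<in> face E ang d"
 shows "face E ang d' = face E ang d"
proof -
 obtain k where k: "k > 0" "(fstep E ang ^^ k) d = d" "face E ang d = (%i. (fstep E ang ^^ i) d) ` {..<k}"
  using face_period[OF assms(1)] by metis
 obtain i where i: "i < k" "d' = (fstep E ang ^^ i) d" using assms(2) k(3) by auto
 have "(fstep E ang ^^ (n + (k - i))) d' = (fstep E ang ^^ n) d" for n
 proof -
  have "(fstep E ang ^^ (n + (k - i))) d' = (fstep E ang ^^ (n + (k - i) + i)) d" by (simp add: funpow_add i(2))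
  also have "n + (k - i) + i = n + k" using i by simp
  finally show ?thesis using k(2) by (simp add: funpow_add)
 qed
 then have "face E ang d <= face E ang d'" unfolding face_def by (metis image_subsetI rangeI)
 moreover have "face E ang d' <= face E ang d" by (auto simp: face_def i(2) funpow_add[symmetric, THEN fun_cong, unfolded o_def])
 ultimately show ?thesis by blast
qed

lemma face_const:
 assumes "!!d. d \<in> darts E ==> C (fstep E ang d) = C d" "d \<in> darts E" "d' \<in> face E ang d"
 shows "C d' = C d"
proof -
 have "C ((fstep E ang ^^ n) d) = C d" for n
  by (induction n) (auto simp: assms fstep_pow_darts)
 then show ?thesis using assms(3) by (auto simp: face_def)
qed

lemma lsum_rsum:
 assumes "{v, j} \<in> E"
 shows "lsum E ang \<omega> v j = \<omega> v j + rsum E ang \<omega> v j"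
proof -
 have "{l \<in> nbrs E v. ang v l <= ang v j} = insert j {l \<in> nbrs E v. ang v l < ang v j}"
  using assms ang_inj[of v] by (auto simp: inj_on_def mem_nbrs order.order_iff_strict)
 then show ?thesis by (simp add: lsum_def rsum_def)
qed

lemma base_potential:
 assumes fl: "flow V E \<omega>" and b: "\<forall>v j. {v, j} \<in> E --> b v + lsum E ang \<omega> v j = b j + rsum E ang \<omega> j v"
  and C: "!!d. C d = b (fst d) + lsum E ang \<omega> (fst d) (snd d)"
 shows "\<forall>d\<in>darts E. C (fstep E ang d) = C d" "\<forall>v j. {v, j} \<in> E --> \<omega> v j = C (v, j) - C (j, v)"
proof -
  have 1: "C (j, v) = b v + rsum E ang \<omega> v j" if "{v, j} \<in> E" for v j
   using b that by (simp add: C insert_commute)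
  have "C (fstep E ang (v, j)) = C (v, j)" if e: "{v, j} \<in> E" for v j
  proof -
   have "rsum E ang \<omega> v (nx v j) = lsum E ang \<omega> v j"
   proof (cases "ang v j < ang v (nx v j)")
    case True
    then show ?thesis using cyc.below_nxt(1)[of j v] e by (simp add: rsum_def lsum_def mem_nbrs)
   next
    case False
    then have "rsum E ang \<omega> v (nx v j) = 0" "lsum E ang \<omega> v j = sum (\<omega> v) (nbrs E v)"
    proof -
     have "{l \<in> nbrs E v. ang v l < ang v (nx v j)} = {}" "{l \<in> nbrs E v. ang v l <= ang v j} = nbrs E v"
      using cyc.below_nxt[of j v] e False by (simp_all add: mem_nbrs)
     then show "rsum E ang \<omega> v (nx v j) = 0" "lsum E ang \<omega> v j = sum (\<omega> v) (nbrs E v)"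
      unfolding rsum_def lsum_def by (simp_all only: sum.empty)
    qed
    then show ?thesis using fl edgeD[OF e] by (auto simp: flow_def)
   qed
   then show ?thesis using 1[OF nx_edge[OF e]] by (simp add: fstep_eq[OF e] C)
  qed
  then show "\<forall>d\<in>darts E. C (fstep E ang d) = C d" by (auto simp: darts_def)
  show "\<forall>v j. {v, j} \<in> E --> \<omega> v j = C (v, j) - C (j, v)"
   using 1 lsum_rsum by (simp add: C)
qed

text \<open>The constant \<open>b v\<close> is what remains free when a potential is integrated
  around \<open>v\<close>. Prefix sums translate between such constants and potentials on darts that
  are constant on faces.\<close>

lemma planar_rot_iff:
 "planar_rot V E ang \<longleftrightarrow> (\<forall>\<omega>. flow V E \<omega> --> (\<exists>C. (\<forall>d\<in>darts E. C (fstep E ang d) = C d) &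
  (\<forall>v j. {v, j} \<in> E --> \<omega> v j = C (v, j) - C (j, v))))"
proof -
 have "(\<exists>b. \<forall>v j. {v, j} \<in> E --> b v + lsum E ang \<omega> v j = b j + rsum E ang \<omega> j v) \<longleftrightarrow>
  (\<exists>C. (\<forall>d\<in>darts E. C (fstep E ang d) = C d) & (\<forall>v j. {v, j} \<in> E --> \<omega> v j = C (v, j) - C (j, v)))"
  if fl: "flow V E \<omega>" for \<omega>
 proof (intro iffI; elim exE)
  fix b assume b: "\<forall>v j. {v, j} \<in> E --> b v + lsum E ang \<omega> v j = b j + rsum E ang \<omega> j v"
  show "\<exists>C. (\<forall>d\<in>darts E. C (fstep E ang d) = C d) & (\<forall>v j. {v, j} \<in> E --> \<omega> v j = C (v, j) - C (j, v))"
   by (intro exI[of _ "%d. b (fst d) + lsum E ang \<omega> (fst d) (snd d)"] conjI base_potential[OF fl b]) (rule refl)+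
 next
  fix C :: "'a \<times> 'a => real" assume C: "(\<forall>d\<in>darts E. C (fstep E ang d) = C d) & (\<forall>v j. {v, j} \<in> E --> \<omega> v j = C (v, j) - C (j, v))"
  have "\<exists>B. \<forall>j\<in>nbrs E v. C (v, j) = B + (\<Sum>l | l \<in> nbrs E v & ang v l <= ang v j. \<omega> v l)" for v
  proof (rule cyc.prefix_sum)
   fix j assume "j \<in> nbrs E v"
   then have e: "{v, j} \<in> E" by (simp add: mem_nbrs)
   have "C (fstep E ang (v, j)) = C (v, j)" using C e by (auto simp: darts_def)
   then have "C (nx v j, v) = C (v, j)" by (simp add: fstep_eq[OF e])
   then show "C (v, nx v j) - C (v, j) = \<omega> v (nx v j)" using C nx_edge[OF e] by simp
  qed
  then obtain b where b: "!!v j. {v, j} \<in> E ==> C (v, j) = b v + lsum E ang \<omega> v j"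
   by (metis lsum_def mem_nbrs)
  have "b v + lsum E ang \<omega> v j = b j + rsum E ang \<omega> j v" if e: "{v, j} \<in> E" for v j
  proof -
   have e': "{j, v} \<in> E" using e by (simp add: insert_commute)
   have "\<omega> j v = C (j, v) - C (v, j)" using C e' by blast
   then show ?thesis using b[OF e] b[OF e'] lsum_rsum[OF e'] by simp
  qed
  then show "\<exists>b. \<forall>v j. {v, j} \<in> E --> b v + lsum E ang \<omega> v j = b j + rsum E ang \<omega> j v" by blast
 qed
 then show ?thesis unfolding planar_rot_def by blast
qed

text \<open>Reversing edges and stepping around faces act transitively on the darts of a connected
  graph: combined they rotate around a vertex, and edges carry the value to the neighbours.\<close>

lemma dart_const:
 assumes con: "conn V E" and inv: "!!v j. {v, j} \<in> E ==> h (j, v) = h (v, j)"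
  "!!d. d \<in> darts E ==> h (fstep E ang d) = h d" and d: "d \<in> darts E" "d' \<in> darts E"
 shows "h d = h d'"
proof -
 have loc: "h (v, j) = h (v, l)" if "{v, j} \<in> E" "{v, l} \<in> E" for v j l
 proof (rule cyc.nxt_const[of v "%j. h (v, j)"])
  fix j assume "j \<in> nbrs E v"
  then have e: "{v, j} \<in> E" by (simp add: mem_nbrs)
  show "h (v, nx v j) = h (v, j)"
   using inv(1)[OF nx_edge[OF e]] inv(2)[of "(v, j)"] e by (simp add: fstep_eq mem_darts)
 qed (use that in "auto simp: mem_nbrs")
 define K where "K = {v\<in>V. \<exists>j. {v, j} \<in> E & h (v, j) = h d}"
 have d1: "{fst d, snd d} \<in> E" "{fst d', snd d'} \<in> E" using d by (auto simp: darts_def)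
 have "K = V"
 proof (rule ccontr)
  assume "K ~= V"
  moreover have "fst d \<in> K" using d1(1) edgeD[OF d1(1)] by (auto simp: K_def)
  moreover have "K <= V" by (auto simp: K_def)
  ultimately obtain x y where xy: "x \<in> K" "y \<in> V - K" "{x, y} \<in> E"
   using con unfolding conn_def by (metis empty_iff)
  then obtain j where "{x, j} \<in> E" "h (x, j) = h d" by (auto simp: K_def)
  then have "h (y, x) = h d" using loc[of x j y] inv(1)[OF xy(3)] xy by simp
  then show False using xy by (auto simp: K_def insert_commute)
 qed
 then have "fst d' \<in> K" using d1 edgeD by blast
 then show ?thesis using loc[OF d1(2)] by (force simp: K_def)
qed

text \<open>One face is dropped because a potential can be normalised to vanish on it; this raises
  the bound of \<open>many_faces\<close> by one, to that of Euler's formula.\<close>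

lemma num_faces:
 assumes "planar_rot V E ang" "E ~= {}"
 shows "card E + 2 <= card (face E ang ` darts E) + card V"
proof -
 obtain e where "e \<in> E" using assms by auto
 then obtain x y where "{x, y} \<in> E" using edge_ex by metis
 then have d0: "(x, y) \<in> darts E" and V: "V ~= {}" using edgeD by (auto simp: mem_darts)
 let ?F = "face E ang ` darts E - {face E ang (x, y)}"
 have "card E + 1 <= card ?F + card V"
 proof (rule many_faces[where f = "face E ang"])
  fix \<omega> assume "flow V E \<omega>"
  then obtain C where C: "\<forall>d\<in>darts E. C (fstep E ang d) = C d" "!!v j. {v, j} \<in> E ==> \<omega> v j = C (v, j) - C (j, v)"
   using assms(1) planar_rot_iff by metis
  define c where "c X = (if X \<in> ?F then C (SOME d. d \<in> X) - C (x, y) else 0)" for X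
  have "c (face E ang d) = C d - C (x, y)" if d: "d \<in> darts E" for d
  proof (cases "face E ang d = face E ang (x, y)")
   case True
   then have "(x, y) \<in> face E ang d" using face_refl by metis
   then show ?thesis using face_const[of C d "(x,y)"] C(1) d True by (simp add: c_def)
  next
   case False
   have "(SOME d'. d' \<in> face E ang d) \<in> face E ang d" using face_refl by (metis someI)
   then have "C (SOME d'. d' \<in> face E ang d) = C d" using face_const[of C d] C(1) d by simp
   then show ?thesis using False d by (simp add: c_def)
  qed
  then have "\<forall>v j. {v, j} \<in> E --> \<omega> v j = c (face E ang (v, j)) - c (face E ang (j, v))"
   using C(2) by (simp add: mem_darts insert_commute)
  moreover have "\<forall>X. X ~: ?F --> c X = 0" by (simp add: c_def)
  ultimately show "\<exists>c. (\<forall>X. X ~: ?F --> c X = 0) & (\<forall>v j. {v, j} \<in> E --> \<omega> v j = c (face E ang (v, j)) - c (face E ang (j, v)))"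
   by blast
 qed (use V in auto)
 moreover have "card (face E ang ` darts E) = card ?F + 1"
  using d0 card_Suc_Diff1[of "face E ang ` darts E" "face E ang (x, y)"] by force
 ultimately show ?thesis by simp
qed

lemma tri_rot: "tri E ang x y z ==> tri E ang y z x"
 by (auto simp: tri_def)

lemma tri_face:
 assumes "tri E ang x y z" shows "face E ang (x, y) = {(x, y), (z, x), (y, z)}"
proof -
 have s: "fstep E ang (x, y) = (z, x)" "fstep E ang (z, x) = (y, z)" "fstep E ang (y, z) = (x, y)"
  using assms by (auto simp: tri_def fstep_eq)
 have "(fstep E ang ^^ n) (x, y) \<in> {(x, y), (z, x), (y, z)}" for n by (induction n) (use s in auto)
 then have "face E ang (x, y) <= {(x, y), (z, x), (y, z)}" unfolding face_def by blast
 moreover have "(z, x) \<in> face E ang (x, y)" "(y, z) \<in> face E ang (x, y)"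
  unfolding face_def by (rule range_eqI[of _ _ 1], use s in simp) (rule range_eqI[of _ _ 2], use s in \<open>simp add: numeral_2_eq_2\<close>)
 ultimately show ?thesis using face_refl[of "(x, y)"] by blast
qed

text \<open>Minimum degree 2 prevents the walk from turning back along the edge it came from. An
  orbit of length three then closes up to a triangle because \<open>fstep\<close> is
  injective.\<close>

lemma face_small:
 assumes deg: "!!v. v \<in> V ==> card (nbrs E v) >= 2" and d: "{v, j} \<in> E"
 shows "card (face E ang (v, j)) >= 3" "card (face E ang (v, j)) = 3 ==> tri E ang v j (nx v j)"
proof -
 let ?k = "nx v j" let ?l = "nx ?k v"
 have kv: "{?k, v} \<in> E" using nx_edge[OF d] by (simp add: insert_commute)
 have lk: "{?l, ?k} \<in> E" using nx_edge[OF kv] by (simp add: insert_commute)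
 have fin: "finite (face E ang (v, j))" using face_sub[of "(v, j)"] d finite_subset fin_darts by (metis mem_darts)
 have s: "fstep E ang (v, j) = (?k, v)" "fstep E ang (?k, v) = (?l, ?k)" "fstep E ang (?l, ?k) = (nx ?l ?k, ?l)"
  by (auto simp: fstep_eq d kv lk)
 have pw: "(fstep E ang ^^ 1) (v, j) = (?k, v)" "(fstep E ang ^^ 2) (v, j) = (?l, ?k)" "(fstep E ang ^^ 3) (v, j) = (nx ?l ?k, ?l)"
  using s by (simp_all add: eval_nat_numeral)
 then have inf: "{(v, j), (?k, v), (?l, ?k), (nx ?l ?k, ?l)} <= face E ang (v, j)"
  using face_refl[of "(v, j)"] unfolding face_def by (auto simp del: One_nat_def) (metis rangeI)+
 have "?k ~= j"
 proof
  assume kj: "?k = j"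
  have "card (nbrs E v) >= 2" using deg edgeD[OF d] by auto
  then obtain l where l: "l \<in> nbrs E v" "l ~= j" using d
   by (metis card_1_singleton_iff One_nat_def is_singletonI' is_singleton_altdef mem_nbrs not_less_eq_eq numeral_2_eq_2 order_refl equals0D)
  show False using cyc.nxt_between[of j v l] cyc.nxt_between[of j v j] l kj d ang_inj[of v]
   by (auto simp: mem_nbrs inj_on_def)
 qed
 then have ne: "(v, j) ~= (?l, ?k)" by (metis prod.inject)
 moreover have "(v, j) ~= (?k, v)" "(?k, v) ~= (?l, ?k)" using edgeD[OF kv] edgeD[OF lk] by auto
 ultimately have dist: "card {(v, j), (?k, v), (?l, ?k)} = 3" unfolding card_3_iff by blast
 show "card (face E ang (v, j)) >= 3" using card_mono[OF fin, of "{(v, j), (?k, v), (?l, ?k)}"] inf dist by auto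
 assume c3: "card (face E ang (v, j)) = 3"
 then have "face E ang (v, j) = {(v, j), (?k, v), (?l, ?k)}"
  using card_subset_eq[OF fin, of "{(v, j), (?k, v), (?l, ?k)}"] inf dist by auto
 then have "(nx ?l ?k, ?l) \<in> {(v, j), (?k, v), (?l, ?k)}" using inf by auto
 moreover have "(nx ?l ?k, ?l) ~= (?k, v)" using s ne fstep_inj by (metis injD)
 ultimately have "nx ?l ?k = v & ?l = j" using edgeD[OF kv] edgeD[OF lk] by auto
 then show "tri E ang v j ?k" using d kv lk by (auto simp: tri_def insert_commute)
qed

end

section \<open>Contractible edges of Laman graphs\<close>

definition tight :: "'a set set => 'a set => bool" where
 "tight E X \<longleftrightarrow> card (induced E X) + 3 = 2 * card X"

text \<open>The obstructions to contracting the edge \<open>{a, b}\<close> of the triangle \<open>a b c\<close>.\<close>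
definition blocker :: "'a set => 'a set set => 'a => 'a => 'a => 'a set => bool" where
 "blocker V E a b c X \<longleftrightarrow> X <= V & a \<in> X & b \<in> X & c ~: X & 3 <= card X & tight E X"

lemma induced_induced: "W <= X ==> induced (induced E X) W = induced E W"
 by (auto simp: induced_def)

lemma edge_induced: "{x, y} \<in> induced E X \<longleftrightarrow> {x, y} \<in> E & x \<in> X & y \<in> X"
 by (auto simp: induced_def)

text \<open>The Laman counts with the 3 moved to the other side, which avoids truncated
  subtraction.\<close>

locale lgraph = sgraph V E for V :: "'a set" and E +
 assumes card_V: "2 <= card V" and card_E: "card E + 3 = 2 * card V"
  and sparse: "W <= V ==> 2 <= card W ==> card (induced E W) + 3 <= 2 * card W"

lemma lgraph_iff:
 assumes "simple_graph V E" shows "lgraph V E \<longleftrightarrow> laman V E"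
proof -
 have sg: "sgraph V E" using assms by unfold_locales (auto simp: simple_graph_def)
 have c: "2 <= card V" using assms by (simp add: simple_graph_def)
 have ar: "x <= 2 * k - 3 \<longleftrightarrow> x + 3 <= 2 * k" "x = 2 * k - 3 \<longleftrightarrow> x + 3 = 2 * k" if "2 <= k" for x k :: nat
  using that by auto
 show ?thesis
  unfolding lgraph_def lgraph_axioms_def laman_def induced_def[symmetric] using sg c ar by metis
qed

context lgraph
begin

lemma finI [simp]: "finite (induced E X)"
 using finE by (simp add: induced_def)

lemma induced_V: "induced E V = E"
 using edge_sub by (auto simp: induced_def)

lemma fin_sub: "X <= V ==> finite X"
 using finV finite_subset by blast

lemma induced_small: "card X < 2 ==> X <= V ==> induced E X = {}"
proof (rule ccontr)
 assume "card X < 2" "X <= V" "induced E X ~= {}"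
 then obtain e where "e \<in> E" "e <= X" by (auto simp: induced_def)
 then show False using edge_card[of e] card_mono[of X e] fin_sub[OF \<open>X <= V\<close>] \<open>card X < 2\<close> by auto
qed

lemma induced_bound: "X <= V ==> X ~= {} ==> card (induced E X) + 2 <= 2 * card X"
 using sparse[of X] induced_small[of X] fin_sub[of X] card_gt_0_iff[of X] by (cases "card X < 2") auto

lemma card_induced_Un:
 "card (induced E X \<union> induced E Y) + card (induced E (X \<inter> Y)) = card (induced E X) + card (induced E Y)"
proof -
 have "induced E X \<inter> induced E Y = induced E (X \<inter> Y)" by (auto simp: induced_def)
 then show ?thesis using card_Un_Int[of "induced E X" "induced E Y"] by simp
qed

text \<open>The number of induced edges is supermodular while the bound is modular, so both
  inequalities are equalities; in particular no edge joins \<open>X - Y\<close> to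
  \<open>Y - X\<close>.\<close>

lemma tight_Un_Int:
 assumes X: "X <= V" "tight E X" and Y: "Y <= V" "tight E Y" and c: "2 <= card (X \<inter> Y)"
 shows "tight E (X \<union> Y)" "tight E (X \<inter> Y)" "induced E (X \<union> Y) = induced E X \<union> induced E Y"
proof -
 have fin: "finite X" "finite Y" using X Y fin_sub by auto
 have sub: "induced E X \<union> induced E Y <= induced E (X \<union> Y)" by (auto simp: induced_def)
 have "card (X \<inter> Y) <= card (X \<union> Y)" by (rule card_mono) (use fin in auto)
 then have 1: "card (induced E (X \<union> Y)) + 3 <= 2 * card (X \<union> Y)"
  using sparse[of "X \<union> Y"] X Y c by auto
 have 2: "card (induced E (X \<inter> Y)) + 3 <= 2 * card (X \<inter> Y)" using sparse[of "X \<inter> Y"] X Y c by auto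
 have 3: "card (induced E X \<union> induced E Y) <= card (induced E (X \<union> Y))"
  by (rule card_mono) (use sub in auto)
 have 4: "card X + card Y = card (X \<union> Y) + card (X \<inter> Y)" using card_Un_Int fin by blast
 show "tight E (X \<union> Y)" "tight E (X \<inter> Y)"
  using 1 2 3 4 card_induced_Un[of X Y] X(2) Y(2) by (auto simp: tight_def)
 have "card (induced E X \<union> induced E Y) = card (induced E (X \<union> Y))"
  using 1 2 3 4 card_induced_Un[of X Y] X(2) Y(2) by (auto simp: tight_def)
 then show "induced E (X \<union> Y) = induced E X \<union> induced E Y"
  using card_subset_eq[OF _ sub] by simp
qed

lemma lgraph_induced: "X <= V ==> 2 <= card X ==> tight E X ==> lgraph X (induced E X)"
 unfolding lgraph_def lgraph_axioms_def tight_def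
 using sgraph_induced sparse by (auto simp: induced_induced)

text \<open>Each side of a cut spans at most twice its size minus 2 edges, single vertices included.
  Without an edge across, at most \<open>2 * card V - 4\<close> edges would remain.\<close>

lemma connected: "conn V E"
 unfolding conn_def
proof (intro allI impI, rule ccontr)
 fix K assume K: "K <= V" "K ~= {}" "K ~= V" and no: "\<not> (\<exists>x\<in>K. \<exists>y\<in>V - K. {x, y} \<in> E)"
 have no': "{x, y} ~: E" if "x \<in> K" "y \<in> V - K" for x y using no that by blast
 have "E = induced E K \<union> induced E (V - K)"
 proof (intro equalityI subsetI)
  fix e assume e: "e \<in> E"
  then obtain x y where xy: "e = {x, y}" using edge_ex by metis
  then show "e \<in> induced E K \<union> induced E (V - K)"
   using e no'[of x y] no'[of y x] edgeD[of x y] by (auto simp: induced_def insert_commute)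
 qed (auto simp: induced_def)
 then have "card E <= card (induced E K) + card (induced E (V - K))" by (metis card_Un_le)
 moreover have "card K + card (V - K) = card V"
  using K finV card_Diff_subset[of K V] card_mono[of V K] fin_sub by auto
 ultimately show False
  using induced_bound[of K] induced_bound[of "V - K"] K card_E by auto
qed

text \<open>The two sides of a cut, each taken together with \<open>v\<close>, span at most
  \<open>2 * (card V + 1) - 6\<close> edges, one too few. This is what later allows a path to be
  closed up through \<open>v\<close>.\<close>

lemma conn_remove:
 assumes v: "v \<in> V" and n: "3 <= card V"
 shows "conn (V - {v}) (induced E (V - {v}))"
 unfolding conn_def
proof (intro allI impI, rule ccontr)
 fix K assume K: "K <= V - {v}" "K ~= {}" "K ~= V - {v}"
  and no: "\<not> (\<exists>x\<in>K. \<exists>y\<in>V - {v} - K. {x, y} \<in> induced E (V - {v}))"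
 have no': "{x, y} ~: E" if "x \<in> K" "y \<in> V - {v} - K" for x y using no that K(1) by (auto simp: edge_induced)
 let ?A = "insert v K" and ?B = "V - K"
 have "E = induced E ?A \<union> induced E ?B"
 proof (intro equalityI subsetI)
  fix e assume e: "e \<in> E"
  then obtain x y where xy: "e = {x, y}" using edge_ex by metis
  then show "e \<in> induced E ?A \<union> induced E ?B"
   using e no'[of x y] no'[of y x] edgeD[of x y] by (auto simp: induced_def insert_commute)
 qed (auto simp: induced_def)
 then have "card E <= card (induced E ?A) + card (induced E ?B)" by (metis card_Un_le)
 moreover have fK: "finite K" using K finV finite_subset by blast
 moreover have "card ?A + card ?B = card V + 1"
 proof -
  have "K <= V" using K(1) by blast
  then have "card K + card (V - K) = card V"
   using fK finV card_Diff_subset[of K V] card_mono[of V K] by simp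
  then show ?thesis using K fK by (auto simp: card_insert_if)
 qed
 moreover have "2 <= card ?A" using K v fK card_gt_0_iff[of K] by (auto simp: card_insert_if)
 moreover have "2 <= card ?B"
 proof -
  obtain w where "w \<in> V - {v} - K" using K by blast
  then have "{v, w} <= ?B" "v ~= w" using K v by auto
  then show ?thesis using card_mono[of ?B "{v, w}"] finV by auto
 qed
 ultimately show False
  using sparse[of ?A] sparse[of ?B] K v card_E by auto
qed

lemma degree_ge_2:
 assumes v: "v \<in> V" and n: "3 <= card V"
 shows "2 <= card (nbrs E v)"
proof -
 let ?W = "V - {v}"
 have "E = induced E ?W \<union> (%j. {v, j}) ` nbrs E v"
 proof (intro equalityI subsetI)
  fix e assume e: "e \<in> E"
  then obtain x y where xy: "e = {x, y}" using edge_ex by metis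
  then show "e \<in> induced E ?W \<union> (%j. {v, j}) ` nbrs E v"
   using e edgeD[of x y] by (auto simp: induced_def mem_nbrs insert_commute)
 qed (auto simp: induced_def mem_nbrs)
 then have "card E <= card (induced E ?W) + card ((%j. {v, j}) ` nbrs E v)" by (metis card_Un_le)
 also have "\<dots> <= card (induced E ?W) + card (nbrs E v)" using card_image_le[OF fin_nbrs] by simp
 finally have "card E <= card (induced E ?W) + card (nbrs E v)" .
 moreover have W: "card ?W + 1 = card V" using v finV card_Suc_Diff1 by fastforce
 moreover have "card (induced E ?W) + 3 <= 2 * card ?W" using sparse[of ?W] n W by auto
 ultimately show ?thesis using card_E by linarith
qed

text \<open>\<open>K\<close> is a union of components of the complement of a maximal blocker
  \<open>X\<close>, not containing \<open>c\<close>. The sets \<open>X \<union> K\<close> and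
  \<open>V - K\<close> meet in \<open>X\<close> and cover all edges, so the counts force
  \<open>X \<union> K\<close> to be tight, hence a blocker.\<close>

lemma complement_connected:
 assumes max: "!!Y. blocker V E a b c Y ==> X <= Y ==> Y = X" and X: "blocker V E a b c X"
  and K: "K <= V - X" "c ~: K" and no: "!!x y. x \<in> K ==> y \<in> V - X - K ==> {x, y} ~: E" and c: "c \<in> V"
 shows "K = {}"
proof (rule ccontr)
 assume "K ~= {}"
 let ?A = "X \<union> K" and ?B = "V - K"
 have XV: "X <= V" "tight E X" "3 <= card X" using X by (auto simp: blocker_def)
 have "E = induced E ?A \<union> induced E ?B"
 proof (intro equalityI subsetI)
  fix e assume e: "e \<in> E"
  then obtain x y where xy: "e = {x, y}" using edge_ex by metis
  then show "e \<in> induced E ?A \<union> induced E ?B"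
   using e no[of x y] no[of y x] edgeD[of x y] by (auto simp: induced_def insert_commute)
 qed (auto simp: induced_def)
 moreover have AB: "?A \<inter> ?B = X" "?A \<union> ?B = V" using K XV by auto
 ultimately have 1: "card E + card (induced E X) = card (induced E ?A) + card (induced E ?B)"
  using card_induced_Un[of ?A ?B] by simp
 have fin: "finite ?A" "finite ?B" using XV K finV fin_sub by (auto intro: finite_subset)
 have 2: "card ?A + card ?B = card V + card X" using card_Un_Int[OF fin] AB by simp
 have "card X <= card ?A" "card X <= card ?B" using AB fin by (auto intro!: card_mono)
 then have 3: "card (induced E ?A) + 3 <= 2 * card ?A" "card (induced E ?B) + 3 <= 2 * card ?B" "3 <= card ?A"
  using sparse[of ?A] sparse[of ?B] XV K by auto
 have "tight E ?A" using 1 2 3 card_E XV by (auto simp: tight_def)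
 then have "blocker V E a b c ?A" using X K 3 by (auto simp: blocker_def)
 then have "?A = X" using max by blast
 then show False using \<open>K ~= {}\<close> K by blast
qed

end

section \<open>Facial triangles and blockers in Laman graphs with a planar rotation system\<close>

locale lrot = rsys V E ang + lgraph V E for V :: "'a set" and E and ang +
 assumes planar: "planar_rot V E ang"
begin

lemma lsum_induced:
 assumes "x \<in> X" "!!l. {x, l} \<in> E ==> l ~: X ==> \<omega> x l = 0"
 shows "lsum (induced E X) ang \<omega> x y = lsum E ang \<omega> x y" "rsum (induced E X) ang \<omega> x y = rsum E ang \<omega> x y"
proof -
 have *: "(\<Sum>l | l \<in> nbrs (induced E X) x & P l. \<omega> x l) = (\<Sum>l | l \<in> nbrs E x & P l. \<omega> x l)" for P
  using assms by (intro sum.mono_neutral_left) (auto simp: induced_nbrs mem_nbrs[symmetric])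
 show "lsum (induced E X) ang \<omega> x y = lsum E ang \<omega> x y" "rsum (induced E X) ang \<omega> x y = rsum E ang \<omega> x y"
  unfolding lsum_def rsum_def by (rule *)+
qed

lemma extend_flow:
 assumes X: "X <= V" and fl: "flow X (induced E X) \<omega>"
 shows "flow V E (%x y. if x \<in> X & y \<in> X then \<omega> x y else 0)"
proof -
 have "(\<Sum>j\<in>nbrs E v. if v \<in> X & j \<in> X then \<omega> v j else 0) = 0" if "v \<in> V" for v
 proof (cases "v \<in> X")
  case True
  have "(\<Sum>j\<in>nbrs E v. if v \<in> X & j \<in> X then \<omega> v j else 0) = (\<Sum>j\<in>nbrs (induced E X) v. \<omega> v j)"
   by (rule sum.mono_neutral_cong_right) (auto simp: induced_nbrs True)
  then show ?thesis using fl True by (simp add: flow_def)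
 qed auto
 then show ?thesis using fl by (auto simp: flow_def edge_induced)
qed

lemma rsys_induced: "X <= V ==> rsys X (induced E X) ang"
 unfolding rsys_def rsys_axioms_def
 using sgraph_induced ang_inj ang_rng
 by (auto simp: edge_induced nbrs_def inj_on_def)

text \<open>The flow is extended by zero. Edges without flow do not change the prefix sums, so the
  same constants serve.\<close>

lemma planar_induced:
 assumes X: "X <= V" shows "planar_rot X (induced E X) ang"
 unfolding planar_rot_def
proof (intro allI impI)
 fix \<omega> assume fl: "flow X (induced E X) \<omega>"
 let ?w = "%x y. if x \<in> X & y \<in> X then \<omega> x y else 0"
 obtain b where b: "\<forall>v j. {v, j} \<in> E --> b v + lsum E ang ?w v j = b j + rsum E ang ?w j v"
  using planar extend_flow[OF X fl] unfolding planar_rot_def by blast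
 have eq: "lsum (induced E X) ang \<omega> v j = lsum (induced E X) ang ?w v j"
  "rsum (induced E X) ang \<omega> v j = rsum (induced E X) ang ?w v j" if "v \<in> X" for v j
  unfolding lsum_def rsum_def using that by (auto intro!: sum.cong simp: induced_nbrs)
 have "\<forall>v j. {v, j} \<in> induced E X --> b v + lsum (induced E X) ang \<omega> v j = b j + rsum (induced E X) ang \<omega> j v"
  using b lsum_induced[of _ X ?w] by (auto simp: edge_induced eq)
 then show "\<exists>b. \<forall>v j. {v, j} \<in> induced E X --> b v + lsum (induced E X) ang \<omega> v j = b j + rsum (induced E X) ang \<omega> j v"
  by blast
qed

lemma lrot_induced: "X <= V ==> 2 <= card X ==> tight E X ==> lrot X (induced E X) ang"
 by (simp add: lrot_def lrot_axioms_def rsys_induced lgraph_induced planar_induced)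

text \<open>With n vertices there are at least n - 1 faces, and their lengths add up to 4n - 6. If
  all faces but the given one had length at least 4, the sum would be at least 3 + 4(n - 2) = 4n -
  5.\<close>

lemma tri_exists:
 assumes n: "3 <= card V" and d0: "d0 \<in> darts E"
 obtains x y z where "tri E ang x y z" "(x, y) ~: face E ang d0"
proof -
 let ?F = "face E ang ` darts E"
 have finF: "finite ?F" and fin: "!!X. X \<in> ?F ==> finite X"
  using face_sub finite_subset fin_darts by (auto, blast)
 have "E ~= {}" using d0 by (auto simp: darts_def)
 then have nf: "card E + 2 <= card ?F + card V" using num_faces planar by simp
 have "\<Union>?F = darts E" using face_sub face_refl by blast
 moreover have "X \<inter> Y = {}" if "X \<in> ?F" "Y \<in> ?F" "X ~= Y" for X Y
  using that face_eq by blast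
 ultimately have "card (darts E) = (\<Sum>X\<in>?F. card X)"
  using card_Union_disjoint[of ?F] fin by (auto simp: pairwise_def disjnt_def)
 then have sum: "(\<Sum>X\<in>?F. card X) = 2 * card E" using card_darts by simp
 have c3: "3 <= card X" if "X \<in> ?F" for X
  using that face_small(1)[OF degree_ge_2] n by (auto simp: darts_def)
 have "\<exists>X\<in>?F - {face E ang d0}. card X = 3"
 proof (rule ccontr)
  assume "\<not> ?thesis"
  then have c4: "4 <= card X" if "X \<in> ?F - {face E ang d0}" for X
   using c3[of X] that by (metis DiffD1 le_neq_implies_less Suc_leI eval_nat_numeral(3) numeral_eq_Suc pred_numeral_simps(2) semiring_norm(26) semiring_norm(27))
  have "(\<Sum>X\<in>?F. card X) = card (face E ang d0) + (\<Sum>X\<in>?F - {face E ang d0}. card X)"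
   by (rule sum.remove) (use finF d0 in auto)
  moreover have "(\<Sum>X\<in>?F - {face E ang d0}. 4) <= (\<Sum>X\<in>?F - {face E ang d0}. card X)"
   by (rule sum_mono) (use c4 in auto)
  moreover have "card (?F - {face E ang d0}) + 1 = card ?F"
   using finF d0 card_Suc_Diff1[of ?F "face E ang d0"] by force
  moreover have "3 <= card (face E ang d0)" using c3 d0 by auto
  ultimately show False using nf sum card_E n by auto
 qed
 then obtain d where d: "d \<in> darts E" "face E ang d ~= face E ang d0" "card (face E ang d) = 3" by auto
 then have "tri E ang (fst d) (snd d) (nx (fst d) (snd d))"
  using face_small(2)[OF degree_ge_2, of "fst d" "snd d"] n by (auto simp: darts_def case_prod_beta)
 moreover have "(fst d, snd d) ~: face E ang d0" using face_eq[OF d0] d(2) by (metis prod.collapse)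
 ultimately show ?thesis using that by blast
qed

text \<open>Pull the indicator function of a face of the induced subgraph back to the whole graph: as the
 complement of a maximal blocker is connected, it lies in a single face of the subgraph.\<close>
lemma face_outside_maximal_blocker:
 assumes X: "blocker V E a b c X" and max: "!!Y. blocker V E a b c Y ==> X <= Y ==> Y = X"
  and t: "tri E ang a b c" and vj: "{v, j} \<in> induced E X"
  and nf: "face (induced E X) ang (v, j) ~= face (induced E X) ang (a, b)"
 shows "nxt (nbrs (induced E X) v) (ang v) j = nx v j"
proof (rule ccontr)
 assume neq: "nxt (nbrs (induced E X) v) (ang v) j ~= nx v j"
 let ?E = "induced E X"
 have XV: "X <= V" "tight E X" "3 <= card X" "a \<in> X" "b \<in> X" "c ~: X" using X by (auto simp: blocker_def)
 interpret X: lrot X "induced E X" ang using lrot_induced XV by auto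
 have tE: "{a, b} \<in> E" "{b, c} \<in> E" "{c, a} \<in> E" "nx a b = c" using t by (auto simp: tri_def)
 have cV: "c \<in> V" using edgeD[OF tE(2)] by auto
 have vjE: "{v, j} \<in> E" "v \<in> X" "j \<in> X" using vj by (auto simp: edge_induced)
 define l where "l = nx v j"
 have lE: "{v, l} \<in> E" using nx_edge[OF vjE(1)] l_def by simp
 have lX: "l ~: X"
 proof
  assume "l \<in> X"
  then have "nxt (nbrs ?E v) (ang v) j = l"
   by (intro X.cyc.nxt_eqI) (use vjE lE in "auto simp: induced_nbrs mem_nbrs l_def intro: cyc.nxt_le")
  then show False using neq l_def by simp
 qed
 \<comment> \<open>Indicator of the face of \<open>(v, j)\<close> in the induced subgraph. Its
   coboundary is a flow, which is extended by zero and integrated to a potential \<open>C\<close> on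
   the whole graph.\<close>
 define c0 where "c0 d = (if d \<in> face ?E ang (v, j) then 1 else 0 :: real)" for d
 have vjd: "(v, j) \<in> darts ?E" using vj by (simp add: mem_darts)
 have c0_step: "c0 (fstep ?E ang d) = c0 d" if "d \<in> darts ?E" for d
 proof -
  have "fstep ?E ang d \<in> face ?E ang d" unfolding face_def by (rule range_eqI[of _ _ 1]) simp
  then have "face ?E ang (fstep ?E ang d) = face ?E ang d" using X.face_eq[OF that] by blast
  moreover have "d' \<in> face ?E ang (v, j) \<longleftrightarrow> face ?E ang d' = face ?E ang (v, j)" for d'
   using X.face_eq[OF vjd] X.face_refl by metis
  ultimately show ?thesis by (simp add: c0_def)
 qed
 define \<omega> where "\<omega> x y = c0 (x, y) - c0 (y, x)" for x y
 have fl: "flow X ?E \<omega>"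
  unfolding flow_def
 proof (intro conjI ballI allI impI)
  fix x assume "x \<in> X"
  have "(\<Sum>y\<in>nbrs ?E x. c0 (y, x)) = (\<Sum>y\<in>nbrs ?E x. c0 (X.nx x y, x))"
   by (rule sum.reindex_bij_betw[OF X.cyc.nxt_bij, symmetric])
  also have "\<dots> = (\<Sum>y\<in>nbrs ?E x. c0 (x, y))"
  proof (rule sum.cong[OF refl])
   fix y assume "y \<in> nbrs ?E x"
   then have "{x, y} \<in> ?E" by (simp add: mem_nbrs)
   then show "c0 (X.nx x y, x) = c0 (x, y)" using c0_step[of "(x, y)"] by (simp add: X.fstep_eq mem_darts)
  qed
  finally show "(\<Sum>y\<in>nbrs ?E x. \<omega> x y) = 0" by (simp add: \<omega>_def sum_subtractf)
 qed (simp add: \<omega>_def)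
 define w where "w x y = (if x \<in> X & y \<in> X then \<omega> x y else 0)" for x y
 have flw: "flow V E w" using extend_flow[OF XV(1) fl] by (simp add: w_def[abs_def])
 obtain \<beta> where \<beta>: "\<forall>v j. {v, j} \<in> E --> \<beta> v + lsum E ang w v j = \<beta> j + rsum E ang w j v"
  using planar flw unfolding planar_rot_def by blast
 define C where "C d = \<beta> (fst d) + lsum E ang w (fst d) (snd d)" for d
 have C_step: "C (nx x y, x) = C (x, y)" if "{x, y} \<in> E" for x y
  using bspec[OF base_potential(1)[OF flw \<beta> C_def], of "(x, y)"] that fstep_eq[OF that] by (simp add: mem_darts)
 have C_jump: "w x y = C (x, y) - C (y, x)" if "{x, y} \<in> E" for x y
  using base_potential(2)[OF flw \<beta> C_def] that by blast
 have flw': "flow X ?E w" using fl by (auto simp: flow_def w_def edge_induced induced_nbrs)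
 have \<beta>': "\<forall>v j. {v, j} \<in> ?E --> \<beta> v + lsum ?E ang w v j = \<beta> j + rsum ?E ang w j v"
  using \<beta> lsum_induced[of _ X w] by (auto simp: edge_induced w_def)
 define C' where "C' d = \<beta> (fst d) + lsum ?E ang w (fst d) (snd d)" for d
 have CC: "C' (x, y) = C (x, y)" if "x \<in> X" for x y
  using lsum_induced[of x X w] that by (simp add: C'_def C_def w_def)
 \<comment> \<open>\<open>C'\<close> and \<open>c0\<close> are potentials of the same flow on a
   connected subgraph, so they differ by a constant.\<close>
 have "C' (v, j) - c0 (v, j) = C' (a, b) - c0 (a, b)"
 proof (rule X.dart_const[OF X.connected, of "%d. C' d - c0 d"])
  show "C' (x, y) - c0 (x, y) = C' (y, x) - c0 (y, x)" if "{y, x} \<in> ?E" for x y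
  proof -
   have "w y x = C' (y, x) - C' (x, y)" using X.base_potential(2)[OF flw' \<beta>' C'_def] that by blast
   moreover have "w y x = c0 (y, x) - c0 (x, y)" using that by (simp add: w_def \<omega>_def edge_induced)
   ultimately show ?thesis by simp
  qed
  show "C' (fstep ?E ang d) - c0 (fstep ?E ang d) = C' d - c0 d" if "d \<in> darts ?E" for d
   using X.base_potential(1)[OF flw' \<beta>' C'_def] c0_step[OF that] that by auto
 qed (use vjd tE XV in "auto simp: mem_darts edge_induced")
 moreover have "c0 (v, j) = 1" using X.face_refl by (simp add: c0_def)
 moreover have "c0 (a, b) = 0"
  using X.face_eq[OF vjd, of "(a, b)"] nf by (auto simp: c0_def)
 moreover have "C' (v, j) = C (v, j)" "C' (a, b) = C (a, b)" using CC vjE XV by auto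
 moreover have "C (v, j) = C (l, v)" "C (a, b) = C (c, a)" using C_step[OF vjE(1)] C_step[OF tE(1)] tE(4) l_def by auto
 moreover have "C (l, v) = C (c, a)"
 proof -
  \<comment> \<open>Outside \<open>X\<close> the potential has no jumps, hence one value per vertex,
    and adjacent vertices share it. By \<open>complement_connected\<close> there is only one value,
    so \<open>C\<close> agrees at \<open>l\<close> and at \<open>c\<close>, while \<open>c0\<close>
    tells the two sectors apart.\<close>
  define K where "K = {x \<in> V - X. \<exists>y. {x, y} \<in> E & C (x, y) ~= C (c, a)}"
  have rev: "C (x, y) = C (y, x)" if "{x, y} \<in> E" "x ~: X" for x y
   using C_jump[OF that(1)] that(2) by (simp add: w_def)
  have loc: "C (x, y) = C (x, z)" if "{x, y} \<in> E" "{x, z} \<in> E" "x ~: X" for x y z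
  proof (rule cyc.nxt_const[of x "%y. C (x, y)"])
   fix y assume "y \<in> nbrs E x"
   then have e: "{x, y} \<in> E" by (simp add: mem_nbrs)
   show "C (x, nx x y) = C (x, y)" using C_step[OF e] rev[OF nx_edge[OF e]] that by simp
  qed (use that in "auto simp: mem_nbrs")
  have "K = {}"
  proof (rule complement_connected[OF max X])
   have K0: "x ~: K" if "{x, y} \<in> E" "C (x, y) = C (c, a)" "x ~: X" for x y
    unfolding K_def mem_Collect_eq using loc[of x y] that by metis
   show "c ~: K" using K0[OF tE(3) refl XV(6)] .
   show "{x, y} ~: E" if xy: "x \<in> K" "y \<in> V - X - K" for x y
   proof
    assume e: "{x, y} \<in> E"
    have "{y, x} \<in> E" using e by (simp add: insert_commute)
    then have "C (y, x) = C (c, a)" using xy(2) unfolding K_def by blast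
    then have "C (x, y) = C (c, a)" using rev[OF e] xy by (simp add: K_def)
    then show False using xy K0[OF e] by (simp add: K_def)
   qed
  qed (auto simp: K_def cV)
  moreover have "{l, v} \<in> E" "l \<in> V - X" using lE lX edgeD[OF lE] by (simp_all add: insert_commute)
  ultimately show ?thesis unfolding K_def by blast
 qed
 ultimately show False by simp
qed

lemma maximal_blocker:
 assumes "blocker V E a b c X"
 obtains Y where "blocker V E a b c Y" "!!Z. blocker V E a b c Z ==> Y <= Z ==> Z = Y"
proof -
 have bd: "\<forall>Z. blocker V E a b c Z --> card Z < Suc (card V)"
  using card_mono[OF finV] by (auto simp: blocker_def less_Suc_eq_le)
 obtain Y where Y: "blocker V E a b c Y" "!!Z. blocker V E a b c Z ==> card Z <= card Y"
  using ex_has_greatest_nat[OF assms bd] by blast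
 have "Z = Y" if "blocker V E a b c Z" "Y <= Z" for Z
  using card_seteq[of Z Y] Y(2)[OF that(1)] that fin_sub[of Z] by (auto simp: blocker_def)
 then show ?thesis using that Y(1) by blast
qed

text \<open>Faces of the induced subgraph other than that of \<open>(a, b)\<close> are faces of the
  whole graph, so a contractible triangle found inside \<open>X\<close> away from that face is still
  facial.\<close>

lemma contractible_step:
 assumes t: "tri E ang a b c" and X: "blocker V E a b c X" and max: "!!Y. blocker V E a b c Y ==> X <= Y ==> Y = X"
  and uw: "{u, w} \<in> E" "\<not> {u, w} <= X"
  and IH: "\<exists>x y z. tri (induced E X) ang x y z & (x, y) ~: face (induced E X) ang (a, b) & {x, y} ~= {a, b} &
    (\<nexists>Z. blocker X (induced E X) x y z Z)"
 shows "\<exists>x y z. tri E ang x y z & (x, y) ~: face E ang (u, w) & {x, y} ~= {u, w} & (\<nexists>Z. blocker V E x y z Z)"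
proof -
 let ?E = "induced E X"
 have XV: "X <= V" "tight E X" "3 <= card X" "a \<in> X" "b \<in> X" "c ~: X" using X by (auto simp: blocker_def)
 interpret X: lrot X "induced E X" ang using lrot_induced XV by auto
 have tE: "{a, b} \<in> E" "{b, c} \<in> E" "{c, a} \<in> E" "nx a b = c" using t by (auto simp: tri_def)
 obtain x y z where xyz: "tri ?E ang x y z" "(x, y) ~: face ?E ang (a, b)" "{x, y} ~= {a, b}" "\<nexists>Z. blocker X ?E x y z Z"
  using IH by blast
 have eX: "{x, y} \<in> ?E" "{y, z} \<in> ?E" "{z, x} \<in> ?E" using xyz(1) by (auto simp: tri_def)
 have ed: "{x, y} \<in> E" "{y, z} \<in> E" "{z, x} \<in> E" "x \<in> X" "y \<in> X" "z \<in> X" using eX by (auto simp: edge_induced)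
 have fne: "face ?E ang d ~= face ?E ang (a, b)" if "d \<in> {(x, y), (z, x), (y, z)}" for d
 proof -
  have "(x, y) \<in> darts ?E" "d \<in> face ?E ang (x, y)" using that X.tri_face[OF xyz(1)] eX by (auto simp: mem_darts)
  then have "face ?E ang d = face ?E ang (x, y)" using X.face_eq by blast
  then show ?thesis using xyz(2) X.face_refl by metis
 qed
 have "X.nx x y = nx x y" "X.nx z x = nx z x" "X.nx y z = nx y z"
  using face_outside_maximal_blocker[OF X max t] eX fne by auto
 then have t': "tri E ang x y z" using xyz(1) ed by (simp add: tri_def)
 have "(x, y) ~: face E ang (u, w)"
 proof
  assume "(x, y) \<in> face E ang (u, w)"
  then have "face E ang (x, y) = face E ang (u, w)" using face_eq uw by (simp add: mem_darts)
  then have "(u, w) \<in> {(x, y), (z, x), (y, z)}" using face_refl[of "(u, w)"] tri_face[OF t'] by simp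
  then show False using uw(2) ed by auto
 qed
 moreover have "{x, y} ~= {u, w}" using uw(2) ed by auto
 \<comment> \<open>\<open>Z\<close> meets \<open>X\<close> in a tight set, which would already block
   inside \<open>X\<close> unless it is just \<open>{x, y}\<close>. Then \<open>Z \<union> X\<close>
   is tight and larger than \<open>X\<close>, so it contains \<open>c\<close>; the edges from
   \<open>c\<close> to \<open>a\<close> and \<open>b\<close> must lie inside \<open>Z\<close>, which
   forces \<open>{a, b} = {x, y}\<close>.\<close>
 moreover have "\<not> blocker V E x y z Z" for Z
 proof
  assume Z: "blocker V E x y z Z"
  then have Z': "Z <= V" "tight E Z" "x \<in> Z" "y \<in> Z" "z ~: Z" "3 <= card Z" by (auto simp: blocker_def)
  have fin: "finite X" "finite Z" using fin_sub XV Z' by auto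
  have xy: "x ~= y" using edgeD[OF ed(1)] by auto
  then have two: "2 <= card (Z \<inter> X)" using card_mono[of "Z \<inter> X" "{x, y}"] fin Z' ed by auto
  note un = tight_Un_Int[OF Z'(1,2) XV(1,2) two]
  have "\<not> 3 <= card (Z \<inter> X)"
   using xyz(4) un(2) Z' ed by (auto simp: blocker_def tight_def induced_induced)
  then have "card (Z \<inter> X) = card {x, y}" using two xy by simp
  then have ZX: "Z \<inter> X = {x, y}" using card_subset_eq[of "Z \<inter> X" "{x, y}"] fin Z' ed by auto
  have "Z \<union> X ~= X"
  proof
   assume "Z \<union> X = X"
   then have "Z = {x, y}" using ZX by blast
   then show False using Z'(6) xy by simp
  qed
  moreover have "3 <= card (Z \<union> X)" using card_mono[of "Z \<union> X" X] fin XV by auto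
  ultimately have cZ: "c \<in> Z" using max[of "Z \<union> X"] un(1) XV Z' by (auto simp: blocker_def)
  have "{a, c} \<in> induced E (Z \<union> X)" "{b, c} \<in> induced E (Z \<union> X)" using tE cZ XV by (auto simp: induced_def insert_commute)
  then have "a \<in> Z" "b \<in> Z" using un(3) XV(6) by (auto simp: edge_induced)
  then have "{a, b} <= {x, y}" using ZX XV by auto
  then show False using xyz(3) xy edgeD[OF tE(1)] by auto
 qed
 ultimately show ?thesis using t' by blast
qed

end

text \<open>The stronger statement, avoiding a given dart, makes the induction over tight subsets work.\<close>
lemma contractible_edge_avoiding:
 assumes "lrot V E ang" "3 <= card V" "{u, w} \<in> E"
 shows "\<exists>x y z. tri E ang x y z & (x, y) ~: face E ang (u, w) & {x, y} ~= {u, w} & (\<nexists>Z. blocker V E x y z Z)"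
 using assms
proof (induction "card V" arbitrary: V E u w rule: less_induct)
 case less
 interpret lrot V E ang by fact
 have step: ?case if t: "tri E ang a b c" and X: "blocker V E a b c X" and max: "!!Y. blocker V E a b c Y ==> X <= Y ==> Y = X"
  and uw: "\<not> {u, w} <= X" for a b c X
 proof (rule contractible_step[OF t X max less.prems(3) uw])
  have XV: "X <= V" "tight E X" "3 <= card X" "a \<in> X" "b \<in> X" "c ~: X" using X by (auto simp: blocker_def)
  have ab: "{a, b} \<in> induced E X" "c \<in> V" using t XV edgeD[of b c] by (auto simp: tri_def edge_induced)
  have "card X < card V" using XV ab finV by (intro psubset_card_mono) auto
  then show "\<exists>x y z. tri (induced E X) ang x y z & (x, y) ~: face (induced E X) ang (a, b) & {x, y} ~= {a, b} &
    (\<nexists>Z. blocker X (induced E X) x y z Z)"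
   using less.hyps[of X "induced E X" a b] lrot_induced[of X] XV ab by auto
 qed
 have uw: "(u, w) \<in> darts E" "u ~= w" using less.prems(3) edgeD by (auto simp: mem_darts)
 obtain x y z where xyz: "tri E ang x y z" "(x, y) ~: face E ang (u, w)"
  using tri_exists[OF less.prems(2) uw(1)] by blast
 have dist: "x ~= y" "y ~= z" "z ~= x" using xyz(1) edgeD by (auto simp: tri_def)
 have nf: "d ~: face E ang (u, w)" if "d \<in> {(x, y), (z, x), (y, z)}" for d
 proof
  assume "d \<in> face E ang (u, w)"
  moreover have "d \<in> face E ang (x, y)" "(x, y) \<in> darts E" using tri_face[OF xyz(1)] that xyz(1) by (auto simp: mem_darts tri_def)
  ultimately have "face E ang (u, w) = face E ang (x, y)" using face_eq uw(1) by metis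
  then show False using xyz(2) face_refl by metis
 qed
 \<comment> \<open>The three edges of the triangle are distinct, so at least two of them differ from
   \<open>{u, w}\<close>; the corners are renamed to make these \<open>{a, b}\<close> and
   \<open>{b, c}\<close>.\<close>
 have "\<exists>a b c. tri E ang a b c & {a, b} ~= {u, w} & {b, c} ~= {u, w} & (a, b) ~: face E ang (u, w) & (b, c) ~: face E ang (u, w)"
 proof (cases "{x, y} = {u, w}")
  case True
  then show ?thesis using tri_rot[OF xyz(1)] dist nf by (intro exI[of _ y] exI[of _ z] exI[of _ x]) (auto simp: doubleton_eq_iff)
 next
  case False
  show ?thesis
  proof (cases "{y, z} = {u, w}")
   case True
   then show ?thesis using tri_rot[OF tri_rot[OF xyz(1)]] dist nf by (intro exI[of _ z] exI[of _ x] exI[of _ y]) (auto simp: doubleton_eq_iff)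
  next
   case F: False
   have "(x, y) ~: face E ang (u, w)" "(y, z) ~: face E ang (u, w)" using nf by blast+
   then show ?thesis using xyz(1) False F by blast
  qed
 qed
 then obtain a b c where abc: "tri E ang a b c" "{a, b} ~= {u, w}" "{b, c} ~= {u, w}" "(a, b) ~: face E ang (u, w)" "(b, c) ~: face E ang (u, w)"
  by blast
 have bca: "tri E ang b c a" using tri_rot[OF abc(1)] .
 show ?case
 proof (cases "(\<nexists>Z. blocker V E a b c Z) | (\<nexists>Z. blocker V E b c a Z)")
  case True
  then show ?thesis using abc bca by blast
 next
  case False
  then obtain X1 where X1: "blocker V E a b c X1" "!!Z. blocker V E a b c Z ==> X1 <= Z ==> Z = X1"
   using maximal_blocker by metis
  obtain X2 where X2: "blocker V E b c a X2" "!!Z. blocker V E b c a Z ==> X2 <= Z ==> Z = X2"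
   using False maximal_blocker by metis
  \<comment> \<open>Tight sets with two common vertices have no edge between their differences, but
    \<open>{c, a}\<close> would be one: \<open>X1\<close> omits \<open>c\<close> and
    \<open>X2\<close> omits \<open>a\<close>. Hence at most one of the two blockers contains
    \<open>{u, w}\<close>, and the other allows the descent.\<close>
  have "\<not> 2 <= card (X1 \<inter> X2)"
  proof
   assume "2 <= card (X1 \<inter> X2)"
   then have "induced E (X1 \<union> X2) = induced E X1 \<union> induced E X2"
    using tight_Un_Int(3)[of X1 X2] X1(1) X2(1) by (simp add: blocker_def)
   moreover have "{c, a} \<in> induced E (X1 \<union> X2)" using abc(1) X1(1) X2(1) by (auto simp: tri_def edge_induced blocker_def)
   ultimately show False using X1(1) X2(1) by (auto simp: edge_induced blocker_def)
  qed
  moreover have "2 <= card (X1 \<inter> X2)" if "{u, w} <= X1" "{u, w} <= X2"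
   using card_mono[of "X1 \<inter> X2" "{u, w}"] that uw(2) fin_sub[of X1] X1(1) by (auto simp: blocker_def)
  ultimately have "\<not> {u, w} <= X1 | \<not> {u, w} <= X2" by blast
  then show ?thesis using step[OF abc(1) X1] step[OF bca X2] by blast
 qed
qed

lemma (in lrot) contractible_edge:
 assumes "3 <= card V"
 obtains a b c where "tri E ang a b c" "\<nexists>Z. blocker V E a b c Z"
proof -
 have "E ~= {}" using card_E assms by auto
 then obtain u w where "{u, w} \<in> E" using edge_ex by (metis ex_in_conv)
 then show ?thesis using contractible_edge_avoiding[OF lrot_axioms assms] that by blast
qed

section \<open>Contraction of an edge\<close>

definition cyc3 :: "real => real => real => bool" where
 "cyc3 x y z \<longleftrightarrow> x < y & y < z | y < z & z < x | z < x & x < y"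

text \<open>Rotation of the circle of length 1 that brings \<open>t\<close> to 0, used to let the
  angles at \<open>a\<close> and \<open>b\<close> start at \<open>c\<close>.\<close>

definition turn :: "real => real => real" where
 "turn t x = (if t <= x then x - t else x - t + 1)"

lemma turn_range: "0 <= t ==> t < 1 ==> 0 <= x ==> x < 1 ==> 0 <= turn t x & turn t x < 1"
 by (auto simp: turn_def)

lemma turn_self [simp]: "turn t t = 0"
 by (simp add: turn_def)

lemma turn_eq_iff: "0 <= t ==> t < 1 ==> 0 <= x ==> x < 1 ==> 0 <= y ==> y < 1 ==> turn t x = turn t y \<longleftrightarrow> x = y"
 by (auto simp: turn_def)

lemma cd_turn: "0 <= t ==> t < 1 ==> 0 <= x ==> x < 1 ==> 0 <= y ==> y < 1 ==> cd (turn t x) (turn t y) = cd x y"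
 by (auto simp: turn_def cd_def)

lemma cyc3_turn:
 "0 <= t ==> t < 1 ==> 0 <= x ==> x < 1 ==> 0 <= y ==> y < 1 ==> 0 <= z ==> z < 1 ==>
  cyc3 (turn t x) (turn t y) (turn t z) \<longleftrightarrow> cyc3 x y z"
 by (auto simp: turn_def cyc3_def)

lemma (in cyc) nxt_betweenI:
 assumes "j \<in> N" "k \<in> N"
  "!!l. l \<in> N ==> if f j < f k then f l <= f j | f k <= f l else f k <= f l & f l <= f j"
 shows "nxt N f j = k"
proof (rule nxt_eqI[OF assms(1,2)])
 fix l assume l: "l \<in> N"
 show "cd (f j) (f k) <= cd (f j) (f l)"
  using assms(3)[OF l] rng[OF assms(1)] rng[OF assms(2)] rng[OF l] by (auto simp: cd_def split: if_splits)
qed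

lemma (in cyc) cyc_turn: "c \<in> N ==> cyc N (%x. turn (f c) (f x))"
 using fin inj rng[of c] rng turn_range[of "f c"] turn_eq_iff[of "f c"] by unfold_locales (auto simp: inj_on_def)

lemma (in cyc) nxt_turn:
 assumes "c \<in> N" "j \<in> N"
 shows "nxt N (%x. turn (f c) (f x)) j = nxt N f j"
proof -
 interpret t: cyc N "%x. turn (f c) (f x)" by (rule cyc_turn) fact
 show ?thesis
  using nxt_le nxt_in[OF assms(2)] by (intro t.nxt_eqI assms) (auto simp: cd_turn rng assms)
qed

locale contraction = lrot V E ang for V :: "'a set" and E ang +
 fixes a b c :: 'a
 assumes tri: "tri E ang a b c" and no_blocker: "\<not> blocker V E a b c Z" and n3: "3 <= card V"
begin

definition "A = nbrs E a - {b, c}"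
definition "B = nbrs E b - {a, c}"
definition "V' = V - {b}"
definition "E' = {e \<in> E. b ~: e} \<union> (%z. {a, z}) ` B"
definition "ga x = turn (ang a c) (ang a x)"
definition "gb x = turn (ang b c) (ang b x)"
text \<open>Counterclockwise at \<open>a\<close> come \<open>c\<close>, the block \<open>A\<close>,
  then \<open>b\<close>; at \<open>b\<close> come \<open>c\<close>, \<open>a\<close>, then the block
  \<open>B\<close>. Contraction puts \<open>B\<close> in the place of \<open>b\<close>. The order
  \<open>c\<close>, \<open>A\<close>, \<open>B\<close> is obtained by squeezing \<open>ga\<close>
  into the first half of the circle and \<open>gb\<close> into the second.\<close>

definition "ang' v z = (if v = a then (if z \<in> B then 1 / 2 + gb z / 2 else ga z / 2)
 else if v \<in> B & z = a then ang v b else ang v z)"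

lemma edges: "{a, b} \<in> E" "{b, c} \<in> E" "{c, a} \<in> E" "{b, a} \<in> E" "{c, b} \<in> E" "{a, c} \<in> E"
 using tri by (auto simp: tri_def insert_commute)

lemma nx_inj: "{v, j} \<in> E ==> {v, k} \<in> E ==> nx v j = nx v k ==> j = k"
 using cyc.nxt_inj[of v] by (auto simp: inj_on_def mem_nbrs)

lemma nxs: "nx a b = c" "nx c a = b" "nx b c = a"
 using tri by (auto simp: tri_def)

lemma dist: "a ~= b" "b ~= c" "c ~= a" "a \<in> V" "b \<in> V" "c \<in> V"
 using edges edgeD by auto

lemma nbrs_a: "nbrs E a = insert b (insert c A)" and nbrs_b: "nbrs E b = insert a (insert c B)"
 using edges by (auto simp: A_def B_def mem_nbrs)

lemma A_edge: "z \<in> A \<longleftrightarrow> {a, z} \<in> E & z ~= b & z ~= c" and B_edge: "z \<in> B \<longleftrightarrow> {b, z} \<in> E & z ~= a & z ~= c"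
 by (auto simp: A_def B_def mem_nbrs)

lemma AB_ne: "a ~: A" "b ~: B" "b ~: A" "a ~: B" "c ~: A" "c ~: B"
 using nbrs_irrefl by (auto simp: A_def B_def)

lemma AB_sub: "A <= V" "B <= V"
 using nbrs_sub by (auto simp: A_def B_def)

lemma fin_AB: "finite A" "finite B"
 by (auto simp: A_def B_def)

text \<open>A common neighbour \<open>z\<close> other than \<open>c\<close> would make
  \<open>{a, b, z}\<close> a tight set without \<open>c\<close>. So the only edges that merge are
  those from \<open>c\<close>.\<close>

lemma AB_disj: "A \<inter> B = {}"
proof (rule ccontr)
 assume "A \<inter> B ~= {}"
 then obtain z where z: "z \<in> A" "z \<in> B" by blast
 then have ez: "{a, z} \<in> E" "{b, z} \<in> E" "z ~= a" "z ~= b" "z ~= c" using AB_ne by (auto simp: A_edge B_edge)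
 let ?Z = "{a, b, z}"
 have c3: "card ?Z = 3" using ez dist by auto
 have "{{a, b}, {a, z}, {b, z}} <= induced E ?Z" using ez edges by (auto simp: induced_def)
 moreover have "card {{a, b}, {a, z}, {b, z}} = 3" using ez dist by (auto simp: doubleton_eq_iff card_insert_if)
 ultimately have "3 <= card (induced E ?Z)" using card_mono[OF finI] by metis
 moreover have "?Z <= V" using ez edgeD dist by auto
 ultimately have "tight E ?Z" using sparse[of ?Z] c3 by (auto simp: tight_def)
 then have "blocker V E a b c ?Z" using c3 ez dist \<open>?Z <= V\<close> by (auto simp: blocker_def)
 then show False using no_blocker by blast
qed

lemma E'_iff:
 "{x, y} \<in> E' \<longleftrightarrow> {x, y} \<in> E & x ~= b & y ~= b | x = a & y \<in> B | y = a & x \<in> B"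
 by (auto simp: E'_def doubleton_eq_iff)

lemma nbrs'_a: "nbrs E' a = insert c (A \<union> B)"
 using edges dist by (auto simp: mem_nbrs E'_iff A_edge AB_ne)

lemma nbrs'_B: "v \<in> B ==> nbrs E' v = insert a (nbrs E v - {b})"
 using AB_ne by (auto simp: mem_nbrs E'_iff)

lemma nbrs'_other: "v ~: B ==> v ~= a ==> v ~= b ==> nbrs E' v = nbrs E v - {b}"
 by (auto simp: mem_nbrs E'_iff)

lemma nbrs_B: "v \<in> B ==> b \<in> nbrs E v & a ~: nbrs E v"
 using AB_disj AB_ne A_edge[of v] B_edge[of v] by (auto simp: mem_nbrs insert_commute)

lemma sgraph': "sgraph V' E'"
proof
 show "finite V'" using finV by (simp add: V'_def)
 fix e assume "e \<in> E'"
 then show "e <= V'" "card e = 2"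
  using edge_sub[of e] edge_card[of e] dist AB_sub AB_ne by (auto simp: E'_def V'_def card_insert_if)
qed

text \<open>The contraction loses the edge \<open>ab\<close>, and if \<open>c\<close> belongs to the
  set also \<open>bc\<close>, which merges with \<open>ac\<close>.\<close>

lemma card_induced':
 assumes W: "a \<in> W" "W <= V'"
 shows "card (induced E' W) + 1 + (if c \<in> W then 1 else 0) <= card (induced E (insert b W))"
proof -
 define f where "f e = (if e \<in> E then e else insert b (e - {a}))" for e
 have f: "e \<in> E & b ~: e & f e = e | (\<exists>z\<in>B. e = {a, z} & f e = {b, z})" if e: "e \<in> E'" for e
 proof (cases "e \<in> E & b ~: e")
  case False
  then obtain z where z: "z \<in> B" "e = {a, z}" using e by (auto simp: E'_def)
  then have "{a, z} ~: E" using AB_disj AB_ne A_edge[of z] by blast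
  then show ?thesis using z AB_ne by (auto simp: f_def)
 qed (auto simp: f_def)
 have inj: "inj_on f (induced E' W)"
 proof (rule inj_onI)
  fix e e' assume "e \<in> induced E' W" "e' \<in> induced E' W" and eq: "f e = f e'"
  then have "e \<in> E'" "e' \<in> E'" unfolding induced_def by blast+
  note fe = f[OF this(1)] f[OF this(2)]
  show "e = e'"
   using fe
  proof (elim disjE bexE conjE)
   fix z z' assume "e = {a, z}" "f e = {b, z}" "e' = {a, z'}" "f e' = {b, z'}"
   then have "{b, z} = {b, z'}" using eq by metis
   then have "z = z'" by (metis doubleton_eq_iff)
   then show ?thesis using \<open>e = {a, z}\<close> \<open>e' = {a, z'}\<close> by metis
  next
   assume "f e = e" "f e' = e'" then show ?thesis using eq by metis
  next
   fix z assume "b ~: e" "f e = e" "f e' = {b, z}"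
   then show ?thesis using eq by (metis insertI1)
  next
   fix z assume "b ~: e'" "f e' = e'" "f e = {b, z}"
   then show ?thesis using eq by (metis insertI1)
  qed
 qed
 have "f ` induced E' W <= induced E (insert b W) - ({{a, b}} \<union> (if c \<in> W then {{b, c}} else {}))"
 proof (rule image_subsetI)
  fix e assume "e \<in> induced E' W"
  then have e: "e \<in> E'" "e <= W" by (auto simp: induced_def)
  show "f e \<in> induced E (insert b W) - ({{a, b}} \<union> (if c \<in> W then {{b, c}} else {}))"
   using f[OF e(1)]
  proof (elim disjE bexE conjE)
   assume h: "e \<in> E" "b ~: e" "f e = e"
   then have "e ~= {a, b}" "e ~= {b, c}" by auto
   then show ?thesis unfolding h(3) using h(1) e(2) by (auto simp: induced_def)
  next
   fix z assume h: "z \<in> B" "e = {a, z}" "f e = {b, z}"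
   have "z ~= a" "z ~= c" "{b, z} \<in> E" using h(1) by (auto simp: B_edge)
   then have "{b, z} ~= {a, b}" "{b, z} ~= {b, c}" "{b, z} \<in> E" by (auto simp: doubleton_eq_iff)
   moreover have "z \<in> W" using h(2) e(2) by auto
   ultimately show ?thesis unfolding h(3) by (auto simp: induced_def)
  qed
 qed
 then have "card (induced E' W) <= card (induced E (insert b W) - ({{a, b}} \<union> (if c \<in> W then {{b, c}} else {})))"
  using card_inj_on_le[OF inj] by simp
 also have "\<dots> = card (induced E (insert b W)) - card ({{a, b}} \<union> (if c \<in> W then {{b, c}} else {}))"
  by (rule card_Diff_subset) (use W edges in "auto simp: induced_def")
 finally have 1: "card (induced E' W) <= \<dots>" .
 have "card ({{a, b}} \<union> (if c \<in> W then {{b, c}} else {})) = 1 + (if c \<in> W then 1 else 0)"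
  using dist by (auto simp: doubleton_eq_iff)
 moreover have "card ({{a, b}} \<union> (if c \<in> W then {{b, c}} else {})) <= card (induced E (insert b W))"
  by (rule card_mono) (use W edges in "auto simp: edge_induced")
 ultimately show ?thesis using 1 by simp
qed

lemma card_E': "card E' + 2 = card E"
proof -
 have Eq: "E = {e \<in> E. b ~: e} \<union> (%z. {b, z}) ` nbrs E b"
 proof (intro equalityI subsetI)
  fix e assume e: "e \<in> E"
  then obtain x y where xy: "e = {x, y}" using edge_ex by metis
  then show "e \<in> {e \<in> E. b ~: e} \<union> (%z. {b, z}) ` nbrs E b"
   using e by (auto simp: mem_nbrs insert_commute)
 qed (auto simp: mem_nbrs)
 have "card E = card ({e \<in> E. b ~: e} \<union> (%z. {b, z}) ` nbrs E b)" using Eq by (rule arg_cong)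
 moreover have "card ({e \<in> E. b ~: e} \<union> (%z. {b, z}) ` nbrs E b) = card {e \<in> E. b ~: e} + card ((%z. {b, z}) ` nbrs E b)"
  by (rule card_Un_disjoint) (auto simp: finE)
 moreover have "card ((%z. {b, z}) ` nbrs E b) = card (nbrs E b)"
  by (rule card_image) (auto simp: inj_on_def doubleton_eq_iff)
 moreover have "card (nbrs E b) = card B + 2" using nbrs_b AB_ne dist fin_AB by auto
 moreover have "card E' = card {e \<in> E. b ~: e} + card ((%z. {a, z}) ` B)"
  unfolding E'_def by (rule card_Un_disjoint) (use AB_disj AB_ne dist in "auto simp: finE fin_AB A_edge")
 moreover have "card ((%z. {a, z}) ` B) = card B"
  by (rule card_image) (auto simp: inj_on_def doubleton_eq_iff)
 ultimately show ?thesis by linarith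
qed

lemma card_V': "card V' + 1 = card V"
 using dist(5) finV card_Suc_Diff1 by (fastforce simp: V'_def)

text \<open>Adding \<open>b\<close> raises the bound by 2, so two edges must be gained in return.
  Without \<open>c\<close> only one is certain, but then \<open>insert b W\<close> is not tight, as
  it would be a blocker.\<close>

lemma lgraph': "lgraph V' E'"
proof -
 interpret s: sgraph V' E' by (rule sgraph')
 show ?thesis
 proof
  show "2 <= card V'" "card E' + 3 = 2 * card V'" using card_V' card_E' card_E n3 by linarith+
  fix W assume W: "W <= V'" "2 <= card W"
  show "card (induced E' W) + 3 <= 2 * card W"
  proof (cases "a \<in> W")
   case False
   then have "induced E' W = induced E W" using W by (auto simp: induced_def E'_def V'_def)
   then show ?thesis using sparse[of W] W by (auto simp: V'_def)
  next
   case True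
   have fW: "finite W" "b ~: W" "insert b W <= V" using W finV dist by (auto simp: V'_def intro: finite_subset)
   then have cW: "card (insert b W) = card W + 1" by simp
   have sp: "card (induced E (insert b W)) + 3 <= 2 * card (insert b W)" using sparse[OF fW(3)] cW W by simp
   have "card (induced E (insert b W)) + 3 ~= 2 * card (insert b W)" if "c ~: W"
    using no_blocker[of "insert b W"] fW cW W True that dist by (auto simp: blocker_def tight_def)
   then show ?thesis using sp cW card_induced'[OF True W(1)] by (cases "c \<in> W") auto
  qed
 qed
qed

lemma g_range: "x \<in> nbrs E a ==> 0 <= ga x & ga x < 1" "x \<in> nbrs E b ==> 0 <= gb x & gb x < 1"
 using ang_rng[OF edges(6)] ang_rng[OF edges(2)] ang_rng turn_range by (auto simp: ga_def gb_def mem_nbrs)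

lemma g_c [simp]: "ga c = 0" "gb c = 0"
 by (simp_all add: ga_def gb_def)

lemma ga_fun: "ga = (%x. turn (ang a c) (ang a x))" and gb_fun: "gb = (%x. turn (ang b c) (ang b x))"
 by (simp_all add: ga_def gb_def fun_eq_iff)

sublocale a: cyc "nbrs E a" ga
 unfolding ga_fun using edges by (intro cyc.cyc_turn) (simp add: mem_nbrs)

sublocale b: cyc "nbrs E b" gb
 unfolding gb_fun using edges by (intro cyc.cyc_turn) (simp add: mem_nbrs)

lemma g_inj: "inj_on ga (nbrs E a)" "inj_on gb (nbrs E b)"
 by (rule a.inj) (rule b.inj)

lemma nx_a: "j \<in> nbrs E a ==> nxt (nbrs E a) ga j = nx a j" and nx_b: "j \<in> nbrs E b ==> nxt (nbrs E b) gb j = nx b j"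
 unfolding ga_fun gb_fun using edges by (intro cyc.nxt_turn; simp add: mem_nbrs)+

lemma ga_pos: "x \<in> nbrs E a ==> x ~= c ==> 0 < ga x" and gb_pos: "x \<in> nbrs E b ==> x ~= c ==> 0 < gb x"
 using g_range[of x] g_inj edges by (auto simp: inj_on_def mem_nbrs less_le)

lemma ga_b: "x \<in> nbrs E a ==> x ~= b ==> ga x < ga b"
proof -
 assume x: "x \<in> nbrs E a" "x ~= b"
 have "b \<in> nbrs E a" using edges by (simp add: mem_nbrs)
 have "nxt (nbrs E a) ga b = c" using nx_a[OF \<open>b \<in> nbrs E a\<close>] nxs(1) by simp
 then have "ga x <= ga b" using a.nxt_between[OF \<open>b \<in> nbrs E a\<close> x(1)] g_range(1)[OF \<open>b \<in> nbrs E a\<close>] by simp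
 then show ?thesis using x g_inj(1) \<open>b \<in> nbrs E a\<close> by (auto simp: inj_on_def less_le)
qed

lemma gb_a: "x \<in> B ==> gb a < gb x"
proof -
 assume x: "x \<in> B"
 have m: "c \<in> nbrs E b" "x \<in> nbrs E b" "a \<in> nbrs E b" using edges x by (auto simp: mem_nbrs B_edge)
 have ne: "x ~= c" "x ~= a" using x AB_ne by auto
 have "nxt (nbrs E b) gb c = a" using nx_b[OF m(1)] nxs(3) by simp
 then have "gb a <= gb x" using b.nxt_between[OF m(1,2)] gb_pos[OF m(2) ne(1)] gb_pos[OF m(3)] dist by auto
 then show ?thesis using m ne g_inj(2) by (auto simp: inj_on_def less_le)
qed

lemma rsys': "rsys V' E' ang'"
proof -
 interpret s: sgraph V' E' by (rule sgraph')
 have in_a: "x \<in> nbrs E a" if "x \<in> insert c A" for x using that nbrs_a by auto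
 have in_b: "x \<in> nbrs E b" if "x \<in> insert c B" for x using that nbrs_b by auto
 have anga: "ang' a x = (if x \<in> B then 1 / 2 + gb x / 2 else ga x / 2)" for x by (simp add: ang'_def)
 have injv: "inj_on (ang' v) (nbrs E' v) & (\<forall>j\<in>nbrs E' v. 0 <= ang' v j & ang' v j < 1)" for v
 proof (cases "v = a")
  case True
  have r: "0 <= ga x & ga x < 1" if "x \<in> insert c A" for x using g_range(1) in_a that by blast
  have r': "0 <= gb x & gb x < 1" if "x \<in> insert c B" for x using g_range(2) in_b that by blast
  have "inj_on (ang' a) (insert c (A \<union> B))"
  proof (rule inj_onI)
   fix x y assume xy: "x \<in> insert c (A \<union> B)" "y \<in> insert c (A \<union> B)" "ang' a x = ang' a y"
   show "x = y"
   proof (cases "x \<in> B \<longleftrightarrow> y \<in> B")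
    case T: True
    show ?thesis
    proof (cases "x \<in> B")
     case True
     then show ?thesis using T xy g_inj(2) in_b by (auto simp: anga inj_on_def)
    next
     case False
     then have "x \<in> insert c A" "y \<in> insert c A" using T xy by auto
     then show ?thesis using T False xy(3) g_inj(1) in_a by (auto simp: anga inj_on_def)
    qed
   next
    case False
    then have "x \<in> B & y \<in> insert c A | y \<in> B & x \<in> insert c A" using xy by auto
    then show ?thesis
    proof
     assume "x \<in> B & y \<in> insert c A"
     then show ?thesis using r[of y] r'[of x] xy(3) False by (auto simp: anga)
    next
     assume "y \<in> B & x \<in> insert c A"
     then show ?thesis using r[of x] r'[of y] xy(3) False by (auto simp: anga)
    qed
   qed
  qed
  moreover have "0 <= ang' a x & ang' a x < 1" if "x \<in> insert c (A \<union> B)" for x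
   using that r[of x] r'[of x] by (auto simp: anga)
  ultimately show ?thesis by (simp add: True nbrs'_a)
 next
  case va: False
  show ?thesis
  proof (cases "v \<in> B")
   case True
   have "ang' v x = ang v (if x = a then b else x)" if "x \<in> nbrs E' v" for x
    using True va that by (simp add: ang'_def)
   moreover have "(if x = a then b else x) \<in> nbrs E v" if "x \<in> nbrs E' v" for x
    using that nbrs'_B[OF True] nbrs_B[OF True] by auto
   moreover have "inj_on (%x. if x = a then b else x) (nbrs E' v)"
    using nbrs'_B[OF True] dist by (auto simp: inj_on_def)
   ultimately show ?thesis using ang_inj[of v] ang_rng by (fastforce simp: inj_on_def mem_nbrs)
  next
   case False
   show ?thesis
   proof (cases "v = b")
    case True
    have "nbrs E' b = {}" unfolding nbrs_def E'_iff using AB_ne dist(1) by auto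
    then show ?thesis using True by simp
   next
    case F: False
    have "ang' v x = ang v x" for x using False va by (simp add: ang'_def)
    then show ?thesis using ang_inj[of v] ang_rng nbrs'_other[OF False va F] by (auto simp: inj_on_def mem_nbrs)
   qed
  qed
 qed
 show ?thesis
  by unfold_locales (use injv in "auto simp: mem_nbrs")
qed

sublocale r': rsys V' E' ang'
 by (rule rsys')

text \<open>At a vertex of \<open>B\<close> the contraction merely renames the neighbour
  \<open>b\<close> to \<open>a\<close>.\<close>

lemma nx'_B:
 assumes v: "v \<in> B" and j: "j \<in> nbrs E' v"
 shows "r'.nx v j = (let k = nx v (if j = a then b else j) in if k = b then a else k)"
proof -
 define f where "f x = (if x = a then b else x)" for x
 define h where "h x = (if x = b then a else x)" for x
 have va: "v ~= a" using v AB_ne by auto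
 have f: "f x \<in> nbrs E v" "ang' v x = ang v (f x)" "h (f x) = x" if "x \<in> nbrs E' v" for x
  using that nbrs'_B[OF v] nbrs_B[OF v] va v dist by (auto simp: f_def h_def ang'_def)
 have h: "h x \<in> nbrs E' v" "f (h x) = x" if "x \<in> nbrs E v" for x
  using that nbrs'_B[OF v] nbrs_B[OF v] dist by (auto simp: f_def h_def)
 have "r'.nx v j = h (nx v (f j))"
 proof (rule r'.cyc.nxt_betweenI)
  have k: "nx v (f j) \<in> nbrs E v" using f[OF j] cyc.nxt_in by blast
  then show "h (nx v (f j)) \<in> nbrs E' v" using h by blast
  fix l assume l: "l \<in> nbrs E' v"
  show "if ang' v j < ang' v (h (nx v (f j))) then ang' v l <= ang' v j | ang' v (h (nx v (f j))) <= ang' v l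
    else ang' v (h (nx v (f j))) <= ang' v l & ang' v l <= ang' v j"
   using cyc.nxt_between[of "f j" v "f l"] f[OF j] f[OF l] h[OF k] f(2)[OF h(1)[OF k]] by simp
 qed (use j in auto)
 then show ?thesis by (simp add: f_def h_def Let_def)
qed

text \<open>Deleting the neighbour \<open>b\<close> lets its predecessor inherit its successor.
  Among these vertices only \<open>c\<close> can be adjacent to \<open>b\<close>.\<close>

lemma nx'_other:
 assumes v: "v ~: B" "v ~= a" "v ~= b" and j: "j \<in> nbrs E' v"
 shows "r'.nx v j = (if nx v j = b then nx v b else nx v j)"
proof -
 have N: "nbrs E' v = nbrs E v - {b}" by (rule nbrs'_other[OF v])
 have ang: "ang' v x = ang v x" for x using v by (simp add: ang'_def)
 have jN: "j \<in> nbrs E v" "j ~= b" using j N by auto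
 show ?thesis
 proof (cases "nx v j = b")
  case False
  have "r'.nx v j = nx v j"
  proof (rule r'.cyc.nxt_betweenI[OF j])
   show "nx v j \<in> nbrs E' v" using False cyc.nxt_in[OF jN(1)] N by auto
   show "if ang' v j < ang' v (nx v j) then ang' v l <= ang' v j | ang' v (nx v j) <= ang' v l
    else ang' v (nx v j) <= ang' v l & ang' v l <= ang' v j" if "l \<in> nbrs E' v" for l
    using cyc.nxt_between[OF jN(1), of l] that N ang by simp
  qed
  then show ?thesis using False by simp
 next
  case True
  have bN: "b \<in> nbrs E v" using cyc.nxt_in[OF jN(1)] True by simp
  have nb: "nx v b ~= b" using cyc.nxt_inj[of v] True jN bN by (auto simp: inj_on_def)
  have ne: "ang v j ~= ang v b" using ang_inj[of v] jN bN by (auto simp: inj_on_def)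
  have kN: "nx v b \<in> nbrs E v" using cyc.nxt_in[OF bN] .
  have "r'.nx v j = nx v b"
  proof (rule r'.cyc.nxt_betweenI[OF j])
   show "nx v b \<in> nbrs E' v" using nb kN N by auto
   fix l assume l: "l \<in> nbrs E' v"
   have lN: "l \<in> nbrs E v" "ang v l ~= ang v b" using l N ang_inj[of v] bN by (auto simp: inj_on_def)
   have kb: "ang v (nx v b) ~= ang v b" using nb kN bN ang_inj[of v] by (auto simp: inj_on_def)
   show "if ang' v j < ang' v (nx v b) then ang' v l <= ang' v j | ang' v (nx v b) <= ang' v l
    else ang' v (nx v b) <= ang' v l & ang' v l <= ang' v j"
    using cyc.nxt_between[OF jN(1), of l] cyc.nxt_between[OF jN(1), of b] cyc.nxt_between[OF jN(1) kN]
     cyc.nxt_between[OF bN, of l] cyc.nxt_between[OF bN, of j] True ang ne lN kb jN bN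
    by (auto split: if_splits)
  qed
  then show ?thesis using True by simp
 qed
qed

text \<open>Two cyclic orders are spliced: whatever preceded \<open>b\<close> at \<open>a\<close> is
  now followed by what follows \<open>a\<close> at \<open>b\<close>, and the block \<open>B\<close>
  returns to \<open>c\<close>.\<close>

lemma nx'_a:
 assumes j: "j \<in> nbrs E' a"
 shows "r'.nx a j = (if j \<in> B then nx b j else if nx a j = b then nx b a else nx a j)"
proof -
 have anga: "ang' a x = (if x \<in> B then 1 / 2 + gb x / 2 else ga x / 2)" for x by (simp add: ang'_def)
 have in_a: "x \<in> nbrs E a" if "x \<in> insert c A" for x using that nbrs_a by auto
 have in_b: "x \<in> nbrs E b" if "x \<in> insert c B" for x using that nbrs_b by auto
 have r: "0 <= ga x & ga x < 1" if "x \<in> insert c A" for x using g_range(1) in_a that by blast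
 have r': "0 <= gb x & gb x < 1" if "x \<in> insert c B" for x using g_range(2) in_b that by blast
 note N = nbrs'_a
 have aN: "a \<in> nbrs E b" "c \<in> nbrs E b" "b \<in> nbrs E a" "c \<in> nbrs E a" using edges by (auto simp: mem_nbrs)
 show ?thesis
 proof (cases "j \<in> B")
  case True
  let ?k = "nx b j"
  have jb: "j \<in> nbrs E b" "j ~= c" "j ~= a" using True in_b AB_ne by auto
  have k: "?k \<in> nbrs E b" using cyc.nxt_in[OF jb(1)] .
  have "?k ~= a" using nxs(3) cyc.nxt_inj[of b] jb aN by (auto simp: inj_on_def)
  then have kB: "?k \<in> insert c B" using k nbrs_b by auto
  have bet: "if gb j < gb ?k then gb l <= gb j | gb ?k <= gb l else gb ?k <= gb l & gb l <= gb j" if "l \<in> insert c B" for l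
   using b.nxt_between[OF jb(1) in_b[OF that]] unfolding nx_b[OF jb(1)] .
  have "r'.nx a j = ?k"
  proof (rule r'.cyc.nxt_betweenI[OF j])
   show "?k \<in> nbrs E' a" using kB N by auto
   fix l assume "l \<in> nbrs E' a"
   then have l: "l \<in> insert c A | l \<in> B" using N by auto
   show "if ang' a j < ang' a ?k then ang' a l <= ang' a j | ang' a ?k <= ang' a l
    else ang' a ?k <= ang' a l & ang' a l <= ang' a j"
   proof (cases "?k = c")
    case kc: True
    then have "gb l <= gb j" if "l \<in> B" using bet[of l] that r'[of l] r'[of j] True by (auto split: if_splits)
    then show ?thesis using l r[of l] r'[of l] r'[of j] True kc AB_ne AB_disj by (auto simp: anga)
   next
    case False
    then have kB': "?k \<in> B" using kB by auto
    have "gb j < gb ?k" using bet[of c] gb_pos[OF k False] by (auto split: if_splits)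
    then show ?thesis using l bet[of l] r[of l] r'[of l] r'[of j] r'[of ?k] True kB' AB_ne AB_disj by (auto simp: anga)
   qed
  qed
  then show ?thesis using True by simp
 next
  case False
  then have jA: "j \<in> insert c A" using j N by auto
  have ja: "j \<in> nbrs E a" "j ~= b" using in_a[OF jA] jA AB_ne dist by auto
  let ?k = "nx a j"
  have k: "?k \<in> nbrs E a" using cyc.nxt_in[OF ja(1)] .
  have bet: "if ga j < ga ?k then ga l <= ga j | ga ?k <= ga l else ga ?k <= ga l & ga l <= ga j" if "l \<in> nbrs E a" for l
   using a.nxt_between[OF ja(1) that] unfolding nx_a[OF ja(1)] .
  show ?thesis
  proof (cases "?k = b")
   case True
   have maxj: "ga l <= ga j" if "l \<in> insert c A" for l
   proof -
    have "l ~= b" using that AB_ne dist by auto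
    then have "ga l < ga b" using ga_b[OF in_a[OF that]] by simp
    then show ?thesis using bet[OF in_a[OF that]] ga_b[OF ja] unfolding True by simp
   qed
   let ?m = "nx b a"
   have m: "?m \<in> nbrs E b" using cyc.nxt_in[OF aN(1)] .
   have "?m ~= a" using nxs(3) cyc.nxt_inj[of b] aN dist by (auto simp: inj_on_def)
   then have mB: "?m \<in> insert c B" using m nbrs_b by auto
   have betb: "if gb a < gb ?m then gb l <= gb a | gb ?m <= gb l else gb ?m <= gb l & gb l <= gb a" if "l \<in> nbrs E b" for l
    using b.nxt_between[OF aN(1) that] unfolding nx_b[OF aN(1)] .
   have "r'.nx a j = ?m"
   proof (rule r'.cyc.nxt_betweenI[OF j])
    show "?m \<in> nbrs E' a" using mB N by auto
    fix l assume "l \<in> nbrs E' a"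
    then have l: "l \<in> insert c A | l \<in> B" using N by auto
    show "if ang' a j < ang' a ?m then ang' a l <= ang' a j | ang' a ?m <= ang' a l
     else ang' a ?m <= ang' a l & ang' a l <= ang' a j"
    proof (cases "?m = c")
     case mc: True
     have "B = {}"
     proof (rule ccontr)
      assume "B ~= {}"
      then obtain z where "z \<in> B" by blast
      then show False using betb[of z] gb_a[of z] in_b[of z] mc r'[of c] gb_pos[OF aN(1)] dist by (auto split: if_splits)
     qed
     then show ?thesis using l maxj[of l] r[of l] r[of j] jA mc by (auto simp: anga)
    next
     case F: False
     then have mB': "?m \<in> B" using mB by auto
     have "gb ?m <= gb l" if "l \<in> B" using betb[of l] gb_a[OF that] gb_a[OF mB'] in_b[of l] that by auto
     then show ?thesis using l maxj[of l] r[of l] r[of j] r'[of l] r'[of ?m] jA mB' False AB_ne AB_disj by (auto simp: anga)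
    qed
   qed
   then show ?thesis using False True by simp
  next
   case kb: False
   have "?k ~= c" using nxs(1) cyc.nxt_inj[of a] ja aN by (auto simp: inj_on_def)
   then have kA: "?k \<in> A" and kn: "?k ~: B" using k kb nbrs_a AB_disj by auto
   have "ga j < ga ?k" using bet[of c] ga_pos[OF k \<open>?k ~= c\<close>] aN by (auto split: if_splits)
   have "r'.nx a j = ?k"
   proof (rule r'.cyc.nxt_betweenI[OF j])
    show "?k \<in> nbrs E' a" using kA N by auto
    fix l assume "l \<in> nbrs E' a"
    then have l: "l \<in> insert c A | l \<in> B" using N by auto
    show "if ang' a j < ang' a ?k then ang' a l <= ang' a j | ang' a ?k <= ang' a l
     else ang' a ?k <= ang' a l & ang' a l <= ang' a j"
     using l bet[of l] in_a[of l] \<open>ga j < ga ?k\<close> r[of l] r[of j] r'[of l] r[of ?k] jA kA kn False AB_ne AB_disj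
     by (auto simp: anga)
   qed
   then show ?thesis using False kb by simp
  qed
 qed
qed

lemma planar': "planar_rot V' E' ang'"
 unfolding r'.planar_rot_iff
proof (intro allI impI)
 fix \<omega>' assume fl': "flow V' E' \<omega>'"
 \<comment> \<open>The flow is lifted by giving the edge \<open>bc\<close> nothing and letting
   \<open>ab\<close> carry what balances the block \<open>B\<close>.\<close>
 define s where "s = (\<Sum>z\<in>insert c A. \<omega>' a z)"
 define \<omega> where "\<omega> x y = (if x = a & y = b then - s else if x = b & y = a then s
  else if x = b then (if y = c then 0 else \<omega>' a y) else if y = b then (if x = c then 0 else \<omega>' x a) else \<omega>' x y)" for x y
 have anti': "\<omega>' y x = - \<omega>' x y" if "{x, y} \<in> E'" for x y using fl' that by (simp add: flow_def)
 have sum_a: "(\<Sum>z\<in>B. \<omega>' a z) = - s"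
 proof -
  have "a \<in> V'" using dist by (simp add: V'_def)
  then have "(\<Sum>z\<in>nbrs E' a. \<omega>' a z) = 0" using fl' unfolding flow_def by blast
  moreover have "nbrs E' a = insert c A \<union> B" using nbrs'_a by auto
  moreover have "(\<Sum>z\<in>insert c A \<union> B. \<omega>' a z) = (\<Sum>z\<in>insert c A. \<omega>' a z) + (\<Sum>z\<in>B. \<omega>' a z)"
   by (rule sum.union_disjoint) (use AB_disj AB_ne fin_AB in auto)
  ultimately have "s + (\<Sum>z\<in>B. \<omega>' a z) = 0" unfolding s_def by metis
  then show ?thesis by linarith
 qed
 have fl: "flow V E \<omega>"
  unfolding flow_def
 proof (intro conjI allI impI ballI)
  fix x y assume e: "{x, y} \<in> E"
  have B1: "x \<in> B ==> \<omega>' x a = - \<omega>' a x" for x using anti'[of a x] by (simp add: E'_iff)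
  have "x = b ==> y = a | y = c | y \<in> B" using e by (auto simp: B_edge)
  moreover have "y = b ==> x = a | x = c | x \<in> B" using e B_edge[of x] by (auto simp: insert_commute)
  ultimately consider "x = a & y = b | x = b & y = a" | "x = b" "y = c" | "x = c" "y = b" | "x = b" "y \<in> B" | "y = b" "x \<in> B" | "x ~= b" "y ~= b"
   by blast
  then show "\<omega> y x = - \<omega> x y"
  proof cases
   case 1
   then show ?thesis unfolding \<omega>_def using dist(1) by fastforce
  next
   case 4
   then have "y ~= a" "y ~= b" "y ~= c" using AB_ne by blast+
   then show ?thesis unfolding \<omega>_def 4(1) using B1[OF 4(2)] dist by simp
  next
   case 5
   then have "x ~= a" "x ~= b" "x ~= c" using AB_ne by blast+
   then show ?thesis unfolding \<omega>_def 5(1) using B1[OF 5(2)] dist by simp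
  next
   case 6 then show ?thesis using anti'[of x y] e by (auto simp: \<omega>_def E'_iff)
  next
   case 2 then show ?thesis unfolding \<omega>_def 2 using dist by simp
  next
   case 3 then show ?thesis unfolding \<omega>_def 3 using dist by simp
  qed
 next
  fix v assume v: "v \<in> V"
  consider "v = a" | "v = b" | "v \<in> B" | "v ~: B" "v ~= a" "v ~= b" by blast
  then show "(\<Sum>j\<in>nbrs E v. \<omega> v j) = 0"
  proof cases
   case 1
   have "(\<Sum>j\<in>insert c A. \<omega> a j) = s" unfolding s_def
    by (rule sum.cong) (use AB_ne dist in "auto simp: \<omega>_def")
   then show ?thesis using 1 nbrs_a AB_ne dist fin_AB by (simp add: \<omega>_def)
  next
   case 2
   have "(\<Sum>j\<in>B. \<omega> b j) = - s" unfolding sum_a[symmetric]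
    by (rule sum.cong) (use AB_ne dist in "auto simp: \<omega>_def")
   then show ?thesis using 2 nbrs_b AB_ne dist fin_AB by (simp add: \<omega>_def)
  next
   case 3
   have vn: "v ~= a" "v ~= b" "v ~= c" "v \<in> V'" using 3 AB_ne v by (auto simp: V'_def)
   have "(\<Sum>j\<in>nbrs E v. \<omega> v j) = \<omega> v b + (\<Sum>j\<in>nbrs E v - {b}. \<omega> v j)"
    by (rule sum.remove) (use nbrs_B[OF 3] in auto)
   also have "(\<Sum>j\<in>nbrs E v - {b}. \<omega> v j) = (\<Sum>j\<in>nbrs E v - {b}. \<omega>' v j)"
    by (rule sum.cong) (use vn nbrs_B[OF 3] in "auto simp: \<omega>_def")
   also have "\<omega> v b = \<omega>' v a" using vn by (simp add: \<omega>_def)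
   also have "\<omega>' v a + (\<Sum>j\<in>nbrs E v - {b}. \<omega>' v j) = (\<Sum>j\<in>nbrs E' v. \<omega>' v j)"
    using nbrs'_B[OF 3] nbrs_B[OF 3] by simp
   also have "\<dots> = 0" using fl' vn by (simp add: flow_def)
   finally show ?thesis .
  next
   case 4
   have "(\<Sum>j\<in>nbrs E v. \<omega> v j) = (\<Sum>j\<in>nbrs E v - {b}. \<omega>' v j)"
   proof (rule sum.mono_neutral_cong_right)
    show "\<forall>i\<in>nbrs E v - (nbrs E v - {b}). \<omega> v i = 0"
    proof
     fix i assume "i \<in> nbrs E v - (nbrs E v - {b})"
     then have i: "i = b" "{b, v} \<in> E" by (auto simp: mem_nbrs insert_commute)
     then have "v = c" using 4 B_edge[of v] by blast
     then show "\<omega> v i = 0" using 4 by (simp add: \<omega>_def i(1))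
    qed
    show "\<omega> v x = \<omega>' v x" if "x \<in> nbrs E v - {b}" for x using that 4 by (simp add: \<omega>_def)
   qed auto
   also have "\<dots> = (\<Sum>j\<in>nbrs E' v. \<omega>' v j)" unfolding nbrs'_other[OF 4] ..
   also have "\<dots> = 0" using fl' 4 v by (simp add: flow_def V'_def)
   finally show ?thesis .
  qed
 qed
 obtain C where C: "!!d. d \<in> darts E ==> C (fstep E ang d) = C d" "!!v j. {v, j} \<in> E ==> \<omega> v j = C (v, j) - C (j, v)"
  using planar fl unfolding planar_rot_iff by blast
 have Cs: "C (nx x y, x) = C (x, y)" if "{x, y} \<in> E" for x y
  using C(1)[of "(x, y)"] that by (simp add: fstep_eq mem_darts)
 have tria: "C (c, a) = C (a, b)" "C (b, c) = C (c, a)" using Cs[OF edges(1)] Cs[OF edges(3)] nxs by auto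
 have cb: "C (c, b) = C (c, a)" using C(2)[OF edges(2)] tria dist by (simp add: \<omega>_def)
 \<comment> \<open>Potentials are transported along the renaming of darts. As \<open>bc\<close>
   carries no flow, the sectors on its two sides have equal values, so the merged edge
   \<open>ac\<close> sees the correct value on both sides.\<close>
 define C' where "C' d = (if fst d = a & snd d \<in> B then C (b, snd d) else if snd d = a & fst d \<in> B then C (fst d, b) else C d)" for d
 have C'B: "z \<in> B ==> C' (a, z) = C (b, z)" "z \<in> B ==> C' (z, a) = C (z, b)" for z
  using AB_ne by (auto simp: C'_def)
 have C'o: "\<not> (x = a & y \<in> B) ==> \<not> (y = a & x \<in> B) ==> C' (x, y) = C (x, y)" for x y
  unfolding C'_def by auto
 have jump: "\<omega>' v j = C' (v, j) - C' (j, v)" if e: "{v, j} \<in> E'" for v j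
 proof -
  consider "v = a" "j \<in> B" | "j = a" "v \<in> B" | "\<not> (v = a & j \<in> B)" "\<not> (j = a & v \<in> B)" by blast
  then show ?thesis
  proof cases
   case 1
   have "j ~= a" "j ~= b" "j ~= c" "{b, j} \<in> E" using 1 AB_ne B_edge[of j] by blast+
   then show ?thesis using C(2)[of b j] C'B[OF 1(2)] dist unfolding 1(1) by (simp add: \<omega>_def)
  next
   case 2
   have "v ~= a" "v ~= b" "v ~= c" "{v, b} \<in> E" using 2 AB_ne B_edge[of v] by (blast, blast, blast, simp add: insert_commute)
   then show ?thesis using C(2)[of v b] C'B[OF 2(2)] dist unfolding 2(1) by (simp add: \<omega>_def)
  next
   case 3
   have "{v, j} \<in> E" "v ~= b" "j ~= b" using e 3 by (auto simp: E'_iff)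
   then show ?thesis using C(2)[of v j] C'o 3 by (auto simp: \<omega>_def)
  qed
 qed
 have step: "C' (r'.nx v j, v) = C' (v, j)" if e: "{v, j} \<in> E'" for v j
 proof -
  have vb: "v ~= b" "j ~= b" using e AB_ne dist by (auto simp: E'_iff)
  have jN: "j \<in> nbrs E' v" using e by (simp add: mem_nbrs)
  consider "v = a" | "v \<in> B" | "v ~: B" "v ~= a" by blast
  then show ?thesis
  proof cases
   case 1
   note va = this
   have ib: "C' (z, a) = C (z, b)" if "z \<in> nbrs E b" "z ~= a" for z
    using that C'B C'o[of c a] cb nbrs_b AB_ne dist by auto
   show ?thesis
   proof (cases "j \<in> B")
    case True
    then have e': "{b, j} \<in> E" by (simp add: B_edge)
    have "nx b j ~= a" using nx_inj[OF e' edges(2)] nxs(3) True AB_ne by metis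
    then have "C' (nx b j, a) = C (nx b j, b)" using ib[of "nx b j"] nx_edge[OF e'] by (simp add: mem_nbrs)
    then show ?thesis using nx'_a[of j] jN 1 True Cs[OF e'] C'B[OF True] by simp
   next
    case False
    have e': "{a, j} \<in> E" using e 1 False AB_ne by (auto simp: E'_iff)
    have C'aj: "C' (a, j) = C (a, j)" using False C'o AB_ne by auto
    show ?thesis
    proof (cases "nx a j = b")
     case True
     have "nx b a ~= a" using nx_inj[OF edges(4,2)] nxs(3) dist by metis
     then have "C' (nx b a, a) = C (nx b a, b)" using ib[of "nx b a"] nx_edge[OF edges(4)] by (simp add: mem_nbrs)
     then show ?thesis using nx'_a[of j] jN va False True Cs[OF e'] Cs[OF edges(4)] C'aj by simp
    next
     case F: False
     have "nx a j \<in> insert c A" using nx_edge[OF e'] F by (auto simp: A_edge)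
     then have "C' (nx a j, a) = C (nx a j, a)" using C'o AB_disj AB_ne by auto
     then show ?thesis using nx'_a[of j] jN va False F Cs[OF e'] C'aj by simp
    qed
   qed
  next
   case 2
   let ?f = "%x. if x = a then b else x"
   have va: "v ~= a" using 2 AB_ne by auto
   have e': "{v, ?f j} \<in> E" using e 2 va vb nbrs_B[OF 2] by (auto simp: E'_iff mem_nbrs)
   have 3: "C' (v, x) = C (v, ?f x)" "C' (x, v) = C (?f x, v)" for x
    using 2 va AB_ne C'B[OF 2] by (auto simp: C'_def)
   have k: "nx v (?f j) ~= a" using nx_edge[OF e'] nbrs_B[OF 2] by (auto simp: mem_nbrs)
   have "r'.nx v j = (if nx v (?f j) = b then a else nx v (?f j))" using nx'_B[OF 2 jN] by (simp add: Let_def)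
   then have "C' (r'.nx v j, v) = C (nx v (?f j), v)" using 3 k by auto
   then show ?thesis using Cs[OF e'] 3 by simp
  next
   case 3
   have e': "{v, j} \<in> E" using e 3 vb by (auto simp: E'_iff)
   have 4: "C' (v, x) = C (v, x)" "C' (x, v) = C (x, v)" for x using 3 by (auto simp: C'_def)
   show ?thesis
   proof (cases "nx v j = b")
    case True
    then have vbE: "{v, b} \<in> E" using nx_edge[OF e'] by simp
    then have vc: "v = c" using 3 by (auto simp: B_edge insert_commute)
    have "j = a" using True e' nx_inj[of c j a] edges(3) nxs(2) unfolding vc by metis
    then show ?thesis using nx'_other[OF 3 vb(1) jN] True 4 Cs[OF vbE] cb vc by simp
   next
    case False
    then show ?thesis using nx'_other[OF 3 vb(1) jN] 4 Cs[OF e'] by simp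
   qed
  qed
 qed
 have "\<forall>d\<in>darts E'. C' (fstep E' ang' d) = C' d" using step by (auto simp: darts_def r'.fstep_eq)
 then show "\<exists>C. (\<forall>d\<in>darts E'. C (fstep E' ang' d) = C d) & (\<forall>v j. {v, j} \<in> E' --> \<omega>' v j = C (v, j) - C (j, v))"
  using jump by blast
qed

lemma lrot': "lrot V' E' ang'"
 by (simp add: lrot_def lrot_axioms_def rsys' lgraph' planar')

end

section \<open>Pointed realisations by vertex splitting\<close>

definition cr :: "complex => complex => real" where
 "cr u w = Re u * Im w - Im u * Re w"

text \<open>\<open>ccw3 u v w\<close>: turning counterclockwise from \<open>u\<close>, the direction \<open>v\<close> is met before \<open>w\<close>.\<close>
definition ccw3 :: "complex => complex => complex => bool" where
 "ccw3 u v w \<longleftrightarrow> cr u v > 0 & cr v w > 0 | cr v w > 0 & cr w u > 0 | cr w u > 0 & cr u v > 0"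

definition orient :: "('a => complex) => 'a => 'a => 'a => real" where
 "orient p i j k = cr (p j - p i) (p k - p i)"

definition genpos :: "'a set => ('a => complex) => bool" where
 "genpos V p \<longleftrightarrow> inj_on p V & (\<forall>i\<in>V. \<forall>j\<in>V. \<forall>k\<in>V. i ~= j --> j ~= k --> i ~= k --> orient p i j k ~= 0)"

text \<open>Only disjoint edges are compared; edges with a common endpoint are taken care of by
  general position.\<close>

definition ncross :: "'a set set => ('a => complex) => bool" where
 "ncross E p \<longleftrightarrow> (\<forall>e\<in>E. \<forall>f\<in>E. e \<inter> f = {} --> convex hull (p ` e) \<inter> convex hull (p ` f) = {})"

text \<open>Pointedness as an open half-plane containing all edges at \<open>v\<close>: in contrast
  to the angle condition, it is visibly stable under perturbation.\<close>

definition ptd :: "'a set set => ('a => complex) => 'a => bool" where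
 "ptd E p v \<longleftrightarrow> (\<exists>n. \<forall>j\<in>nbrs E v. (p j - p v) \<bullet> n > 0)"

definition realises :: "'a set set => ('a => 'a => real) => ('a => complex) => bool" where
 "realises E ang p \<longleftrightarrow> (\<forall>v j k l. {v, j} \<in> E --> {v, k} \<in> E --> {v, l} \<in> E --> cyc3 (ang v j) (ang v k) (ang v l) -->
  ccw3 (p j - p v) (p k - p v) (p l - p v))"

lemma cr_anti: "cr u w = - cr w u" by (simp add: cr_def)
lemma cr_self [simp]: "cr u u = 0" by (simp add: cr_def)
lemma cr_add: "cr (u + v) w = cr u w + cr v w" "cr u (v + w) = cr u v + cr u w"
 and cr_diff: "cr (u - v) w = cr u w - cr v w" "cr u (v - w) = cr u v - cr u w"
 and cr_minus: "cr (- u) w = - cr u w" "cr u (- w) = - cr u w"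
 and cr_scale: "cr (of_real t * u) w = t * cr u w" "cr u (of_real t * w) = t * cr u w"
 and cr_scaleR: "cr (t *\<^sub>R u) w = t * cr u w" "cr u (t *\<^sub>R w) = t * cr u w"
 by (simp_all add: cr_def algebra_simps)

lemma cr_mult: "cr (m * u) (m * w) = (norm m)\<^sup>2 * cr u w"
 unfolding cr_def cmod_power2 by (simp add: algebra_simps power2_eq_square)

lemma ccw3_rot: "ccw3 u v w \<longleftrightarrow> ccw3 v w u" by (auto simp: ccw3_def)
lemma cyc3_rot: "cyc3 x y z \<longleftrightarrow> cyc3 y z x" by (auto simp: cyc3_def)

lemma ccw3_scale: "t > 0 ==> ccw3 (t *\<^sub>R u) v w \<longleftrightarrow> ccw3 u v w"
 by (simp add: ccw3_def cr_scaleR zero_less_mult_iff)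

lemma ccw3_mult: "m ~= 0 ==> ccw3 (m * u) (m * v) (m * w) \<longleftrightarrow> ccw3 u v w"
 by (simp add: ccw3_def cr_mult zero_less_mult_iff)

lemma orient_rot: "orient p i j k = orient p j k i" and orient_swap: "orient p i j k = - orient p i k j"
 by (simp_all add: orient_def cr_def algebra_simps)

section \<open>The direction in which a vertex is split\<close>

lemma choose_between:
 fixes L U G :: "real set"
 assumes "finite L" "finite U" "finite G" "!!l u. l \<in> L ==> u \<in> U ==> l < u"
 shows "\<exists>t. (\<forall>l\<in>L. l < t) & (\<forall>u\<in>U. t < u) & t ~: G"
proof -
 obtain lo where lo: "\<forall>l\<in>L. l <= lo" "\<forall>u\<in>U. lo < u"
 proof (cases "L = {}")
  case True
  then show ?thesis using that[of "Min U - 1"] assms(2) by (cases "U = {}") (auto simp: less_le_trans[of _ "Min U"])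
 next
  case False
  then show ?thesis using that[of "Max L"] assms by auto
 qed
 define hi where "hi = (if U = {} then lo + 1 else Min U)"
 have "lo < hi" using lo assms(2) by (auto simp: hi_def)
 then have "infinite ({lo<..<hi} - G)" using assms(3) infinite_Ioo by simp
 then obtain t where "t \<in> {lo<..<hi} - G" using infinite_imp_nonempty by blast
 moreover have "t < u" if "u \<in> U" "t < hi" for u
  using that assms(2) Min_le[of U u] by (auto simp: hi_def split: if_splits)
 ultimately show ?thesis using lo by (intro exI[of _ t]) force
qed

lemma choose_between_fun:
 fixes T :: "'b => real" and S :: "'c => real"
 assumes "finite L" "finite U" "finite G" "!!l u. l \<in> L ==> u \<in> U ==> T l < S u"
 obtains t where "\<forall>l\<in>L. T l < t" "\<forall>u\<in>U. t < S u" "t ~: G"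
proof -
 have "\<exists>t. (\<forall>l\<in>T ` L. l < t) & (\<forall>u\<in>S ` U. t < u) & t ~: G"
  by (rule choose_between) (use assms in auto)
 then show ?thesis using that by blast
qed

text \<open>The direction in which the new vertex is split off. All directions at the split vertex lie in a
 half-plane, so they are described by their slopes \<open>T\<close>; two cases, according to whether the wide
 angle lies before or inside the block \<open>A\<close>.\<close>
lemma split_direction_Re:
 fixes d :: "'a => complex" and h :: "'a => real"
 assumes fin: "finite A" "finite B" "finite F" and c: "c ~: A" "c ~: B"
  and Re: "!!x. x \<in> insert c (A \<union> B) ==> Re (d x) > 0"
  and cyc: "!!x y z. x \<in> insert c (A \<union> B) ==> y \<in> insert c (A \<union> B) ==> z \<in> insert c (A \<union> B) ==>
    cyc3 (h x) (h y) (h z) ==> ccw3 (d x) (d y) (d z)"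
  and ne: "!!x. x \<in> A \<union> B ==> cr (d c) (d x) ~= 0"
  and h: "!!x. x \<in> A \<union> B ==> h c < h x" "!!x y. x \<in> A ==> y \<in> B ==> h x < h y"
  and F: "!!f. f \<in> F ==> f ~= 0"
 shows "\<exists>\<delta>. (\<forall>f\<in>F. cr \<delta> f ~= 0) & cr (d c) \<delta> < 0
  & (\<forall>x\<in>insert c A. \<forall>y\<in>insert c A. h x < h y --> ccw3 \<delta> (d x) (d y))
  & (\<forall>x\<in>B. \<forall>y\<in>insert c B. h x < h y | y = c --> ccw3 (- \<delta>) (d x) (d y))
  & (\<forall>x\<in>insert c A. \<forall>y\<in>insert c B. x ~= c | y ~= c --> (\<forall>s r t. s >= 0 --> r >= 0 --> t > 0 --> t *\<^sub>R \<delta> ~= s *\<^sub>R d x - r *\<^sub>R d y))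
  & (\<exists>n. (\<forall>x\<in>insert c A. d x \<bullet> n > 0) & \<delta> \<bullet> n > 0)
  & (\<exists>n. (\<forall>x\<in>insert c B. d x \<bullet> n > 0) & - \<delta> \<bullet> n > 0)"
proof -
 let ?N = "insert c (A \<union> B)"
 \<comment> \<open>In the right half-plane the sign of a cross product is the sign of a slope
   difference, so all cyclic comparisons become comparisons of real numbers.\<close>
 define T where "T x = Im (d x) / Re (d x)" for x
 have Im: "Im (d x) = T x * Re (d x)" if "x \<in> ?N" for x using Re[OF that] by (simp add: T_def)
 have crd: "cr (d x) (d y) = Re (d x) * Re (d y) * (T y - T x)" if "x \<in> ?N" "y \<in> ?N" for x y
  using Im[OF that(1)] Im[OF that(2)] by (simp add: cr_def algebra_simps)
 have crpos: "cr (d x) (d y) > 0 \<longleftrightarrow> T x < T y" if "x \<in> ?N" "y \<in> ?N" for x y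
 proof -
  note * = crd[OF that] mult_pos_pos[OF Re[OF that(1)] Re[OF that(2)]]
  obtain K where "K > 0" "cr (d x) (d y) = K * (T y - T x)"
   using * by blast
  then show ?thesis by (simp add: zero_less_mult_iff)
 qed
 have ccwT: "ccw3 (d x) (d y) (d z) \<longleftrightarrow> cyc3 (T x) (T y) (T z)" if "x \<in> ?N" "y \<in> ?N" "z \<in> ?N" for x y z
  using crpos that by (auto simp: ccw3_def cyc3_def)
 have TT: "cyc3 (T c) (T x) (T y)" if "x \<in> A \<union> B" "y \<in> A \<union> B" "h x < h y" for x y
 proof -
  have "cyc3 (h c) (h x) (h y)" using h(1) that by (auto simp: cyc3_def)
  then have "ccw3 (d c) (d x) (d y)" using cyc[of c x y] that by blast
  then show ?thesis using ccwT[of c x y] that by blast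
 qed
 have TAB: "cyc3 (T c) (T x) (T y)" if "x \<in> A" "y \<in> B" for x y using TT[of x y] h(2) that by blast
 have Tne: "T x ~= T c" if "x \<in> A \<union> B" for x using ne[OF that] crd[of c x] that by auto
 define G where "G = (%f. Im f / Re f) ` F"
 have G: "cr (Complex 1 t) f ~= 0" if "t ~: G" "f \<in> F" for t f
 proof
  assume 0: "cr (Complex 1 t) f = 0"
  then have "Im f = t * Re f" by (simp add: cr_def)
  moreover have "Re f ~= 0" using calculation F[OF that(2)] by (auto simp: complex_eq_iff)
  ultimately have "t = Im f / Re f" by simp
  then show False using that by (auto simp: G_def)
 qed
 have finG: "finite G" using fin by (simp add: G_def)
 have cru: "cr (d x) (Complex 1 t) = Re (d x) * (t - T x)" "cr (Complex 1 t) (d x) = Re (d x) * (T x - t)" if "x \<in> ?N" for x t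
  using Im[OF that] by (simp_all add: cr_def algebra_simps)
 have in_dot: "d x \<bullet> Complex s 1 = Re (d x) * (T x + s)" "d x \<bullet> Complex s (-1) = Re (d x) * (s - T x)" if "x \<in> ?N" for x s
  using Im[OF that] by (simp_all add: inner_complex_def algebra_simps)
 have dot_pos: "x \<in> ?N ==> T x < s ==> d x \<bullet> Complex s (-1) > 0" "x \<in> ?N ==> - s < T x ==> d x \<bullet> Complex s 1 > 0"
  "x \<in> ?N ==> d x \<bullet> 1 > 0" for x s
  using in_dot[of x s] Re[of x] mult_pos_pos[of "Re (d x)" "s - T x"] mult_pos_pos[of "Re (d x)" "T x + s"]
  by (simp_all add: inner_complex_def)
 show ?thesis
 proof (cases "\<forall>x\<in>A. T c < T x")
  case True
  have AB: "T x < T y" if "x \<in> insert c A" "y \<in> B" "T c < T y" for x y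
   using TAB[of x y] that True by (auto simp: cyc3_def)
  have f1: "finite (insert c A)" "finite {y\<in>B. T c < T y}" "finite {()}" using fin by auto
  have l1: "T x < T y" if "x \<in> insert c A" "y \<in> {y\<in>B. T c < T y}" for x y using AB that by blast
  obtain \<tau> where \<tau>0: "\<forall>x\<in>insert c A. T x < \<tau>" "\<forall>y\<in>{y\<in>B. T c < T y}. \<tau> < T y" "\<tau> ~: G"
   by (rule choose_between_fun[OF f1(1,2) finG l1])
  then have \<tau>: "\<forall>x\<in>insert c A. T x < \<tau>" "\<forall>y\<in>B. T c < T y --> \<tau> < T y" "\<tau> ~: G" by blast+
  obtain \<tau>' where \<tau>'0: "\<forall>x\<in>insert c A. T x < \<tau>'" "\<forall>u\<in>{()}. \<tau>' < \<tau>"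
   using choose_between_fun[OF f1(1,3) finite.emptyI, of T "%_. \<tau>"] \<tau>(1) by metis
  then have \<tau>': "\<forall>x\<in>insert c A. T x < \<tau>'" "\<tau>' < \<tau>" by blast+
  have AA: "T x < T y" if "x \<in> insert c A" "y \<in> insert c A" "h x < h y" for x y
  proof -
   have "y ~= c" using that h(1)[of x] by auto
   then show ?thesis using that True TT[of x y] by (cases "x = c") (auto simp: cyc3_def)
  qed
  \<comment> \<open>All slopes of \<open>A\<close> exceed that of \<open>c\<close>, so \<tau> fits
    between \<open>A\<close> and those of \<open>B\<close> above \<open>c\<close>. The new vertex is
    moved backwards: its own edges, including the one back to the old vertex, stay in the right
    half-plane, and those of the old vertex lie on one side of a line whose slope \<tau>' is between
    \<open>A\<close> and \<tau>.\<close>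
  let ?\<delta> = "- Complex 1 \<tau>"
  have pa: "\<forall>x\<in>insert c A. d x \<bullet> Complex \<tau>' (-1) > 0" "?\<delta> \<bullet> Complex \<tau>' (-1) > 0"
   using dot_pos(1) \<tau>' by (blast, simp add: inner_complex_def)
  have pb: "\<forall>x\<in>insert c B. d x \<bullet> 1 > 0" "- ?\<delta> \<bullet> 1 > 0"
   using dot_pos(3) by (blast, simp add: inner_complex_def)
  have 2: "ccw3 ?\<delta> (d x) (d y)" if xy: "x \<in> insert c A" "y \<in> insert c A" "h x < h y" for x y
  proof -
   have "cr (d x) (d y) > 0" using crpos[of x y] AA[OF xy] xy by blast
   moreover have "cr ?\<delta> (d x) > 0" using cru(2)[of x \<tau>] Re[of x] \<tau>(1) xy by (auto simp: cr_minus zero_less_mult_iff mult_less_0_iff)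
   ultimately show ?thesis by (simp add: ccw3_def)
  qed
  have 3: "ccw3 (- ?\<delta>) (d x) (d y)" if xy: "x \<in> B" "y \<in> insert c B" "h x < h y | y = c" for x y
  proof -
   have Tc: "T c < \<tau>" using \<tau> by auto
   have T1: "\<tau> < T x | T x < T c" "\<tau> < T y | T y <= T c" using \<tau>(2) xy Tne[of x] Tne[of y] by force+
   have "cyc3 \<tau> (T x) (T y)"
   proof (cases "y = c")
    case True then show ?thesis using T1 Tc by (auto simp: cyc3_def)
   next
    case False
    then show ?thesis using TT[of x y] xy T1 Tc Tne[of y] by (auto simp: cyc3_def)
   qed
   moreover have "x \<in> ?N" "y \<in> ?N" using xy by auto
   ultimately show ?thesis using cru[of x \<tau>] cru[of y \<tau>] crpos[of x y] Re[of x] Re[of y]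
    unfolding ccw3_def cyc3_def by (simp add: zero_less_mult_iff)
  qed
  \<comment> \<open>A common point of an edge at the old and an edge at the new vertex would give
    this equation. Its real part eliminates one coefficient; what remains has opposite strict signs
    on the two sides.\<close>
  have 4: "t *\<^sub>R ?\<delta> ~= s *\<^sub>R d x - r *\<^sub>R d y" if xy: "x \<in> insert c A" "y \<in> insert c B" "x ~= c | y ~= c" and srt: "s >= 0" "r >= 0" "t > 0" for x y s r t
  proof
   assume eq: "t *\<^sub>R ?\<delta> = s *\<^sub>R d x - r *\<^sub>R d y"
   define X where "X = s * Re (d x)"
   define Y where "Y = r * Re (d y)"
   have "x \<in> ?N" "y \<in> ?N" using xy by auto
   have e1: "- t = X - Y" using arg_cong[OF eq, of Re] by (simp add: X_def Y_def)
   have e2: "- t * \<tau> = X * T x - Y * T y"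
    using arg_cong[OF eq, of Im] Im[OF \<open>x \<in> ?N\<close>] Im[OF \<open>y \<in> ?N\<close>] by (simp add: X_def Y_def algebra_simps)
   have X0: "X >= 0" using srt Re[of x] \<open>x \<in> ?N\<close> by (simp add: X_def less_imp_le)
   have Yt: "Y = X + t" using e1 by simp
   have e3: "X * (T x - T y) = t * (T y - \<tau>)" using e2 unfolding Yt by (simp add: algebra_simps)
   have Tc: "T c < \<tau>" using \<tau> by auto
   show False
   proof (cases "y \<in> B & T c < T y")
    case True
    then have "T x - T y <= 0" "0 < T y - \<tau>" using AB[of x y] xy(1) \<tau>(2) by (simp_all add: less_imp_le)
    then have "X * (T x - T y) <= 0" "0 < t * (T y - \<tau>)" using X0 srt(3) by (simp_all only: mult_nonneg_nonpos mult_pos_pos)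
    then show False using e3 by linarith
   next
    case False
    then have "T y <= T c" using xy by auto
    moreover have "T c <= T x" using xy True by auto
    ultimately have "0 <= T x - T y" "T y - \<tau> < 0" using Tc by linarith+
    then have "0 <= X * (T x - T y)" "t * (T y - \<tau>) < 0" using X0 srt(3) by (simp_all only: mult_nonneg_nonneg mult_pos_neg)
    then show False using e3 by linarith
   qed
  qed
  show ?thesis
  proof (rule exI[of _ ?\<delta>], intro conjI)
   show "\<forall>f\<in>F. cr ?\<delta> f ~= 0" using G[OF \<tau>(3)] by (simp add: cr_minus)
   show "cr (d c) ?\<delta> < 0" using cru(1)[of c \<tau>] \<tau> Re[of c] by (simp add: cr_minus zero_less_mult_iff)
   show "\<exists>n. (\<forall>x\<in>insert c A. d x \<bullet> n > 0) & ?\<delta> \<bullet> n > 0" using pa by blast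
   show "\<exists>n. (\<forall>x\<in>insert c B. d x \<bullet> n > 0) & - ?\<delta> \<bullet> n > 0" using pb by blast
  qed (use 2 3 4 in blast)+
 next
  case False
  then obtain x1 where x1: "x1 \<in> A" "T x1 < T c" using Tne by force
  have Bc: "T y < T c" if "y \<in> B" for y using TAB[OF x1(1) that] x1 by (auto simp: cyc3_def)
  have A2: "T x < T y" if "x \<in> A" "T x < T c" "y \<in> insert c B" for x y
   using TAB[of x y] that by (auto simp: cyc3_def)
  have f1: "finite {x\<in>A. T x < T c}" "finite (insert c B)" "finite {()}" using fin by auto
  have l1: "T x < T y" if "x \<in> {x\<in>A. T x < T c}" "y \<in> insert c B" for x y using A2 that by blast
  obtain \<tau> where \<tau>0: "\<forall>x\<in>{x\<in>A. T x < T c}. T x < \<tau>" "\<forall>y\<in>insert c B. \<tau> < T y" "\<tau> ~: G"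
   by (rule choose_between_fun[OF f1(1,2) finG l1])
  then have \<tau>: "\<forall>x\<in>A. T x < T c --> T x < \<tau>" "\<forall>y\<in>insert c B. \<tau> < T y" "\<tau> ~: G" by blast+
  obtain \<tau>' where \<tau>'0: "\<forall>y\<in>insert c B. \<tau>' < T y" "\<forall>u\<in>{()}. \<tau> < \<tau>'"
   using choose_between_fun[OF f1(3,2) finite.emptyI, of "%_. \<tau>" T] \<tau>(2) by metis
  then have \<tau>': "\<forall>y\<in>insert c B. \<tau>' < T y" "\<tau> < \<tau>'" by blast+
  \<comment> \<open>Some of \<open>A\<close> lies below \<open>c\<close> in slope, hence below all
    of \<open>B\<close>, and \<open>B\<close> lies below \<open>c\<close>. The new vertex is moved
    forwards with a slope between these low elements of \<open>A\<close> and \<open>B\<close>, and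
    the two half-planes exchange their roles.\<close>
  let ?\<delta> = "Complex 1 \<tau>"
  have Tc: "\<tau> < T c" using \<tau> by auto
  have pa: "\<forall>x\<in>insert c A. d x \<bullet> 1 > 0" "?\<delta> \<bullet> 1 > 0"
   using dot_pos(3) by (blast, simp add: inner_complex_def)
  have pb: "\<forall>x\<in>insert c B. d x \<bullet> Complex (- \<tau>') 1 > 0" "- ?\<delta> \<bullet> Complex (- \<tau>') 1 > 0"
   using dot_pos(2)[of _ "- \<tau>'"] \<tau>' by (simp, simp add: inner_complex_def)
  have 2: "ccw3 ?\<delta> (d x) (d y)" if xy: "x \<in> insert c A" "y \<in> insert c A" "h x < h y" for x y
  proof -
   have yc: "y \<in> A" using xy h(1)[of x] by auto
   have T1: "T c <= T x | T x < \<tau>" "T c < T y | T y < \<tau>" using \<tau>(1) xy Tne[of y] yc by force+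
   have "cyc3 \<tau> (T x) (T y)"
   proof (cases "x = c")
    case True then show ?thesis using T1 Tc by (auto simp: cyc3_def)
   next
    case False
    then show ?thesis using TT[of x y] xy yc T1 Tc by (auto simp: cyc3_def)
   qed
   moreover have "x \<in> ?N" "y \<in> ?N" using xy by auto
   ultimately show ?thesis using cru[of x \<tau>] cru[of y \<tau>] crpos[of x y] Re[of x] Re[of y]
    unfolding ccw3_def cyc3_def by (simp add: zero_less_mult_iff)
  qed
  have 3: "ccw3 (- ?\<delta>) (d x) (d y)" if xy: "x \<in> B" "y \<in> insert c B" "h x < h y | y = c" for x y
  proof -
   have "T x < T y" using xy TT[of x y] Bc[of x] Bc[of y] by (cases "y = c") (auto simp: cyc3_def)
   then have "cr (d x) (d y) > 0" using crpos[of x y] xy by blast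
   moreover have "cr (d y) (- ?\<delta>) > 0" using cru(1)[of y \<tau>] Re[of y] \<tau>(2) xy by (auto simp: cr_minus mult_less_0_iff)
   ultimately show ?thesis by (simp add: ccw3_def)
  qed
  have 4: "t *\<^sub>R ?\<delta> ~= s *\<^sub>R d x - r *\<^sub>R d y" if xy: "x \<in> insert c A" "y \<in> insert c B" "x ~= c | y ~= c" and srt: "s >= 0" "r >= 0" "t > 0" for x y s r t
  proof
   assume eq: "t *\<^sub>R ?\<delta> = s *\<^sub>R d x - r *\<^sub>R d y"
   define X where "X = s * Re (d x)"
   define Y where "Y = r * Re (d y)"
   have "x \<in> ?N" "y \<in> ?N" using xy by auto
   have e1: "t = X - Y" using arg_cong[OF eq, of Re] by (simp add: X_def Y_def)
   have e2: "t * \<tau> = X * T x - Y * T y"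
    using arg_cong[OF eq, of Im] Im[OF \<open>x \<in> ?N\<close>] Im[OF \<open>y \<in> ?N\<close>] by (simp add: X_def Y_def algebra_simps)
   have Y0: "Y >= 0" using srt Re[of y] \<open>y \<in> ?N\<close> by (simp add: Y_def less_imp_le)
   have Xt: "X = Y + t" using e1 by simp
   have e3: "Y * (T x - T y) = t * (\<tau> - T x)" using e2 unfolding Xt by (simp add: algebra_simps)
   show False
   proof (cases "x \<in> A & T x < T c")
    case True
    then have "T x - T y <= 0" "0 < \<tau> - T x" using A2[of x y] xy(2) \<tau>(1) by (simp_all add: less_imp_le)
    then have "Y * (T x - T y) <= 0" "0 < t * (\<tau> - T x)" using Y0 srt(3) by (simp_all only: mult_nonneg_nonpos mult_pos_pos)
    then show False using e3 by linarith
   next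
    case False
    then have "T c <= T x" using xy by auto
    moreover have "T y <= T c" using xy Bc by force
    ultimately have "0 <= T x - T y" "\<tau> - T x < 0" using Tc by linarith+
    then have "0 <= Y * (T x - T y)" "t * (\<tau> - T x) < 0" using Y0 srt(3) by (simp_all only: mult_nonneg_nonneg mult_pos_neg)
    then show False using e3 by linarith
   qed
  qed
  show ?thesis
  proof (rule exI[of _ ?\<delta>], intro conjI)
   show "\<forall>f\<in>F. cr ?\<delta> f ~= 0" using G[OF \<tau>(3)] by simp
   show "cr (d c) ?\<delta> < 0" using cru(1)[of c \<tau>] Tc Re[of c] by (simp add: mult_less_0_iff)
   show "\<exists>n. (\<forall>x\<in>insert c A. d x \<bullet> n > 0) & ?\<delta> \<bullet> n > 0" using pa by blast
   show "\<exists>n. (\<forall>x\<in>insert c B. d x \<bullet> n > 0) & - ?\<delta> \<bullet> n > 0" using pb by blast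
  qed (use 2 3 4 in blast)+
 qed
qed

text \<open>Multiplication by the conjugate of \<open>n\<close> carries the half-plane of
  \<open>n\<close> to the right half-plane and preserves all conditions. These serve, in this order,
  for general position, the orientation of the triangle \<open>abc\<close>, the cyclic orders at the
  old and at the new vertex, disjointness of their edges, and pointedness at both.\<close>

lemma split_direction:
 fixes d :: "'a => complex" and h :: "'a => real"
 assumes fin: "finite A" "finite B" "finite F" and c: "c ~: A" "c ~: B"
  and n: "!!x. x \<in> insert c (A \<union> B) ==> d x \<bullet> n > 0"
  and cyc: "!!x y z. x \<in> insert c (A \<union> B) ==> y \<in> insert c (A \<union> B) ==> z \<in> insert c (A \<union> B) ==>
    cyc3 (h x) (h y) (h z) ==> ccw3 (d x) (d y) (d z)"
  and ne: "!!x. x \<in> A \<union> B ==> cr (d c) (d x) ~= 0"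
  and h: "!!x. x \<in> A \<union> B ==> h c < h x" "!!x y. x \<in> A ==> y \<in> B ==> h x < h y"
  and F: "!!f. f \<in> F ==> f ~= 0"
 obtains \<delta> n1 n2 where "\<forall>f\<in>F. cr \<delta> f ~= 0" "cr (d c) \<delta> < 0"
  "\<forall>x\<in>insert c A. \<forall>y\<in>insert c A. h x < h y --> ccw3 \<delta> (d x) (d y)"
  "\<forall>x\<in>B. \<forall>y\<in>insert c B. h x < h y | y = c --> ccw3 (- \<delta>) (d x) (d y)"
  "\<forall>x\<in>insert c A. \<forall>y\<in>insert c B. x ~= c | y ~= c --> (\<forall>s r t. s >= 0 --> r >= 0 --> t > 0 --> t *\<^sub>R \<delta> ~= s *\<^sub>R d x - r *\<^sub>R d y)"
  "\<forall>x\<in>insert c A. d x \<bullet> n1 > 0" "\<delta> \<bullet> n1 > 0"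
  "\<forall>x\<in>insert c B. d x \<bullet> n2 > 0" "- \<delta> \<bullet> n2 > 0"
proof -
 have n0: "n ~= 0" using n[of c] by auto
 let ?m = "cnj n"
 have m0: "?m ~= 0" using n0 by simp
 have inn: "u \<bullet> w = Re (cnj w * u)" for u w :: complex by (simp add: inner_complex_def)
 have inm: "(?m * u) \<bullet> w = u \<bullet> (n * w)" for u w by (simp add: inner_complex_def algebra_simps)
 have "\<exists>\<delta>. (\<forall>f\<in>(*) ?m ` F. cr \<delta> f ~= 0) & cr (?m * d c) \<delta> < 0
  & (\<forall>x\<in>insert c A. \<forall>y\<in>insert c A. h x < h y --> ccw3 \<delta> (?m * d x) (?m * d y))
  & (\<forall>x\<in>B. \<forall>y\<in>insert c B. h x < h y | y = c --> ccw3 (- \<delta>) (?m * d x) (?m * d y))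
  & (\<forall>x\<in>insert c A. \<forall>y\<in>insert c B. x ~= c | y ~= c --> (\<forall>s r t. s >= 0 --> r >= 0 --> t > 0 --> t *\<^sub>R \<delta> ~= s *\<^sub>R (?m * d x) - r *\<^sub>R (?m * d y)))
  & (\<exists>n. (\<forall>x\<in>insert c A. (?m * d x) \<bullet> n > 0) & \<delta> \<bullet> n > 0)
  & (\<exists>n. (\<forall>x\<in>insert c B. (?m * d x) \<bullet> n > 0) & - \<delta> \<bullet> n > 0)"
 proof (rule split_direction_Re[where d = "%x. ?m * d x" and h = h and A = A and B = B and c = c and F = "(*) ?m ` F"])
  show "finite A" "finite B" "finite ((*) ?m ` F)" "c ~: A" "c ~: B" using fin c by auto
  show "Re (?m * d x) > 0" if "x \<in> insert c (A \<union> B)" for x using n[OF that] unfolding inn .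
  show "ccw3 (?m * d x) (?m * d y) (?m * d z)"
   if "x \<in> insert c (A \<union> B)" "y \<in> insert c (A \<union> B)" "z \<in> insert c (A \<union> B)" "cyc3 (h x) (h y) (h z)" for x y z
   unfolding ccw3_mult[OF m0] using cyc that by blast
  show "cr (?m * d c) (?m * d x) ~= 0" if "x \<in> A \<union> B" for x using ne[OF that] m0 unfolding cr_mult by simp
  show "h c < h x" if "x \<in> A \<union> B" for x using h(1) that by blast
  show "h x < h y" if "x \<in> A" "y \<in> B" for x y using h(2) that by blast
  show "f ~= 0" if "f \<in> (*) ?m ` F" for f using that F m0 by auto
 qed
 then obtain \<delta>' where D: "\<forall>f\<in>(*) ?m ` F. cr \<delta>' f ~= 0" "cr (?m * d c) \<delta>' < 0"
  "\<forall>x\<in>insert c A. \<forall>y\<in>insert c A. h x < h y --> ccw3 \<delta>' (?m * d x) (?m * d y)"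
  "\<forall>x\<in>B. \<forall>y\<in>insert c B. h x < h y | y = c --> ccw3 (- \<delta>') (?m * d x) (?m * d y)"
  "\<forall>x\<in>insert c A. \<forall>y\<in>insert c B. x ~= c | y ~= c --> (\<forall>s r t. s >= 0 --> r >= 0 --> t > 0 --> t *\<^sub>R \<delta>' ~= s *\<^sub>R (?m * d x) - r *\<^sub>R (?m * d y))"
  "\<exists>n. (\<forall>x\<in>insert c A. (?m * d x) \<bullet> n > 0) & \<delta>' \<bullet> n > 0"
  "\<exists>n. (\<forall>x\<in>insert c B. (?m * d x) \<bullet> n > 0) & - \<delta>' \<bullet> n > 0"
  by - (erule exE, (erule conjE)+, rule that)
 obtain n1 where n1: "\<forall>x\<in>insert c A. (?m * d x) \<bullet> n1 > 0" "\<delta>' \<bullet> n1 > 0" using D(6) by blast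
 obtain n2 where n2: "\<forall>x\<in>insert c B. (?m * d x) \<bullet> n2 > 0" "- \<delta>' \<bullet> n2 > 0" using D(7) by blast
 define \<delta> where "\<delta> = \<delta>' / ?m"
 have \<delta>': "\<delta>' = ?m * \<delta>" using m0 by (simp add: \<delta>_def)
 have pos: "(norm ?m)\<^sup>2 > 0" using m0 by simp
 show ?thesis
 proof (rule that[of \<delta> "n * n1" "n * n2"]; (intro ballI allI impI)?)
  show "cr \<delta> f ~= 0" if "f \<in> F" for f
   using D(1)[rule_format, OF imageI[OF that]] unfolding \<delta>' cr_mult by simp
  show "cr (d c) \<delta> < 0" using D(2) pos unfolding \<delta>' cr_mult by (simp add: mult_less_0_iff)
  show "ccw3 \<delta> (d x) (d y)" if "x \<in> insert c A" "y \<in> insert c A" "h x < h y" for x y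
   using D(3)[rule_format, OF that] unfolding \<delta>' ccw3_mult[OF m0] .
  show "ccw3 (- \<delta>) (d x) (d y)" if "x \<in> B" "y \<in> insert c B" "h x < h y | y = c" for x y
   using D(4)[rule_format, OF that] unfolding \<delta>' mult_minus_right[symmetric] ccw3_mult[OF m0] .
  show "t *\<^sub>R \<delta> ~= s *\<^sub>R d x - r *\<^sub>R d y" if "x \<in> insert c A" "y \<in> insert c B" "x ~= c | y ~= c" "s >= 0" "r >= 0" "t > 0" for x y s r t
  proof
   assume "t *\<^sub>R \<delta> = s *\<^sub>R d x - r *\<^sub>R d y"
   then have "?m * (t *\<^sub>R \<delta>) = ?m * (s *\<^sub>R d x - r *\<^sub>R d y)" by simp
   then show False using D(5)[rule_format, OF that] unfolding \<delta>' by (simp add: right_diff_distrib)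
  qed
  show "d x \<bullet> (n * n1) > 0" if "x \<in> insert c A" for x using n1(1)[rule_format, OF that] unfolding inm .
  show "\<delta> \<bullet> (n * n1) > 0" using n1(2) unfolding \<delta>' inm .
  show "d x \<bullet> (n * n2) > 0" if "x \<in> insert c B" for x using n2(1)[rule_format, OF that] unfolding inm .
  show "- \<delta> \<bullet> (n * n2) > 0" using n2(2) unfolding \<delta>' mult_minus_right[symmetric] inm .
 qed
qed

section \<open>Pointed drawings in general position and their vertex splits\<close>

definition good :: "'a set => 'a set set => ('a => 'a => real) => ('a => complex) => bool" where
 "good V E ang p \<longleftrightarrow> genpos V p & ncross E p & (\<forall>v\<in>V. ptd E p v) & realises E ang p"

lemma tendsto_cr [tendsto_intros]:
 "(f \<longlongrightarrow> a) F ==> (g \<longlongrightarrow> b) F ==> ((%x. cr (f x) (g x)) \<longlongrightarrow> cr a b) F"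
 unfolding cr_def by (intro tendsto_intros)

lemma ccw3_eventually:
 assumes "(f \<longlongrightarrow> a) F" "(g \<longlongrightarrow> b) F" "(h \<longlongrightarrow> c) F" "ccw3 a b c"
 shows "eventually (%x. ccw3 (f x) (g x) (h x)) F"
proof -
 have *: "eventually (%x. cr (u x) (v x) > 0) F" if "(u \<longlongrightarrow> a') F" "(v \<longlongrightarrow> b') F" "cr a' b' > 0" for u v a' b'
  using tendsto_cr[OF that(1,2)] that(3) by (rule order_tendstoD)
 from assms(4) show ?thesis unfolding ccw3_def[of a b c]
 proof (elim disjE conjE)
  assume "cr a b > 0" "cr b c > 0"
  then have "eventually (%x. cr (f x) (g x) > 0) F" "eventually (%x. cr (g x) (h x) > 0) F"
   using *[OF assms(1,2)] *[OF assms(2,3)] by blast+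
  then show ?thesis by eventually_elim (simp add: ccw3_def)
 next
  assume "cr b c > 0" "cr c a > 0"
  then have "eventually (%x. cr (g x) (h x) > 0) F" "eventually (%x. cr (h x) (f x) > 0) F"
   using *[OF assms(2,3)] *[OF assms(3,1)] by blast+
  then show ?thesis by eventually_elim (simp add: ccw3_def)
 next
  assume "cr c a > 0" "cr a b > 0"
  then have "eventually (%x. cr (h x) (f x) > 0) F" "eventually (%x. cr (f x) (g x) > 0) F"
   using *[OF assms(3,1)] *[OF assms(1,2)] by blast+
  then show ?thesis by eventually_elim (simp add: ccw3_def)
 qed
qed

lemma segment_2: "convex hull (p ` {x, y}) = closed_segment (p x) (p y)"
 by (simp add: segment_convex_hull)

text \<open>The segment has positive distance from \<open>S\<close>, and moving one endpoint by
  \<open>t *\<^sub>R \<delta>\<close> moves no point of it by more than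
  \<open>t * norm \<delta>\<close>.\<close>

lemma segment_perturb:
 fixes q w \<delta> :: complex
 assumes "closed S" "closed_segment q w \<inter> S = {}"
 shows "\<forall>\<^sub>F t in at_right (0::real). closed_segment (q + t *\<^sub>R \<delta>) w \<inter> S = {}"
proof -
 obtain d where d: "d > 0" "!!x y. x \<in> closed_segment q w ==> y \<in> S ==> d <= dist x y"
  using separate_compact_closed[OF compact_segment assms(1,2)] by blast
 have "((%t::real. t * norm \<delta>) \<longlongrightarrow> 0 * norm \<delta>) (at_right 0)" by (intro tendsto_intros)
 then have "\<forall>\<^sub>F t in at_right (0::real). t * norm \<delta> < d" using order_tendstoD(2) d(1) by fastforce
 moreover have "\<forall>\<^sub>F t in at_right (0::real). t > 0" by (simp add: eventually_at_right_less)
 ultimately show ?thesis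
 proof eventually_elim
  case (elim t)
  show ?case
  proof (rule ccontr)
   assume "closed_segment (q + t *\<^sub>R \<delta>) w \<inter> S ~= {}"
   then obtain u where u: "0 <= u" "u <= 1" "(1 - u) *\<^sub>R (q + t *\<^sub>R \<delta>) + u *\<^sub>R w \<in> S"
    by (auto simp: closed_segment_def)
   have "(1 - u) *\<^sub>R q + u *\<^sub>R w \<in> closed_segment q w" using u by (auto simp: closed_segment_def)
   then have "d <= dist ((1 - u) *\<^sub>R q + u *\<^sub>R w) ((1 - u) *\<^sub>R (q + t *\<^sub>R \<delta>) + u *\<^sub>R w)" using d(2) u(3) by blast
   also have "\<dots> = norm (- (((1 - u) * t) *\<^sub>R \<delta>))"
    unfolding dist_norm by (rule arg_cong[of _ _ norm]) (simp add: algebra_simps)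
   also have "\<dots> = (1 - u) * (t * norm \<delta>)" using u elim by simp
   also have "\<dots> <= t * norm \<delta>" using u elim mult_left_le_one_le[of "t * norm \<delta>" "1 - u"] by simp
   finally show False using elim by simp
  qed
 qed
qed

lemma orient_segment:
 assumes "z \<in> closed_segment (p x) (p y)" "p q = z"
 shows "orient p q x y = 0"
proof -
 obtain u where "p q = (1 - u) *\<^sub>R p x + u *\<^sub>R p y" using assms by (auto simp: closed_segment_def)
 then have "p x - p q = u *\<^sub>R (p x - p y)" "p y - p q = (u - 1) *\<^sub>R (p x - p y)" by (simp_all add: algebra_simps)
 then show ?thesis by (simp add: orient_def cr_scaleR)
qed

lemma eventually_right_scaleR:
 fixes q \<delta> :: complex
 shows "((%t::real. q + t *\<^sub>R \<delta>) \<longlongrightarrow> q) (at_right 0)"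
 by (rule tendsto_eq_intros refl tendsto_ident_at)+ simp

lemma genposD: "genpos V p ==> i \<in> V ==> j \<in> V ==> k \<in> V ==> i ~= j ==> j ~= k ==> i ~= k ==> orient p i j k ~= 0"
 by (simp add: genpos_def)

context contraction
begin

text \<open>At \<open>c\<close> the vertices \<open>a\<close> and \<open>b\<close> are consecutive,
  so no third neighbour separates them and \<open>b\<close> may be replaced by \<open>a\<close> in
  cyclic comparisons.\<close>

lemma cyc3_c:
 assumes "{v, x} \<in> E" "{v, y} \<in> E" "v = c" "x ~= a" "x ~= b" "y ~= a" "y ~= b"
 shows "cyc3 (ang v b) (ang v x) (ang v y) ==> cyc3 (ang v a) (ang v x) (ang v y)"
  "\<not> cyc3 (ang v b) (ang v a) (ang v x)"
proof -
 have ab: "a \<in> nbrs E c" "b \<in> nbrs E c" using edges by (auto simp: mem_nbrs)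
 have ne: "ang c u ~= ang c w" if "u \<in> nbrs E c" "w \<in> nbrs E c" "u ~= w" for u w
  using ang_inj[of c] that by (auto simp: inj_on_def)
 have xy: "x \<in> nbrs E c" "y \<in> nbrs E c" using assms by (auto simp: mem_nbrs)
 have bet: "if ang c a < ang c b then ang c l <= ang c a | ang c b <= ang c l else ang c b <= ang c l & ang c l <= ang c a" if "l \<in> nbrs E c" for l
  using cyc.nxt_between[OF ab(1) that] unfolding nxs .
 show "cyc3 (ang v b) (ang v x) (ang v y) ==> cyc3 (ang v a) (ang v x) (ang v y)"
  using bet[OF xy(1)] bet[OF xy(2)] ne[OF xy(1) ab(1)] ne[OF xy(2) ab(1)] ne[OF xy(1) ab(2)] ne[OF xy(2) ab(2)] assms
  unfolding cyc3_def assms(3) by (simp split: if_splits) linarith+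
 show "\<not> cyc3 (ang v b) (ang v a) (ang v x)"
  using bet[OF xy(1)] ne[OF xy(1) ab(1)] ne[OF xy(1) ab(2)] assms
  unfolding cyc3_def assms(3) by (simp split: if_splits) linarith+
qed

text \<open>All points are kept and \<open>b\<close> is placed at
  \<open>q + t *\<^sub>R \<delta>\<close>. The requirements amount to finitely many conditions, each
  true for all small positive t: either it holds strictly in the limit, where \<open>b\<close>
  coincides with \<open>a\<close>, or it is one for which \<delta> was chosen.\<close>

lemma split_good:
 assumes p0: "good V' E' ang' p0"
 shows "\<exists>p. good V E ang p"
proof -
 have gp: "genpos V' p0" and nc: "ncross E' p0" and pt: "!!v. v \<in> V' ==> ptd E' p0 v" and re: "realises E' ang' p0"
  using p0 by (auto simp: good_def)
 define q where "q = p0 a"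
 define d where "d z = p0 z - q" for z
 have aV: "a \<in> V'" "c \<in> V'" using dist by (auto simp: V'_def)
 have ABV: "A <= V'" "B <= V'" using AB_sub AB_ne by (auto simp: V'_def)
 have N: "nbrs E' a = insert c (A \<union> B)" by (rule nbrs'_a)
 have ND: "x ~= a" if "x \<in> insert c (A \<union> B)" for x using that AB_ne dist by auto
 have inV: "x \<in> V'" if "x \<in> insert c (A \<union> B)" for x using that ABV aV by auto
 have crd: "cr (d x) (d y) ~= 0" if "x \<in> V'" "y \<in> V'" "x ~= y" "x ~= a" "y ~= a" for x y
 proof -
  have "orient p0 a x y ~= 0" using genposD[OF gp aV(1) that(1,2)] that by simp
  then show ?thesis by (simp add: orient_def d_def q_def)
 qed
 obtain n where n: "!!x. x \<in> insert c (A \<union> B) ==> d x \<bullet> n > 0"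
  using pt[OF aV(1)] unfolding ptd_def N d_def q_def by blast
 have hc: "ang' a c = 0" using AB_ne by (simp add: ang'_def)
 have hA: "ang' a x = ga x / 2" if "x \<in> insert c A" for x using that AB_disj AB_ne by (auto simp: ang'_def)
 have hB: "ang' a x = 1 / 2 + gb x / 2" if "x \<in> B" for x using that by (simp add: ang'_def)
 have gA: "0 < ga x & ga x < 1" if "x \<in> A" for x using ga_pos[of x] g_range(1)[of x] that nbrs_a AB_ne by auto
 have gB: "0 < gb x & gb x < 1" if "x \<in> B" for x using gb_pos[of x] g_range(2)[of x] that nbrs_b AB_ne by auto
 have real_a: "ccw3 (d x) (d y) (d z)" if "x \<in> insert c (A \<union> B)" "y \<in> insert c (A \<union> B)" "z \<in> insert c (A \<union> B)"
  "cyc3 (ang' a x) (ang' a y) (ang' a z)" for x y z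
 proof -
  have "{a, x} \<in> E'" "{a, y} \<in> E'" "{a, z} \<in> E'" using that N unfolding mem_nbrs[symmetric] by blast+
  then show ?thesis using re that(4) unfolding realises_def d_def q_def by blast
 qed
 have posh: "ang' a c < ang' a x" if "x \<in> A \<union> B" for x
  using that gA[of x] gB[of x] hA[of x] hB[of x] hc by auto
 have hAB: "ang' a x < ang' a y" if "x \<in> A" "y \<in> B" for x y
  using that gA[of x] gB[of y] hA[of x] hB[of y] by auto
 have dF: "f ~= 0" if "f \<in> d ` (V' - {a})" for f
  using that gp aV unfolding genpos_def inj_on_def d_def q_def by auto
 have finF: "finite (d ` (V' - {a}))" using finV by (auto simp: V'_def)
 have crc: "cr (d c) (d x) ~= 0" if "x \<in> A \<union> B" for x
  using crd[of c x] that AB_ne ABV aV dist by blast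
 obtain \<delta> n1 n2 where D0: "\<forall>f\<in>d ` (V' - {a}). cr \<delta> f ~= 0" "cr (d c) \<delta> < 0"
  "\<forall>x\<in>insert c A. \<forall>y\<in>insert c A. ang' a x < ang' a y --> ccw3 \<delta> (d x) (d y)"
  "\<forall>x\<in>B. \<forall>y\<in>insert c B. ang' a x < ang' a y | y = c --> ccw3 (- \<delta>) (d x) (d y)"
  "\<forall>x\<in>insert c A. \<forall>y\<in>insert c B. x ~= c | y ~= c --> (\<forall>s r t. s >= 0 --> r >= 0 --> t > 0 --> t *\<^sub>R \<delta> ~= s *\<^sub>R d x - r *\<^sub>R d y)"
  "\<forall>x\<in>insert c A. d x \<bullet> n1 > 0" "\<delta> \<bullet> n1 > 0"
  "\<forall>x\<in>insert c B. d x \<bullet> n2 > 0" "- \<delta> \<bullet> n2 > 0"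
  by (rule split_direction[where d = d and h = "ang' a", OF fin_AB finF AB_ne(5,6) n real_a crc posh hAB dF])
 note D = D0[rule_format]
 define P where "P t = p0(b := q + t *\<^sub>R \<delta>)" for t :: real
 \<comment> \<open>The contraction map: as t tends to 0, every vertex \<open>x\<close> tends to
   \<open>p0 (f x)\<close>.\<close>
 define f where "f x = (if x = b then a else x)" for x
 have Pb: "P t b = q + t *\<^sub>R \<delta>" and Po: "x ~= b ==> P t x = p0 x" for t x by (simp_all add: P_def)
 have Pa: "P t a = q" for t using dist by (simp add: P_def q_def)
 have lim: "((%t. P t x) \<longlongrightarrow> p0 (f x)) (at_right 0)" for x
  unfolding P_def f_def using eventually_right_scaleR[of q \<delta>] by (auto simp: q_def)
 have limd: "((%t. P t x - P t v) \<longlongrightarrow> p0 (f x) - p0 (f v)) (at_right 0)" for x v by (intro tendsto_intros lim)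
 have pos: "\<forall>\<^sub>F t in at_right (0::real). t > 0" by (simp add: eventually_at_right_less)
 have fV: "f x \<in> V'" if "x \<in> V" for x using that aV by (auto simp: f_def V'_def)

 have or1: "\<forall>\<^sub>F t in at_right 0. orient (P t) i j k ~= 0"
  if ijk: "i \<in> V" "j \<in> V" "k \<in> V" "f i ~= f j" "f j ~= f k" "f i ~= f k" for i j k
 proof -
  have "orient p0 (f i) (f j) (f k) ~= 0" using genposD[OF gp fV fV fV] ijk by simp
  moreover have "((%t. orient (P t) i j k) \<longlongrightarrow> orient p0 (f i) (f j) (f k)) (at_right 0)"
   unfolding orient_def by (intro tendsto_intros lim)
  ultimately show ?thesis using tendsto_imp_eventually_ne by blast
 qed
 have or2: "\<forall>\<^sub>F t in at_right 0. orient (P t) a b k ~= 0" if k: "k \<in> V" "k ~= a" "k ~= b" for k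
  using pos
 proof eventually_elim
  case (elim t)
  have "cr \<delta> (d k) ~= 0" using D(1) k by (auto simp: V'_def)
  then show ?case using k elim by (simp add: orient_def Pa Pb Po cr_scaleR d_def)
 qed
 have or: "\<forall>\<^sub>F t in at_right 0. i ~= j --> j ~= k --> i ~= k --> orient (P t) i j k ~= 0" if ijk: "i \<in> V" "j \<in> V" "k \<in> V" for i j k
 proof (cases "i ~= j & j ~= k & i ~= k")
  case True
  have sw: "orient g j i k ~= 0 ==> orient g i j k ~= 0" "orient g i k j ~= 0 ==> orient g i j k ~= 0"
   "orient g j k i ~= 0 ==> orient g i j k ~= 0" "orient g k i j ~= 0 ==> orient g i j k ~= 0"
   "orient g k j i ~= 0 ==> orient g i j k ~= 0" for g
   using orient_rot[of g i j k] orient_rot[of g j k i] orient_swap[of g i j k] orient_swap[of g j i k]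
    orient_rot[of g j i k] orient_rot[of g i k j] orient_swap[of g k i j] orient_rot[of g k j i] by linarith+
  have feq: "f x = f y ==> x ~= y ==> x = a & y = b | x = b & y = a" for x y
   by (auto simp: f_def split: if_splits)
  consider "f i ~= f j" "f j ~= f k" "f i ~= f k" | "i = a" "j = b" | "i = b" "j = a" | "j = a" "k = b" | "j = b" "k = a"
   | "i = a" "k = b" | "i = b" "k = a"
   using True feq[of i j] feq[of j k] feq[of i k] by blast
  then have "\<forall>\<^sub>F t in at_right 0. orient (P t) i j k ~= 0"
  proof cases
   case 1 then show ?thesis using or1 ijk by blast
  next
   case 2
   then have "k ~= a" "k ~= b" using True by auto
   then show ?thesis using or2[OF ijk(3)] 2 by simp
  next
   case 3
   then have "k ~= a" "k ~= b" using True by auto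
   then have "\<forall>\<^sub>F t in at_right 0. orient (P t) j i k ~= 0" using or2[OF ijk(3)] 3 by simp
   then show ?thesis by eventually_elim (rule sw(1))
  next
   case 4
   then have "i ~= a" "i ~= b" using True by auto
   then have "\<forall>\<^sub>F t in at_right 0. orient (P t) j k i ~= 0" using or2[OF ijk(1)] 4 by simp
   then show ?thesis by eventually_elim (rule sw(3))
  next
   case 5
   then have "i ~= a" "i ~= b" using True by auto
   then have "\<forall>\<^sub>F t in at_right 0. orient (P t) k j i ~= 0" using or2[OF ijk(1)] 5 by simp
   then show ?thesis by eventually_elim (rule sw(5))
  next
   case 6
   then have "j ~= a" "j ~= b" using True by auto
   then have "\<forall>\<^sub>F t in at_right 0. orient (P t) i k j ~= 0" using or2[OF ijk(2)] 6 by simp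
   then show ?thesis by eventually_elim (rule sw(2))
  next
   case 7
   then have "j ~= a" "j ~= b" using True by auto
   then have "\<forall>\<^sub>F t in at_right 0. orient (P t) k i j ~= 0" using or2[OF ijk(2)] 7 by simp
   then show ?thesis by eventually_elim (rule sw(4))
  qed
  then show ?thesis by (auto elim: eventually_mono)
 qed auto
 have GP: "\<forall>\<^sub>F t in at_right 0. genpos V (P t)"
 proof -
  have "\<forall>\<^sub>F t in at_right 0. \<forall>i\<in>V. \<forall>j\<in>V. \<forall>k\<in>V. i ~= j --> j ~= k --> i ~= k --> orient (P t) i j k ~= 0"
   by (intro eventually_ball_finite finV ballI or)
  then show ?thesis
  proof eventually_elim
   case (elim t)
   have "P t i ~= P t j" if "i \<in> V" "j \<in> V" "i ~= j" for i j
   proof -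
    have "card {i, j} < card V" using n3 that by auto
    then obtain k where "k \<in> V" "k ~= i" "k ~= j" using that finV
     by (metis card_mono finite.emptyI finite_insert insertCI not_less subsetI)
    then have "orient (P t) i j k ~= 0" using elim[rule_format, OF that(1,2) \<open>k \<in> V\<close>] that(3) by metis
    then show ?thesis by (auto simp: orient_def cr_def)
   qed
   then show ?case using elim unfolding genpos_def inj_on_def by blast
  qed
 qed

 have E'I: "{x, y} \<in> E'" if "{x, y} \<in> E" "x ~= b" "y ~= b" for x y using that by (simp add: E'_iff)
 have aE': "{a, z} \<in> E'" if "{b, z} \<in> E" "z ~= a" for z
  using that edges(6) dist by (cases "z = c") (auto simp: E'_iff B_edge)
 have ncb: "\<forall>\<^sub>F t in at_right 0. closed_segment (P t b) (P t z) \<inter> closed_segment (P t x) (P t y) = {}"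
  if e: "{b, z} \<in> E" and g: "{x, y} \<in> E" "{b, z} \<inter> {x, y} = {}" for x y z
 proof (cases "x = a | y = a")
  case False
  have zb: "z ~= b" "x ~= b" "y ~= b" "x ~= z" "y ~= z" "x ~= y" using g(2) edgeD[OF e] edgeD[OF g(1)] by auto
  have "closed_segment q (p0 z) \<inter> closed_segment (p0 x) (p0 y) = {}"
  proof (cases "z = a")
   case True
   have "x \<in> V'" "y \<in> V'" using edgeD[OF g(1)] zb by (auto simp: V'_def)
   then have "orient p0 a x y ~= 0" using genposD[OF gp aV(1)] False zb by metis
   then have "q ~: closed_segment (p0 x) (p0 y)" using orient_segment[where p = p0 and q = a and x = x and y = y and z = q] q_def by blast
   then show ?thesis using True by (simp add: q_def)
  next
   case za: False
   have "{a, z} \<in> E'" "{x, y} \<in> E'" "{a, z} \<inter> {x, y} = {}" using aE'[OF e za] E'I[OF g(1)] zb False by auto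
   then have "convex hull (p0 ` {a, z}) \<inter> convex hull (p0 ` {x, y}) = {}" using nc unfolding ncross_def by blast
   then show ?thesis unfolding segment_2 q_def .
  qed
  then have "\<forall>\<^sub>F t in at_right 0. closed_segment (q + t *\<^sub>R \<delta>) (p0 z) \<inter> closed_segment (p0 x) (p0 y) = {}"
   by (rule segment_perturb[OF closed_segment])
  then show ?thesis using zb by (simp add: Pb Po)
 next
  case True
  \<comment> \<open>Edges at \<open>a\<close> and edges at \<open>b\<close> meet in the limit, so
    here disjointness comes from the choice of \<delta>. Only if the common point were
    \<open>z\<close> itself does general position decide.\<close>
  have main: "closed_segment (P t b) (P t z) \<inter> closed_segment q (P t y) = {}" if t: "t > 0" and gy: "{a, y} \<in> E" "y ~= b" "z ~= a" "z ~= y" for t y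
  proof (rule ccontr)
   have zb: "z ~= b" "y ~= a" "z \<in> V" "y \<in> V" using edgeD[OF e] edgeD[OF gy(1)] by auto
   have zB: "z \<in> insert c B" using e gy by (auto simp: B_edge)
   have yA: "y \<in> insert c A" using gy by (auto simp: A_edge)
   assume "closed_segment (P t b) (P t z) \<inter> closed_segment q (P t y) ~= {}"
   then obtain r s where rs: "0 <= r" "r <= 1" "0 <= s" "s <= 1"
    "(1 - r) *\<^sub>R (q + t *\<^sub>R \<delta>) + r *\<^sub>R p0 z = (1 - s) *\<^sub>R q + s *\<^sub>R p0 y"
    using zb gy by (auto simp: closed_segment_def Pb Po)
   then have eq: "((1 - r) * t) *\<^sub>R \<delta> = s *\<^sub>R d y - r *\<^sub>R d z" by (simp add: d_def algebra_simps)
   show False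
   proof (cases "r = 1")
    case True
    then have "d z = s *\<^sub>R d y" using eq by simp
    then have "cr (d z) (d y) = 0" by (simp add: cr_scaleR)
    then show False using crd[of z y] zb gy by (auto simp: V'_def)
   next
    case False
    then show False using D(5)[OF yA zB, of s r "(1 - r) * t"] gy rs t eq by auto
   qed
  qed
  have zy: "{a, y'} \<in> E & y' ~= b & z ~= a & z ~= y'" if "{x, y} = {a, y'}" for y' using g that edgeD[OF g(1)] by auto
  show ?thesis using pos
  proof eventually_elim
   case (elim t)
   show ?case
   proof (cases "x = a")
    case True
    then show ?thesis using main[OF elim, of y] zy[of y] Pa by simp
   next
    case False
    then have ya: "y = a" using \<open>x = a | y = a\<close> by simp
    have "closed_segment (P t b) (P t z) \<inter> closed_segment q (P t x) = {}" using main[OF elim, of x] zy[of x] ya by (simp add: insert_commute)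
    then show ?thesis unfolding ya Pa closed_segment_commute[of "P t x" q] .
   qed
  qed
 qed
 have nc1: "\<forall>\<^sub>F t in at_right 0. e \<inter> g = {} --> convex hull (P t ` e) \<inter> convex hull (P t ` g) = {}" if eg: "e \<in> E" "g \<in> E" for e g
 proof (cases "e \<inter> g = {}")
  case True
  have ncb': "\<forall>\<^sub>F t in at_right 0. convex hull (P t ` e') \<inter> convex hull (P t ` g') = {}"
   if eg': "e' \<in> E" "g' \<in> E" "e' \<inter> g' = {}" "b \<in> e'" for e' g'
  proof -
   obtain z where z: "e' = {b, z}" using edge_ex[OF eg'(1)] eg'(4) by (metis insertE insert_commute singletonD)
   obtain x y where xy: "g' = {x, y}" using edge_ex[OF eg'(2)] by metis
   show ?thesis unfolding z xy segment_2 using ncb[of z x y] eg' z xy by blast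
  qed
  show ?thesis
  proof (cases "b \<in> e | b \<in> g")
   case bb: True
   then show ?thesis
   proof
    assume "b \<in> e"
    then show ?thesis using ncb'[OF eg True] by (auto elim: eventually_mono)
   next
    assume "b \<in> g"
    moreover have "g \<inter> e = {}" using True by blast
    ultimately have "\<forall>\<^sub>F t in at_right 0. convex hull (P t ` g) \<inter> convex hull (P t ` e) = {}" using ncb'[OF eg(2,1)] by blast
    then show ?thesis by eventually_elim blast
   qed
  next
   case False
   then have "e \<in> E'" "g \<in> E'" using eg by (auto simp: E'_def)
   then have "convex hull (p0 ` e) \<inter> convex hull (p0 ` g) = {}" using nc True unfolding ncross_def by blast
   moreover have "P t ` e = p0 ` e" "P t ` g = p0 ` g" for t using False by (auto simp: P_def)
   ultimately show ?thesis by simp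
  qed
 qed auto
 have NC: "\<forall>\<^sub>F t in at_right 0. ncross E (P t)"
  unfolding ncross_def by (intro eventually_ball_finite finE ballI nc1)

 have pt1: "\<forall>\<^sub>F t in at_right 0. ptd E (P t) v" if v: "v \<in> V" for v
 proof -
  have pos_lim: "\<forall>\<^sub>F t in at_right 0. (P t j - P t v) \<bullet> m > 0" if "(p0 (f j) - p0 (f v)) \<bullet> m > 0" for j m
   using tendsto_inner[OF limd[of j v] tendsto_const[of m]] that by (rule order_tendstoD)
  have ex: "\<exists>m. \<forall>j\<in>nbrs E v. \<forall>\<^sub>F t in at_right 0. (P t j - P t v) \<bullet> m > 0"
  proof -
   consider "v = a" | "v = b" | "v ~= a" "v ~= b" by blast
   then show ?thesis
   proof cases
    case 1
    have "\<forall>\<^sub>F t in at_right 0. (P t j - P t a) \<bullet> n1 > 0" if "j \<in> nbrs E a" for j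
    proof (cases "j = b")
     case True
     show ?thesis unfolding True Pa Pb using pos by eventually_elim (use D(7) in simp)
    next
     case False
     then have "j \<in> insert c A" using that nbrs_a by auto
     then show ?thesis using D(6) False by (simp add: Pa Po d_def)
    qed
    then show ?thesis using 1 by blast
   next
    case 2
    have "\<forall>\<^sub>F t in at_right 0. (P t j - P t b) \<bullet> n2 > 0" if "j \<in> nbrs E b" for j
    proof (cases "j = a")
     case True
     show ?thesis unfolding True Pa Pb using pos by eventually_elim (use D(9) in \<open>simp add: mult_pos_neg\<close>)
    next
     case False
     then have j: "j \<in> insert c B" "j ~= b" using that nbrs_b AB_ne dist by auto
     have "(p0 (f j) - p0 (f b)) \<bullet> n2 > 0" using D(8)[OF j(1)] j by (simp add: f_def d_def q_def)
     then show ?thesis using pos_lim[of j n2] 2 by simp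
    qed
    then show ?thesis using 2 by blast
   next
    case 3
    obtain m where m: "!!j. j \<in> nbrs E' v ==> (p0 j - p0 v) \<bullet> m > 0"
     using pt[of v] v 3 unfolding ptd_def by (auto simp: V'_def)
    have "f j \<in> nbrs E' v" if "j \<in> nbrs E v" for j
    proof (cases "j = b")
     case True
     then show ?thesis using aE'[of v] that 3 by (auto simp: mem_nbrs f_def insert_commute)
    next
     case False
     then show ?thesis using E'I[of v j] that 3 by (auto simp: mem_nbrs f_def)
    qed
    then show ?thesis using pos_lim m 3 by (intro exI[of _ m]) (auto simp: f_def)
   qed
  qed
  then obtain m where m: "\<forall>j\<in>nbrs E v. \<forall>\<^sub>F t in at_right 0. (P t j - P t v) \<bullet> m > 0" by blast
  have "\<forall>\<^sub>F t in at_right 0. \<forall>j\<in>nbrs E v. (P t j - P t v) \<bullet> m > 0"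
   by (rule eventually_ball_finite[OF fin_nbrs m])
  then show ?thesis unfolding ptd_def by eventually_elim blast
 qed
 have PT: "\<forall>\<^sub>F t in at_right 0. \<forall>v\<in>V. ptd E (P t) v"
  by (intro eventually_ball_finite finV ballI pt1)

 \<comment> \<open>The cyclic order of one triple for all small t. Rotating the triple brings the
   neighbour that needs care to the front.\<close>
 define R where "R v j k l \<longleftrightarrow> (\<forall>\<^sub>F t in at_right 0. ccw3 (P t j - P t v) (P t k - P t v) (P t l - P t v))" for v j k l
 have R_rot: "R v k l j ==> R v j k l" for v j k l unfolding R_def by (erule eventually_mono, rule ccw3_rot[THEN iffD2])
 have R_lim: "R v j k l" if "ccw3 (p0 (f j) - p0 (f v)) (p0 (f k) - p0 (f v)) (p0 (f l) - p0 (f v))" for v j k l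
  unfolding R_def by (rule ccw3_eventually[OF limd limd limd that])
 have rng_a: "0 <= ang a x & ang a x < 1" if "x \<in> nbrs E a" for x using ang_rng that by (simp add: mem_nbrs)
 have rng_b: "0 <= ang b x & ang b x < 1" if "x \<in> nbrs E b" for x using ang_rng that by (simp add: mem_nbrs)
 have cab: "c \<in> nbrs E a" "c \<in> nbrs E b" using edges by (auto simp: mem_nbrs)
 have R1: "R v j k l" if N: "j \<in> nbrs E v" "k \<in> nbrs E v" "l \<in> nbrs E v" and cyc: "cyc3 (ang v j) (ang v k) (ang v l)" for v j k l
 proof -
  have dj: "j ~= k" "k ~= l" "j ~= l" using cyc by (auto simp: cyc3_def)
  consider "v = a" | "v = b" | "v ~= a" "v ~= b" by blast
  then show ?thesis
  proof cases
   case 1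
   have gcyc: "cyc3 (ga j) (ga k) (ga l)"
    unfolding ga_def using cyc3_turn rng_a N cyc cab unfolding 1 by blast
   have base: "R a b k l" if kl: "k \<in> nbrs E a" "l \<in> nbrs E a" "b ~= k" "b ~= l" "cyc3 (ga b) (ga k) (ga l)" for k l
   proof -
    have kA: "k \<in> insert c A" "l \<in> insert c A" "k ~= b" "l ~= b" using kl nbrs_a by auto
    have "ga k < ga b" "ga l < ga b" using ga_b kl by auto
    then have "ga k < ga l" using kl(5) by (auto simp: cyc3_def)
    then have "ang' a k < ang' a l" using hA[OF kA(1)] hA[OF kA(2)] by simp
    then have "ccw3 \<delta> (d k) (d l)" using D(3) kA by blast
    then show ?thesis unfolding R_def Pa Pb using pos by (elim eventually_mono) (use kA in "simp add: Po d_def ccw3_scale")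
   qed
   consider "b ~= j" "b ~= k" "b ~= l" | "j = b" | "k = b" | "l = b" by blast
   then show ?thesis
   proof cases
    case no: 1
    have A3: "j \<in> insert c A" "k \<in> insert c A" "l \<in> insert c A" using N no nbrs_a unfolding 1 by auto
    have "cyc3 (ang' a j) (ang' a k) (ang' a l)" using gcyc unfolding hA[OF A3(1)] hA[OF A3(2)] hA[OF A3(3)] by (simp add: cyc3_def)
    then have "ccw3 (d j) (d k) (d l)" using real_a A3 by blast
    then show ?thesis unfolding R_def 1 Pa using no by (simp add: Po d_def)
   next
    case 2 then show ?thesis using base[of k l] N dj gcyc unfolding 1 by auto
   next
    case 3 then show ?thesis using base[of l j] N dj gcyc cyc3_rot R_rot unfolding 1 by metis
   next
    case 4 then show ?thesis using base[of j k] N dj gcyc cyc3_rot R_rot unfolding 1 by metis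
   qed
  next
   case 2
   have gcyc: "cyc3 (gb j) (gb k) (gb l)"
    unfolding gb_def using cyc3_turn rng_b N cyc cab unfolding 2 by blast
   have base: "R b a k l" if kl: "k \<in> nbrs E b" "l \<in> nbrs E b" "a ~= k" "a ~= l" "cyc3 (gb a) (gb k) (gb l)" for k l
   proof -
    have kB: "k \<in> insert c B" "l \<in> insert c B" "k ~= b" "l ~= b" using kl nbrs_b AB_ne dist by auto
    have ga0: "0 < gb a" using gb_pos[of a] edges dist by (auto simp: mem_nbrs)
    have gba: "gb a < gb x" if "x \<in> B" for x using gb_a that by blast
    have kc: "k ~= c" using kl(5) ga0 gba[of l] kB by (auto simp: cyc3_def)
    have "gb k < gb l | l = c" using kl(5) gba[of k] gba[of l] kB kc ga0 by (auto simp: cyc3_def)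
    then have "ang' a k < ang' a l | l = c" using hB kB kc by auto
    then have "ccw3 (- \<delta>) (d k) (d l)" using D(4) kB kc by blast
    moreover have "((%t. P t k - P t b) \<longlongrightarrow> d k) (at_right 0)" "((%t. P t l - P t b) \<longlongrightarrow> d l) (at_right 0)"
     using limd[of k b] limd[of l b] kB by (simp_all add: f_def d_def q_def)
    ultimately have "\<forall>\<^sub>F t in at_right 0. ccw3 (- \<delta>) (P t k - P t b) (P t l - P t b)"
     using ccw3_eventually[OF tendsto_const] by blast
    then show ?thesis unfolding R_def using pos
    proof eventually_elim
     case (elim t)
     have "P t a - P t b = t *\<^sub>R (- \<delta>)" by (simp add: Pa Pb)
     then show ?case using elim ccw3_scale[of t "- \<delta>"] by simp
    qed
   qed
   consider "a ~= j" "a ~= k" "a ~= l" | "j = a" | "k = a" | "l = a" by blast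
   then show ?thesis
   proof cases
    case no: 1
    have B3: "x \<in> insert c B" "x ~= b" if "x \<in> {j, k, l}" for x using that N no nbrs_b AB_ne dist unfolding 2 by auto
    have mono: "gb x < gb y \<longleftrightarrow> ang' a x < ang' a y" if "x \<in> {j, k, l}" "y \<in> {j, k, l}" for x y
     using B3[OF that(1)] B3[OF that(2)] gB[of x] gB[of y] hB hc by auto
    have "cyc3 (ang' a j) (ang' a k) (ang' a l)" using gcyc mono unfolding cyc3_def by simp
    moreover have "j \<in> insert c (A \<union> B)" "k \<in> insert c (A \<union> B)" "l \<in> insert c (A \<union> B)"
     using B3(1)[of j] B3(1)[of k] B3(1)[of l] by auto
    ultimately have "ccw3 (d j) (d k) (d l)" using real_a[of j k l] by simp
    then show ?thesis unfolding 2 by (intro R_lim) (use B3 in "simp add: f_def d_def q_def")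
   next
    case 22: 2 then show ?thesis using base[of k l] N dj gcyc unfolding 2 by auto
   next
    case 3 then show ?thesis using base[of l j] N dj gcyc cyc3_rot R_rot unfolding 2 by metis
   next
    case 4 then show ?thesis using base[of j k] N dj gcyc cyc3_rot R_rot unfolding 2 by metis
   qed
  next
   case 3
   have fN: "f x \<in> nbrs E' v" if "x \<in> nbrs E v" for x
    using aE'[of v] E'I[of v x] that 3 by (cases "x = b") (auto simp: mem_nbrs f_def insert_commute)
   have fv: "f v = v" using 3 by (simp add: f_def)
   have lift: "R v x y z" if "x \<in> nbrs E v" "y \<in> nbrs E v" "z \<in> nbrs E v" "cyc3 (ang' v (f x)) (ang' v (f y)) (ang' v (f z))" for x y z
   proof (rule R_lim)
    show "ccw3 (p0 (f x) - p0 (f v)) (p0 (f y) - p0 (f v)) (p0 (f z) - p0 (f v))"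
     unfolding fv using re fN that unfolding realises_def mem_nbrs by blast
   qed
   show ?thesis
   proof (cases "v \<in> B")
    case True
    have "ang' v (f x) = ang v x" if "x \<in> nbrs E v" for x
     using True nbrs_B[OF True] that 3 by (auto simp: f_def ang'_def)
    then show ?thesis using lift N cyc by simp
   next
    case nB: False
    have ang: "ang' v x = ang v x" for x using nB 3 by (simp add: ang'_def)
    show ?thesis
    proof (cases "b \<in> {j, k, l}")
     case False
     then show ?thesis using lift N cyc by (auto simp: f_def ang)
    next
     case True
     then have "{b, v} \<in> E" using N by (auto simp: mem_nbrs insert_commute)
     then have vc: "v = c" using nB 3 by (auto simp: B_edge)
     have base: "R v b x y" if xy: "x \<in> nbrs E v" "y \<in> nbrs E v" "b ~= x" "b ~= y" "x ~= y" "cyc3 (ang v b) (ang v x) (ang v y)" for x y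
     proof -
      have bN: "b \<in> nbrs E v" using edges vc by (simp add: mem_nbrs)
      consider "x ~= a" "y ~= a" | "x = a" | "y = a" "x ~= a" by blast
      then show ?thesis
      proof cases
       case 1
       have "cyc3 (ang v a) (ang v x) (ang v y)" using cyc3_c(1)[of v x y] xy 1 vc by (auto simp: mem_nbrs)
       then show ?thesis using lift[OF bN xy(1,2)] xy by (simp add: ang f_def)
      next
       case 2
       then show ?thesis using cyc3_c(2)[of v y y] xy vc by (auto simp: mem_nbrs)
      next
       case 3
       have xV: "x \<in> V'" "x ~= c" using xy edgeD[of v x] vc by (auto simp: mem_nbrs V'_def)
       have "orient p0 c a x ~= 0" using genposD[OF gp aV(2,1) xV(1)] xV 3 dist by simp
       then have ne: "cr (p0 x - p0 c) (q - p0 c) ~= 0" by (simp add: orient_def q_def cr_anti[of "p0 x - p0 c"])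
       \<comment> \<open>The triple \<open>b\<close>, \<open>x\<close>, \<open>a\<close> seen from
         \<open>c\<close> degenerates in the limit. The cross product of the directions to
         \<open>a\<close> and \<open>b\<close> is positive by the choice of \<delta>; depending on
         the sign of \<open>?L\<close>, the pair \<open>x\<close>, \<open>a\<close> or the pair
         \<open>b\<close>, \<open>x\<close> completes \<open>ccw3\<close>.\<close>
       let ?L = "cr (p0 x - p0 c) (q - p0 c)"
       have l1: "((%t. cr (P t b - P t c) (P t x - P t c)) \<longlongrightarrow> - ?L) (at_right 0)"
        using tendsto_cr[OF limd[of b c] limd[of x c]] xy dist cr_anti[of "p0 a - p0 c"] by (simp add: f_def q_def)
       have ab: "cr (P t a - P t c) (P t b - P t c) = t * - cr (d c) \<delta>" for t
        using dist by (simp add: Pa Pb Po d_def cr_def algebra_simps)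
       have "\<forall>\<^sub>F t in at_right 0. cr (P t a - P t c) (P t b - P t c) > 0"
        using pos by eventually_elim (use D(2) ab in \<open>simp add: mult_pos_neg\<close>)
       moreover have xa: "cr (P t x - P t c) (P t a - P t c) = ?L" for t using xy dist by (simp add: Pa Po)
       ultimately show ?thesis
       proof (cases "?L > 0")
        case True
        have "\<forall>\<^sub>F t in at_right 0. cr (P t a - P t c) (P t b - P t c) > 0"
         using pos by eventually_elim (use D(2) ab in \<open>simp add: mult_pos_neg\<close>)
        then show ?thesis unfolding R_def vc 3(1) by eventually_elim (use True xa in "simp add: ccw3_def")
       next
        case False
        then have "\<forall>\<^sub>F t in at_right 0. cr (P t b - P t c) (P t x - P t c) > 0"
         using order_tendstoD(1)[OF l1, of 0] ne by simp
        moreover have "\<forall>\<^sub>F t in at_right 0. cr (P t a - P t c) (P t b - P t c) > 0"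
         using pos by eventually_elim (use D(2) ab in \<open>simp add: mult_pos_neg\<close>)
        ultimately show ?thesis unfolding R_def vc 3(1) by eventually_elim (simp add: ccw3_def)
       qed
      qed
     qed
     from True consider "j = b" | "k = b" | "l = b" by blast
     then show ?thesis
     proof cases
      case 1 then show ?thesis using base[of k l] N dj cyc by auto
     next
      case 2 then show ?thesis using base[of l j] N dj cyc cyc3_rot R_rot by metis
     next
      case 3 then show ?thesis using base[of j k] N dj cyc cyc3_rot R_rot by metis
     qed
    qed
   qed
  qed
 qed
 have RE1: "\<forall>\<^sub>F t in at_right 0. \<forall>v\<in>V. \<forall>j\<in>nbrs E v. \<forall>k\<in>nbrs E v. \<forall>l\<in>nbrs E v. cyc3 (ang v j) (ang v k) (ang v l) -->
   ccw3 (P t j - P t v) (P t k - P t v) (P t l - P t v)"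
 proof (intro eventually_ball_finite finV fin_nbrs ballI)
  fix v j k l assume "j \<in> nbrs E v" "k \<in> nbrs E v" "l \<in> nbrs E v"
  then show "\<forall>\<^sub>F t in at_right 0. cyc3 (ang v j) (ang v k) (ang v l) --> ccw3 (P t j - P t v) (P t k - P t v) (P t l - P t v)"
   using R1[of j v k l] unfolding R_def by (cases "cyc3 (ang v j) (ang v k) (ang v l)") auto
 qed
 have RE: "\<forall>\<^sub>F t in at_right 0. realises E ang (P t)"
  using RE1 by eventually_elim (use edgeD in "auto simp: realises_def mem_nbrs")
 have "\<forall>\<^sub>F t in at_right 0. good V E ang (P t)"
  using GP NC PT RE by eventually_elim (simp add: good_def)
 then obtain t where "good V E ang (P t)" using eventually_happens'[OF trivial_limit_at_right_real] by blast
 then show ?thesis by blast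
qed

end

theorem pointed_embedding:
 assumes "lrot V E ang"
 shows "\<exists>p. good V E ang p"
 using assms
proof (induction "card V" arbitrary: V E ang rule: less_induct)
 case less
 interpret lrot V E ang by fact
 show ?case
 proof (cases "3 <= card V")
  case True
  obtain a b c where abc: "tri E ang a b c" "\<nexists>Z. blocker V E a b c Z" using contractible_edge[OF True] .
  interpret contraction V E ang a b c by unfold_locales (use abc True in auto)
  have "card V' < card V" using card_V' by simp
  then show ?thesis using less.hyps[OF _ lrot'] split_good by blast
 next
  case False
  then have c2: "card V = 2" using card_V by simp
  then obtain x y where xy: "V = {x, y}" "x ~= y" by (auto simp: card_2_iff)
  define p where "p v = (if v = x then 0 else 1 :: complex)" for v
  have E1: "e = {x, y}" if "e \<in> E" for e
   using edge_sub[OF that] edge_card[OF that] xy card_subset_eq[of "{x, y}" e] by simp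
  have nb: "j \<in> nbrs E v ==> v = x & j = y | v = y & j = x" for v j
   using E1[of "{v, j}"] xy(2) by (auto simp: mem_nbrs doubleton_eq_iff)
  have "genpos V p" using xy by (auto simp: genpos_def p_def inj_on_def)
  moreover have "ncross E p" unfolding ncross_def using E1 by blast
  moreover have "ptd E p v" if "v \<in> V" for v
  proof -
   have "(p j - p v) \<bullet> (if v = x then 1 else -1) > 0" if "j \<in> nbrs E v" for j
    using nb[OF that] xy(2) by (auto simp: p_def inner_complex_def)
   then show ?thesis unfolding ptd_def by blast
  qed
  moreover have "realises E ang p"
   unfolding realises_def using nb by (auto simp: mem_nbrs cyc3_def)
  ultimately show ?thesis unfolding good_def by blast
 qed
qed

section \<open>Stresses and rigidity\<close>

text \<open>In the transposed system the equation of an index with \<open>x k ~= 0\<close> is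
  dropped, which leaves fewer equations than unknowns. A solution of the rest satisfies the dropped
  equation too, because \<open>x\<close> is a linear dependence among all of them.\<close>

lemma square_left_kernel:
 fixes a :: "'j => 'i => real"
 assumes "finite J" "finite I" "card I = card J" and x: "\<exists>i\<in>I. x i ~= 0" "\<forall>j\<in>J. (\<Sum>i\<in>I. a j i * x i) = 0"
 shows "\<exists>y. (\<exists>j\<in>J. y j ~= 0) & (\<forall>i\<in>I. (\<Sum>j\<in>J. a j i * y j) = 0)"
proof -
 obtain k where k: "k \<in> I" "x k ~= 0" using x by blast
 have "card (I - {k}) < card J" using k assms by (metis card_Diff1_less)
 then obtain y where y: "\<exists>j\<in>J. y j ~= 0" "\<forall>i\<in>I - {k}. (\<Sum>j\<in>J. a j i * y j) = 0"
  using homogeneous_nontrivial[of "I - {k}" J "%i j. a j i"] assms by auto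
 have "0 = (\<Sum>j\<in>J. (\<Sum>i\<in>I. a j i * x i) * y j)" using x(2) by simp
 also have "\<dots> = (\<Sum>i\<in>I. x i * (\<Sum>j\<in>J. a j i * y j))"
  by (simp add: sum_distrib_left sum_distrib_right sum.swap[of _ J] mult_ac)
 also have "\<dots> = x k * (\<Sum>j\<in>J. a j k * y j)"
  using k assms y(2) by (subst sum.remove[of I k]) auto
 finally have "(\<Sum>j\<in>J. a j k * y j) = 0" using k by simp
 then show ?thesis using y by blast
qed

lemma pair_diff: "(x :: complex) + y - 2 * x = y - x" "x + y - 2 * y = x - y"
 unfolding mult_2 by simp_all

definition force :: "'a set set => ('a => complex) => ('a set => real) => 'a => complex" where
 "force E p s v = (\<Sum>j\<in>nbrs E v. s {v, j} *\<^sub>R (p j - p v))"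

text \<open>Linear independence of the rows of the rigidity matrix.\<close>

definition stress_free :: "'a set => 'a set set => ('a => complex) => bool" where
 "stress_free V E p \<longleftrightarrow> (\<forall>s. (\<forall>v\<in>V. force E p s v = 0) --> (\<forall>e\<in>E. s e = 0))"

context sgraph
begin

lemma sum_incident:
 fixes g :: "'a set => 'b :: comm_monoid_add"
 shows "(\<Sum>e\<in>E. if v \<in> e then g e else 0) = (\<Sum>j\<in>nbrs E v. g {v, j})"
proof -
 have "(\<Sum>e\<in>E. if v \<in> e then g e else 0) = (\<Sum>e\<in>{e\<in>E. v \<in> e}. g e)"
  by (rule sum.mono_neutral_cong_right) (auto simp: finE)
 also have "{e\<in>E. v \<in> e} = (%j. {v, j}) ` nbrs E v"
 proof (intro equalityI subsetI)
  fix e assume e: "e \<in> {e\<in>E. v \<in> e}"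
  then obtain x y where "e = {x, y}" "x ~= y" using edge_ex[of e] by blast
  with e show "e \<in> (%j. {v, j}) ` nbrs E v" by (auto simp: mem_nbrs insert_commute)
 qed (auto simp: mem_nbrs)
 also have "(\<Sum>e\<in>(%j. {v, j}) ` nbrs E v. g e) = (\<Sum>j\<in>nbrs E v. g {v, j})"
  by (subst sum.reindex) (auto simp: inj_on_def doubleton_eq_iff)
 finally show ?thesis .
qed

text \<open>Virtual work: the power of the bar forces in a velocity field is the sum over the bars
  of stress times strain. The factor 2 accounts for the two darts of a bar.\<close>

lemma work:
 "2 * (\<Sum>v\<in>V. force E p s v \<bullet> u v) = - (\<Sum>v\<in>V. \<Sum>j\<in>nbrs E v. s {v, j} * ((p v - p j) \<bullet> (u v - u j)))"
proof -
 have 1: "(\<Sum>v\<in>V. force E p s v \<bullet> u v) = (\<Sum>v\<in>V. \<Sum>j\<in>nbrs E v. s {v, j} * ((p j - p v) \<bullet> u v))"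
  by (simp add: force_def inner_sum_left)
 also have "\<dots> = (\<Sum>v\<in>V. \<Sum>j\<in>nbrs E v. s {v, j} * ((p v - p j) \<bullet> u j))"
  by (subst sum_darts_swap) (simp add: insert_commute)
 finally have "2 * (\<Sum>v\<in>V. force E p s v \<bullet> u v) = (\<Sum>v\<in>V. \<Sum>j\<in>nbrs E v. s {v, j} * ((p j - p v) \<bullet> u v))
  + (\<Sum>v\<in>V. \<Sum>j\<in>nbrs E v. s {v, j} * ((p v - p j) \<bullet> u j))" using 1 by simp
 also have "\<dots> = (\<Sum>v\<in>V. \<Sum>j\<in>nbrs E v. - (s {v, j} * ((p v - p j) \<bullet> (u v - u j))))"
  unfolding sum.distrib[symmetric] by (intro sum.cong refl) (simp add: algebra_simps inner_diff_left inner_diff_right)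
 finally show ?thesis by (simp add: sum_negf)
qed

lemma inner_rot: "x \<bullet> (of_real w * \<i> * x) = 0"
 by (simp add: inner_complex_def)

lemma force_trivial: "trivial_motion V p u ==> (\<Sum>v\<in>V. force E p s v \<bullet> u v) = 0"
proof -
 assume "trivial_motion V p u"
 then obtain a w where u: "!!v. v \<in> V ==> u v = a + of_real w * \<i> * p v" unfolding trivial_motion_def by blast
 have "(\<Sum>v\<in>V. \<Sum>j\<in>nbrs E v. s {v, j} * ((p v - p j) \<bullet> (u v - u j))) = (\<Sum>v\<in>V. \<Sum>j\<in>nbrs E v. 0)"
 proof (rule sum_nbrs_cong)
  fix v j assume "{v, j} \<in> E"
  then have "u v - u j = of_real w * \<i> * (p v - p j)" using u edgeD by (simp add: algebra_simps)
  then show "s {v, j} * ((p v - p j) \<bullet> (u v - u j)) = 0" using inner_rot by simp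
 qed
 then show ?thesis using work[where p = p and s = s and u = u] by simp
qed

text \<open>Coordinates on the velocity fields that vanish at \<open>a\<close> and move \<open>b\<close> along the line \<open>ab\<close>:
 these represent the motions modulo the trivial ones.\<close>
definition pin :: "('a => complex) => 'a => 'a => ('a \<times> bool) option => 'a => complex" where
 "pin p a b i v = (case i of None => if v = b then p b - p a else 0
  | Some (w, t) => if v = w then (if t then 1 else \<i>) else 0)"

definition pin_index :: "'a => 'a => ('a \<times> bool) option set" where
 "pin_index a b = insert None (Some ` ((V - {a, b}) \<times> UNIV))"

text \<open>The rigidity matrix in pinned coordinates. The vector from \<open>v\<close> to the other
  endpoint of \<open>e\<close> is written as \<open>sum p e - 2 * p v\<close>, which needs no
  orientation of \<open>e\<close>.\<close>

definition rmat :: "('a => complex) => 'a => 'a => 'a set => ('a \<times> bool) option => real" where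
 "rmat p a b e i = (\<Sum>v\<in>e. (sum p e - 2 * p v) \<bullet> pin p a b i v)"

definition field :: "('a => complex) => 'a => 'a => (('a \<times> bool) option => real) => 'a => complex" where
 "field p a b x v = (\<Sum>i\<in>pin_index a b. x i *\<^sub>R pin p a b i v)"

lemma fin_pin: "finite (pin_index a b)"
 using finV by (simp add: pin_index_def)

lemma card_pin: "a \<in> V ==> b \<in> V ==> a ~= b ==> card (pin_index a b) + 3 = 2 * card V"
proof -
 assume ab: "a \<in> V" "b \<in> V" "a ~= b"
 have "card (V - {a, b}) + 2 = card V" using ab finV card_Diff_subset[of "{a, b}" V] card_mono[of V "{a, b}"] by auto
 moreover have "card (pin_index a b) = 1 + card (V - {a, b}) * 2"
  unfolding pin_index_def using finV by (simp add: card_image card_cartesian_product)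
 ultimately show ?thesis by simp
qed

lemma field_eq:
 assumes "a ~= b"
 shows "field p a b x a = 0" "field p a b x b = x None *\<^sub>R (p b - p a)"
  "w \<in> V ==> w ~= a ==> w ~= b ==> field p a b x w = Complex (x (Some (w, True))) (x (Some (w, False)))"
proof -
 have split: "field p a b x v = x None *\<^sub>R pin p a b None v + (\<Sum>k\<in>(V - {a, b}) \<times> UNIV. x (Some k) *\<^sub>R pin p a b (Some k) v)" for v
  unfolding field_def pin_index_def using finV by (simp add: sum.reindex image_iff)
 have z: "(\<Sum>k\<in>(V - {a, b}) \<times> UNIV. x (Some k) *\<^sub>R pin p a b (Some k) v) = 0" if "v = a | v = b" for v
  by (rule sum.neutral) (use that in "auto simp: pin_def")
 show "field p a b x a = 0" "field p a b x b = x None *\<^sub>R (p b - p a)"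
  using assms by (simp_all add: split z) (simp_all add: pin_def)
 assume w: "w \<in> V" "w ~= a" "w ~= b"
 have "(\<Sum>k\<in>(V - {a, b}) \<times> UNIV. x (Some k) *\<^sub>R pin p a b (Some k) w) = (\<Sum>k\<in>{(w, True), (w, False)}. x (Some k) *\<^sub>R pin p a b (Some k) w)"
  by (rule sum.mono_neutral_right) (use w finV in "auto simp: pin_def")
 then show "field p a b x w = Complex (x (Some (w, True))) (x (Some (w, False)))"
  using w by (simp add: split pin_def complex_eq_iff)
qed

lemma rmat_field:
 assumes "{v, j} \<in> E"
 shows "(\<Sum>i\<in>pin_index a b. rmat p a b {v, j} i * x i) = - ((p v - p j) \<bullet> (field p a b x v - field p a b x j))"
proof -
 have vj: "v ~= j" using edgeD[OF assms] by auto
 have "rmat p a b {v, j} i * x i = (p j - p v) \<bullet> (x i *\<^sub>R pin p a b i v) + (p v - p j) \<bullet> (x i *\<^sub>R pin p a b i j)" for i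
 proof -
  have s: "sum p {v, j} = p v + p j" using vj by simp
  have gen: "sum g {v, j} = g v + g j" for g :: "'a => real" using vj by simp
  have "rmat p a b {v, j} i = (p j - p v) \<bullet> pin p a b i v + (p v - p j) \<bullet> pin p a b i j"
   unfolding rmat_def gen s pair_diff ..
  then show ?thesis by (simp only: distrib_left distrib_right inner_scaleR_right mult.commute)
 qed
 then have "(\<Sum>i\<in>pin_index a b. rmat p a b {v, j} i * x i) = (p j - p v) \<bullet> field p a b x v + (p v - p j) \<bullet> field p a b x j"
  by (simp only: field_def inner_sum_right sum.distrib)
 then show ?thesis by (simp add: algebra_simps inner_diff_left inner_diff_right)
qed

lemma rmat_force: "(\<Sum>e\<in>E. rmat p a b e i * y e) = (\<Sum>v\<in>V. force E p y v \<bullet> pin p a b i v)"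
proof -
 have "(\<Sum>v\<in>V. force E p y v \<bullet> pin p a b i v) = (\<Sum>v\<in>V. \<Sum>j\<in>nbrs E v. y {v, j} * ((p j - p v) \<bullet> pin p a b i v))"
  by (simp add: force_def inner_sum_left)
 also have "\<dots> = (\<Sum>v\<in>V. \<Sum>j\<in>nbrs E v. y {v, j} * ((sum p {v, j} - 2 * p v) \<bullet> pin p a b i v))"
 proof (rule sum_nbrs_cong)
  fix v j assume "{v, j} \<in> E"
  then have "sum p {v, j} = p v + p j" using edgeD[of v j] by simp
  then show "y {v, j} * ((p j - p v) \<bullet> pin p a b i v) = y {v, j} * ((sum p {v, j} - 2 * p v) \<bullet> pin p a b i v)"
   by (simp only: pair_diff)
 qed
 also have "\<dots> = (\<Sum>v\<in>V. \<Sum>e\<in>E. if v \<in> e then y e * ((sum p e - 2 * p v) \<bullet> pin p a b i v) else 0)"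
  by (simp only: sum_incident)
 also have "\<dots> = (\<Sum>e\<in>E. \<Sum>v\<in>V. if v \<in> e then y e * ((sum p e - 2 * p v) \<bullet> pin p a b i v) else 0)"
  by (rule sum.swap)
 also have "\<dots> = (\<Sum>e\<in>E. rmat p a b e i * y e)"
 proof (rule sum.cong[OF refl])
  fix e assume "e \<in> E"
  have "(\<Sum>v\<in>V. if v \<in> e then y e * ((sum p e - 2 * p v) \<bullet> pin p a b i v) else 0) = (\<Sum>v\<in>e. y e * ((sum p e - 2 * p v) \<bullet> pin p a b i v))"
   by (rule sum.mono_neutral_cong_right) (use finV edge_sub[OF \<open>e \<in> E\<close>] in auto)
  then show "(\<Sum>v\<in>V. if v \<in> e then y e * ((sum p e - 2 * p v) \<bullet> pin p a b i v) else 0) = rmat p a b e i * y e"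
   by (simp add: rmat_def sum_distrib_left mult.commute)
 qed
 finally show ?thesis by simp
qed

text \<open>The pinned coordinates kill the forces at all vertices but \<open>a\<close> and
  \<open>b\<close> and the component along \<open>ab\<close> of the force at \<open>b\<close>. The
  three remaining components vanish because internal forces do no work in translations and
  rotations.\<close>

lemma pinned_equilibrium:
 assumes ab: "a \<in> V" "b \<in> V" "p a ~= p b" and 0: "!!i. i \<in> pin_index a b ==> (\<Sum>e\<in>E. rmat p a b e i * y e) = 0" and v: "v \<in> V"
 shows "force E p y v = 0"
proof -
 have anb: "a ~= b" using ab by auto
 have one: "(\<Sum>v\<in>V. force E p y v \<bullet> pin p a b i v) = 0" if "i \<in> pin_index a b" for i using 0[OF that] rmat_force by simp
 have other: "force E p y w = 0" if w: "w \<in> V" "w ~= a" "w ~= b" for w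
 proof -
  have "(\<Sum>v\<in>V. force E p y v \<bullet> pin p a b (Some (w, t)) v) = force E p y w \<bullet> (if t then 1 else \<i>)" for t
   using finV w by (subst sum.remove[of V w]) (auto simp: pin_def intro!: sum.neutral)
  moreover have "Some (w, t) \<in> pin_index a b" for t using w by (auto simp: pin_index_def)
  ultimately have "force E p y w \<bullet> 1 = 0" "force E p y w \<bullet> \<i> = 0" using one[of "Some (w, True)"] one[of "Some (w, False)"] by auto
  then show ?thesis by (simp add: inner_complex_def complex_eq_iff)
 qed
 have two: "(\<Sum>v\<in>V. force E p y v \<bullet> u v) = force E p y a \<bullet> u a + force E p y b \<bullet> u b" for u
 proof -
  have "(\<Sum>v\<in>V. force E p y v \<bullet> u v) = (\<Sum>v\<in>{a, b}. force E p y v \<bullet> u v)"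
   by (rule sum.mono_neutral_right) (use finV ab other in auto)
  then show ?thesis using anb by simp
 qed
 have "None \<in> pin_index a b" by (simp add: pin_index_def)
 from one[OF this] have e1: "force E p y b \<bullet> (p b - p a) = 0" using anb by (simp add: two pin_def)
 have "trivial_motion V p (%v. - \<i> * p a + of_real 1 * \<i> * p v)" unfolding trivial_motion_def by blast
 from force_trivial[OF this, where s = y, unfolded two] have e2: "force E p y b \<bullet> (\<i> * (p b - p a)) = 0"
  by (simp add: algebra_simps inner_diff_right)
 have b0: "force E p y b = 0"
 proof -
  define f d where "f = force E p y b" and "d = p b - p a"
  have "d ~= 0" using ab by (simp add: d_def)
  moreover have "Re f * Re d + Im f * Im d = 0" "Im f * Re d - Re f * Im d = 0"
   using e1 e2 by (simp_all add: inner_complex_def f_def d_def algebra_simps)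
  then have "f * cnj d = 0" by (simp add: complex_eq_iff)
  ultimately show ?thesis by (simp add: f_def)
 qed
 have "trivial_motion V p (%v. force E p y a + of_real 0 * \<i> * p v)" unfolding trivial_motion_def by blast
 from force_trivial[OF this, where s = y, unfolded two] have "force E p y a = 0" using b0 by simp
 then show ?thesis using other b0 v by blast
qed

lemma stress_free_card:
 assumes "stress_free V E p" "a \<in> V" "b \<in> V" "p a ~= p b"
 shows "card E + 3 <= 2 * card V"
proof (rule ccontr)
 assume "\<not> card E + 3 <= 2 * card V"
 moreover have "a ~= b" using assms by auto
 ultimately have "card (pin_index a b) < card E" using card_pin[of a b] assms by linarith
 then obtain y where y: "\<exists>e\<in>E. y e ~= 0" "\<forall>i\<in>pin_index a b. (\<Sum>e\<in>E. rmat p a b e i * y e) = 0"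
  using homogeneous_nontrivial[OF fin_pin finE, of a b "%i e. rmat p a b e i"] by blast
 then have "\<forall>v\<in>V. force E p y v = 0" using pinned_equilibrium[OF assms(2-4)] by blast
 then show False using assms(1) y unfolding stress_free_def by blast
qed

lemma field_motion:
 assumes "\<forall>e\<in>E. (\<Sum>i\<in>pin_index a b. rmat p a b e i * x i) = 0"
 shows "infinitesimal_motion E p (field p a b x)"
 using assms rmat_field[where p = p and a = a and b = b and x = x] unfolding infinitesimal_motion_def by fastforce

text \<open>With fewer edges than pinned coordinates there is a nonzero pinned motion, and the only
  trivial motion among the pinned ones is zero.\<close>

lemma rigid_card:
 assumes "infinitesimally_rigid V E p" "a \<in> V" "b \<in> V" "p a ~= p b"
 shows "2 * card V <= card E + 3"
proof (rule ccontr)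
 assume "\<not> 2 * card V <= card E + 3"
 moreover have "a ~= b" using assms by auto
 ultimately have "card E < card (pin_index a b)" using card_pin[of a b] assms by linarith
 then obtain x where x: "\<exists>i\<in>pin_index a b. x i ~= 0" "\<forall>e\<in>E. (\<Sum>i\<in>pin_index a b. rmat p a b e i * x i) = 0"
  using homogeneous_nontrivial[OF finE fin_pin] by blast
 have anb: "a ~= b" using assms by auto
 have "trivial_motion V p (field p a b x)" using assms(1) field_motion[OF x(2)] unfolding infinitesimally_rigid_def by blast
 then obtain c w where cw: "!!v. v \<in> V ==> field p a b x v = c + of_real w * \<i> * p v" unfolding trivial_motion_def by blast
 have "c = - of_real w * \<i> * p a" using cw[OF assms(2)] field_eq(1)[OF anb] by (simp add: add_eq_0_iff)
 then have f: "field p a b x v = of_real w * \<i> * (p v - p a)" if "v \<in> V" for v using cw[OF that] by (simp add: algebra_simps)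
 define d where "d = p b - p a"
 have d: "d ~= 0" using assms by (simp add: d_def)
 have "of_real (x None) * d = of_real w * \<i> * d" using f[OF assms(3)] field_eq(2)[OF anb, where p = p and x = x] by (simp add: d_def scaleR_conv_of_real)
 then have "of_real (x None) = of_real w * \<i>" using d by simp
 then have w: "w = 0" "x None = 0" by (simp_all add: complex_eq_iff)
 have "x (Some (v, t)) = 0" if "v \<in> V" "v ~= a" "v ~= b" for v t
  using field_eq(3)[OF anb that, where p = p and x = x] f[OF that(1)] w(1) by (cases t) (simp_all add: complex_eq_iff)
 then show False using x(1) w(2) by (auto simp: pin_index_def)
qed

text \<open>After subtracting a trivial motion, a motion vanishes at \<open>a\<close> and points
  along the line \<open>ab\<close> at \<open>b\<close>. It then lies in the kernel of the pinned
  rigidity matrix, which is square and has independent rows.\<close>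

lemma stress_free_rigid:
 assumes sf: "stress_free V E p" and ab: "a \<in> V" "b \<in> V" "p a ~= p b" and c: "card E + 3 = 2 * card V"
 shows "infinitesimally_rigid V E p"
 unfolding infinitesimally_rigid_def
proof (intro allI impI)
 fix u assume u: "infinitesimal_motion E p u"
 have anb: "a ~= b" using ab by auto
 define d where "d = p b - p a"
 have d: "d ~= 0" using ab by (simp add: d_def)
 \<comment> \<open>Dividing the relative velocity by \<open>d\<close> separates stretching, the real
   part, from rotation, the imaginary part.\<close>
 define r where "r = (u b - u a) / d"
 define w where "w = Im r"
 define u' where "u' v = u v - u a - of_real w * \<i> * (p v - p a)" for v
 have ub: "u' b = of_real (Re r) * d"
 proof -
  have "u b - u a = r * d" using d by (simp add: r_def)
  moreover have "r = of_real (Re r) + of_real w * \<i>" by (simp add: w_def complex_eq_iff)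
  ultimately have "u b - u a = (of_real (Re r) + of_real w * \<i>) * d" by metis
  then show ?thesis by (simp add: u'_def d_def algebra_simps)
 qed
 define x where "x i = (case i of None => Re r | Some (v, t) => if t then Re (u' v) else Im (u' v))" for i
 have fx: "field p a b x v = u' v" if "v \<in> V" for v
 proof -
  consider "v = a" | "v = b" | "v ~= a" "v ~= b" by blast
  then show ?thesis
   by cases (use field_eq[OF anb, where p = p and x = x] ub that in "auto simp: u'_def x_def d_def scaleR_conv_of_real complex_eq_iff")
 qed
 have "(\<Sum>i\<in>pin_index a b. rmat p a b e i * x i) = 0" if e: "e \<in> E" for e
 proof -
  obtain v j where vj: "e = {v, j}" "{v, j} \<in> E" using edge_ex[OF e] e by metis
  have "u' v - u' j = (u v - u j) - of_real w * \<i> * (p v - p j)" by (simp add: u'_def algebra_simps)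
  then have "(p v - p j) \<bullet> (u' v - u' j) = 0" using u vj(2) inner_rot by (simp add: inner_diff_right infinitesimal_motion_def)
  then show ?thesis using rmat_field[OF vj(2), where p = p and a = a and b = b and x = x] fx edgeD[OF vj(2)] vj(1) by simp
 qed
 then have all: "\<forall>e\<in>E. (\<Sum>i\<in>pin_index a b. rmat p a b e i * x i) = 0" by blast
 have "\<not> (\<exists>i\<in>pin_index a b. x i ~= 0)"
 proof
  assume "\<exists>i\<in>pin_index a b. x i ~= 0"
  moreover have "card (pin_index a b) = card E" using card_pin[OF ab(1,2) anb] c by simp
  ultimately obtain y where y: "\<exists>e\<in>E. y e ~= 0" "\<forall>i\<in>pin_index a b. (\<Sum>e\<in>E. rmat p a b e i * y e) = 0"
   using square_left_kernel[OF finE fin_pin _ _ all] by blast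
  then have "\<forall>v\<in>V. force E p y v = 0" using pinned_equilibrium[OF ab] by blast
  then show False using sf y unfolding stress_free_def by blast
 qed
 then have "field p a b x v = 0" for v by (simp add: field_def)
 then have "u v = (u a - of_real w * \<i> * p a) + of_real w * \<i> * p v" if "v \<in> V" for v
  using fx[OF that] by (simp add: u'_def algebra_simps)
 then show "trivial_motion V p u" unfolding trivial_motion_def by blast
qed

text \<open>An edge with nonzero stress is redundant: by virtual work, a motion that preserves all
  other lengths to first order also preserves its length. Minimality therefore excludes
  stresses.\<close>

lemma minimally_rigid_stress_free:
 assumes r: "infinitesimally_rigid V E p" and m: "!!e. e \<in> E ==> \<not> infinitesimally_rigid V (E - {e}) p"
 shows "stress_free V E p"
 unfolding stress_free_def
proof (intro allI impI ballI, rule ccontr)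
 fix s e assume s: "\<forall>v\<in>V. force E p s v = 0" and e: "e \<in> E" "s e ~= 0"
 have "infinitesimally_rigid V (E - {e}) p"
  unfolding infinitesimally_rigid_def
 proof (intro allI impI)
  fix u assume u: "infinitesimal_motion (E - {e}) p u"
  obtain x y where xy: "e = {x, y}" "x ~= y" using edge_ex[OF e(1)] by blast
  define g where "g f = (if f = e then s e * ((p x - p y) \<bullet> (u x - u y)) else 0)" for f
  have "(\<Sum>v\<in>V. \<Sum>j\<in>nbrs E v. s {v, j} * ((p v - p j) \<bullet> (u v - u j))) = (\<Sum>v\<in>V. \<Sum>j\<in>nbrs E v. g {v, j})"
  proof (rule sum_nbrs_cong)
   fix v j assume vj: "{v, j} \<in> E"
   show "s {v, j} * ((p v - p j) \<bullet> (u v - u j)) = g {v, j}"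
   proof (cases "{v, j} = e")
    case True
    then have "v = x & j = y | v = y & j = x" using xy by (simp add: doubleton_eq_iff)
    moreover have "(p x - p y) \<bullet> (u x - u y) = (p y - p x) \<bullet> (u y - u x)" by (simp add: inner_diff_left inner_diff_right)
    ultimately show ?thesis using True by (auto simp: g_def)
   next
    case False
    then show ?thesis using u vj by (simp add: g_def infinitesimal_motion_def)
   qed
  qed
  also have "\<dots> = 2 * g e" unfolding sum_darts_edges using finE e(1) by (simp add: sum.remove[of E e] g_def)
  finally have "g e = 0" using work[where p = p and s = s and u = u] s by simp
  then have z: "(p x - p y) \<bullet> (u x - u y) = 0" using e by (simp add: g_def)
  have "infinitesimal_motion E p u"
   unfolding infinitesimal_motion_def
  proof (intro allI impI)
   fix v j assume vj: "{v, j} \<in> E"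
   show "(p v - p j) \<bullet> (u v - u j) = 0"
   proof (cases "{v, j} = e")
    case True
    then have "v = x & j = y | v = y & j = x" using xy by (simp add: doubleton_eq_iff)
    then show ?thesis using z by (auto simp: inner_diff_left inner_diff_right)
   next
    case False
    then show ?thesis using u vj by (simp add: infinitesimal_motion_def)
   qed
  qed
  then show "trivial_motion V p u" using r unfolding infinitesimally_rigid_def by blast
 qed
 then show False using m[OF e(1)] by blast
qed

lemma stress_free_induced:
 assumes sf: "stress_free V E p" and X: "X <= V"
 shows "stress_free X (induced E X) p"
 unfolding stress_free_def
proof (intro allI impI ballI)
 fix s e assume s: "\<forall>v\<in>X. force (induced E X) p s v = 0" and e: "e \<in> induced E X"
 define s' where "s' f = (if f \<in> induced E X then s f else 0)" for f
 have "force E p s' v = 0" if "v \<in> V" for v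
 proof (cases "v \<in> X")
  case True
  have "force E p s' v = force (induced E X) p s v"
   unfolding force_def by (rule sum.mono_neutral_cong_right) (auto simp: s'_def induced_nbrs True mem_nbrs induced_def)
  then show ?thesis using s True by simp
 next
  case False
  then have "s' {v, j} = 0" for j by (simp add: s'_def induced_def)
  then show ?thesis by (simp add: force_def)
 qed
 then have "s' e = 0" using sf e unfolding stress_free_def by (auto simp: induced_def)
 then show "s e = 0" using e by (simp add: s'_def)
qed

lemma stress_free_sparse:
 assumes sf: "stress_free V E p" and inj: "inj_on p V" and W: "W <= V" "2 <= card W"
 shows "card (induced E W) + 3 <= 2 * card W"
proof -
 interpret W: sgraph W "induced E W" by (rule sgraph_induced[OF W(1)])
 obtain a b where "a \<in> W" "b \<in> W" "a ~= b" using W(2)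
  by (metis card_2_iff' card_le_Suc0_iff_eq W.finV not_less_eq_eq numeral_2_eq_2)
 then show ?thesis using W.stress_free_card[OF stress_free_induced[OF sf W(1)]] inj W(1)
  by (meson inj_onD subsetD)
qed

end

section \<open>Rational polynomials and generic points\<close>

abbreviation "keys \<equiv> Poly_Mapping.keys"
abbreviation "lookup \<equiv> Poly_Mapping.lookup"
abbreviation "single \<equiv> Poly_Mapping.single"

definition mono_val :: "('x \<Rightarrow>\<^sub>0 nat) => ('x => real) => real" where
 "mono_val m x = (\<Prod>i\<in>keys m. x i ^ lookup m i)"

lemma mono_val_superset: "finite S ==> keys m <= S ==> mono_val m x = (\<Prod>i\<in>S. x i ^ lookup m i)"
 unfolding mono_val_def by (rule prod.mono_neutral_left) (auto simp: in_keys_iff)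

lemma mono_val_add: "mono_val (m + n) x = mono_val m x * mono_val n x"
proof -
 let ?S = "keys m \<union> keys n"
 have "mono_val (m + n) x = (\<Prod>i\<in>?S. x i ^ lookup (m + n) i)"
  by (rule mono_val_superset) (auto simp: Poly_Mapping.keys_add)
 also have "\<dots> = (\<Prod>i\<in>?S. x i ^ lookup m i) * (\<Prod>i\<in>?S. x i ^ lookup n i)"
  by (simp add: lookup_add power_add prod.distrib)
 also have "\<dots> = mono_val m x * mono_val n x" by (simp add: mono_val_superset[of ?S])
 finally show ?thesis .
qed

lemma eval_eq: "eval_poly_rat q x = (\<Sum>m\<in>keys q. of_rat (lookup q m) * mono_val m x)"
 by (simp add: eval_poly_rat_def mono_val_def)

lemma eval_superset: "finite S ==> keys q <= S ==>
  eval_poly_rat q x = (\<Sum>m\<in>S. of_rat (lookup q m) * mono_val m x)"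
 unfolding eval_eq by (rule sum.mono_neutral_left) (auto simp: in_keys_iff)

lemma eval_0 [simp]: "eval_poly_rat 0 x = 0"
 by (simp add: eval_eq)

lemma eval_add: "eval_poly_rat (q + r) x = eval_poly_rat q x + eval_poly_rat r x"
proof -
 let ?S = "keys q \<union> keys r"
 have "eval_poly_rat (q + r) x = (\<Sum>m\<in>?S. of_rat (lookup (q + r) m) * mono_val m x)"
  by (rule eval_superset) (auto simp: Poly_Mapping.keys_add)
 also have "\<dots> = eval_poly_rat q x + eval_poly_rat r x"
  by (simp add: lookup_add of_rat_add distrib_right sum.distrib eval_superset[of ?S])
 finally show ?thesis .
qed

lemma eval_single: "eval_poly_rat (single m c) x = of_rat c * mono_val m x"
 by (cases "c = 0") (simp_all add: eval_eq)

lemma eval_sum: "finite A ==> eval_poly_rat (\<Sum>a\<in>A. f a) x = (\<Sum>a\<in>A. eval_poly_rat (f a) x)"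
 by (induction A rule: finite_induct) (simp_all add: eval_add)

lemma sum_monomials: "(\<Sum>m\<in>keys q. single m (lookup q m)) = q"
 by (rule poly_mapping_eqI) (simp add: lookup_sum lookup_single when_def in_keys_iff)

lemma eval_mult: "eval_poly_rat (q * r) x = eval_poly_rat q x * eval_poly_rat r x"
proof -
 have "q * r = (\<Sum>m\<in>keys q. single m (lookup q m)) * (\<Sum>n\<in>keys r. single n (lookup r n))"
  by (simp only: sum_monomials)
 also have "\<dots> = (\<Sum>m\<in>keys q. \<Sum>n\<in>keys r. single (m + n) (lookup q m * lookup r n))"
  by (simp add: sum_product mult_single)
 finally have "eval_poly_rat (q * r) x = (\<Sum>m\<in>keys q. \<Sum>n\<in>keys r. of_rat (lookup q m * lookup r n) * mono_val (m + n) x)"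
  by (simp add: eval_sum eval_single)
 also have "\<dots> = eval_poly_rat q x * eval_poly_rat r x"
  by (simp add: eval_eq sum_product of_rat_mult mono_val_add mult_ac)
 finally show ?thesis .
qed

text \<open>Polynomials are handled as functions closed under the ring operations; their coefficient
  maps appear only when genericity is applied.\<close>

definition polyfun :: "'x set => (('x => real) => real) => bool" where
 "polyfun I f \<longleftrightarrow> (\<exists>q :: ('x \<Rightarrow>\<^sub>0 nat) \<Rightarrow>\<^sub>0 rat. (\<forall>m\<in>keys q. keys m <= I) & (\<forall>x. f x = eval_poly_rat q x))"

lemma polyfunI: "(!!m. m \<in> keys q ==> keys m <= I) ==> (!!x. f x = eval_poly_rat q x) ==> polyfun I f"
 unfolding polyfun_def by blast

lemma polyfun_const: "polyfun I (%x. of_rat c)"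
 by (rule polyfunI[of "single 0 c"]) (auto simp: eval_single mono_val_def split: if_splits)

lemma polyfun_0: "polyfun I (%x. 0)" and polyfun_1: "polyfun I (%x. 1)" and polyfun_m1: "polyfun I (%x. -1)"
 using polyfun_const[of I 0] polyfun_const[of I 1] polyfun_const[of I "-1"] by (simp_all add: of_rat_minus)

lemma polyfun_var: "i \<in> I ==> polyfun I (%x. x i)"
 by (rule polyfunI[of "single (single i 1) 1"]) (auto simp: eval_single mono_val_def)

lemma polyfun_add: "polyfun I f ==> polyfun I g ==> polyfun I (%x. f x + g x)"
proof -
 assume "polyfun I f" "polyfun I g"
 then obtain q r where "\<forall>m\<in>keys q. keys m <= I" "\<forall>x. f x = eval_poly_rat q x"
  "\<forall>m\<in>keys r. keys m <= I" "\<forall>x. g x = eval_poly_rat r x" unfolding polyfun_def by blast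
 note qr = this
 show ?thesis
 proof (rule polyfunI[of "q + r"])
  fix m assume "m \<in> keys (q + r)"
  then have "m \<in> keys q \<union> keys r" by (rule subsetD[OF Poly_Mapping.keys_add])
  then show "keys m <= I" using qr by blast
 qed (simp add: qr eval_add)
qed

lemma polyfun_mult: "polyfun I f ==> polyfun I g ==> polyfun I (%x. f x * g x)"
proof -
 assume "polyfun I f" "polyfun I g"
 then obtain q r where qr: "\<forall>m\<in>keys q. keys m <= I" "\<forall>x. f x = eval_poly_rat q x"
  "\<forall>m\<in>keys r. keys m <= I" "\<forall>x. g x = eval_poly_rat r x" unfolding polyfun_def by blast
 show ?thesis
 proof (rule polyfunI[of "q * r"])
  fix m assume "m \<in> keys (q * r)"
  then obtain a b where "m = a + b" "a \<in> keys q" "b \<in> keys r" using keys_mult[of q r] by blast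
  then show "keys m <= I" using qr Poly_Mapping.keys_add[of a b] by blast
 qed (simp add: qr eval_mult)
qed

lemma polyfun_diff: "polyfun I f ==> polyfun I g ==> polyfun I (%x. f x - g x)"
 using polyfun_add[OF _ polyfun_mult[OF polyfun_m1], of I f g] by simp

lemma polyfun_sum: "finite A ==> (!!a. a \<in> A ==> polyfun I (f a)) ==> polyfun I (%x. \<Sum>a\<in>A. f a x)"
 by (induction A rule: finite_induct) (simp_all add: polyfun_0 polyfun_add)

lemma polyfun_generic:
 assumes "polyfun I f" "f x0 ~= 0" "algebraically_independent_rat I x"
 shows "f x ~= 0"
proof -
 obtain q where q: "\<forall>m\<in>keys q. keys m <= I" "\<forall>x. f x = eval_poly_rat q x"
  using assms(1) unfolding polyfun_def by blast
 then have "q ~= 0" using assms(2) by auto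
 then show ?thesis using assms(3) q unfolding algebraically_independent_rat_def by metis
qed

text \<open>Fraction-free Gaussian elimination: triviality of the kernel is witnessed by a nonvanishing polynomial.\<close>
lemma polyfun_trivial_kernel:
 fixes a :: "'j => 'i => ('x => real) => real"
 assumes "finite K" "finite J" "!!j i. j \<in> J ==> i \<in> K ==> polyfun I (a j i)"
  "\<forall>z. (\<forall>j\<in>J. (\<Sum>i\<in>K. a j i x0 * z i) = 0) --> (\<forall>i\<in>K. z i = 0)"
 shows "\<exists>D. polyfun I D & D x0 ~= 0 &
  (\<forall>x. D x ~= 0 --> (\<forall>z. (\<forall>j\<in>J. (\<Sum>i\<in>K. a j i x * z i) = 0) --> (\<forall>i\<in>K. z i = 0)))"
 using assms
proof (induction K arbitrary: J a rule: finite_induct)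
 case empty
 then show ?case by (intro exI[of _ "%_. 1"]) (simp add: polyfun_1)
next
 case (insert k K)
 have sumk: "(\<Sum>i\<in>insert k K. a j i x * z i) = a j k x * z k + (\<Sum>i\<in>K. a j i x * z i)" for j x z
  using insert.hyps by simp
 obtain h where h: "h \<in> J" "a h k x0 ~= 0"
 proof -
  have "\<not> (\<forall>j\<in>J. a j k x0 = 0)"
  proof
   assume z: "\<forall>j\<in>J. a j k x0 = 0"
   let ?z = "%i. if i = k then 1 else 0 :: real"
   have "(\<Sum>i\<in>K. a j i x0 * ?z i) = 0" for j using insert.hyps by (intro sum.neutral) auto
   then have "\<forall>j\<in>J. (\<Sum>i\<in>insert k K. a j i x0 * ?z i) = 0" using z unfolding sumk by simp
   then have "\<forall>i\<in>insert k K. ?z i = 0" by (rule insert.prems(3)[THEN spec, THEN mp])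
   then show False by simp
  qed
  then show ?thesis using that by blast
 qed
 \<comment> \<open>Elimination of the unknown \<open>k\<close> by cross-multiplication with the
   pivot row \<open>h\<close>. The pivot is nonzero at \<open>x0\<close> and becomes a factor of the
   final polynomial.\<close>
 define b where "b j i x = a h k x * a j i x - a j k x * a h i x" for j i x
 have red: "(\<Sum>i\<in>K. b j i x * z i) = a h k x * (\<Sum>i\<in>K. a j i x * z i) - a j k x * (\<Sum>i\<in>K. a h i x * z i)" for j x z
  by (simp add: b_def left_diff_distrib sum_subtractf sum_distrib_left mult.assoc)
 have "\<exists>D. polyfun I D & D x0 ~= 0 &
  (\<forall>x. D x ~= 0 --> (\<forall>z. (\<forall>j\<in>J. (\<Sum>i\<in>K. b j i x * z i) = 0) --> (\<forall>i\<in>K. z i = 0)))"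
 proof (rule insert.IH[OF insert.prems(1)])
  show "polyfun I (b j i)" if "j \<in> J" "i \<in> K" for j i
   unfolding b_def[abs_def] using that h(1) insert.prems(2) by (intro polyfun_diff polyfun_mult) auto
  show "\<forall>z. (\<forall>j\<in>J. (\<Sum>i\<in>K. b j i x0 * z i) = 0) --> (\<forall>i\<in>K. z i = 0)"
  proof (intro allI impI)
   fix z assume z: "\<forall>j\<in>J. (\<Sum>i\<in>K. b j i x0 * z i) = 0"
   let ?s = "\<Sum>i\<in>K. a h i x0 * z i"
   define z' where "z' = z(k := - ?s / a h k x0)"
   have z'K: "(\<Sum>i\<in>K. a j i x0 * z' i) = (\<Sum>i\<in>K. a j i x0 * z i)" for j
    using insert.hyps by (intro sum.cong) (auto simp: z'_def)
   have "(\<Sum>i\<in>insert k K. a j i x0 * z' i) = 0" if "j \<in> J" for j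
   proof -
    have "a h k x0 * (\<Sum>i\<in>K. a j i x0 * z i) = a j k x0 * ?s" using z that red[of j x0 z] by simp
    then have "(\<Sum>i\<in>K. a j i x0 * z i) = a j k x0 * ?s / a h k x0" using h(2) by (simp add: field_simps)
    then show ?thesis unfolding sumk z'K by (simp add: z'_def)
   qed
   then have "\<forall>i\<in>insert k K. z' i = 0" using insert.prems(3)[THEN spec, of z'] by blast
   then show "\<forall>i\<in>K. z i = 0" using insert.hyps by (auto simp: z'_def split: if_splits)
  qed
 qed
 then obtain D where D: "polyfun I D" "D x0 ~= 0"
  "!!x z. D x ~= 0 ==> \<forall>j\<in>J. (\<Sum>i\<in>K. b j i x * z i) = 0 ==> \<forall>i\<in>K. z i = 0" by blast
 show ?case
 proof (rule exI[of _ "%x. a h k x * D x"], intro conjI allI impI)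
  show "polyfun I (%x. a h k x * D x)" using D(1) insert.prems(2) h(1) by (intro polyfun_mult) auto
  show "a h k x0 * D x0 ~= 0" using h D by simp
  fix x z assume x: "a h k x * D x ~= 0" and z: "\<forall>j\<in>J. (\<Sum>i\<in>insert k K. a j i x * z i) = 0"
  have e: "(\<Sum>i\<in>K. a j i x * z i) = - (a j k x * z k)" if "j \<in> J" for j
   using z that unfolding sumk by (simp add: add_eq_0_iff)
  have "\<forall>j\<in>J. (\<Sum>i\<in>K. b j i x * z i) = 0" using red[of _ x z] e h(1) by (simp add: algebra_simps)
  then have K0: "\<forall>i\<in>K. z i = 0" using D(3)[of x z] x by simp
  then have "a h k x * z k = 0" using e[OF h(1)] by simp
  then show "\<forall>i\<in>insert k K. z i = 0" using K0 x by simp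
 qed
qed

lemma countable_poly_mapping:
 fixes K :: "'k set"
 assumes "countable K"
 shows "countable {q :: 'k \<Rightarrow>\<^sub>0 ('c :: {zero, countable}). keys q <= K}"
proof -
 let ?g = "%q :: 'k \<Rightarrow>\<^sub>0 'c. (%k. (k, lookup q k)) ` keys q"
 have "inj_on ?g {q. keys q <= K}"
 proof (rule inj_onI)
  fix q r :: "'k \<Rightarrow>\<^sub>0 'c" assume eq: "?g q = ?g r"
  have "lookup q k = lookup r k" for k
  proof (cases "k \<in> keys q | k \<in> keys r")
   case True
   have "(k, lookup q k) \<in> ?g r | (k, lookup r k) \<in> ?g q"
    using True
   proof
    assume "k \<in> keys q"
    then have "(k, lookup q k) \<in> ?g q" by (rule imageI)
    then show ?thesis unfolding eq by (rule disjI1)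
   next
    assume "k \<in> keys r"
    then have "(k, lookup r k) \<in> ?g r" by (rule imageI)
    then show ?thesis unfolding eq[symmetric] by (rule disjI2)
   qed
   then show ?thesis by auto
  next
   case False
   then show ?thesis by (simp add: in_keys_iff)
  qed
  then show "q = r" by (rule poly_mapping_eqI)
 qed
 moreover have "countable (?g ` {q. keys q <= K})"
 proof (rule countable_subset)
  show "?g ` {q. keys q <= K} <= {S. S <= K \<times> UNIV & finite S}" by auto
  show "countable {S :: ('k \<times> 'c) set. S <= K \<times> UNIV & finite S}"
   using countable_Collect_finite_subset[of "K \<times> (UNIV :: 'c set)"] assms by (simp add: conj_commute)
 qed
 ultimately show ?thesis by (rule countable_image_inj_on[rotated])
qed

text \<open>A nonzero polynomial, read as a polynomial in the new variable, has a coefficient that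
  does not vanish at \<open>x\<close>, hence finitely many roots. There are only countably many
  polynomials, so some real number avoids all these roots.\<close>

lemma alg_indep_extend:
 assumes I: "finite I" "i ~: I" and x: "algebraically_independent_rat I x"
 shows "\<exists>t. algebraically_independent_rat (insert i I) (x(i := t))"
proof -
 define Q where "Q = {q :: ('a \<Rightarrow>\<^sub>0 nat) \<Rightarrow>\<^sub>0 rat. keys q <= {m. keys m <= insert i I}}"
 have cQ: "countable Q" unfolding Q_def
  by (intro countable_poly_mapping countable_finite) (use I in auto)
 have fin: "finite {t. eval_poly_rat q (x(i := t)) = 0}" if q: "q \<in> Q" "q ~= 0" for q
 proof -
  \<comment> \<open>Removes the variable \<open>i\<close> from a monomial; grouping monomials by the
    exponent of \<open>i\<close> then yields the coefficients \<open>qk\<close>.\<close>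
  define strip :: "('a \<Rightarrow>\<^sub>0 nat) => ('a \<Rightarrow>\<^sub>0 nat)" where "strip m = Poly_Mapping.update i 0 m" for m
  have ls: "lookup (strip m) k = (if k = i then 0 else lookup m k)" for m k
   by (simp add: strip_def lookup_update)
  have ks: "keys (strip m) = keys m - {i}" for m by (auto simp: in_keys_iff ls split: if_splits)
  have mv: "mono_val m (x(i := t)) = t ^ lookup m i * mono_val (strip m) x" for m t
  proof -
   let ?S = "insert i (keys m)"
   have "mono_val m (x(i := t)) = (\<Prod>k\<in>?S. (x(i := t)) k ^ lookup m k)" by (rule mono_val_superset) auto
   also have "\<dots> = t ^ lookup m i * (\<Prod>k\<in>?S - {i}. (x(i := t)) k ^ lookup m k)"
    by (subst prod.remove[of ?S i]) auto
   also have "(\<Prod>k\<in>?S - {i}. (x(i := t)) k ^ lookup m k) = (\<Prod>k\<in>keys (strip m). x k ^ lookup (strip m) k)"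
    by (rule prod.cong) (auto simp: ks ls)
   finally show ?thesis by (simp add: mono_val_def)
  qed
  define K where "K = Max (insert 0 ((%m. lookup m i) ` keys q))"
  have K: "lookup m i <= K" if "m \<in> keys q" for m using that by (simp add: K_def)
  define M where "M k = {m \<in> keys q. lookup m i = k}" for k
  define qk where "qk k = (\<Sum>m\<in>M k. single (strip m) (lookup q m))" for k
  have finM: "finite (M k)" for k by (simp add: M_def)
  have ev: "eval_poly_rat q (x(i := t)) = (\<Sum>k\<le>K. eval_poly_rat (qk k) x * t ^ k)" for t
  proof -
   have "eval_poly_rat q (x(i := t)) = (\<Sum>m\<in>keys q. of_rat (lookup q m) * (t ^ lookup m i * mono_val (strip m) x))"
    by (simp add: eval_eq mv)
   also have "\<dots> = (\<Sum>k\<le>K. \<Sum>m\<in>M k. of_rat (lookup q m) * (t ^ lookup m i * mono_val (strip m) x))"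
    unfolding M_def by (rule sum.group[symmetric]) (use K in auto)
   also have "\<dots> = (\<Sum>k\<le>K. eval_poly_rat (qk k) x * t ^ k)"
    by (intro sum.cong refl) (simp add: qk_def eval_sum finM eval_single sum_distrib_right sum_distrib_left M_def mult_ac)
   finally show ?thesis .
  qed
  obtain m0 where m0: "m0 \<in> keys q" using q(2) by (metis ex_in_conv keys_eq_empty)
  let ?k = "lookup m0 i"
  have inj: "m = m0" if "m \<in> M ?k" "strip m = strip m0" for m
  proof (rule poly_mapping_eqI)
   fix l show "lookup m l = lookup m0 l"
    using that ls[of m l] ls[of m0 l] by (cases "l = i") (auto simp: M_def)
  qed
  have "lookup (qk ?k) (strip m0) = (\<Sum>m\<in>M ?k. lookup (single (strip m) (lookup q m)) (strip m0))"
   by (simp add: qk_def lookup_sum)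
  also have "\<dots> = (\<Sum>m\<in>M ?k. if m = m0 then lookup q m0 else 0)"
   by (rule sum.cong) (use inj in "auto simp: lookup_single when_def")
  also have "\<dots> = lookup q m0" using finM m0 by (simp add: M_def)
  finally have "qk ?k ~= 0" using m0 by (auto simp: in_keys_iff)
  moreover have "keys m <= I" if "m \<in> keys (qk ?k)" for m
  proof -
   have "m \<in> (\<Union>m\<in>M ?k. keys (single (strip m) (lookup q m)))"
    using that keys_sum[of "%m. single (strip m) (lookup q m)" "M ?k"] unfolding qk_def by blast
   then obtain m' where "m' \<in> M ?k" "m = strip m'" by (auto split: if_splits)
   then show ?thesis using q(1) ks[of m'] by (auto simp: Q_def M_def)
  qed
  ultimately have "eval_poly_rat (qk ?k) x ~= 0" using x unfolding algebraically_independent_rat_def by blast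
  then have "\<exists>k\<le>K. eval_poly_rat (qk k) x ~= 0" using K[OF m0] by blast
  then show ?thesis unfolding ev using polyfun_finite_roots[of "%k. eval_poly_rat (qk k) x" K] by blast
 qed
 have "countable (\<Union>q\<in>Q - {0}. {t. eval_poly_rat q (x(i := t)) = 0})"
  by (rule countable_UN) (use cQ fin in "auto intro: countable_finite")
 then obtain t where t: "t ~: (\<Union>q\<in>Q - {0}. {t. eval_poly_rat q (x(i := t)) = 0})"
  using uncountable_UNIV_real by (metis UNIV_eq_I)
 have "algebraically_independent_rat (insert i I) (x(i := t))"
  unfolding algebraically_independent_rat_def using t by (auto simp: Q_def)
 then show ?thesis by blast
qed

lemma alg_indep_exists: "finite I ==> \<exists>x. algebraically_independent_rat I x"
proof (induction I rule: finite_induct)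
 case empty
 have "eval_poly_rat q x ~= 0" if "q ~= 0" "\<forall>m\<in>keys q. keys m <= {}" for q :: "('a \<Rightarrow>\<^sub>0 nat) \<Rightarrow>\<^sub>0 rat" and x
 proof -
  have "m = 0" if "m \<in> keys q" for m using that \<open>\<forall>m\<in>keys q. keys m <= {}\<close> by auto
  then have "keys q = {0}" using that(1) by (metis ex_in_conv keys_eq_empty subsetI subset_singletonD singletonI)
  then show ?thesis using in_keys_iff[of 0 q] by (simp add: eval_eq mono_val_def)
 qed
 then show ?case unfolding algebraically_independent_rat_def by blast
next
 case (insert i I)
 obtain x where x: "algebraically_independent_rat I x" using insert.IH by blast
 from alg_indep_extend[OF insert.hyps x] show ?case by blast
qed

text \<open>A statement about all generic placements carries information about the graph only
  because one of them exists.\<close>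

lemma generic_exists: "finite V ==> \<exists>p. generic_points V p"
proof -
 assume "finite V"
 then obtain x where x: "algebraically_independent_rat (V <+> V) x" using alg_indep_exists[of "V <+> V"] by auto
 have "case_sum (%i. Re (Complex (x (Inl i)) (x (Inr i)))) (%i. Im (Complex (x (Inl i)) (x (Inr i)))) = x"
  by (auto simp: fun_eq_iff split: sum.split)
 then show ?thesis using x unfolding generic_points_def by (intro exI[of _ "%i. Complex (x (Inl i)) (x (Inr i))"]) simp
qed

abbreviation coords :: "('a => complex) => 'a + 'a => real" where
 "coords p \<equiv> case_sum (%i. Re (p i)) (%i. Im (p i))"

lemma generic_inj:
 assumes "generic_points V p" "a \<in> V" "b \<in> V" "a ~= b"
 shows "p a ~= p b"
proof -
 have "polyfun (V <+> V) (%x. x (Inl a) - x (Inl b))" using assms by (intro polyfun_diff polyfun_var) auto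
 from polyfun_generic[OF this, of "%i. if i = Inl a then 1 else 0" "coords p"]
 show ?thesis using assms unfolding generic_points_def by auto
qed

context sgraph
begin

text \<open>Independence at \<open>p0\<close> is witnessed by a rational polynomial in the
  coordinates that is nonzero there, and such a polynomial cannot vanish at a generic
  placement.\<close>

lemma stress_free_generic:
 assumes sf: "stress_free V E p0" and g: "generic_points V p"
 shows "stress_free V E p"
proof -
 define a where "a r e x = (case r of (v, t) => if v \<in> e then (\<Sum>w\<in>e. x (if t then Inl w else Inr w)) - 2 * x (if t then Inl v else Inr v) else (0::real))"
  for r :: "'a \<times> bool" and e and x :: "'a + 'a => real"
 have two: "2 * f x = f x + (f x :: real)" for f :: "('a + 'a => real) => real" and x by simp
 have pf: "polyfun (V <+> V) (a r e)" if "r \<in> V \<times> UNIV" "e \<in> E" for r e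
 proof (cases "fst r \<in> e")
  case True
  have "polyfun (V <+> V) (%x. (\<Sum>w\<in>e. x (if snd r then Inl w else Inr w)) - (x (if snd r then Inl (fst r) else Inr (fst r)) + x (if snd r then Inl (fst r) else Inr (fst r))))"
   using that edge_sub[OF that(2)] finite_subset[OF _ finV]
   by (intro polyfun_diff polyfun_add polyfun_sum polyfun_var) auto
  then show ?thesis using True by (simp add: a_def[abs_def] case_prod_beta)
 next
  case False
  then show ?thesis using polyfun_0 by (simp add: a_def[abs_def] case_prod_beta)
 qed
 have fc: "(\<Sum>e\<in>E. a (v, t) e (coords p) * s e) = (if t then Re (force E p s v) else Im (force E p s v))" for v t p s
 proof -
  have "(\<Sum>e\<in>E. a (v, t) e (coords p) * s e) = (\<Sum>e\<in>E. if v \<in> e then a (v, t) e (coords p) * s e else 0)"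
   by (rule sum.cong) (auto simp: a_def)
  also have "\<dots> = (\<Sum>j\<in>nbrs E v. a (v, t) {v, j} (coords p) * s {v, j})" by (rule sum_incident)
  also have "\<dots> = (\<Sum>j\<in>nbrs E v. if t then Re (s {v, j} *\<^sub>R (p j - p v)) else Im (s {v, j} *\<^sub>R (p j - p v)))"
  proof (rule sum.cong[OF refl])
   fix j assume "j \<in> nbrs E v"
   then have "v ~= j" using edgeD by (auto simp: mem_nbrs)
   then show "a (v, t) {v, j} (coords p) * s {v, j} = (if t then Re (s {v, j} *\<^sub>R (p j - p v)) else Im (s {v, j} *\<^sub>R (p j - p v)))"
    by (simp add: a_def algebra_simps)
  qed
  finally show ?thesis by (simp add: force_def)
 qed
 have key: "(\<forall>r\<in>V \<times> UNIV. (\<Sum>e\<in>E. a r e (coords p) * s e) = 0) \<longleftrightarrow> (\<forall>v\<in>V. force E p s v = 0)" for p s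
 proof
  assume h: "\<forall>r\<in>V \<times> UNIV. (\<Sum>e\<in>E. a r e (coords p) * s e) = 0"
  show "\<forall>v\<in>V. force E p s v = 0"
  proof
   fix v assume "v \<in> V"
   then have "Re (force E p s v) = 0" "Im (force E p s v) = 0" using bspec[OF h, of "(v, True)"] bspec[OF h, of "(v, False)"] by (simp_all add: fc)
   then show "force E p s v = 0" by (simp add: complex_eq_iff)
  qed
 qed (auto simp: fc)
 have "\<forall>z. (\<forall>r\<in>V \<times> UNIV. (\<Sum>e\<in>E. a r e (coords p0) * z e) = 0) --> (\<forall>e\<in>E. z e = 0)"
  using sf unfolding key stress_free_def .
 then have "\<exists>D. polyfun (V <+> V) D & D (coords p0) ~= 0 &
  (\<forall>x. D x ~= 0 --> (\<forall>z. (\<forall>r\<in>V \<times> UNIV. (\<Sum>e\<in>E. a r e x * z e) = 0) --> (\<forall>e\<in>E. z e = 0)))"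
  using finV pf by (intro polyfun_trivial_kernel finE) auto
 then obtain D where D: "polyfun (V <+> V) D" "D (coords p0) ~= 0"
  "\<forall>x. D x ~= 0 --> (\<forall>z. (\<forall>r\<in>V \<times> UNIV. (\<Sum>e\<in>E. a r e x * z e) = 0) --> (\<forall>e\<in>E. z e = 0))"
  by blast
 have "D (coords p) ~= 0" by (rule polyfun_generic[OF D(1,2) g[unfolded generic_points_def]])
 then show ?thesis using D(3) unfolding stress_free_def key[symmetric] by blast
qed

lemma two_vertices:
 assumes "2 <= card V" obtains a b where "a \<in> V" "b \<in> V" "a ~= b"
proof -
 have "\<not> card V <= Suc 0" using assms by simp
 then show ?thesis using that card_le_Suc0_iff_eq[OF finV] by blast
qed

lemma generically_minimally_rigidI:
 assumes sf: "stress_free V E p0" and c: "card E + 3 = 2 * card V" and n: "2 <= card V"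
 shows "generically_minimally_rigid V E"
 unfolding generically_minimally_rigid_def
proof (intro allI impI conjI ballI)
 fix p assume g: "generic_points V p"
 obtain a b where ab: "a \<in> V" "b \<in> V" "a ~= b" using two_vertices[OF n] .
 have pab: "p a ~= p b" by (rule generic_inj[OF g ab])
 show "infinitesimally_rigid V E p"
  by (rule stress_free_rigid[OF stress_free_generic[OF sf g] ab(1,2) pab c])
 fix e assume e: "e \<in> E"
 interpret e: sgraph V "E - {e}" by unfold_locales (use finV edge_sub edge_card in auto)
 have "card (E - {e}) < card E" using e finE by (rule card_Diff1_less[rotated])
 then show "\<not> infinitesimally_rigid V (E - {e}) p"
  using e.rigid_card[OF _ ab(1,2) pab] c by auto
qed

lemma generically_minimally_rigid_laman:
 assumes r: "generically_minimally_rigid V E" and n: "2 <= card V"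
 shows "laman V E"
proof -
 obtain p where g: "generic_points V p" using generic_exists[OF finV] by blast
 have inj: "inj_on p V" using generic_inj[OF g] by (auto simp: inj_on_def)
 obtain a b where ab: "a \<in> V" "b \<in> V" "a ~= b" using two_vertices[OF n] .
 have pab: "p a ~= p b" by (rule generic_inj[OF g ab])
 have ri: "infinitesimally_rigid V E p" and mi: "!!e. e \<in> E ==> \<not> infinitesimally_rigid V (E - {e}) p"
  using r g unfolding generically_minimally_rigid_def by blast+
 have sf: "stress_free V E p" by (rule minimally_rigid_stress_free[OF ri mi])
 have "card E = 2 * card V - 3" using stress_free_card[OF sf ab(1,2) pab] rigid_card[OF ri ab(1,2) pab] by simp
 moreover have "card {e \<in> E. e <= W} <= 2 * card W - 3" if "W <= V" "2 <= card W" for W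
  using stress_free_sparse[OF sf inj that] by (simp add: induced_def)
 ultimately show ?thesis unfolding laman_def by blast
qed

end

section \<open>Winding numbers and liftings\<close>

text \<open>The angle under which the way from \<open>v\<close> to \<open>j\<close> is seen from
  \<open>q\<close>, weighted by \<omega>. For a flow and \<open>q\<close> off the drawing both darts
  of an edge contribute equally, hence 4 pi instead of 2 pi.\<close>

definition winding :: "'a set => 'a set set => ('a => complex) => ('a => 'a => real) => complex => real" where
 "winding V E p \<omega> q = (\<Sum>v\<in>V. \<Sum>j\<in>nbrs E v. \<omega> v j * Arg ((p j - q) / (p v - q))) / (4 * pi)"

text \<open>The branch cut of the angle is met only on the segment itself, so the summands of
  \<open>winding\<close> are smooth off the drawing.\<close>

lemma quotient_nonpos:
 fixes a b q :: complex
 assumes "(a - q) / (b - q) \<in> \<real>\<^sub>\<le>\<^sub>0" "q ~= b"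
 shows "q \<in> closed_segment b a"
proof -
 obtain r where r: "(a - q) / (b - q) = of_real r" "r <= 0" using assms(1) by (auto simp: nonpos_Reals_def)
 then have eq: "a - q = of_real r * (b - q)" using assms(2) nonzero_divide_eq_eq[of "b - q" "a - q"] by simp
 have r1: "1 - r > 0" using r by simp
 define u where "u = 1 / (1 - r)"
 have u: "0 <= u" "u <= 1" "u * (1 - r) = 1" using r1 r by (auto simp: u_def field_simps)
 have "q * of_real (1 - r) = a - of_real r * b" using eq by (simp add: algebra_simps)
 then have "of_real u * (q * of_real (1 - r)) = of_real u * (a - of_real r * b)" by simp
 moreover have "of_real u * (q * of_real (1 - r)) = q * of_real (u * (1 - r))" by simp
 ultimately have "q = of_real u * a - of_real (u * r) * b" unfolding u(3) by (simp add: algebra_simps)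
 moreover have ur: "u * r = u - 1" using u(3) by (simp add: algebra_simps)
 ultimately have "q = of_real u * a - of_real (u - 1) * b" by simp
 then have "q = (1 - u) *\<^sub>R b + u *\<^sub>R a" by (simp add: scaleR_conv_of_real algebra_simps)
 then show ?thesis using u by (auto simp: closed_segment_def)
qed

locale drawn = sgraph V E for V :: "'a set" and E +
 fixes p :: "'a => complex"
 assumes nce: "noncrossing_embedding V E p" and non_isolated: "v \<in> V ==> nbrs E v ~= {}"
begin

abbreviation "D \<equiv> drawing V E p"

abbreviation seg :: "'a => 'a => complex set" where "seg v j \<equiv> closed_segment (p v) (p j)"

lemma inj: "v \<in> V ==> j \<in> V ==> p v = p j ==> v = j"
 using nce by (auto simp: noncrossing_embedding_def inj_on_def)

lemma edge_p: "{v, j} \<in> E ==> p v ~= p j"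
 using inj edgeD by blast

lemma seg_inter: "{v, j} \<in> E ==> {k, l} \<in> E ==> {v, j} ~= {k, l} ==> seg v j \<inter> seg k l = p ` ({v, j} \<inter> {k, l})"
proof -
 assume h: "{v, j} \<in> E" "{k, l} \<in> E" "{v, j} ~= {k, l}"
 have "\<forall>e\<in>E. \<forall>f\<in>E. e ~= f --> convex hull (p ` e) \<inter> convex hull (p ` f) = p ` (e \<inter> f)"
  using nce unfolding noncrossing_embedding_def by blast
 from this[rule_format, OF h] show ?thesis unfolding segment_2 .
qed

lemma vertex_on_seg:
 assumes e: "{v, j} \<in> E" and w: "w \<in> V" "p w \<in> seg v j"
 shows "w = v | w = j"
proof (rule ccontr)
 assume n: "\<not> (w = v | w = j)"
 obtain l where l: "{w, l} \<in> E" using non_isolated[OF w(1)] by (auto simp: nbrs_def)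
 have ne: "{v, j} ~= {w, l}" using n by auto
 have "p w \<in> seg v j \<inter> seg w l" using w by simp
 then have "p w \<in> p ` ({v, j} \<inter> {w, l})" unfolding seg_inter[OF e l ne] .
 then obtain x where "p w = p x" "x \<in> {v, j} \<inter> {w, l}" by (rule imageE)
 then show False using inj[of x w] n w edgeD[OF e] by auto
qed

lemma D_eq: "D = (\<Union>d\<in>darts E. seg (fst d) (snd d))"
proof -
 have "(\<Union>e\<in>E. convex hull (p ` e)) = (\<Union>d\<in>darts E. seg (fst d) (snd d))"
 proof (intro equalityI subsetI)
  fix x assume "x \<in> (\<Union>e\<in>E. convex hull (p ` e))"
  then obtain e where e: "e \<in> E" "x \<in> convex hull (p ` e)" by blast
  obtain v j where "e = {v, j}" using edge_ex[OF e(1)] by metis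
  then show "x \<in> (\<Union>d\<in>darts E. seg (fst d) (snd d))" using e segment_2[of p v j] by (intro UN_I[of "(v, j)"]) (auto simp: mem_darts)
 next
  fix x assume "x \<in> (\<Union>d\<in>darts E. seg (fst d) (snd d))"
  then obtain v j where "{v, j} \<in> E" "x \<in> seg v j" by (auto simp: darts_def)
  then show "x \<in> (\<Union>e\<in>E. convex hull (p ` e))" using segment_2[of p v j] by (intro UN_I[of "{v, j}"]) auto
 qed
 moreover have "p ` V <= (\<Union>d\<in>darts E. seg (fst d) (snd d))"
 proof
  fix x assume "x \<in> p ` V"
  then obtain v where v: "v \<in> V" "x = p v" by blast
  then obtain j where "{v, j} \<in> E" using non_isolated[of v] by (auto simp: nbrs_def)
  then show "x \<in> (\<Union>d\<in>darts E. seg (fst d) (snd d))" using v by (intro UN_I[of "(v, j)"]) (auto simp: mem_darts)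
 qed
 ultimately show ?thesis unfolding drawing_def by blast
qed

lemma seg_sub: "{v, j} \<in> E ==> seg v j <= D"
 unfolding D_eq by (rule subsetI, rule UN_I[of "(v, j)"]) (simp_all add: mem_darts)

lemma D_cases: "x \<in> D ==> (!!v j. {v, j} \<in> E ==> x \<in> seg v j ==> thesis) ==> thesis"
 unfolding D_eq by (auto simp: darts_def)

lemma D_closed: "closed D"
 unfolding D_eq by (intro closed_UN) auto

lemma D_compact: "compact D"
 unfolding D_eq by (intro compact_UN) auto

lemma vertex_D: "v \<in> V ==> p v \<in> D"
 by (auto simp: drawing_def)

lemma Arg_field_derivative:
 assumes "{v, j} \<in> E" "q ~: D"
 shows "((%q. Ln ((p j - q) / (p v - q))) has_field_derivative (1 / (p v - q) - 1 / (p j - q))) (at q)"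
proof -
 have q: "q ~= p v" "q ~= p j" using vertex_D edgeD assms by blast+
 have "(p j - q) / (p v - q) ~: \<real>\<^sub>\<le>\<^sub>0" using quotient_nonpos q seg_sub assms by blast
 then have L: "(Ln has_field_derivative inverse ((p j - q) / (p v - q))) (at ((p j - q) / (p v - q)))"
  by (rule has_field_derivative_Ln)
 have "((%q. (p j - q) / (p v - q)) has_field_derivative ((- 1) * (p v - q) - (p j - q) * (- 1)) / ((p v - q) * (p v - q))) (at q)"
  using q by (auto intro!: derivative_eq_intros)
 from DERIV_chain2[OF L this] have D1: "((%q. Ln ((p j - q) / (p v - q))) has_field_derivative
  inverse ((p j - q) / (p v - q)) * (((- 1) * (p v - q) - (p j - q) * (- 1)) / ((p v - q) * (p v - q)))) (at q)" .
 have eq: "inverse (B / A) * (((- 1) * A - B * (- 1)) / (A * A)) = 1 / A - 1 / B" if "A ~= 0" "B ~= 0" for A B :: complex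
  using that by (simp add: field_simps)
 have "p v - q ~= 0" "p j - q ~= 0" using q by auto
 then show ?thesis using D1 unfolding eq[OF \<open>p v - q ~= 0\<close> \<open>p j - q ~= 0\<close>] by blast
qed

text \<open>The weighted sum of logarithms has as its complex derivative the pairing of \<omega>
  with the differences of \<open>1 / (p v - q)\<close>, which is zero because \<omega> is a
  flow.\<close>

lemma winding_locally_constant:
 assumes fl: "flow V E \<omega>" and S: "open S" "connected S" "S <= - D" and xy: "x \<in> S" "y \<in> S"
 shows "winding V E p \<omega> x = winding V E p \<omega> y"
proof -
 define G where "G q = (\<Sum>v\<in>V. \<Sum>j\<in>nbrs E v. of_real (\<omega> v j) * Ln ((p j - q) / (p v - q)))" for q
 have "(G has_field_derivative 0) (at q)" if "q \<in> S" for q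
 proof -
  have "(G has_field_derivative (\<Sum>v\<in>V. \<Sum>j\<in>nbrs E v. of_real (\<omega> v j) * (1 / (p v - q) - 1 / (p j - q)))) (at q)"
   unfolding G_def using that S(3)
   by (intro DERIV_sum DERIV_cmult Arg_field_derivative) (auto simp: mem_nbrs)
  moreover have "(\<Sum>v\<in>V. \<Sum>j\<in>nbrs E v. of_real (\<omega> v j) * (f v - f j)) = (0::complex)" for f
   by (rule complex_eqI; simp add: right_diff_distrib sum_subtractf flow_potential[OF fl])
  ultimately show ?thesis by metis
 qed
 then have Gxy: "G x = G y" using DERIV_zero_connected_constant[OF S(2,1) finite.emptyI, of G] xy
  by (metis DERIV_isCont Diff_empty continuous_at_imp_continuous_on)
 moreover have img: "Im (G q) = (\<Sum>v\<in>V. \<Sum>j\<in>nbrs E v. \<omega> v j * Arg ((p j - q) / (p v - q)))" if "q \<in> S" for q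
 proof -
  have "Im (Ln ((p j - q) / (p v - q))) = Arg ((p j - q) / (p v - q))" if "{v, j} \<in> E" for v j
  proof -
   have "q ~= p v" "q ~= p j" using vertex_D edgeD[OF that] \<open>q \<in> S\<close> S(3) by blast+
   then show ?thesis by (simp add: Arg_eq_Im_Ln)
  qed
  then have "(\<Sum>v\<in>V. \<Sum>j\<in>nbrs E v. \<omega> v j * Im (Ln ((p j - q) / (p v - q)))) = (\<Sum>v\<in>V. \<Sum>j\<in>nbrs E v. \<omega> v j * Arg ((p j - q) / (p v - q)))"
   by (intro sum_nbrs_cong) simp
  then show ?thesis by (simp add: G_def)
 qed
 ultimately have "(\<Sum>v\<in>V. \<Sum>j\<in>nbrs E v. \<omega> v j * Arg ((p j - x) / (p v - x))) = (\<Sum>v\<in>V. \<Sum>j\<in>nbrs E v. \<omega> v j * Arg ((p j - y) / (p v - y)))"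
  using img[OF xy(1)] img[OF xy(2)] Gxy by simp
 then show ?thesis unfolding winding_def by (rule arg_cong)
qed

lemma D_bounded: obtains R where "R > 0" "D <= ball 0 R"
 using D_compact compact_imp_bounded bounded_subset_ballD by metis

text \<open>Each angle tends to \<open>Arg 1 = 0\<close> at infinity, and a ball around
  \<open>q\<close> joins \<open>q\<close> to the connected exterior of the disc of radius
  \<open>norm q\<close>.\<close>

lemma winding_outside:
 assumes fl: "flow V E \<omega>" and R: "D <= ball 0 R" and q: "norm q >= R"
 shows "winding V E p \<omega> q = 0"
proof -
 let ?S = "- cball (0::complex) (norm q)"
 obtain R' where R': "norm q < R'" by (meson gt_ex)
 have Rq: "norm x >= R ==> x ~: D" for x using R by auto
 have qD: "q ~: D" using Rq q by blast
 obtain r where r: "r > 0" "ball q r <= - D" using D_closed qD open_contains_ball[of "- D"] by (auto simp: open_Compl)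
 have con: "connected (- cball (0::complex) s)" for s using connected_complement_bounded_convex[of "cball (0::complex) s"] by simp
 let ?U = "ball q r \<union> ?S"
 have "\<exists>x. x \<in> ball q r \<inter> ?S"
 proof (cases "q = 0")
  case True
  then show ?thesis using r(1) by (intro exI[of _ "of_real (r / 2)"]) (simp add: dist_norm)
 next
  case False
  define t where "t = r / (2 * norm q)"
  have t: "t > 0" "t * norm q = r / 2" using r(1) False by (auto simp: t_def)
  have "norm ((1 + t) *\<^sub>R q) = (1 + t) * norm q" using t(1) by simp
  then have "norm ((1 + t) *\<^sub>R q) = norm q + r / 2" using t(2) by (simp add: distrib_right)
  moreover have "dist q ((1 + t) *\<^sub>R q) = r / 2"
  proof -
   have "q - (1 + t) *\<^sub>R q = - (t *\<^sub>R q)" by (simp add: algebra_simps)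
   then show ?thesis using t by (simp add: dist_norm)
  qed
  ultimately show ?thesis using r(1) by (intro exI[of _ "(1 + t) *\<^sub>R q"]) simp
 qed
 then have cU: "connected ?U" using connected_Un[OF convex_connected[OF convex_ball[of q r]] con[of "norm q"]] by blast
 have oU: "open ?U" by auto
 have UD: "?U <= - D" using r q R by auto
 have const: "winding V E p \<omega> x = winding V E p \<omega> q" if "x \<in> ?U" for x
  using winding_locally_constant[OF fl oU cU UD that] r by simp
 have main: "((%x. Arg ((p j - x) / (p v - x))) \<longlongrightarrow> Arg 1) at_infinity" for v j
 proof -
  have inf: "filterlim (%x. p v - x) at_infinity at_infinity"
   unfolding filterlim_at_infinity[OF order_refl] eventually_at_infinity
  proof (intro allI impI)
   fix r :: real
   have "r <= norm (p v - x)" if "r + norm (p v) <= norm x" for x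
    using that norm_triangle_ineq2[of x "p v"] by (simp add: norm_minus_commute)
   then show "\<exists>b. \<forall>x. b <= norm x --> r <= norm (p v - x)" by blast
  qed
  have "((%x. 1 + (p j - p v) / (p v - x)) \<longlongrightarrow> 1 + 0) at_infinity"
   by (intro tendsto_intros tendsto_divide_0[OF tendsto_const] inf)
  moreover have "eventually (%x. 1 + (p j - p v) / (p v - x) = (p j - x) / (p v - x)) at_infinity"
   unfolding eventually_at_infinity
  proof (rule exI[of _ "norm (p v) + 1"], intro allI impI)
   fix x :: complex assume "norm (p v) + 1 <= norm x"
   then have "p v - x ~= 0" by auto
   then show "1 + (p j - p v) / (p v - x) = (p j - x) / (p v - x)" by (simp add: divide_simps)
  qed
  ultimately have "((%x. (p j - x) / (p v - x)) \<longlongrightarrow> 1) at_infinity"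
   by (simp add: tendsto_cong)
  moreover have "isCont Arg 1" by (rule continuous_at_Arg) auto
  ultimately show ?thesis
   using isCont_tendsto_compose by blast
 qed
 have "((%x. winding V E p \<omega> x) \<longlongrightarrow> (\<Sum>v\<in>V. \<Sum>j\<in>nbrs E v. \<omega> v j * Arg 1) / (4 * pi)) at_infinity"
  unfolding winding_def by (intro tendsto_divide tendsto_sum tendsto_mult tendsto_const main) simp
 then have lim0: "((%x. winding V E p \<omega> x) \<longlongrightarrow> 0) at_infinity" by simp
 have "eventually (%x. winding V E p \<omega> x = winding V E p \<omega> q) at_infinity"
  unfolding eventually_at_infinity using const R' by (intro exI[of _ R']) auto
 then have "((%x. winding V E p \<omega> x) \<longlongrightarrow> winding V E p \<omega> q) at_infinity"
  using tendsto_eventually by blast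
 then show ?thesis using lim0 tendsto_unique trivial_limit_at_infinity by blast
qed

lemma mid_side_free:
 assumes e: "{v, j} \<in> E" "{k, l} \<in> E" "{k, l} ~= {v, j}"
 shows "(p v + p j) / 2 ~: seg k l"
proof
 assume "(p v + p j) / 2 \<in> seg k l"
 moreover have "(p v + p j) / 2 \<in> seg v j"
  by (auto simp: closed_segment_def scaleR_conv_of_real field_simps intro!: exI[of _ "1/2"])
 ultimately have "(p v + p j) / 2 \<in> seg v j \<inter> seg k l" by blast
 then have "(p v + p j) / 2 \<in> p ` ({v, j} \<inter> {k, l})" unfolding seg_inter[OF e(1,2) e(3)[symmetric]] .
 then obtain x where x: "(p v + p j) / 2 = p x" "x \<in> {v, j} \<inter> {k, l}" by (rule imageE)
 then show False using edge_p[OF e(1)] by (auto simp: field_simps)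
qed

text \<open>Only the two darts of the crossed edge jump, by 2 pi and by - 2 pi; antisymmetry of
  \<omega> adds this up to 4 pi times \<open>\<omega> v j\<close>.\<close>

lemma winding_jump:
 assumes fl: "flow V E \<omega>" and e: "{v, j} \<in> E"
 defines "m \<equiv> (p v + p j) / 2" and "d \<equiv> p j - p v"
 shows "((%t. winding V E p \<omega> (m + of_real t * \<i> * d) - winding V E p \<omega> (m - of_real t * \<i> * d)) \<longlongrightarrow> \<omega> v j) (at_right 0)"
proof -
 have d0: "d ~= 0" using edge_p[OF e] by (simp add: d_def)
 let ?a = "%x y q. Arg ((p y - q) / (p x - q))"
 let ?l = "%t. m + of_real t * \<i> * d" and ?r = "%t. m - of_real t * \<i> * d"
 have lr: "(?l \<longlongrightarrow> m) (at_right 0)" "(?r \<longlongrightarrow> m) (at_right 0)"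
  by (rule tendsto_eq_intros refl tendsto_ident_at | simp)+
 have other: "((%t. ?a x y (?l t) - ?a x y (?r t)) \<longlongrightarrow> 0) (at_right 0)" if "{x, y} \<in> E" "{x, y} ~= {v, j}" for x y
 proof -
  have ns: "m ~: seg x y" using mid_side_free[OF e that] by (simp add: m_def)
  then have mx: "m ~= p x" by auto
  have "(p y - m) / (p x - m) ~: \<real>\<^sub>\<le>\<^sub>0" using quotient_nonpos mx ns by blast
  then have A: "isCont Arg ((p y - m) / (p x - m))" by (rule continuous_at_Arg)
  have "((%t. ?a x y (?l t) - ?a x y (?r t)) \<longlongrightarrow> ?a x y m - ?a x y m) (at_right 0)"
   by (intro tendsto_intros isCont_tendsto_compose[OF A] lr) (use mx in auto)
  then show ?thesis by simp
 qed
 \<comment> \<open>Seen from a point displaced from the midpoint, the quotient of the endpoints is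
   \<open>- w t\<close> or \<open>- inverse (w t)\<close>. Both tend to -1, from above and from
   below the branch cut respectively.\<close>
 define w where "w t = (1 - 2 * of_real t * \<i>) / (1 + 2 * of_real t * \<i> :: complex)" for t :: real
 have den: "1 + 2 * of_real t * \<i> ~= (0::complex)" "1 - 2 * of_real t * \<i> ~= (0::complex)" for t :: real
  by (auto simp: complex_eq_iff)
 have wIm: "Im (w t) < 0" if "t > 0" for t
  using that by (simp add: w_def Im_divide power2_eq_square divide_neg_pos add_pos_nonneg)
 have wIm': "Im (inverse (w t)) > 0" if "t > 0" for t
  using that by (simp add: w_def Im_divide power2_eq_square divide_pos_pos add_pos_nonneg)
 have ql: "(p j - ?l t) / (p v - ?l t) = - w t" "(p v - ?l t) / (p j - ?l t) = - inverse (w t)"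
  "(p j - ?r t) / (p v - ?r t) = - inverse (w t)" "(p v - ?r t) / (p j - ?r t) = - w t" for t
 proof -
  have 1: "p j - ?l t = d / 2 * (1 - 2 * of_real t * \<i>)" "p v - ?l t = - (d / 2) * (1 + 2 * of_real t * \<i>)"
   "p j - ?r t = d / 2 * (1 + 2 * of_real t * \<i>)" "p v - ?r t = - (d / 2) * (1 - 2 * of_real t * \<i>)"
   by (simp_all add: m_def d_def field_simps)
  show "(p j - ?l t) / (p v - ?l t) = - w t" "(p v - ?l t) / (p j - ?l t) = - inverse (w t)"
  "(p j - ?r t) / (p v - ?r t) = - inverse (w t)" "(p v - ?r t) / (p j - ?r t) = - w t"
   unfolding 1 using d0 den[of t] by (simp_all add: w_def)
 qed
 have w0: "w t ~= 0" for t using den by (simp add: w_def)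
 have ml: "Arg (- w t) = Arg (w t) + pi" if "t > 0" for t
  using wIm[OF that] w0[of t] Arg_minus[of "w t"] Arg_lt_pi[of "w t"] Arg_less_0[of "w t"] by (auto split: if_splits)
 have mr: "Arg (- inverse (w t)) = Arg (inverse (w t)) - pi" if "t > 0" for t
  using wIm'[OF that] w0[of t] Arg_minus[of "inverse (w t)"] Arg_less_0[of "inverse (w t)"] Arg_eq_0[of "inverse (w t)"]
  by (auto split: if_splits simp: complex_is_Real_iff)
 have wlim: "(w \<longlongrightarrow> 1) (at_right 0)"
  unfolding w_def by (rule tendsto_eq_intros refl tendsto_ident_at | simp)+
 then have wlim': "((%t. inverse (w t)) \<longlongrightarrow> 1) (at_right 0)" using tendsto_inverse[OF wlim] by simp
 have A1: "isCont Arg 1" by (rule continuous_at_Arg) auto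
 have L: "((%t. Arg (- w t)) \<longlongrightarrow> pi) (at_right 0)"
 proof -
  have "((%t. Arg (w t) + pi) \<longlongrightarrow> Arg 1 + pi) (at_right 0)" by (intro tendsto_intros isCont_tendsto_compose[OF A1] wlim)
  moreover have "eventually (%t. Arg (w t) + pi = Arg (- w t)) (at_right 0)"
   using eventually_at_right_less[of "0::real"] by eventually_elim (simp add: ml)
  ultimately show ?thesis using tendsto_cong by fastforce
 qed
 have Rr: "((%t. Arg (- inverse (w t))) \<longlongrightarrow> - pi) (at_right 0)"
 proof -
  have "((%t. Arg (inverse (w t)) - pi) \<longlongrightarrow> Arg 1 - pi) (at_right 0)" by (intro tendsto_intros isCont_tendsto_compose[OF A1] wlim')
  moreover have "eventually (%t. Arg (inverse (w t)) - pi = Arg (- inverse (w t))) (at_right 0)"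
   using eventually_at_right_less[of "0::real"] by eventually_elim (simp add: mr)
  ultimately show ?thesis using tendsto_cong by fastforce
 qed
 have vj: "v ~= j" "v \<in> V" "j \<in> V" using edgeD[OF e] by auto
 define g where "g x y = (if x = v & y = j then 2 * pi else if x = j & y = v then - 2 * pi else 0)" for x y
 have "((%t. ?a x y (?l t) - ?a x y (?r t)) \<longlongrightarrow> g x y) (at_right 0)" if "{x, y} \<in> E" for x y
 proof (cases "{x, y} = {v, j}")
  case True
  then consider "x = v" "y = j" | "x = j" "y = v" by (auto simp: doubleton_eq_iff)
  then show ?thesis
  proof cases
   case 1
   have "((%t. Arg (- w t) - Arg (- inverse (w t))) \<longlongrightarrow> pi - (- pi)) (at_right 0)" by (intro tendsto_intros L Rr)
   then show ?thesis unfolding 1 ql by (simp add: g_def)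
  next
   case 2
   have "((%t. Arg (- inverse (w t)) - Arg (- w t)) \<longlongrightarrow> - pi - pi) (at_right 0)" by (intro tendsto_intros L Rr)
   then show ?thesis unfolding 2 ql using vj by (simp add: g_def)
  qed
 next
  case False
  then have "g x y = 0" by (auto simp: g_def)
  then show ?thesis using other[OF that False] by simp
 qed
 then have "((%t. (\<Sum>x\<in>V. \<Sum>y\<in>nbrs E x. \<omega> x y * (?a x y (?l t) - ?a x y (?r t))) / (4 * pi)) \<longlongrightarrow>
   (\<Sum>x\<in>V. \<Sum>y\<in>nbrs E x. \<omega> x y * g x y) / (4 * pi)) (at_right 0)"
  by (intro tendsto_intros) (auto simp: mem_nbrs)
 moreover have "(\<Sum>x\<in>V. \<Sum>y\<in>nbrs E x. \<omega> x y * g x y) = 4 * pi * \<omega> v j"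
 proof -
  have "(\<Sum>x\<in>V. \<Sum>y\<in>nbrs E x. \<omega> x y * g x y) = (\<Sum>d\<in>darts E. \<omega> (fst d) (snd d) * g (fst d) (snd d))"
   by (rule sum_darts[symmetric])
  also have "\<dots> = (\<Sum>d\<in>{(v, j), (j, v)}. \<omega> (fst d) (snd d) * g (fst d) (snd d))"
  proof (rule sum.mono_neutral_right)
   show "{(v, j), (j, v)} <= darts E" using e by (simp add: mem_darts insert_commute)
   show "\<forall>d\<in>darts E - {(v, j), (j, v)}. \<omega> (fst d) (snd d) * g (fst d) (snd d) = 0"
   proof
    fix d assume d: "d \<in> darts E - {(v, j), (j, v)}"
    obtain x y where xy: "d = (x, y)" by (cases d)
    then have "g x y = 0" using d unfolding g_def by auto
    then show "\<omega> (fst d) (snd d) * g (fst d) (snd d) = 0" using xy by simp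
   qed
  qed simp
  also have "\<dots> = 2 * pi * \<omega> v j - 2 * pi * \<omega> j v" using vj by (simp add: g_def)
  also have "\<omega> j v = - \<omega> v j" using fl e by (simp add: flow_def)
  finally show ?thesis by simp
 qed
 ultimately show ?thesis
  by (simp add: winding_def diff_divide_distrib[symmetric] sum_subtractf[symmetric] right_diff_distrib)
qed

end

lemma tendsto_pair_unique:
 fixes f :: "complex => real"
 assumes "isCont f z" "isCont g z" "\<forall>\<^sub>F t in at_right (0::real). f (z + of_real t * n) = g (z + of_real t * n)"
 shows "f z = g z"
proof -
 have l: "((%t::real. z + of_real t * n) \<longlongrightarrow> z) (at_right 0)"
  by (rule tendsto_eq_intros refl tendsto_ident_at | simp)+
 have "((%t. f (z + of_real t * n)) \<longlongrightarrow> f z) (at_right 0)" "((%t. g (z + of_real t * n)) \<longlongrightarrow> g z) (at_right 0)"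
  using isCont_tendsto_compose[OF assms(1) l] isCont_tendsto_compose[OF assms(2) l] by auto
 moreover have "((%t. f (z + of_real t * n)) \<longlongrightarrow> g z) (at_right 0)"
  using calculation(2) tendsto_cong[OF assms(3)] by blast
 ultimately show ?thesis using tendsto_unique[OF trivial_limit_at_right_real] by blast
qed

section \<open>The lifting of a stress\<close>

context drawn
begin

text \<open>With \<open>Re\<close>, \<open>Im\<close> and \<open>cr\<close> for \<open>g\<close>
  these are the components and the moment of the edge forces; in equilibrium each of the three is a
  flow.\<close>

definition stress_flow :: "('a set => real) => (complex => complex => real) => 'a => 'a => real" where
 "stress_flow s g v j = s {v, j} * g (p j - p v) (p v)"

text \<open>The lifting of Maxwell and Cremona: a piecewise linear function whose creases along the edges are given by the stress.\<close>
definition lifting :: "('a set => real) => complex => real" where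
 "lifting s q = (\<Sum>v\<in>V. \<Sum>j\<in>nbrs E v. s {v, j} * cr (p j - p v) (q - p v) * Arg ((p j - q) / (p v - q))) / (4 * pi)"

lemma stress_flow_flow:
 assumes s: "!!v. v \<in> V ==> force E p s v = 0"
 shows "flow V E (stress_flow s (%d x. Re d))" "flow V E (stress_flow s (%d x. Im d))" "flow V E (stress_flow s cr)"
proof -
 have fs: "flow V E (stress_flow s g)" if "!!v j. g (p v - p j) (p j) = - g (p j - p v) (p v)"
  "!!v. (\<Sum>j\<in>nbrs E v. s {v, j} * g (p j - p v) (p v)) = h v (force E p s v)" "!!v. h v 0 = 0" for g and h :: "'a => complex => real"
  unfolding flow_def stress_flow_def
 proof (intro conjI allI impI ballI)
  fix v j
  have "s {j, v} * g (p v - p j) (p j) = s {v, j} * (- g (p j - p v) (p v))" using that(1)[of v j] by (simp only: insert_commute)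
  then show "s {j, v} * g (p v - p j) (p j) = - (s {v, j} * g (p j - p v) (p v))" by simp
 next
  fix v assume "v \<in> V"
  then show "(\<Sum>j\<in>nbrs E v. s {v, j} * g (p j - p v) (p v)) = 0" using that(2)[of v] that(3)[of v] s[of v] by simp
 qed
 have cs: "cr (\<Sum>j\<in>A. f j) w = (\<Sum>j\<in>A. cr (f j) w)" for f :: "'a => complex" and A w
  by (simp add: cr_def sum_subtractf sum_distrib_right)
 show "flow V E (stress_flow s (%d x. Re d))" by (rule fs[where h="%_. Re"]) (simp_all add: force_def)
 show "flow V E (stress_flow s (%d x. Im d))" by (rule fs[where h="%_. Im"]) (simp_all add: force_def)
 show "flow V E (stress_flow s cr)"
  by (rule fs[where h="%v f. cr f (p v)"]) (simp_all add: force_def cs cr_scaleR, simp_all add: cr_def algebra_simps)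
qed

text \<open>The coefficients are winding numbers, hence constant on each face, so the lifting is
  affine there.\<close>

lemma lifting_affine: "lifting s q = winding V E p (stress_flow s (%d x. Re d)) q * Im q
  - winding V E p (stress_flow s (%d x. Im d)) q * Re q - winding V E p (stress_flow s cr) q"
proof -
 have "s {v, j} * cr (p j - p v) (q - p v) * A = s {v, j} * Re (p j - p v) * A * Im q - s {v, j} * Im (p j - p v) * A * Re q
   - s {v, j} * cr (p j - p v) (p v) * A" for v j A by (simp add: cr_def algebra_simps)
 then show ?thesis
  by (simp only: lifting_def winding_def stress_flow_def sum_subtractf sum_distrib_right[symmetric] diff_divide_distrib times_divide_eq_left)
qed

text \<open>The angle can jump only where its factor, a multiple of the signed distance from the
  line of the edge, vanishes.\<close>

lemma lifting_cont: "isCont (lifting s) q0"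
proof -
 have "isCont (%q. cr (p j - p v) (q - p v) * Arg ((p j - q) / (p v - q))) q0" for v j
 proof (cases "cr (p j - p v) (q0 - p v) = 0")
  case False
  have q0: "q0 ~= p v" using False by (auto simp: cr_def)
  have "(p j - q0) / (p v - q0) ~: \<real>\<^sub>\<le>\<^sub>0"
  proof
   assume "(p j - q0) / (p v - q0) \<in> \<real>\<^sub>\<le>\<^sub>0"
   then have "q0 \<in> closed_segment (p v) (p j)" using quotient_nonpos q0 by blast
   then obtain u where "q0 = (1 - u) *\<^sub>R p v + u *\<^sub>R p j" by (auto simp: closed_segment_def)
   then have "q0 - p v = u *\<^sub>R (p j - p v)" by (simp add: algebra_simps)
   then show False using False by (simp add: cr_scaleR)
  qed
  then have A: "isCont Arg ((p j - q0) / (p v - q0))" by (rule continuous_at_Arg)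
  have "isCont (%q. Arg ((p j - q) / (p v - q))) q0"
   by (rule isCont_o2[where f="%q. (p j - q) / (p v - q)" and g=Arg]) (use q0 A in "auto intro!: continuous_intros")
  moreover have "isCont (%q. cr (p j - p v) (q - p v)) q0" unfolding cr_def by (intro isCont_diff isCont_mult continuous_const isCont_Im isCont_Re continuous_ident)
  ultimately show ?thesis by (intro continuous_intros)
 next
  case True
  have "((%q. cr (p j - p v) (q - p v)) \<longlongrightarrow> cr (p j - p v) (q0 - p v)) (at q0)" by (intro tendsto_intros)
  then have "((%q. cr (p j - p v) (q - p v) * pi) \<longlongrightarrow> 0 * pi) (at q0)" unfolding True by (intro tendsto_intros)
  then have lim: "((%q. cr (p j - p v) (q - p v) * pi) \<longlongrightarrow> 0) (at q0)" by simp
  have "((%q. cr (p j - p v) (q - p v) * Arg ((p j - q) / (p v - q))) \<longlongrightarrow> 0) (at q0)"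
  proof (rule Lim_null_comparison[OF _ tendsto_norm_zero[OF lim]])
   have "\<bar>Arg z\<bar> <= pi" for z using Arg_bounded[of z] by auto
   then show "\<forall>\<^sub>F q in at q0. norm (cr (p j - p v) (q - p v) * Arg ((p j - q) / (p v - q))) <= norm (cr (p j - p v) (q - p v) * pi)"
    by (intro always_eventually allI) (simp add: abs_mult mult_left_mono)
  qed
  then show ?thesis using True by (simp add: isCont_def)
 qed
 note C = this
 have "isCont (%q. \<Sum>v\<in>V. \<Sum>j\<in>nbrs E v. s {v, j} * (cr (p j - p v) (q - p v) * Arg ((p j - q) / (p v - q)))) q0"
  by (intro continuous_sum, rule continuous_mult[OF continuous_const C])
 then have "isCont (%q. (\<Sum>v\<in>V. \<Sum>j\<in>nbrs E v. s {v, j} * (cr (p j - p v) (q - p v) * Arg ((p j - q) / (p v - q)))) / (4 * pi)) q0"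
  by (rule isCont_divide) simp_all
 then show ?thesis by (simp add: lifting_def[abs_def] mult.assoc)
qed

text \<open>At an extreme point of the set where the lifting attains its maximum there is a half-disc on which
 the lifting is affine, which is impossible unless the maximum is zero.\<close>
lemma lifting_nonpos:
 assumes s: "!!v. v \<in> V ==> force E p s v = 0"
  and half: "!!x. \<exists>n r. n ~= 0 & r > 0 & (\<forall>y\<in>ball x r. (y - x) \<bullet> n > 0 --> y ~: D)"
 shows "lifting s q1 <= 0"
proof (rule ccontr)
 assume "\<not> lifting s q1 <= 0"
 then have q1: "lifting s q1 > 0" by simp
 note fl = stress_flow_flow[OF s]
 obtain R where R: "R > 0" "D <= ball 0 R" using D_bounded by metis
 have out: "lifting s q = 0" if "norm q >= R" for q
  using winding_outside[OF fl(1) R(2) that] winding_outside[OF fl(2) R(2) that] winding_outside[OF fl(3) R(2) that]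
  by (simp add: lifting_affine)
 have cont: "continuous_on S (lifting s)" for S using lifting_cont continuous_at_imp_continuous_on by blast
 have "norm q1 <= R" using out[of q1] q1 by (cases "norm q1 <= R") auto
 have ne: "cball (0::complex) R ~= {}" using R(1) by simp
 obtain x0 where x0: "x0 \<in> cball 0 R" "\<forall>y\<in>cball 0 R. lifting s y <= lifting s x0"
  using continuous_attains_sup[OF compact_cball ne cont] by blast
 define M where "M = lifting s x0"
 have M: "M > 0" using x0 q1 \<open>norm q1 <= R\<close> by (force simp: M_def)
 have le: "lifting s y <= M" for y using x0(2) out[of y] M by (cases "norm y <= R") (auto simp: M_def)
 define Z where "Z = {q. lifting s q = M}"
 have "closed Z" unfolding Z_def using continuous_closed_preimage_constant[OF cont closed_UNIV, of M] by simp
 moreover have "Z <= ball 0 R"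
 proof
  fix q assume "q \<in> Z"
  then show "q \<in> ball 0 R" using out[of q] M by (cases "R <= norm q") (auto simp: Z_def)
 qed
 ultimately have "compact Z" using bounded_subset[OF bounded_ball] compact_eq_bounded_closed by blast
 then have "compact (convex hull Z)" by (rule compact_convex_hull)
 moreover have "convex hull Z ~= {}" using M_def Z_def by auto
 ultimately obtain x where x: "x extreme_point_of (convex hull Z)"
  using extreme_point_exists_convex convex_convex_hull by blast
 then have xZ: "lifting s x = M" using extreme_point_of_convex_hull[OF x] by (simp add: Z_def)
 obtain n r where n: "n ~= 0" "r > 0" "\<forall>y\<in>ball x r. (y - x) \<bullet> n > 0 --> y ~: D" using half by blast
 define U where "U = ball x r \<inter> {y. n \<bullet> y > n \<bullet> x}"
 have U: "open U" "connected U" "U <= - D"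
 proof -
  show "open U" unfolding U_def by (intro open_Int open_ball open_halfspace_gt)
  show "connected U" unfolding U_def by (intro convex_connected convex_Int convex_ball convex_halfspace_gt)
  show "U <= - D"
  proof
   fix y assume "y \<in> U"
   then have "y \<in> ball x r" "(y - x) \<bullet> n > 0" by (auto simp: U_def inner_diff_left inner_diff_right inner_commute)
   then show "y \<in> - D" using n(3) by blast
  qed
 qed
 define t where "t = r / (2 * norm n)"
 have t: "t > 0" "t * norm n = r / 2" using n by (auto simp: t_def)
 define y0 where "y0 = x + of_real t * n"
 have close: "x + of_real u * (\<i> * n) + of_real e * n \<in> U" if "\<bar>u\<bar> <= t" "0 < e" "e < t" for u e
 proof -
  have "norm (of_real u * (\<i> * n) + of_real e * n) <= \<bar>u\<bar> * norm n + e * norm n"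
   using norm_triangle_ineq[of "of_real u * (\<i> * n)" "of_real e * n"] that by (simp add: norm_mult)
  also have "\<dots> < t * norm n + t * norm n" using that n by (intro add_le_less_mono mult_right_mono mult_strict_right_mono) auto
  finally have "norm (of_real u * (\<i> * n) + of_real e * n) < r" using t by simp
  moreover have "n \<bullet> (x + of_real u * (\<i> * n) + of_real e * n) = n \<bullet> x + e * (n \<bullet> n)"
   by (simp add: inner_complex_def algebra_simps)
  moreover have "dist x (x + of_real u * (\<i> * n) + of_real e * n) = norm (of_real u * (\<i> * n) + of_real e * n)"
   by (metis add.assoc add_diff_cancel_left' dist_commute dist_norm)
  moreover have "0 < e * (n \<bullet> n)" using n that by simp
  ultimately show ?thesis by (simp add: U_def)
 qed
 define w1 w2 w3 where "w1 = winding V E p (stress_flow s (%d x. Re d)) (x + of_real (t / 2) * n)"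
  and "w2 = winding V E p (stress_flow s (%d x. Im d)) (x + of_real (t / 2) * n)" and "w3 = winding V E p (stress_flow s cr) (x + of_real (t / 2) * n)"
 define L where "L q = w1 * Im q - w2 * Re q - w3" for q
 have base: "x + of_real (t / 2) * n \<in> U" using close[of 0 "t / 2"] t by simp
 have LU: "lifting s q = L q" if "q \<in> U" for q
  using winding_locally_constant[OF fl(1) U that base] winding_locally_constant[OF fl(2) U that base] winding_locally_constant[OF fl(3) U that base]
  by (simp add: lifting_affine L_def w1_def w2_def w3_def)
 have contL: "isCont L z" for z unfolding L_def[abs_def]
  by (intro isCont_diff isCont_mult continuous_const isCont_Re isCont_Im continuous_ident)
 \<comment> \<open>The bounding diameter of the half-disc may contain parts of the drawing, so the
   affine formula is carried to it by continuity.\<close>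
 have Lz: "lifting s (x + of_real u * (\<i> * n)) = L (x + of_real u * (\<i> * n))" if "\<bar>u\<bar> <= t" for u
 proof (rule tendsto_pair_unique[OF lifting_cont contL, where n=n])
  have "\<forall>\<^sub>F e in at_right (0::real). 0 < e & e < t" using t(1) eventually_at_right_real[of 0 t] by (auto elim: eventually_mono)
  then show "\<forall>\<^sub>F e in at_right 0. lifting s (x + of_real u * (\<i> * n) + of_real e * n) = L (x + of_real u * (\<i> * n) + of_real e * n)"
   by eventually_elim (use close[OF that] LU in blast)
 qed
 define a b where "a = x + of_real t * (\<i> * n)" and "b = x + of_real (- t) * (\<i> * n)"
 \<comment> \<open>\<open>x\<close> is the midpoint of \<open>a\<close> and \<open>b\<close>; as
   neither value exceeds \<open>M\<close>, both equal \<open>M\<close>, contrary to the extremality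
   of \<open>x\<close>.\<close>
 have "L a + L b = 2 * L x" by (simp add: L_def a_def b_def algebra_simps)
 moreover have "lifting s a = L a" "lifting s b = L b" "lifting s x = L x" using Lz[of t] Lz[of "-t"] Lz[of 0] t by (simp_all add: a_def b_def)
 ultimately have "lifting s a = M" "lifting s b = M" using le[of a] le[of b] xZ by linarith+
 then have "a \<in> convex hull Z" "b \<in> convex hull Z" by (auto simp: Z_def intro: hull_inc)
 moreover have "x \<in> open_segment a b"
 proof -
  have "a ~= b" using t n by (simp add: a_def b_def)
  moreover have "midpoint a b = x" by (simp add: midpoint_def a_def b_def scaleR_conv_of_real)
  ultimately show ?thesis using midpoint_in_open_segment by metis
 qed
 ultimately show False using x unfolding extreme_point_of_def by blast
qed

section \<open>Wedges along edges and sectors at vertices\<close>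

text \<open>For positive \<tau>, an open triangle standing on the left of the edge, with slope
  \<tau> at both ends, in the coordinate that makes the edge the unit interval. It represents the
  face along the whole edge.\<close>

definition wedge :: "real => 'a => 'a => complex set" where
 "wedge \<tau> v j = (%z. p v + z * (p j - p v)) ` {z. 0 < Im z & Im z < \<tau> * Re z & Im z < \<tau> * (1 - Re z)}"

lemma wedge_connected: "connected (wedge \<tau> v j)"
proof -
 have eq: "{z. 0 < Im z & Im z < \<tau> * Re z & Im z < \<tau> * (1 - Re z)} =
  {z. \<i> \<bullet> z > 0} \<inter> ({z. Complex (- \<tau>) 1 \<bullet> z < 0} \<inter> {z. Complex \<tau> 1 \<bullet> z < \<tau>})"
  by (auto simp: inner_complex_def algebra_simps)
 have "connected {z. 0 < Im z & Im z < \<tau> * Re z & Im z < \<tau> * (1 - Re z)}"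
  unfolding eq by (intro convex_connected convex_Int convex_halfspace_gt convex_halfspace_lt)
 then show ?thesis unfolding wedge_def by (intro connected_continuous_image continuous_intros)
qed

lemma wedge_mono: "\<sigma> <= \<tau> ==> wedge \<sigma> v j <= wedge \<tau> v j"
proof -
 assume le: "\<sigma> <= \<tau>"
 have "Im z < \<tau> * Re z & Im z < \<tau> * (1 - Re z)" if z: "0 < Im z" "Im z < \<sigma> * Re z" "Im z < \<sigma> * (1 - Re z)" for z
 proof -
  have "\<sigma> * Re z + \<sigma> * (1 - Re z) > 0" using z by linarith
  then have "\<sigma> > 0" by (simp add: algebra_simps)
  then have "Re z > 0" "1 - Re z > 0" using z by (meson less_trans zero_less_mult_pos)+
  then have "\<sigma> * Re z <= \<tau> * Re z" "\<sigma> * (1 - Re z) <= \<tau> * (1 - Re z)" using le by (simp_all add: mult_right_mono)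
  then show ?thesis using z by linarith
 qed
 then show ?thesis unfolding wedge_def by blast
qed

text \<open>A disjoint edge has positive distance from \<open>vj\<close>, and an edge with a common
  endpoint leaves it along a ray, which a thin enough wedge avoids.\<close>

lemma wedge_free1:
 assumes e: "{v, j} \<in> E" and f: "{k, l} \<in> E"
 shows "\<exists>\<tau>>0. wedge \<tau> v j \<inter> seg k l = {}"
proof -
 define d where "d = p j - p v"
 have d0: "d ~= 0" using edge_p[OF e] by (simp add: d_def)
 have pos: "\<tau> > 0 & 0 < Re z & Re z < 1" if "0 < Im z" "Im z < \<tau> * Re z" "Im z < \<tau> * (1 - Re z)" for z \<tau>
 proof -
  have "\<tau> * Re z + \<tau> * (1 - Re z) > 0" using that by linarith
  then have "\<tau> > 0" by (simp add: algebra_simps)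
  moreover have "0 < \<tau> * Re z" "0 < \<tau> * (1 - Re z)" using that by linarith+
  ultimately show ?thesis by (simp add: zero_less_mult_iff)
 qed
 text \<open>In the coordinate \<open>z\<close> along the edge, a ray from the origin meets the thin wedge only if its slope is small.\<close>
 have ray: "\<exists>\<tau>>0. \<forall>z c. c >= 0 --> z = of_real c * w --> 0 < Im z --> 0 < Re z --> \<not> Im z < \<tau> * Re z" for w :: complex
 proof (cases "0 < Im w & 0 < Re w")
  case True
  then show ?thesis by (intro exI[of _ "Im w / Re w"]) auto
 next
  case False
  then show ?thesis by (intro exI[of _ 1]) (auto simp: zero_less_mult_iff)
 qed
 have share: "\<exists>\<tau>>0. wedge \<tau> v j \<inter> seg v l = {}" for l
 proof -
  obtain \<tau> where \<tau>: "\<tau> > 0" "!!z c. c >= 0 ==> z = of_real c * ((p l - p v) / d) ==> 0 < Im z ==> 0 < Re z ==> \<not> Im z < \<tau> * Re z"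
   using ray[of "(p l - p v) / d"] by blast
  have False if x: "x \<in> wedge \<tau> v j" "x \<in> seg v l" for x
  proof -
   obtain z where z: "x = p v + z * d" "0 < Im z" "Im z < \<tau> * Re z" "Im z < \<tau> * (1 - Re z)" using x(1) unfolding wedge_def d_def by blast
   obtain u where u: "0 <= u" "x = (1 - u) *\<^sub>R p v + u *\<^sub>R p l" using x(2) by (auto simp: closed_segment_def)
   have "z * d = of_real u * (p l - p v)" using z(1) u(2) by (simp add: scaleR_conv_of_real algebra_simps)
   then have "z = of_real u * ((p l - p v) / d)" using d0 by (simp add: field_simps)
   then show False using \<tau>(2)[OF u(1)] z pos[OF z(2-4)] by blast
  qed
  then show ?thesis using \<tau>(1) by blast
 qed
 have share': "\<exists>\<tau>>0. wedge \<tau> v j \<inter> seg j l = {}" for l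
 proof -
  \<comment> \<open>The reflection that sends \<open>z\<close> to \<open>1 - cnj z\<close> exchanges
    the two ends of the edge and reduces to the previous case.\<close>
  let ?w = "- cnj ((p l - p j) / d)"
  obtain \<tau> where \<tau>: "\<tau> > 0" "!!z c. c >= 0 ==> z = of_real c * ?w ==> 0 < Im z ==> 0 < Re z ==> \<not> Im z < \<tau> * Re z"
   using ray[of ?w] by blast
  have False if x: "x \<in> wedge \<tau> v j" "x \<in> seg j l" for x
  proof -
   obtain z where z: "x = p v + z * d" "0 < Im z" "Im z < \<tau> * Re z" "Im z < \<tau> * (1 - Re z)" using x(1) unfolding wedge_def d_def by blast
   obtain u where u: "0 <= u" "x = (1 - u) *\<^sub>R p j + u *\<^sub>R p l" using x(2) by (auto simp: closed_segment_def)
   have "(z - 1) * d = of_real u * (p l - p j)" using z(1) u(2) by (simp add: scaleR_conv_of_real algebra_simps d_def)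
   then have "z - 1 = of_real u * ((p l - p j) / d)" using d0 by (simp add: field_simps)
   then have eq: "- cnj (z - 1) = of_real u * ?w" by (metis complex_cnj_complex_of_real complex_cnj_mult mult_minus_right)
   have ri: "Im (- cnj (z - 1)) = Im z" "Re (- cnj (z - 1)) = 1 - Re z" by simp_all
   show False using \<tau>(2)[OF u(1) eq, unfolded ri] z(2,4) pos[OF z(2-4)] by simp
  qed
  then show ?thesis using \<tau>(1) by blast
 qed
 consider "k = v" | "k = j" | "l = v" | "l = j" | "{v, j} \<inter> {k, l} = {}" by auto
 then show ?thesis
 proof cases
  case 1 then show ?thesis using share by simp
 next
  case 2 then show ?thesis using share' by simp
 next
  case 3 then show ?thesis using share[of k] by (simp add: closed_segment_commute)
 next
  case 4 then show ?thesis using share'[of k] by (simp add: closed_segment_commute)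
 next
  case 5
  then have "seg v j \<inter> seg k l = {}" using seg_inter[OF e f] by auto
  then have "\<exists>\<delta>>0. \<forall>x\<in>seg v j. \<forall>y\<in>seg k l. \<delta> <= dist x y"
   by (rule separate_compact_closed[OF compact_segment closed_segment])
  then obtain \<delta> where \<delta>: "\<delta> > 0" "!!x y. x \<in> seg v j ==> y \<in> seg k l ==> \<delta> <= dist x y"
   by blast
  have False if x: "x \<in> wedge (\<delta> / norm d) v j" "x \<in> seg k l" for x
  proof -
   obtain z where z: "x = p v + z * d" "0 < Im z" "Im z < \<delta> / norm d * Re z" "Im z < \<delta> / norm d * (1 - Re z)" using x(1) unfolding wedge_def d_def by blast
   have zr: "0 < Re z" "Re z < 1" using pos[OF z(2-4)] by auto
   have "p v + of_real (Re z) * d \<in> seg v j"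
    using zr by (auto simp: closed_segment_def d_def scaleR_conv_of_real algebra_simps intro!: exI[of _ "Re z"])
   then have "\<delta> <= dist (p v + of_real (Re z) * d) x" using \<delta>(2) that(2) by blast
   also have "\<dots> = norm ((of_real (Re z) - z) * d)" by (simp add: dist_norm z(1) algebra_simps)
   also have "of_real (Re z) - z = - (\<i> * of_real (Im z))" by (simp add: complex_eq_iff)
   finally have "\<delta> <= Im z * norm d" using z by (simp add: norm_mult)
   moreover have "Im z * norm d < \<delta> / norm d * Re z * norm d" using z(3) d0 by (intro mult_strict_right_mono) auto
   moreover have "\<delta> / norm d * Re z * norm d <= \<delta>" using d0 zr \<delta>(1) by (simp add: mult_left_le)
   ultimately show False by linarith
  qed
  then show ?thesis using \<delta>(1) d0 by (intro exI[of _ "\<delta> / norm d"]) auto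
 qed
qed

lemma wedge_free: "\<exists>\<tau>>0. \<forall>v j. {v, j} \<in> E --> wedge \<tau> v j \<inter> D = {}"
proof -
 have fin: "finite (darts E \<times> darts E)" by simp
 have "\<forall>x\<in>darts E \<times> darts E. \<exists>\<tau>>0. wedge \<tau> (fst (fst x)) (snd (fst x)) \<inter> seg (fst (snd x)) (snd (snd x)) = {}"
  using wedge_free1 by (auto simp: darts_def)
 then obtain t where t: "\<forall>x\<in>darts E \<times> darts E. t x > 0 & wedge (t x) (fst (fst x)) (snd (fst x)) \<inter> seg (fst (snd x)) (snd (snd x)) = {}"
  using bchoice[of "darts E \<times> darts E"] by metis
 define \<tau> where "\<tau> = Min (insert 1 (t ` (darts E \<times> darts E)))"
 have "\<tau> > 0" unfolding \<tau>_def using t by (subst Min_gr_iff) auto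
 moreover have "wedge \<tau> v j \<inter> D = {}" if "{v, j} \<in> E" for v j
 proof (rule ccontr)
  assume "wedge \<tau> v j \<inter> D ~= {}"
  then obtain x where x: "x \<in> wedge \<tau> v j" "x \<in> D" by blast
  obtain k l where kl: "{k, l} \<in> E" "x \<in> seg k l" using x(2) by (rule D_cases)
  have m: "((v, j), (k, l)) \<in> darts E \<times> darts E" using that kl by (simp add: mem_darts)
  then have "\<tau> <= t ((v, j), (k, l))" unfolding \<tau>_def by (intro Min_le) auto
  then show False using wedge_mono[of \<tau> "t ((v, j), (k, l))" v j] x kl bspec[OF t m] by auto
 qed
 ultimately show ?thesis by blast
qed

definition "\<tau>0 = (SOME \<tau>. \<tau> > 0 & (\<forall>v j. {v, j} \<in> E --> wedge \<tau> v j \<inter> D = {}))"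

lemma \<tau>0: "\<tau>0 > 0" "{v, j} \<in> E ==> wedge \<tau>0 v j \<inter> D = {}"
 using someI_ex[OF wedge_free] unfolding \<tau>0_def by blast+

definition base :: "'a => 'a => complex" where
 "base v j = p v + Complex (1 / 2) (\<tau>0 / 4) * (p j - p v)"

text \<open>The face to the left of a dart, anchored at a point of its wedge.\<close>

definition left :: "'a => 'a => complex set" where
 "left v j = connected_component_set (- D) (base v j)"

lemma base_wedge: "base v j \<in> wedge \<tau>0 v j"
 unfolding base_def wedge_def using \<tau>0(1) by (intro image_eqI[OF refl]) auto

lemma base_D: "{v, j} \<in> E ==> base v j ~: D"
 using base_wedge \<tau>0(2) by blast

lemma wedge_left: "{v, j} \<in> E ==> wedge \<tau>0 v j <= left v j"
 unfolding left_def using \<tau>0(2) base_wedge wedge_connected by (intro connected_component_maximal) blast+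

lemma left_component: "{v, j} \<in> E ==> left v j \<in> components (- D)"
 unfolding left_def using base_D by (intro componentsI) simp

lemma left_open: "open (left v j)" and left_connected: "connected (left v j)" and left_sub: "left v j <= - D"
 unfolding left_def using D_closed by (auto intro: open_connected_component simp: open_Compl connected_component_subset)

lemma base_left: "{v, j} \<in> E ==> base v j \<in> left v j"
 using base_wedge wedge_left by blast

lemma left_eqI: "{v, j} \<in> E ==> {k, l} \<in> E ==> x \<in> left v j ==> x \<in> left k l ==> left v j = left k l"
 using left_component components_nonoverlap by (metis disjoint_iff)

lemma winding_left:
 assumes "flow V E \<omega>" "{v, j} \<in> E" "x \<in> left v j" "y \<in> left v j"
 shows "winding V E p \<omega> x = winding V E p \<omega> y"
 by (rule winding_locally_constant[OF assms(1) left_open left_connected left_sub assms(3,4)])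

lemma mid_wedge:
 assumes "0 < t" "t < \<tau>0 / 2"
 shows "(p v + p j) / 2 + of_real t * \<i> * (p j - p v) \<in> wedge \<tau>0 v j" "(p v + p j) / 2 - of_real t * \<i> * (p j - p v) \<in> wedge \<tau>0 j v"
proof -
 have "(p v + p j) / 2 + of_real t * \<i> * (p j - p v) = p v + Complex (1 / 2) t * (p j - p v)"
  "(p v + p j) / 2 - of_real t * \<i> * (p j - p v) = p j + Complex (1 / 2) t * (p v - p j)"
  by (simp_all add: complex_eq_iff field_simps)
 then show "(p v + p j) / 2 + of_real t * \<i> * (p j - p v) \<in> wedge \<tau>0 v j" "(p v + p j) / 2 - of_real t * \<i> * (p j - p v) \<in> wedge \<tau>0 j v"
  unfolding wedge_def using assms by auto
qed

lemma winding_left_jump: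
 assumes fl: "flow V E \<omega>" and e: "{v, j} \<in> E"
 shows "\<omega> v j = winding V E p \<omega> (base v j) - winding V E p \<omega> (base j v)"
proof -
 have e': "{j, v} \<in> E" using e by (simp add: insert_commute)
 have "\<forall>\<^sub>F t in at_right (0::real). 0 < t & t < \<tau>0 / 2" using \<tau>0(1) eventually_at_right_real[of 0 "\<tau>0 / 2"] by (auto elim: eventually_mono)
 then have "\<forall>\<^sub>F t in at_right 0. winding V E p \<omega> ((p v + p j) / 2 + of_real t * \<i> * (p j - p v)) - winding V E p \<omega> ((p v + p j) / 2 - of_real t * \<i> * (p j - p v))
  = winding V E p \<omega> (base v j) - winding V E p \<omega> (base j v)"
 proof eventually_elim
  case (elim t)
  then show ?case
   using winding_left[OF fl e _ base_left[OF e]] winding_left[OF fl e' _ base_left[OF e']] mid_wedge[of t v j] wedge_left[OF e] wedge_left[OF e']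
   by (metis subsetD)
 qed
 then have "((%t. winding V E p \<omega> ((p v + p j) / 2 + of_real t * \<i> * (p j - p v)) - winding V E p \<omega> ((p v + p j) / 2 - of_real t * \<i> * (p j - p v)))
  \<longlongrightarrow> winding V E p \<omega> (base v j) - winding V E p \<omega> (base j v)) (at_right 0)" by (rule tendsto_eventually)
 then show ?thesis using winding_jump[OF fl e] tendsto_unique[OF trivial_limit_at_right_real] by blast
qed

text \<open>The maximum argument for \<open>s\<close> and for its negative makes the lifting vanish.
  Then the linear coefficients vanish on every face next to an edge, and their jumps across the edge
  are the stress times the edge vector.\<close>

lemma stress_free_half_discs:
 assumes half: "!!x. \<exists>n r. n ~= 0 & r > 0 & (\<forall>y\<in>ball x r. (y - x) \<bullet> n > 0 --> y ~: D)"
 shows "stress_free V E p"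
 unfolding stress_free_def
proof (intro allI impI ballI)
 fix s e assume s0: "\<forall>v\<in>V. force E p s v = 0" and e: "e \<in> E"
 have s: "force E p s v = 0" if "v \<in> V" for v using s0 that by blast
 have s': "force E p (%e. - s e) v = 0" if "v \<in> V" for v using s[OF that] by (simp add: force_def sum_negf)
 have "lifting (%e. - s e) q = - lifting s q" for q by (simp add: lifting_def sum_negf)
 then have L0: "lifting s q = 0" for q
  using lifting_nonpos[OF s half, of q] lifting_nonpos[OF s' half, of q] by simp
 note fl = stress_flow_flow[OF s]
 have w0: "winding V E p (stress_flow s (%d x. Re d)) (base v j) = 0 & winding V E p (stress_flow s (%d x. Im d)) (base v j) = 0"
  if vj: "{v, j} \<in> E" for v j
 proof -
  define b where "b = base v j"
  obtain r where r: "r > 0" "ball b r <= left v j" using left_open base_left[OF vj] open_contains_ball b_def by metis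
  define h where "h = r / 2"
  have in_l: "b \<in> left v j" "b + of_real h \<in> left v j" "b + of_real h * \<i> \<in> left v j"
   using r by (auto simp: h_def dist_norm norm_mult intro!: subsetD[OF r(2)])
  let ?w = "%g. winding V E p (stress_flow s g) b"
  have "?w (%d x. Re d) * Im q - ?w (%d x. Im d) * Re q - ?w cr = 0" if "q \<in> left v j" for q
   using L0[of q] winding_left[OF fl(1) vj that in_l(1)] winding_left[OF fl(2) vj that in_l(1)] winding_left[OF fl(3) vj that in_l(1)]
   by (simp add: lifting_affine)
  from this[OF in_l(1)] this[OF in_l(2)] this[OF in_l(3)] have "?w (%d x. Re d) * h = 0" "?w (%d x. Im d) * h = 0"
   by (simp_all add: algebra_simps)
  then show ?thesis using r(1) by (simp add: h_def b_def)
 qed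
 obtain v j where vj: "e = {v, j}" "{v, j} \<in> E" using edge_ex[OF e] e by metis
 have "{j, v} \<in> E" using vj by (simp add: insert_commute)
 then have "stress_flow s (%d x. Re d) v j = 0" "stress_flow s (%d x. Im d) v j = 0"
  using winding_left_jump[OF fl(1) vj(2)] winding_left_jump[OF fl(2) vj(2)] w0[OF vj(2)] w0[of j v] by simp_all
 then have "s e = 0 | p j - p v = 0" by (auto simp: stress_flow_def vj(1) complex_eq_iff)
 then show "s e = 0" using edge_p[OF vj(2)] by auto
qed

lemma near_point: "\<exists>r>0. \<forall>v j. {v, j} \<in> E --> x ~: seg v j --> ball x r \<inter> seg v j = {}"
proof -
 let ?S = "\<Union>d\<in>{d \<in> darts E. x ~: seg (fst d) (snd d)}. seg (fst d) (snd d)"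
 have "closed ?S" by (intro closed_UN) auto
 moreover have "x ~: ?S" by auto
 ultimately have "open (- ?S)" "x \<in> - ?S" by (simp_all only: open_Compl Compl_iff not_False_eq_True)
 then obtain r where "r > 0" "ball x r <= - ?S" by (rule openE)
 then show ?thesis by (intro exI[of _ r]) (auto simp: darts_def)
qed

lemma seg_points: "x \<in> seg v j ==> \<exists>c. 0 <= c & c <= 1 & x = p v + of_real c * (p j - p v)"
 by (auto simp: closed_segment_def scaleR_conv_of_real algebra_simps)

text \<open>At a vertex the half-disc opposite to its edges is free, in the interior of an edge one
  side of the edge, and elsewhere a whole disc.\<close>

lemma half_disc:
 assumes pt: "!!v. v \<in> V ==> ptd E p v"
 shows "\<exists>n r. n ~= 0 & r > 0 & (\<forall>y\<in>ball x r. (y - x) \<bullet> n > 0 --> y ~: D)"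
proof -
 obtain r where r: "r > 0" "!!v j. {v, j} \<in> E ==> x ~: seg v j ==> ball x r \<inter> seg v j = {}" using near_point by blast
 have "\<exists>n. n ~= 0 & (\<forall>v j y. {v, j} \<in> E --> x \<in> seg v j --> y \<in> seg v j --> (y - x) \<bullet> n <= 0)"
 proof (cases "x \<in> p ` V")
  case True
  then obtain w where w: "w \<in> V" "x = p w" by blast
  obtain n where n: "!!j. j \<in> nbrs E w ==> (p j - p w) \<bullet> n > 0" using pt[OF w(1)] unfolding ptd_def by blast
  have "(y - x) \<bullet> (- n) <= 0" if e: "{v, j} \<in> E" "x \<in> seg v j" "y \<in> seg v j" for v j y
  proof -
   have wv: "w = v | w = j" using vertex_on_seg[OF e(1) w(1)] e(2) w(2) by simp
   have main: "(y - x) \<bullet> (- n) <= 0" if m: "{w, j} \<in> E" "y \<in> seg w j" for j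
   proof -
    obtain c where c: "0 <= c" "y = p w + of_real c * (p j - p w)" using seg_points[OF m(2)] by blast
    have "(y - x) \<bullet> (- n) = - (c * ((p j - p w) \<bullet> n))" using c(2) w(2) by (simp add: scaleR_conv_of_real[symmetric])
    then show ?thesis using n[of j] that(1) c(1) by (simp add: mem_nbrs)
   qed
   show ?thesis using wv main[of j] main[of v] e by (auto simp: insert_commute closed_segment_commute)
  qed
  moreover have "n ~= 0" using n non_isolated[OF w(1)] by fastforce
  ultimately show ?thesis by (intro exI[of _ "- n"]) simp
 next
  case False
  show ?thesis
  proof (cases "x \<in> D")
   case True
   obtain v j where e: "{v, j} \<in> E" "x \<in> seg v j" using True by (rule D_cases)
   have uniq: "{k, l} = {v, j}" if "{k, l} \<in> E" "x \<in> seg k l" for k l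
   proof (rule ccontr)
    assume ne: "{k, l} ~= {v, j}"
    have "x \<in> seg k l \<inter> seg v j" using that e by blast
    then have "x \<in> p ` ({k, l} \<inter> {v, j})" unfolding seg_inter[OF that(1) e(1) ne] .
    then show False using False edgeD[OF e(1)] by auto
   qed
   let ?n = "\<i> * (p j - p v)"
   have "(y - x) \<bullet> ?n <= 0" if m: "y \<in> seg v j" for y
   proof -
    obtain c where c: "y = p v + of_real c * (p j - p v)" using seg_points[OF m] by blast
    obtain b where b: "x = p v + of_real b * (p j - p v)" using seg_points[OF e(2)] by blast
    have "y - x = of_real (c - b) * (p j - p v)" by (simp only: b c) (simp add: algebra_simps)
    moreover have "(of_real t * d) \<bullet> (\<i> * d) = 0" for t and d :: complex by (simp add: inner_complex_def algebra_simps)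
    ultimately show ?thesis by (simp del: of_real_diff)
   qed
   then have "(y - x) \<bullet> ?n <= 0" if "{k, l} \<in> E" "x \<in> seg k l" "y \<in> seg k l" for k l y
    using uniq[OF that(1,2)] that(3) by (auto simp: doubleton_eq_iff closed_segment_commute)
   moreover have "?n ~= 0" using edge_p[OF e(1)] by simp
   ultimately show ?thesis by blast
  next
   case F: False
   then have "x ~: seg v j" if "{v, j} \<in> E" for v j using seg_sub[OF that] by blast
   then show ?thesis by (intro exI[of _ 1]) auto
  qed
 qed
 then obtain n where n: "n ~= 0" "!!v j y. {v, j} \<in> E ==> x \<in> seg v j ==> y \<in> seg v j ==> (y - x) \<bullet> n <= 0" by blast
 have "y ~: D" if y: "y \<in> ball x r" "(y - x) \<bullet> n > 0" for y
 proof
  assume "y \<in> D"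
  then obtain v j where vj: "{v, j} \<in> E" "y \<in> seg v j" by (rule D_cases)
  then show False using r(2)[OF vj(1)] n(2)[OF vj(1) _ vj(2)] y by (cases "x \<in> seg v j") auto
 qed
 then show ?thesis using n(1) r(1) by blast
qed

lemma pointed_stress_free: "(!!v. v \<in> V ==> ptd E p v) ==> stress_free V E p"
 by (rule stress_free_half_discs) (rule half_disc)

end

section \<open>Angles and faces of a drawing\<close>

lemma ccw_polar:
 assumes "u ~= 0" "w ~= 0"
 shows "0 < ccw_angle u w" "ccw_angle u w <= 2 * pi" "w = of_real (norm w / norm u) * cis (ccw_angle u w) * u"
proof -
 have A: "0 <= Arg2pi (w / u)" "Arg2pi (w / u) < 2 * pi" using Arg2pi[of "w / u"] by blast+
 show "0 < ccw_angle u w" "ccw_angle u w <= 2 * pi" using A by (simp_all add: ccw_angle_def)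
 have "cis (2 * pi) = 1" by (simp add: complex_eq_iff)
 then have c: "cis (ccw_angle u w) = cis (Arg2pi (w / u))" by (simp add: ccw_angle_def)
 have "w / u = of_real (norm (w / u)) * cis (Arg2pi (w / u))" using Arg2pi_eq[of "w / u"] unfolding cis_conv_exp .
 then have "w / u = of_real (norm w / norm u) * cis (ccw_angle u w)" by (simp only: c norm_divide)
 then show "w = of_real (norm w / norm u) * cis (ccw_angle u w) * u" by (simp only: nonzero_divide_eq_eq[OF assms(1)])
qed

lemma ccw_unique:
 assumes "u ~= 0" "0 < c" "0 < \<theta>" "\<theta> <= 2 * pi"
 shows "ccw_angle u (of_real c * cis \<theta> * u) = \<theta>"
proof (cases "\<theta> = 2 * pi")
 case True
 have "cis (2 * pi) = 1" by (simp add: complex_eq_iff)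
 then show ?thesis using assms True by (simp add: ccw_angle_def Arg2pi_of_real)
next
 case False
 have "Arg2pi (of_real c * cis \<theta>) = \<theta>"
  by (rule Arg2pi_unique[of c]) (use assms False in "auto simp: cis_conv_exp")
 then show ?thesis using assms by (simp add: ccw_angle_def)
qed

lemma ccw_swap:
 assumes "u ~= 0" "w ~= 0" "ccw_angle u w < 2 * pi"
 shows "ccw_angle w u = 2 * pi - ccw_angle u w"
proof -
 let ?t = "ccw_angle u w"
 note P = ccw_polar[OF assms(1,2)]
 have "cis (2 * pi - ?t) * cis ?t = 1" by (simp add: cis_mult complex_eq_iff)
 moreover have "of_real (norm u / norm w) * of_real (norm w / norm u) = (1 :: complex)" using assms by simp
 ultimately have "of_real (norm u / norm w) * cis (2 * pi - ?t) * (of_real (norm w / norm u) * cis ?t * u) = u"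
  by (metis mult.assoc mult.left_commute mult_1)
 then have "of_real (norm u / norm w) * cis (2 * pi - ?t) * w = u" using P(3) by metis
 then show ?thesis using ccw_unique[of w "norm u / norm w" "2 * pi - ?t"] assms P by simp
qed

lemma inner_cis: "(of_real c * cis \<theta> * d) \<bullet> (cis \<phi> * d) = c * (norm d)\<^sup>2 * cos (\<theta> - \<phi>)"
 by (simp add: power2_norm_eq_inner inner_complex_def cos_diff algebra_simps)

text \<open>Polar coordinates of a point lying both in a small sector and in a wedge along one of
  its sides; this links sectors with wedges.\<close>

lemma small_polar:
 fixes r a t :: real
 assumes "0 < r" "0 < a" "0 < t"
 shows "\<exists>\<theta> \<rho>. 0 < \<theta> & \<theta> < a & 0 < \<rho> & \<rho> < r & 0 < \<rho> * sin \<theta> & \<rho> * sin \<theta> < t * (\<rho> * cos \<theta>) & \<rho> * sin \<theta> < t * (1 - \<rho> * cos \<theta>)"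
proof -
 have "((%\<theta>. sin \<theta> - t * cos \<theta>) \<longlongrightarrow> sin 0 - t * cos 0) (at_right 0)" by (intro tendsto_intros)
 then have "\<forall>\<^sub>F \<theta> in at_right 0. sin \<theta> - t * cos \<theta> < 0" by (rule order_tendstoD) (use assms in simp)
 moreover have "\<forall>\<^sub>F \<theta> in at_right (0::real). 0 < \<theta> & \<theta> < min a pi"
  using eventually_at_right_real[of 0 "min a pi"] assms by (auto elim: eventually_mono)
 ultimately have "\<forall>\<^sub>F \<theta> in at_right (0::real). sin \<theta> - t * cos \<theta> < 0 & 0 < \<theta> & \<theta> < min a pi" by eventually_elim simp
 then obtain \<theta> where th: "sin \<theta> - t * cos \<theta> < 0" "0 < \<theta>" "\<theta> < min a pi"
  using eventually_happens'[OF trivial_limit_at_right_real] by blast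
 have "((%\<rho>. \<rho> * sin \<theta> - t * (1 - \<rho> * cos \<theta>)) \<longlongrightarrow> 0 * sin \<theta> - t * (1 - 0 * cos \<theta>)) (at_right 0)" by (intro tendsto_intros)
 then have "\<forall>\<^sub>F \<rho> in at_right 0. \<rho> * sin \<theta> - t * (1 - \<rho> * cos \<theta>) < 0" by (rule order_tendstoD) (use assms in simp)
 moreover have "\<forall>\<^sub>F \<rho> in at_right (0::real). 0 < \<rho> & \<rho> < r"
  using eventually_at_right_real[of 0 r] assms by (auto elim: eventually_mono)
 ultimately have "\<forall>\<^sub>F \<rho> in at_right (0::real). \<rho> * sin \<theta> - t * (1 - \<rho> * cos \<theta>) < 0 & 0 < \<rho> & \<rho> < r" by eventually_elim simp
 then obtain \<rho> where rh: "\<rho> * sin \<theta> - t * (1 - \<rho> * cos \<theta>) < 0" "0 < \<rho>" "\<rho> < r"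
  using eventually_happens'[OF trivial_limit_at_right_real] by blast
 have "0 < sin \<theta>" using th by (intro sin_gt_zero) auto
 moreover have "\<rho> * sin \<theta> < \<rho> * (t * cos \<theta>)" using th(1) rh(2) by simp
 ultimately show ?thesis using th rh by (intro exI[of _ \<theta>] exI[of _ \<rho>]) (simp add: mult_ac)
qed

context drawn
begin

lemma dir0: "{v, j} \<in> E ==> p j - p v ~= 0"
 using edge_p by fastforce

lemma same_dir:
 assumes e: "{v, j} \<in> E" "{v, k} \<in> E" and c: "0 < c" "p k - p v = of_real c * (p j - p v)"
 shows "k = j"
proof -
 have on: "k = j" if e: "{v, j} \<in> E" "{v, k} \<in> E" and c: "0 < c" "c <= 1" "p k - p v = of_real c * (p j - p v)" for j k c
 proof -
  have "p k = (1 - c) *\<^sub>R p v + c *\<^sub>R p j" using c(3) by (simp add: scaleR_conv_of_real algebra_simps)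
  then have "p k \<in> seg v j" using c(1,2) by (auto simp: closed_segment_def)
  then show ?thesis using vertex_on_seg[OF e(1), of k] edgeD[OF e(2)] by blast
 qed
 show ?thesis
 proof (cases "c <= 1")
  case True then show ?thesis using on[OF e c(1) _ c(2)] by blast
 next
  case False
  then have "p j - p v = of_real (1 / c) * (p k - p v)" using c by simp
  then show ?thesis using on[OF e(2,1), of "1 / c"] False by simp
 qed
qed

definition dang :: "'a => 'a => real" where
 "dang v j = Arg2pi (p j - p v) / (2 * pi)"

lemma rsys_dang: "rsys V E dang"
proof unfold_locales
 show "inj_on (dang v) (nbrs E v)" for v
 proof (rule inj_onI)
  fix j k assume jk: "j \<in> nbrs E v" "k \<in> nbrs E v" "dang v j = dang v k"
  then have e: "{v, j} \<in> E" "{v, k} \<in> E" by (simp_all add: mem_nbrs)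
  have "Arg2pi (p j - p v) = Arg2pi (p k - p v)" using jk(3) by (simp add: dang_def)
  then obtain c where "0 < c" "p j - p v = of_real c * (p k - p v)" using Arg2pi_eq_iff[OF dir0[OF e(1)] dir0[OF e(2)]] by blast
  then show "j = k" by (rule same_dir[OF e(2,1)])
 qed
 show "0 <= dang v j & dang v j < 1" for v j
  using Arg2pi[of "p j - p v"] by (simp add: dang_def)
qed

sublocale rs: rsys V E dang by (rule rsys_dang)

lemma ccw_cd:
 assumes e: "{v, j} \<in> E" "{v, k} \<in> E"
 shows "ccw_angle (p j - p v) (p k - p v) = 2 * pi * cd (dang v j) (dang v k)"
proof -
 define u w where "u = p j - p v" and "w = p k - p v"
 define a b where "a = Arg2pi u" and "b = Arg2pi w"
 have uw: "u ~= 0" "w ~= 0" using dir0 e by (auto simp: u_def w_def)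
 have ab: "0 <= a" "a < 2 * pi" "0 <= b" "b < 2 * pi" using Arg2pi by (auto simp: a_def b_def)
 define \<theta> where "\<theta> = (if a < b then b - a else b - a + 2 * pi)"
 have "cis \<theta> * cis a = cis b" by (simp add: \<theta>_def cis_mult complex_eq_iff)
 moreover have "of_real (norm w / norm u) * of_real (norm u) = (of_real (norm w) :: complex)" using uw by simp
 moreover have pu: "u = of_real (norm u) * cis a" and pw: "w = of_real (norm w) * cis b"
  using Arg2pi_eq[of u] Arg2pi_eq[of w] by (simp_all add: cis_conv_exp a_def b_def)
 ultimately have "of_real (norm w / norm u) * cis \<theta> * (of_real (norm u) * cis a) = w"
  by (metis mult.assoc mult.left_commute)
 then have "of_real (norm w / norm u) * cis \<theta> * u = w" using pu by metis
 then have "ccw_angle u w = \<theta>" using ccw_unique[of u "norm w / norm u" \<theta>] uw ab by (simp add: \<theta>_def split: if_splits)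
 moreover have "2 * pi * cd (dang v j) (dang v k) = \<theta>"
  by (simp add: cd_def dang_def u_def[symmetric] w_def[symmetric] a_def[symmetric] b_def[symmetric] \<theta>_def divide_less_cancel field_simps)
 ultimately show ?thesis by (simp add: u_def w_def)
qed

text \<open>The angle of the sector that the dart \<open>(v, j)\<close> stands for.\<close>

definition alpha :: "'a => 'a => real" where
 "alpha v j = ccw_angle (p j - p v) (p (rs.nx v j) - p v)"

lemma alpha_bounds: "{v, j} \<in> E ==> 0 < alpha v j & alpha v j <= 2 * pi"
 unfolding alpha_def using ccw_polar[OF dir0 dir0[OF rs.nx_edge]] by blast

lemma alpha_le: "{v, j} \<in> E ==> {v, l} \<in> E ==> alpha v j <= ccw_angle (p j - p v) (p l - p v)"
 unfolding alpha_def using rs.cyc.nxt_le[of l v j] ccw_cd[of v j] rs.nx_edge[of v j] by (simp add: mem_nbrs)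

lemma consecutive_iff: "consecutive_at E p v j k \<longleftrightarrow> {v, j} \<in> E & k = rs.nx v j"
proof
 assume c: "consecutive_at E p v j k"
 then have e: "{v, j} \<in> E" "{v, k} \<in> E" by (simp_all add: consecutive_at_def)
 have "rs.nx v j = k"
 proof (rule rs.cyc.nxt_eqI)
  fix l assume "l \<in> nbrs E v"
  then have l: "{v, l} \<in> E" by (simp add: mem_nbrs)
  then have "ccw_angle (p j - p v) (p k - p v) <= ccw_angle (p j - p v) (p l - p v)" using c by (simp add: consecutive_at_def)
  then show "cd (dang v j) (dang v k) <= cd (dang v j) (dang v l)" using ccw_cd e l by simp
 qed (use e in "auto simp: mem_nbrs")
 then show "{v, j} \<in> E & k = rs.nx v j" using e by simp
next
 assume "{v, j} \<in> E & k = rs.nx v j"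
 then show "consecutive_at E p v j k"
  unfolding consecutive_at_def using rs.nx_edge alpha_le unfolding alpha_def by blast
qed

lemma pointed_iff: "pointed_at E p v \<longleftrightarrow> (\<exists>j. {v, j} \<in> E & alpha v j > pi)"
 unfolding pointed_at_def consecutive_iff alpha_def by blast

lemma near_vertex:
 assumes v: "v \<in> V"
 shows "\<exists>r>0. \<forall>y\<in>ball (p v) r \<inter> D. y ~= p v --> (\<exists>l c. {v, l} \<in> E & 0 < c & y = p v + of_real c * (p l - p v))"
proof -
 obtain r where r: "r > 0" "!!k l. {k, l} \<in> E ==> p v ~: seg k l ==> ball (p v) r \<inter> seg k l = {}" using near_point[of "p v"] by blast
 have "\<exists>l c. {v, l} \<in> E & 0 < c & y = p v + of_real c * (p l - p v)" if y: "y \<in> ball (p v) r \<inter> D" "y ~= p v" for y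
 proof -
  obtain k l where kl: "{k, l} \<in> E" "y \<in> seg k l" using y(1) by (auto elim: D_cases)
  have "p v \<in> seg k l" using r(2)[OF kl(1)] kl(2) y(1) by blast
  then have "v = k | v = l" using vertex_on_seg[OF kl(1) v] by blast
  then obtain m where m: "{v, m} \<in> E" "y \<in> seg v m" using kl by (auto simp: insert_commute closed_segment_commute)
  obtain c where c: "0 <= c" "y = p v + of_real c * (p m - p v)" using seg_points[OF m(2)] by blast
  have "c ~= 0" using c y(2) by auto
  then show ?thesis using m c by (intro exI[of _ m] exI[of _ c]) simp
 qed
 then show ?thesis using r(1) by blast
qed

abbreviation pol :: "'a => 'a => real => real => complex" where
 "pol v j \<rho> \<theta> \<equiv> p v + of_real \<rho> * cis \<theta> * (p j - p v)"

lemma sector_free: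
 assumes e: "{v, j} \<in> E"
 shows "\<exists>r>0. \<forall>\<rho> \<theta>. 0 < \<rho> --> \<rho> < r --> 0 < \<theta> --> \<theta> < alpha v j --> pol v j \<rho> \<theta> ~: D"
proof -
 have v: "v \<in> V" using edgeD[OF e] by blast
 obtain r0 where r0: "r0 > 0" "!!y. y \<in> ball (p v) r0 \<inter> D ==> y ~= p v ==> \<exists>l c. {v, l} \<in> E & 0 < c & y = p v + of_real c * (p l - p v)"
  using near_vertex[OF v] by blast
 let ?d = "p j - p v"
 note d0 = dir0[OF e]
 have "pol v j \<rho> \<theta> ~: D" if h: "0 < \<rho>" "\<rho> < r0 / norm ?d" "0 < \<theta>" "\<theta> < alpha v j" for \<rho> \<theta>
 proof
  assume D: "pol v j \<rho> \<theta> \<in> D"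
  have "dist (p v) (pol v j \<rho> \<theta>) = \<rho> * norm ?d" using h(1) by (simp add: dist_norm norm_mult)
  also have "\<dots> < r0" using h(2) d0 by (simp add: pos_less_divide_eq)
  finally have b: "pol v j \<rho> \<theta> \<in> ball (p v) r0 \<inter> D" using D by simp
  have "pol v j \<rho> \<theta> ~= p v" using h(1) d0 by simp
  then obtain l c where l: "{v, l} \<in> E" "0 < c" "pol v j \<rho> \<theta> = p v + of_real c * (p l - p v)" using r0(2)[OF b] by blast
  then have "of_real \<rho> * cis \<theta> * ?d = of_real c * (p l - p v)" by simp
  then have "p l - p v = of_real (\<rho> / c) * cis \<theta> * ?d" using l(2) by (simp add: field_simps)
  then have "ccw_angle ?d (p l - p v) = \<theta>" using ccw_unique[OF d0, of "\<rho> / c" \<theta>] h l(2) alpha_bounds[OF e] by simp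
  then show False using alpha_le[OF e l(1)] h(4) by simp
 qed
 then show ?thesis using r0(1) d0 by (intro exI[of _ "r0 / norm ?d"]) simp
qed

text \<open>A small sector at \<open>v\<close> is connected and free of the drawing, and it meets
  both the wedge of \<open>(v, j)\<close> and that of the next dart of the orbit. So the orbits of
  the face permutation run along faces of the drawing.\<close>

lemma sector_left_nx:
 assumes e: "{v, j} \<in> E"
 shows "(\<exists>r>0. \<forall>\<rho> \<theta>. 0 < \<rho> --> \<rho> < r --> 0 < \<theta> --> \<theta> < alpha v j --> pol v j \<rho> \<theta> \<in> left v j) & left (rs.nx v j) v = left v j"
proof -
 let ?d = "p j - p v"
 let ?k = "rs.nx v j"
 note d0 = dir0[OF e]
 have ek: "{v, ?k} \<in> E" using rs.nx_edge[OF e] .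
 have ke: "{?k, v} \<in> E" using ek by (simp add: insert_commute)
 obtain r where r: "r > 0" "!!\<rho> \<theta>. 0 < \<rho> ==> \<rho> < r ==> 0 < \<theta> ==> \<theta> < alpha v j ==> pol v j \<rho> \<theta> ~: D"
  using sector_free[OF e] by blast
 define S where "S = (%x. pol v j (fst x) (snd x)) ` ({0<..<r} \<times> {0<..<alpha v j})"
 have S_in: "pol v j \<rho> \<theta> \<in> S" if "0 < \<rho>" "\<rho> < r" "0 < \<theta>" "\<theta> < alpha v j" for \<rho> \<theta>
  unfolding S_def using that by (intro image_eqI[of _ _ "(\<rho>, \<theta>)"]) auto
 have "connected S" unfolding S_def
  by (intro connected_continuous_image connected_Times connected_Ioo continuous_intros)
 moreover have "S <= - D" using r(2) by (auto simp: S_def)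
 ultimately have max: "S <= C" if "C \<in> components (- D)" "C \<inter> S ~= {}" for C
  using components_maximal[OF that(1) _ _ that(2)] by blast
 have SL: "S <= left v j"
 proof -
  obtain \<theta> \<rho> where h: "0 < \<theta>" "\<theta> < alpha v j" "0 < \<rho>" "\<rho> < r" "0 < \<rho> * sin \<theta>" "\<rho> * sin \<theta> < \<tau>0 * (\<rho> * cos \<theta>)" "\<rho> * sin \<theta> < \<tau>0 * (1 - \<rho> * cos \<theta>)"
   using small_polar[OF r(1) _ \<tau>0(1), of "alpha v j"] alpha_bounds[OF e] by blast
  have "pol v j \<rho> \<theta> \<in> wedge \<tau>0 v j" unfolding wedge_def
   by (rule image_eqI[of _ _ "of_real \<rho> * cis \<theta>"]) (use h in simp_all)
  then show ?thesis using max[OF left_component[OF e]] wedge_left[OF e] S_in[OF h(3,4,1,2)] by blast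
 qed
 moreover have "left ?k v = left v j"
 proof -
  define c where "c = norm (p ?k - p v) / norm ?d"
  have c: "c > 0" "p ?k - p v = of_real c * cis (alpha v j) * ?d"
   using ccw_polar(3)[OF d0 dir0[OF ek]] dir0[OF ek] d0 by (simp_all add: c_def alpha_def)
  have "r / c > 0" using r(1) c(1) by simp
  then obtain \<theta> \<rho> where h: "0 < \<theta>" "\<theta> < alpha v j" "0 < \<rho>" "\<rho> < r / c" "0 < \<rho> * sin \<theta>" "\<rho> * sin \<theta> < \<tau>0 * (\<rho> * cos \<theta>)" "\<rho> * sin \<theta> < \<tau>0 * (1 - \<rho> * cos \<theta>)"
   using small_polar[of "r / c" "alpha v j" \<tau>0] \<tau>0(1) alpha_bounds[OF e] by blast
  let ?q = "pol v j (\<rho> * c) (alpha v j - \<theta>)"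
  have "cis (- \<theta>) * cis (alpha v j) = cis (alpha v j - \<theta>)" by (simp add: cis_mult)
  then have q: "?q = p v + of_real \<rho> * cis (- \<theta>) * (p ?k - p v)" unfolding c(2) by (simp add: mult_ac)
  have "\<rho> * c < r" using h(4) c(1) by (simp add: pos_less_divide_eq)
  then have "?q \<in> left v j" using SL S_in[of "\<rho> * c" "alpha v j - \<theta>"] h c(1) by auto
  moreover have "?q \<in> wedge \<tau>0 ?k v" unfolding wedge_def
  proof (rule image_eqI[of _ _ "1 - of_real \<rho> * cis (- \<theta>)"])
   show "?q = p ?k + (1 - of_real \<rho> * cis (- \<theta>)) * (p v - p ?k)" unfolding q by (simp add: algebra_simps)
   show "1 - of_real \<rho> * cis (- \<theta>) \<in> {z. 0 < Im z & Im z < \<tau>0 * Re z & Im z < \<tau>0 * (1 - Re z)}" using h by simp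
  qed
  ultimately show ?thesis using left_eqI[OF ke e] wedge_left[OF ke] by blast
 qed
 ultimately show ?thesis using r(1) S_in by blast
qed

lemma sector_left: "{v, j} \<in> E ==> \<exists>r>0. \<forall>\<rho> \<theta>. 0 < \<rho> --> \<rho> < r --> 0 < \<theta> --> \<theta> < alpha v j --> pol v j \<rho> \<theta> \<in> left v j"
 and left_nx: "{v, j} \<in> E ==> left (rs.nx v j) v = left v j"
 using sector_left_nx by blast+

lemma left_fstep: "d \<in> darts E ==> left (fst (fstep E dang d)) (snd (fstep E dang d)) = left (fst d) (snd d)"
proof -
 assume d: "d \<in> darts E"
 obtain v j where vj: "d = (v, j)" by (cases d)
 then have e: "{v, j} \<in> E" using d by (simp add: mem_darts)
 show ?thesis unfolding vj rs.fstep_eq[OF e] using left_nx[OF e] by simp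
qed

text \<open>Winding numbers are the required potential: they are constant on the face to the left of
  a dart and jump by the flow across an edge.\<close>

lemma planar_dang: "planar_rot V E dang"
 unfolding rs.planar_rot_iff
proof (intro allI impI)
 fix \<omega> assume fl: "flow V E \<omega>"
 let ?C = "%d. winding V E p \<omega> (base (fst d) (snd d))"
 have "?C (fstep E dang d) = ?C d" if d: "d \<in> darts E" for d
 proof -
  have e: "{fst d, snd d} \<in> E" using d by (simp add: darts_def case_prod_beta)
  have e': "{fst (fstep E dang d), snd (fstep E dang d)} \<in> E" using rs.fstep_darts[OF d] by (simp add: darts_def case_prod_beta)
  show ?thesis
   by (rule winding_left[OF fl e]) (use base_left[OF e] base_left[OF e'] left_fstep[OF d] in auto)
 qed
 then show "\<exists>C. (\<forall>d\<in>darts E. C (fstep E dang d) = C d) & (\<forall>v j. {v, j} \<in> E --> \<omega> v j = C (v, j) - C (j, v))"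
  using winding_left_jump[OF fl] by (intro exI[of _ ?C]) simp
qed

text \<open>The neighbour with the largest angle relative to \<open>n\<close> is followed by the
  wide sector, the one around the direction \<open>- n\<close>.\<close>

lemma ptd_alpha:
 assumes "v \<in> V" "ptd E p v"
 shows "\<exists>j. {v, j} \<in> E & alpha v j > pi"
proof -
 obtain n where n: "!!j. j \<in> nbrs E v ==> (p j - p v) \<bullet> n > 0" using assms(2) unfolding ptd_def by blast
 have n0: "n ~= 0" using n non_isolated[OF assms(1)] by fastforce
 let ?A = "%j. Arg ((p j - p v) / n)"
 have "finite (?A ` nbrs E v)" "?A ` nbrs E v ~= {}" using non_isolated[OF assms(1)] by auto
 then have "Max (?A ` nbrs E v) \<in> ?A ` nbrs E v" by (rule Max_in)
 then obtain j where j': "Max (?A ` nbrs E v) = ?A j" and jn: "j \<in> nbrs E v" by (rule imageE)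
 note j = jn j'[symmetric]
 have max: "?A l <= ?A j" if "l \<in> nbrs E v" for l unfolding j(2) using that by simp
 have small: "\<bar>?A l\<bar> < pi / 2" if "l \<in> nbrs E v" for l
 proof -
  have "Re ((p l - p v) / n) = ((p l - p v) \<bullet> n) / (norm n)\<^sup>2"
   by (simp add: Re_divide inner_complex_def cmod_power2)
  then have "Re ((p l - p v) / n) > 0" using n[OF that] n0 by simp
  then show ?thesis using Arg_Re_pos by blast
 qed
 have pl: "p l - p v = of_real (norm ((p l - p v) / n)) * cis (?A l) * n" if "l \<in> nbrs E v" for l
 proof -
  have "(p l - p v) / n ~= 0" using n[OF that] n0 by auto
  then have "(p l - p v) / n = of_real (norm ((p l - p v) / n)) * cis (?A l)" using Arg_eq by (simp add: cis_conv_exp)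
  then show ?thesis by (simp only: nonzero_divide_eq_eq[OF n0])
 qed
 let ?k = "rs.nx v j"
 have e: "{v, j} \<in> E" "{v, ?k} \<in> E" using j(1) rs.nx_edge by (simp_all add: mem_nbrs)
 then have k: "?k \<in> nbrs E v" by (simp add: mem_nbrs)
 define x y where "x = norm ((p ?k - p v) / n)" and "y = norm ((p j - p v) / n)"
 have xy: "x > 0" "y > 0" using dir0[OF e(1)] dir0[OF e(2)] n0 by (simp_all add: x_def y_def)
 define \<theta> where "\<theta> = ?A ?k - ?A j + 2 * pi"
 have th: "pi < \<theta>" "\<theta> <= 2 * pi" using small[OF k] small[OF j(1)] max[OF k] by (auto simp: \<theta>_def)
 have "cis \<theta> * cis (?A j) = cis (?A ?k)" by (simp add: \<theta>_def cis_mult complex_eq_iff)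
 moreover have "of_real (x / y) * of_real y = (of_real x :: complex)" using xy by simp
 ultimately have "of_real (x / y) * cis \<theta> * (of_real y * cis (?A j) * n) = of_real x * cis (?A ?k) * n"
  by (metis mult.assoc mult.left_commute)
 then have "of_real (x / y) * cis \<theta> * (p j - p v) = p ?k - p v" using pl[OF j(1)] pl[OF k] unfolding x_def y_def by metis
 then have "alpha v j = \<theta>" using ccw_unique[OF dir0[OF e(1)], of "x / y" \<theta>] xy th by (simp add: alpha_def)
 then show ?thesis using e th by auto
qed

text \<open>The bisector of the complement of the wide sector makes an acute angle with every edge
  at \<open>v\<close>.\<close>

lemma alpha_ptd:
 assumes e: "{v, j} \<in> E" and a: "alpha v j > pi"
 shows "ptd E p v"
 unfolding ptd_def
proof (intro exI ballI)
 let ?d = "p j - p v" and ?f = "(alpha v j + 2 * pi) / 2"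
 fix l assume "l \<in> nbrs E v"
 then have l: "{v, l} \<in> E" by (simp add: mem_nbrs)
 let ?t = "ccw_angle ?d (p l - p v)" and ?c = "norm (p l - p v) / norm ?d"
 have t: "alpha v j <= ?t" "?t <= 2 * pi" "p l - p v = of_real ?c * cis ?t * ?d"
  using alpha_le[OF e l] ccw_polar[OF dir0[OF e] dir0[OF l]] by auto
 have A: "(p l - p v) \<bullet> (cis ?f * ?d) = ?c * (norm ?d)\<^sup>2 * cos (?t - ?f)" using inner_cis t(3) by metis
 have B: "cos (?t - ?f) > 0" using t a by (intro cos_gt_zero_pi) (simp_all add: field_simps)
 have C: "?c * (norm ?d)\<^sup>2 > 0" using dir0[OF e] dir0[OF l] by simp
 show "(p l - p v) \<bullet> (cis ?f * ?d) > 0" unfolding A by (rule mult_pos_pos[OF C B])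
qed

lemma ccw_less:
 assumes e: "{v, j} \<in> E" "{v, l} \<in> E" and ne: "l ~= j"
 shows "ccw_angle (p j - p v) (p l - p v) < 2 * pi"
proof -
 let ?t = "ccw_angle (p j - p v) (p l - p v)"
 note P = ccw_polar[OF dir0[OF e(1)] dir0[OF e(2)]]
 have "?t ~= 2 * pi"
 proof
  assume "?t = 2 * pi"
  moreover have "cis (2 * pi) = 1" by (simp add: complex_eq_iff)
  ultimately have "p l - p v = of_real (norm (p l - p v) / norm (p j - p v)) * (p j - p v)" using P(3) by simp
  then show False using same_dir[OF e] dir0[OF e(1)] dir0[OF e(2)] ne by (metis divide_pos_pos zero_less_norm_iff)
 qed
 then show ?thesis using P by simp
qed

lemma reflex_unique:
 assumes e: "{v, j} \<in> E" "{v, l} \<in> E" and a: "alpha v j > pi" and ne: "l ~= j"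
 shows "alpha v l < pi"
proof -
 have "ccw_angle (p l - p v) (p j - p v) = 2 * pi - ccw_angle (p j - p v) (p l - p v)"
  by (rule ccw_swap[OF dir0[OF e(1)] dir0[OF e(2)] ccw_less[OF e ne]])
 then show ?thesis using alpha_le[OF e(2,1)] alpha_le[OF e] a by simp
qed

section \<open>Convex sectors and the faces of a drawing\<close>

definition csec :: "('a \<times> 'a) set" where
 "csec = {d \<in> darts E. alpha (fst d) (snd d) < pi}"

text \<open>At a pointed vertex one sector exceeds a half turn and all others stay below it, which
  leaves its degree minus one convex sectors.\<close>

lemma card_csec:
 assumes pt: "!!v. v \<in> V ==> ptd E p v"
 shows "card csec + card V = 2 * card E"
proof -
 have 1: "card {j \<in> nbrs E v. alpha v j < pi} + 1 = card (nbrs E v)" if v: "v \<in> V" for v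
 proof -
  obtain j where j: "{v, j} \<in> E" "alpha v j > pi" using ptd_alpha[OF v pt[OF v]] by blast
  have "{j \<in> nbrs E v. alpha v j < pi} = nbrs E v - {j}"
   using j reflex_unique[OF j(1) _ j(2)] by (auto simp: mem_nbrs)
  moreover have "j \<in> nbrs E v" using j by (simp add: mem_nbrs)
  ultimately show ?thesis using card_Suc_Diff1[of "nbrs E v" j] by simp
 qed
 have "csec = Sigma V (%v. {j \<in> nbrs E v. alpha v j < pi})"
  by (auto simp: csec_def darts_Sigma)
 then have "card csec = (\<Sum>v\<in>V. card {j \<in> nbrs E v. alpha v j < pi})" using finV by simp
 then have "card csec + card V = (\<Sum>v\<in>V. card {j \<in> nbrs E v. alpha v j < pi} + 1)" by (simp only: sum.distrib) simp
 also have "\<dots> = (\<Sum>v\<in>V. card (nbrs E v))" using 1 by (intro sum.cong) auto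
 finally show ?thesis using sum_deg by simp
qed

text \<open>An open neighbourhood of the open edge: the wedges on its two sides and the edge between
  them.\<close>

definition kite :: "'a => 'a => complex set" where
 "kite v j = {y. \<bar>Im ((y - p v) * inverse (p j - p v))\<bar> < \<tau>0 * Re ((y - p v) * inverse (p j - p v))} \<inter>
  {y. \<bar>Im ((y - p v) * inverse (p j - p v))\<bar> < \<tau>0 * (1 - Re ((y - p v) * inverse (p j - p v)))}"

lemma kite_open: "open (kite v j)"
 unfolding kite_def by (intro open_Int open_Collect_less continuous_intros)

lemma kite_sub:
 assumes e: "{v, j} \<in> E" shows "kite v j <= seg v j \<union> left v j \<union> left j v"
proof
 fix y assume y: "y \<in> kite v j"
 have e': "{j, v} \<in> E" using e by (simp add: insert_commute)
 define z where "z = (y - p v) * inverse (p j - p v)"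
 have yz: "y = p v + z * (p j - p v)"
  unfolding z_def by (simp only: mult.assoc left_inverse[OF dir0[OF e]] mult_1_right) simp
 have z: "\<bar>Im z\<bar> < \<tau>0 * Re z" "\<bar>Im z\<bar> < \<tau>0 * (1 - Re z)" using y by (simp_all add: kite_def z_def)
 consider "Im z > 0" | "Im z < 0" | "Im z = 0" by linarith
 then show "y \<in> seg v j \<union> left v j \<union> left j v"
 proof cases
  case 1
  then have "y \<in> wedge \<tau>0 v j" unfolding wedge_def using z yz by (intro image_eqI[of _ _ z]) auto
  then show ?thesis using wedge_left[OF e] by blast
 next
  case 2
  have "y = p j + (1 - z) * (p v - p j)" unfolding yz by (simp add: algebra_simps)
  then have "y \<in> wedge \<tau>0 j v" unfolding wedge_def using z 2 by (intro image_eqI[of _ _ "1 - z"]) auto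
  then show ?thesis using wedge_left[OF e'] by blast
 next
  case 3
  then have zr: "z = of_real (Re z)" by (simp add: complex_eq_iff)
  have "0 < Re z" "Re z < 1" using z 3 \<tau>0(1) by (auto simp: zero_less_mult_iff)
  moreover have "y = (1 - Re z) *\<^sub>R p v + Re z *\<^sub>R p j" unfolding yz by (subst zr) (simp add: scaleR_conv_of_real algebra_simps)
  ultimately show ?thesis by (auto simp: closed_segment_def)
 qed
qed

lemma D_kite:
 assumes "y \<in> D" "y ~: p ` V"
 shows "\<exists>v j. {v, j} \<in> E & y \<in> kite v j"
proof -
 obtain v j where vj: "{v, j} \<in> E" "y \<in> seg v j" using assms(1) by (rule D_cases)
 obtain c where c: "0 <= c" "c <= 1" "y = p v + of_real c * (p j - p v)" using seg_points[OF vj(2)] by blast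
 have "c ~= 0" "c ~= 1" using c(3) assms(2) edgeD[OF vj(1)] by auto
 moreover have eq: "(y - p v) * inverse (p j - p v) = of_real c" using c(3) dir0[OF vj(1)] by (simp add: field_simps)
 ultimately have "y \<in> kite v j" unfolding kite_def Int_iff mem_Collect_eq eq using c(1,2) \<tau>0(1) by simp
 then show ?thesis using vj by blast
qed

lemma plane_minus_vertices: "connected (- (p ` V))"
 by (rule path_connected_imp_connected[OF path_connected_complement_countable]) (simp_all add: countable_finite finV)

lemma darts_iff: "d \<in> darts E \<longleftrightarrow> {fst d, snd d} \<in> E"
 by (simp add: darts_def case_prod_beta)

lemma base_pV: "{v, j} \<in> E ==> base v j ~: p ` V"
 using base_D unfolding drawing_def by blast

text \<open>The plane without the vertices is connected. It is covered by two disjoint open sets,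
  the kites and left faces of all darts on one hand and the remaining components on the other, so
  the latter are absent.\<close>

lemma comp_left:
 assumes V: "V ~= {}" and F: "F \<in> components (- D)"
 shows "\<exists>v j. {v, j} \<in> E & F = left v j"
proof (rule ccontr)
 assume no: "\<not> ?thesis"
 define A where "A = (\<Union>d\<in>darts E. kite (fst d) (snd d) \<union> left (fst d) (snd d))"
 define B where "B = \<Union>{G \<in> components (- D). \<not> (\<exists>v j. {v, j} \<in> E & G = left v j)}"
 have oA: "open A" unfolding A_def by (intro open_UN ballI open_Un kite_open left_open)
 have oB: "open B" unfolding B_def using D_closed open_components[of "- D"] by (intro open_Union) (auto simp: open_Compl)
 have "A \<inter> B = {}"
 proof (rule ccontr)
  assume "A \<inter> B ~= {}"
  then obtain x where x: "x \<in> A" "x \<in> B" by blast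
  obtain G where G: "G \<in> components (- D)" "\<not> (\<exists>v j. {v, j} \<in> E & G = left v j)" "x \<in> G" using x(2) by (auto simp: B_def)
  have xD: "x ~: D" using in_components_subset[OF G(1)] G(3) by blast
  obtain d where d: "d \<in> darts E" "x \<in> kite (fst d) (snd d) \<union> left (fst d) (snd d)" using x(1) by (auto simp: A_def)
  have e: "{fst d, snd d} \<in> E" "{snd d, fst d} \<in> E" using d(1) by (simp_all add: darts_iff insert_commute)
  have "x \<in> left (fst d) (snd d) | x \<in> left (snd d) (fst d)" using d(2) kite_sub[OF e(1)] seg_sub[OF e(1)] xD by blast
  then have "G = left (fst d) (snd d) | G = left (snd d) (fst d)"
   using components_nonoverlap[OF G(1) left_component[OF e(1)]] components_nonoverlap[OF G(1) left_component[OF e(2)]] G(3) by blast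
  then show False using G(2) e by blast
 qed
 moreover have "- (p ` V) <= A \<union> B"
 proof
  fix x assume x: "x \<in> - (p ` V)"
  show "x \<in> A \<union> B"
  proof (cases "x \<in> D")
   case True
   then obtain v j where "{v, j} \<in> E" "x \<in> kite v j" using D_kite x by blast
   then have "x \<in> A" unfolding A_def by (intro UN_I[of "(v, j)"]) (auto simp: darts_iff)
   then show ?thesis by blast
  next
   case False
   then obtain G where G: "G \<in> components (- D)" "x \<in> G" using Union_components[of "- D"] by blast
   show ?thesis
   proof (cases "\<exists>v j. {v, j} \<in> E & G = left v j")
    case True
    then obtain v j where "{v, j} \<in> E" "G = left v j" by blast
    then have "x \<in> A" unfolding A_def using G by (intro UN_I[of "(v, j)"]) (auto simp: darts_iff)
    then show ?thesis by blast
   next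
    case F: False
    then show ?thesis using G unfolding B_def by blast
   qed
  qed
 qed
 ultimately have "A \<inter> - (p ` V) = {} | B \<inter> - (p ` V) = {}" using connectedD[OF plane_minus_vertices oA oB] by blast
 moreover have "A \<inter> - (p ` V) ~= {}"
 proof -
  obtain v where "v \<in> V" using V by blast
  then obtain j where e: "{v, j} \<in> E" using non_isolated[of v] by (auto simp: nbrs_def)
  have "base v j \<in> A" unfolding A_def using base_left[OF e] e by (intro UN_I[of "(v, j)"]) (auto simp: darts_iff)
  moreover have "base v j ~: p ` V" by (rule base_pV[OF e])
  ultimately show ?thesis by blast
 qed
 moreover have "F <= B" unfolding B_def using F no by blast
 moreover have "F ~= {}" "F <= - D" using in_components_nonempty[OF F] in_components_subset[OF F] by auto
 ultimately show False using vertex_D by blast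
qed

text \<open>The wedge approaches every point of the open edge, whose closure is the edge.\<close>

lemma left_seg_closure:
 assumes e: "{v, j} \<in> E" shows "seg v j <= frontier (left v j)"
proof -
 have "(%c. p v + of_real c * (p j - p v)) ` {0<..<1} <= closure (left v j)"
 proof
  fix y assume "y \<in> (%c. p v + of_real c * (p j - p v)) ` {0<..<1}"
  then obtain c where c: "0 < c" "c < 1" "y = p v + of_real c * (p j - p v)" by auto
  have "((%t::real. p v + (of_real c + of_real t * \<i>) * (p j - p v)) \<longlongrightarrow> p v + (of_real c + of_real 0 * \<i>) * (p j - p v)) (at_right 0)"
   by (intro tendsto_intros)
  then have l: "((%t::real. p v + (of_real c + of_real t * \<i>) * (p j - p v)) \<longlongrightarrow> y) (at_right 0)" using c by simp
  have "\<forall>\<^sub>F t in at_right (0::real). 0 < t & t < min (\<tau>0 * c) (\<tau>0 * (1 - c))"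
   using eventually_at_right_real[of 0 "min (\<tau>0 * c) (\<tau>0 * (1 - c))"] \<tau>0(1) c by (auto elim: eventually_mono)
  then have "\<forall>\<^sub>F t in at_right (0::real). p v + (of_real c + of_real t * \<i>) * (p j - p v) \<in> closure (left v j)"
  proof eventually_elim
   case (elim t)
   have "p v + (of_real c + of_real t * \<i>) * (p j - p v) \<in> wedge \<tau>0 v j"
    unfolding wedge_def by (rule imageI) (use elim in simp)
   then show ?case using wedge_left[OF e] closure_subset by blast
  qed
  then show "y \<in> closure (left v j)" by (rule Lim_in_closed_set[OF closed_closure _ trivial_limit_at_right_real l])
 qed
 moreover have "seg v j <= closure ((%c. p v + of_real c * (p j - p v)) ` {0<..<1})"
 proof -
  have "seg v j <= (%c. p v + of_real c * (p j - p v)) ` {0..1}"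
  proof
   fix y assume "y \<in> seg v j"
   then obtain c where "0 <= c" "c <= 1" "y = p v + of_real c * (p j - p v)" using seg_points by blast
   then show "y \<in> (%c. p v + of_real c * (p j - p v)) ` {0..1}" by (intro image_eqI[of _ _ c]) auto
  qed
  also have "{0..1} = closure {0<..<(1::real)}" by simp
  also have "(%c. p v + of_real c * (p j - p v)) ` closure {0<..<1} <= closure ((%c. p v + of_real c * (p j - p v)) ` {0<..<1})"
   by (intro image_closure_subset continuous_intros closed_closure closure_subset)
  finally show ?thesis .
 qed
 ultimately have "seg v j <= closure (left v j)" using closure_minimal[OF _ closed_closure] by blast
 moreover have "seg v j \<inter> left v j = {}" using seg_sub[OF e] left_sub by blast
 ultimately show ?thesis using left_open by (auto simp: frontier_def interior_open)
qed

lemma outer_left: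
 assumes e: "{v, j} \<in> E" and b: "\<not> bounded (left v j)"
 shows "left v j = outside D"
proof -
 have bd: "bounded D" using D_compact compact_imp_bounded by blast
 have "outside D \<in> components (- D)"
  unfolding outside_in_components using connected_outside[OF bd] outside_bounded_nonempty[OF bd] by simp
 then show ?thesis
  using cobounded_unique_unbounded_components[OF _ _ unbounded_outside[OF bd] left_component[OF e] b] bd by simp
qed

lemma outside_unbounded: "\<not> bounded (outside D)"
 using D_compact compact_imp_bounded unbounded_outside by blast

text \<open>A cut of the graph would split the drawing into two closed parts, and by hypothesis no
  face borders both. Faces and kites would then split the connected plane without the vertices into
  two open sets.\<close>

lemma connI:
 assumes C: "!!v j. {v, j} \<in> E ==> \<exists>C. connected C & C <= D & (\<forall>k l. {k, l} \<in> E --> left k l = left v j --> seg k l <= C)"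
 shows "conn V E"
 unfolding conn_def
proof (intro allI impI, rule ccontr)
 fix K assume K: "K <= V" "K ~= {}" "K ~= V" and no: "\<not> (\<exists>x\<in>K. \<exists>y\<in>V - K. {x, y} \<in> E)"
 have KK: "x \<in> K \<longleftrightarrow> y \<in> K" if "{x, y} \<in> E" for x y
  using no edgeD[OF that] that by (metis DiffI insert_commute)
 define DD where "DD b = (\<Union>d\<in>{d \<in> darts E. fst d \<in> K \<longleftrightarrow> b}. seg (fst d) (snd d))" for b
 define A where "A b = (\<Union>d\<in>{d \<in> darts E. fst d \<in> K \<longleftrightarrow> b}. kite (fst d) (snd d) \<union> left (fst d) (snd d))" for b
 have clD: "closed (DD b)" for b unfolding DD_def by (intro closed_UN) auto
 have inD: "seg v j <= DD (v \<in> K)" if "{v, j} \<in> E" for v j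
  unfolding DD_def using that by (intro subsetI UN_I[of "(v, j)"]) (auto simp: darts_iff)
 have D_un: "D <= DD True \<union> DD False"
 proof
  fix x assume "x \<in> D"
  then obtain v j where vj: "{v, j} \<in> E" "x \<in> seg v j" by (rule D_cases)
  then show "x \<in> DD True \<union> DD False" using inD[OF vj(1)] by (cases "v \<in> K") auto
 qed
 have disjD: "seg v j \<inter> seg k l = {}" if e: "{v, j} \<in> E" "{k, l} \<in> E" and k: "v \<in> K" "k ~: K" for v j k l
 proof -
  have "{v, j} \<inter> {k, l} = {}" using KK[OF e(1)] KK[OF e(2)] k by auto
  moreover from this have "{v, j} ~= {k, l}" by auto
  ultimately show ?thesis using seg_inter[OF e] by simp
 qed
 have dD: "DD True \<inter> DD False = {}"
 proof (rule ccontr)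
  assume "DD True \<inter> DD False ~= {}"
  then obtain d d' x where "d \<in> darts E" "fst d \<in> K" "x \<in> seg (fst d) (snd d)" "d' \<in> darts E" "fst d' ~: K" "x \<in> seg (fst d') (snd d')"
   unfolding DD_def by blast
  then show False using disjD[of "fst d" "snd d" "fst d'" "snd d'"] by (auto simp: darts_iff)
 qed
 have label: "k \<in> K" if e: "{v, j} \<in> E" "{k, l} \<in> E" and eq: "left k l = left v j" and v: "v \<in> K" for v j k l
 proof (rule ccontr)
  assume k: "k ~: K"
  obtain C where C: "connected C" "C <= D" "!!k l. {k, l} \<in> E ==> left k l = left v j ==> seg k l <= C" using C[OF e(1)] by blast
  have "DD True \<inter> C = {} | DD False \<inter> C = {}"
   using connected_closedD[OF C(1) _ _ clD clD, of True False] dD D_un C(2) by blast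
  moreover have "p v \<in> DD True \<inter> C" using inD[OF e(1)] C(3)[OF e(1) refl] v by auto
  moreover have "p k \<in> DD False \<inter> C" using inD[OF e(2)] C(3)[OF e(2) eq] k by auto
  ultimately show False by blast
 qed
 have oA: "open (A b)" for b unfolding A_def by (intro open_UN ballI open_Un kite_open left_open)
 have "A True \<inter> A False = {}"
 proof (rule ccontr)
  assume "A True \<inter> A False ~= {}"
  then obtain d d' x where d: "d \<in> darts E" "fst d \<in> K" "x \<in> kite (fst d) (snd d) \<union> left (fst d) (snd d)"
   and d': "d' \<in> darts E" "fst d' ~: K" "x \<in> kite (fst d') (snd d') \<union> left (fst d') (snd d')"
   unfolding A_def by blast
  obtain v j k l where vj: "d = (v, j)" "d' = (k, l)" by (cases d, cases d')
  have e: "{v, j} \<in> E" "{j, v} \<in> E" "{k, l} \<in> E" "{l, k} \<in> E" using d(1) d'(1) vj by (auto simp: darts_iff insert_commute)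
  have K4: "v \<in> K" "j \<in> K" "k ~: K" "l ~: K" using d(2) d'(2) KK[OF e(1)] KK[OF e(3)] vj by auto
  have 1: "x \<in> seg v j | x \<in> left v j | x \<in> left j v" using d(3) kite_sub[OF e(1)] vj by auto
  have 2: "x \<in> seg k l | x \<in> left k l | x \<in> left l k" using d'(3) kite_sub[OF e(3)] vj by auto
  show False
  proof (cases "x \<in> D")
   case True
   then have "x \<in> seg v j" "x \<in> seg k l" using 1 2 left_sub by blast+
   then show False using disjD[OF e(1,3) K4(1,3)] by blast
  next
   case False
   then have 1: "x \<in> left v j | x \<in> left j v" and 2: "x \<in> left k l | x \<in> left l k" using 1 2 seg_sub[OF e(1)] seg_sub[OF e(3)] by blast+
   then have "left k l = left v j | left k l = left j v | left l k = left v j | left l k = left j v"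
    using left_eqI e by metis
   then show False using label[OF e(1,3)] label[OF e(2,3)] label[OF e(1,4)] label[OF e(2,4)] K4 by blast
  qed
 qed
 then have dis: "A True \<inter> A False \<inter> - (p ` V) = {}" by blast
 have "V ~= {}" using K by blast
 have cover: "- (p ` V) <= A True \<union> A False"
 proof
  fix x assume x: "x \<in> - (p ` V)"
  have "\<exists>v j. {v, j} \<in> E & x \<in> kite v j \<union> left v j"
  proof (cases "x \<in> D")
   case True
   then show ?thesis using D_kite x by blast
  next
   case False
   then obtain G where G: "G \<in> components (- D)" "x \<in> G" using Union_components[of "- D"] by blast
   then show ?thesis using comp_left[OF \<open>V ~= {}\<close> G(1)] by blast
  qed
  then obtain v j where "{v, j} \<in> E" "x \<in> kite v j \<union> left v j" by blast
  then have "x \<in> A (v \<in> K)" unfolding A_def by (intro UN_I[of "(v, j)"]) (auto simp: darts_iff)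
  then show "x \<in> A True \<union> A False" by (cases "v \<in> K") auto
 qed
 have "A True \<inter> - (p ` V) = {} | A False \<inter> - (p ` V) = {}" by (rule connectedD[OF plane_minus_vertices oA oA dis cover])
 moreover have "A (v \<in> K) \<inter> - (p ` V) ~= {}" if v: "v \<in> V" for v
 proof -
  obtain j where e: "{v, j} \<in> E" using non_isolated[OF v] by (auto simp: nbrs_def)
  have "base v j \<in> A (v \<in> K)" unfolding A_def using base_left[OF e] e by (intro UN_I[of "(v, j)"]) (auto simp: darts_iff)
  moreover have "base v j ~: p ` V" by (rule base_pV[OF e])
  ultimately show ?thesis by blast
 qed
 moreover obtain a b where "a \<in> V" "a \<in> K" "b \<in> V" "b ~: K" using K by blast
 ultimately show False by metis
qed

lemma fin_interior:
 assumes V: "V ~= {}" shows "finite (interior_faces V E p)"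
proof (rule finite_subset)
 show "interior_faces V E p <= (%d. left (fst d) (snd d)) ` darts E"
 proof
  fix F assume "F \<in> interior_faces V E p"
  then obtain v j where "{v, j} \<in> E" "F = left v j" using comp_left[OF V] unfolding interior_faces_def by blast
  then show "F \<in> (%d. left (fst d) (snd d)) ` darts E" by (intro image_eqI[of _ _ "(v, j)"]) (auto simp: mem_darts)
 qed
qed simp

lemma interior_left: "{v, j} \<in> E ==> left v j \<in> interior_faces V E p \<longleftrightarrow> bounded (left v j)"
 by (simp add: interior_faces_def left_component)

text \<open>A face function without jumps is constant on the darts of a connected graph, and it is
  zero on an unbounded face. Together with \<open>faces_ge\<close> this gives Euler's
  formula.\<close>

lemma faces_le:
 assumes V: "V ~= {}" and con: "conn V E"
 shows "card (interior_faces V E p) + card V <= card E + 1"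
proof (rule few_faces[where f="%d. left (fst d) (snd d)", OF V fin_interior[OF V] _ _ con])
 fix c :: "complex set => real"
 have "(\<Sum>j\<in>nbrs E v. c (left v j)) = (\<Sum>j\<in>nbrs E v. c (left j v))" if "v \<in> V" for v
 proof -
  have "(\<Sum>j\<in>nbrs E v. c (left j v)) = (\<Sum>j\<in>nbrs E v. c (left (rs.nx v j) v))"
   by (rule sum.reindex_bij_betw[OF rs.cyc.nxt_bij, symmetric])
  also have "\<dots> = (\<Sum>j\<in>nbrs E v. c (left v j))" by (rule sum.cong) (auto simp: left_nx mem_nbrs)
  finally show ?thesis by simp
 qed
 then show "flow V E (%v j. c (left (fst (v, j)) (snd (v, j))) - c (left (fst (j, v)) (snd (j, v))))"
  by (simp add: flow_def sum_subtractf)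
next
 fix c :: "complex set => real"
 assume z: "!!x. x ~: interior_faces V E p ==> c x = 0"
  and eq: "!!v j. {v, j} \<in> E ==> c (left (fst (v, j)) (snd (v, j))) = c (left (fst (j, v)) (snd (j, v)))"
 let ?h = "%d. c (left (fst d) (snd d))"
 have hc: "?h d = ?h d'" if "d \<in> darts E" "d' \<in> darts E" for d d'
 proof (rule rs.dart_const[OF con _ _ that, where h="?h"])
  show "?h (j, v) = ?h (v, j)" if "{v, j} \<in> E" for v j using eq[OF that] by (rule sym)
  show "?h (fstep E dang d) = ?h d" if "d \<in> darts E" for d using left_fstep[OF that] by (rule arg_cong)
 qed
 have "bounded D" using D_compact compact_imp_bounded by blast
 then obtain F where F: "F \<in> components (- D)" "\<not> bounded F" using cobounded_unbounded_components[of "- D"] by auto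
 then obtain v j where vj: "{v, j} \<in> E" "F = left v j" using comp_left[OF V] by blast
 have 0: "?h (v, j) = 0" using z[of F] F vj by (simp add: interior_faces_def)
 show "\<forall>x\<in>interior_faces V E p. c x = 0"
 proof
  fix x assume x: "x \<in> interior_faces V E p"
  then obtain k l where kl: "{k, l} \<in> E" "x = left k l" using comp_left[OF V] unfolding interior_faces_def by blast
  show "c x = 0" using hc[of "(k, l)" "(v, j)"] 0 kl vj by (simp add: darts_iff)
 qed
qed

text \<open>Winding numbers vanish on unbounded faces, so they define a function supported on the
  interior faces.\<close>

lemma faces_ge:
 assumes V: "V ~= {}"
 shows "card E + 1 <= card (interior_faces V E p) + card V"
proof (rule many_faces[where f="%d. left (fst d) (snd d)", OF V fin_interior[OF V]])
 fix \<omega> assume fl: "flow V E \<omega>"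
 define c where "c F = (if F \<in> interior_faces V E p then winding V E p \<omega> (SOME y. y \<in> F) else 0)" for F
 have c: "c (left v j) = winding V E p \<omega> (base v j)" if e: "{v, j} \<in> E" for v j
 proof (cases "bounded (left v j)")
  case True
  have "(SOME y. y \<in> left v j) \<in> left v j" by (rule someI[of "%y. y \<in> left v j", OF base_left[OF e]])
  then show ?thesis using True e winding_left[OF fl e _ base_left[OF e]] by (simp add: c_def interior_left)
 next
  case False
  obtain R where R: "R > 0" "D <= ball 0 R" using D_bounded by metis
  obtain y where y: "y \<in> left v j" "norm y > R" using False unfolding bounded_iff by (meson not_le)
  have "winding V E p \<omega> y = 0" by (rule winding_outside[OF fl R(2)]) (use y in simp)
  then show ?thesis using False e winding_left[OF fl e y(1) base_left[OF e]] by (simp add: c_def interior_left)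
 qed
 have "\<omega> v j = c (left v j) - c (left j v)" if e: "{v, j} \<in> E" for v j
 proof -
  have e': "{j, v} \<in> E" using e by (simp add: insert_commute)
  show ?thesis using winding_left_jump[OF fl e] c[OF e] c[OF e'] by simp
 qed
 then show "\<exists>c. (\<forall>x. x ~: interior_faces V E p --> c x = 0) &
   (\<forall>v j. {v, j} \<in> E --> \<omega> v j = c (left (fst (v, j)) (snd (v, j))) - c (left (fst (j, v)) (snd (j, v))))"
  by (intro exI[of _ c]) (simp add: c_def)
qed

end

section \<open>Simple polygons\<close>

lemma small_step:
 fixes a u :: complex
 assumes "open S" "a \<in> S"
 shows "\<exists>t>0. t <= 1 & a + of_real t * u \<in> S"
proof -
 have "((%t::real. a + of_real t * u) \<longlongrightarrow> a + of_real 0 * u) (at_right 0)" by (intro tendsto_intros)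
 then have "\<forall>\<^sub>F t in at_right (0::real). a + of_real t * u \<in> S" using assms by (intro topological_tendstoD) auto
 moreover have "\<forall>\<^sub>F t in at_right (0::real). 0 < t & t < 1" using eventually_at_right_real[of 0 1] by (auto elim: eventually_mono)
 ultimately have "\<forall>\<^sub>F t in at_right (0::real). 0 < t & t < 1 & a + of_real t * u \<in> S" by eventually_elim simp
 then obtain t where "0 < t & t < 1 & a + of_real t * u \<in> S" using eventually_happens'[OF trivial_limit_at_right_real] by blast
 then show ?thesis by (intro exI[of _ t]) simp
qed

lemma seg_collinear:
 assumes "y1 \<in> closed_segment a b" "y2 \<in> closed_segment a b" "y3 \<in> closed_segment a b"
 shows "cr (y2 - y1) (y3 - y1) = 0"
proof -
 have *: "\<exists>u::real. y = a + of_real u * (b - a)" if "y \<in> closed_segment a b" for y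
  using that by (auto simp: closed_segment_def scaleR_conv_of_real algebra_simps)
 obtain u1 u2 u3 :: real where u: "y1 = a + of_real u1 * (b - a)" "y2 = a + of_real u2 * (b - a)" "y3 = a + of_real u3 * (b - a)"
  using *[OF assms(1)] *[OF assms(2)] *[OF assms(3)] by blast
 have "y2 - y1 = of_real (u2 - u1) * (b - a)" "y3 - y1 = of_real (u3 - u1) * (b - a)"
  unfolding u by (simp_all add: algebra_simps)
 then show ?thesis by (simp only: cr_scale cr_self mult_zero_right)
qed

lemma (in drawn) D_hull: "D <= convex hull (p ` V)"
proof
 fix y assume "y \<in> D"
 then obtain v j where vj: "{v, j} \<in> E" "y \<in> seg v j" by (rule D_cases)
 have "seg v j <= convex hull (p ` V)" unfolding segment_convex_hull
  by (rule hull_mono) (use edgeD[OF vj(1)] in auto)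
 then show "y \<in> convex hull (p ` V)" using vj(2) by blast
qed

locale polygon =
 fixes k :: nat and x :: "nat => complex"
 assumes simple: "simple_polygon k x"
begin

abbreviation sc :: "nat => nat" where "sc i \<equiv> (i + 1) mod k"
abbreviation pr :: "nat => nat" where "pr i \<equiv> (i + k - 1) mod k"
abbreviation C :: "nat set set" where "C \<equiv> cycle_edges k"

lemma k3: "3 <= k" using simple by (simp add: simple_polygon_def)

lemma sc_eq: "i < k ==> sc i = (if i + 1 = k then 0 else i + 1)"
 by auto

lemma pr_eq: "i < k ==> pr i = (if i = 0 then k - 1 else i - 1)"
proof -
 assume i: "i < k"
 show ?thesis
 proof (cases "i = 0")
  case True then show ?thesis using k3 by simp
 next
  case False
  then have "i + k - 1 = (i - 1) + k" by simp
  then show ?thesis by (simp only: mod_add_self2) (use False i in simp)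
 qed
qed

lemma sc_pr:
 assumes "i < k"
 shows "sc i < k" "pr i < k" "sc (pr i) = i" "pr (sc i) = i" "sc i ~= i" "pr i ~= i" "sc i ~= pr i"
proof -
 show 1: "sc i < k" "pr i < k" using assms by simp_all
 show "sc (pr i) = i" unfolding sc_eq[OF 1(2)] unfolding pr_eq[OF assms] using assms k3 by auto
 show "pr (sc i) = i" unfolding pr_eq[OF 1(1)] unfolding sc_eq[OF assms] using assms k3 by auto
 show "sc i ~= i" "pr i ~= i" "sc i ~= pr i" unfolding sc_eq[OF assms] pr_eq[OF assms] using assms k3 by auto
qed

lemma C_iff: "{i, j} \<in> C \<longleftrightarrow> i < k & (j = sc i | j = pr i)"
proof
 assume "{i, j} \<in> C"
 then obtain m where m: "m < k" "{i, j} = {m, sc m}" by (auto simp: cycle_edges_def)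
 then show "i < k & (j = sc i | j = pr i)" using sc_pr[of m] by (auto simp: doubleton_eq_iff)
next
 assume h: "i < k & (j = sc i | j = pr i)"
 show "{i, j} \<in> C"
 proof (cases "j = sc i")
  case True then show ?thesis using h by (auto simp: cycle_edges_def)
 next
  case False
  then have j: "j = pr i" using h by blast
  have "{j, sc j} \<in> C" using sc_pr(2)[of i] h j by (auto simp: cycle_edges_def)
  moreover have "sc j = i" using sc_pr(3)[of i] h j by simp
  ultimately show ?thesis by (simp add: insert_commute)
 qed
qed

lemma drawn_C: "drawn {..<k} C x"
proof unfold_locales
 show "finite {..<k}" by simp
 show "noncrossing_embedding {..<k} C x" using simple by (simp add: simple_polygon_def)
 fix e assume "e \<in> C"
 then obtain m where m: "m < k" "e = {m, sc m}" by (auto simp: cycle_edges_def)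
 then show "e <= {..<k}" "card e = 2" using sc_pr[OF m(1)] by auto
next
 fix v assume "v \<in> {..<k}"
 then show "nbrs C v ~= {}" using C_iff[of v "sc v"] by (auto simp: nbrs_def)
qed

sublocale P: drawn "{..<k}" C x by (rule drawn_C)

abbreviation "PD \<equiv> drawing {..<k} C x"

lemma nbrs_C: "i < k ==> nbrs C i = {sc i, pr i}"
 by (auto simp: nbrs_def C_iff)

lemma nx_C: assumes i: "i < k" shows "P.rs.nx i (sc i) = pr i" "P.rs.nx i (pr i) = sc i"
proof -
 have c1: "cd (P.dang i a) (P.dang i a) = 1" for a by (simp add: cd_def)
 have c2: "cd (P.dang i a) (P.dang i b) <= 1" if "{i, a} \<in> C" "{i, b} \<in> C" for a b
  using P.rs.ang_rng[OF that(1)] P.rs.ang_rng[OF that(2)] by (auto simp: cd_def)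
 have e: "{i, sc i} \<in> C" "{i, pr i} \<in> C" using C_iff i by blast+
 show "P.rs.nx i (sc i) = pr i"
  by (rule P.rs.cyc.nxt_eqI) (use c1 c2 e nbrs_C[OF i] in auto)
 show "P.rs.nx i (pr i) = sc i"
  by (rule P.rs.cyc.nxt_eqI) (use c1 c2 e nbrs_C[OF i] in auto)
qed

lemma alpha_pr: assumes i: "i < k" shows "P.alpha i (pr i) = 2 * pi - P.alpha i (sc i)"
proof -
 have e: "{i, sc i} \<in> C" "{i, pr i} \<in> C" using C_iff i by blast+
 show ?thesis unfolding P.alpha_def nx_C[OF i]
  by (rule ccw_swap[OF P.dir0[OF e(1)] P.dir0[OF e(2)] P.ccw_less[OF e]]) (use sc_pr[OF i] in auto)
qed

text \<open>The two sides of the closed curve with respect to its given direction of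
  traversal.\<close>

definition "L = P.left 0 (sc 0)"
definition "R = P.left 0 (pr 0)"

lemma left_sc: "i < k ==> P.left i (sc i) = L"
proof (induction i)
 case 0 then show ?case by (simp add: L_def)
next
 case (Suc m)
 then have m: "m < k" "sc m = Suc m" using sc_eq[of m] by auto
 have "P.left (P.rs.nx (Suc m) (sc (Suc m))) (Suc m) = P.left (Suc m) (sc (Suc m))"
  by (rule P.left_nx) (use C_iff Suc.prems in blast)
 moreover have "P.rs.nx (Suc m) (sc (Suc m)) = m" using nx_C(1)[OF Suc.prems] sc_pr(4)[OF m(1)] m(2) by metis
 ultimately show ?case using Suc.IH[OF m(1)] m(2) by metis
qed

lemma left_pr: "i < k ==> P.left i (pr i) = R"
proof (induction i)
 case 0 then show ?case by (simp add: R_def)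
next
 case (Suc m)
 then have m: "m < k" "sc m = Suc m" using sc_eq[of m] by auto
 have "P.left (P.rs.nx m (pr m)) m = P.left m (pr m)"
  by (rule P.left_nx) (use C_iff m in blast)
 moreover have "P.rs.nx m (pr m) = Suc m" using nx_C(2)[OF m(1)] m(2) by simp
 moreover have "pr (Suc m) = m" using sc_pr(4)[OF m(1)] m(2) by metis
 ultimately show ?case using Suc.IH[OF m(1)] by metis
qed

text \<open>The unit flow around the cycle has winding numbers on the two sides of an edge that
  differ by 1: this is the separation part of the Jordan curve theorem for polygons.\<close>

lemma L_ne_R: "L ~= R"
proof
 assume eq: "L = R"
 define \<omega> :: "nat => nat => real" where "\<omega> i j = (if j = sc i then 1 else -1)" for i j
 have fl: "flow {..<k} C \<omega>" unfolding flow_def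
 proof (intro conjI allI impI ballI)
  fix v j assume "{v, j} \<in> C"
  then have h: "v < k" "j = sc v | j = pr v" using C_iff by blast+
  then show "\<omega> j v = - \<omega> v j" using sc_pr[OF h(1)] sc_pr[OF sc_pr(1)[OF h(1)]] sc_pr[OF sc_pr(2)[OF h(1)]] by (metis \<omega>_def minus_minus)
 next
  fix v assume "v \<in> {..<k}"
  then have v: "v < k" by simp
  show "(\<Sum>j\<in>nbrs C v. \<omega> v j) = 0" unfolding nbrs_C[OF v] using sc_pr(7)[OF v] by (simp add: \<omega>_def)
 qed
 have 0: "0 < k" using k3 by simp
 have e: "{0, sc 0} \<in> C" "{sc 0, 0} \<in> C" using C_iff 0 by (blast, metis C_iff insert_commute)
 have "P.left (sc 0) 0 = P.left (sc 0) (pr (sc 0))" using sc_pr(4)[OF 0] by metis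
 also have "\<dots> = L" using left_pr[OF sc_pr(1)[OF 0]] eq by simp
 finally have l: "P.left (sc 0) 0 = P.left 0 (sc 0)" using left_sc[OF 0] by metis
 have "winding {..<k} C x \<omega> (P.base 0 (sc 0)) = winding {..<k} C x \<omega> (P.base (sc 0) 0)"
  by (rule P.winding_left[OF fl e(1) P.base_left[OF e(1)]]) (use P.base_left[OF e(2)] l in metis)
 then have "\<omega> 0 (sc 0) = 0" using P.winding_left_jump[OF fl e(1)] by simp
 then show False by (simp add: \<omega>_def)
qed

lemma LR_comp: "L \<in> components (- PD)" "R \<in> components (- PD)" "L \<inter> R = {}" "- PD = L \<union> R"
proof -
 have 0: "0 < k" using k3 by simp
 show c: "L \<in> components (- PD)" "R \<in> components (- PD)"
  unfolding L_def R_def by (rule P.left_component; use C_iff 0 in blast)+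
 show "L \<inter> R = {}" using components_nonoverlap[OF c] L_ne_R by blast
 have "F = L | F = R" if F: "F \<in> components (- PD)" for F
 proof -
  obtain i j where ij: "{i, j} \<in> C" "F = P.left i j" using P.comp_left[OF _ F] 0 by auto
  then show ?thesis using C_iff left_sc left_pr by metis
 qed
 then have "components (- PD) = {L, R}" using c by blast
 then show "- PD = L \<union> R" using Union_components[of "- PD"] by auto
qed

lemma bounded_PD: "bounded PD"
 using P.D_compact compact_imp_bounded by blast

lemma inside_cases: "(polygon_interior k x = L & outside PD = R) | (polygon_interior k x = R & outside PD = L)"
proof -
 have 0: "0 < k" using k3 by simp
 have "outside PD \<in> components (- PD)"
  unfolding outside_in_components using connected_outside[OF bounded_PD] outside_bounded_nonempty[OF bounded_PD] by simp
 then obtain i j where "{i, j} \<in> C" "outside PD = P.left i j" using P.comp_left[of "outside PD"] 0 by auto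
 then have "outside PD = L | outside PD = R" using C_iff left_sc left_pr by metis
 moreover have "inside PD = (L \<union> R) - outside PD" using inside_outside[of PD] LR_comp(4) by blast
 ultimately show ?thesis unfolding polygon_interior_def using LR_comp(3) by blast
qed

lemma angle_L: assumes i: "i < k" and L: "polygon_interior k x = L" shows "interior_angle k x i = P.alpha i (sc i)"
proof -
 have e: "{i, sc i} \<in> C" using C_iff i by blast
 let ?t = "P.alpha i (sc i)"
 have a: "ccw_angle (x (sc i) - x i) (x (pr i) - x i) = ?t" unfolding P.alpha_def nx_C[OF i] ..
 obtain r where r: "r > 0" "!!\<rho> \<theta>. 0 < \<rho> ==> \<rho> < r ==> 0 < \<theta> ==> \<theta> < ?t ==> P.pol i (sc i) \<rho> \<theta> \<in> P.left i (sc i)"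
  using P.sector_left[OF e] by blast
 have "\<forall>\<^sub>F t in at_right (0::real). 0 < t & t < r" using eventually_at_right_real[of 0 r] r(1) by (auto elim: eventually_mono)
 then have "\<forall>\<^sub>F t in at_right 0. x i + complex_of_real t * ((x (sc i) - x i) * cis (?t / 2)) \<in> polygon_interior k x"
 proof eventually_elim
  case (elim t)
  then show ?case using r(2)[of t "?t / 2"] P.alpha_bounds[OF e] left_sc[OF i] L by (simp add: mult_ac)
 qed
 then show ?thesis unfolding interior_angle_def Let_def a by simp
qed

lemma angle_R: assumes i: "i < k" and L: "polygon_interior k x = R" shows "interior_angle k x i = P.alpha i (pr i)"
proof -
 have e: "{i, sc i} \<in> C" using C_iff i by blast
 let ?t = "P.alpha i (sc i)"
 have a: "ccw_angle (x (sc i) - x i) (x (pr i) - x i) = ?t" unfolding P.alpha_def nx_C[OF i] ..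
 obtain r where r: "r > 0" "!!\<rho> \<theta>. 0 < \<rho> ==> \<rho> < r ==> 0 < \<theta> ==> \<theta> < ?t ==> P.pol i (sc i) \<rho> \<theta> \<in> P.left i (sc i)"
  using P.sector_left[OF e] by blast
 have "\<forall>\<^sub>F t in at_right (0::real). 0 < t & t < r" using eventually_at_right_real[of 0 r] r(1) by (auto elim: eventually_mono)
 then have ev: "\<forall>\<^sub>F t in at_right 0. x i + complex_of_real t * ((x (sc i) - x i) * cis (?t / 2)) ~: polygon_interior k x"
 proof eventually_elim
  case (elim t)
  have "x i + complex_of_real t * ((x (sc i) - x i) * cis (?t / 2)) \<in> L"
   using r(2)[of t "?t / 2"] elim P.alpha_bounds[OF e] left_sc[OF i] by (simp add: mult_ac)
  then show ?case using LR_comp(3) L by blast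
 qed
 have "\<not> (\<forall>\<^sub>F t in at_right 0. x i + complex_of_real t * ((x (sc i) - x i) * cis (?t / 2)) \<in> polygon_interior k x)"
 proof
  assume "\<forall>\<^sub>F t in at_right 0. x i + complex_of_real t * ((x (sc i) - x i) * cis (?t / 2)) \<in> polygon_interior k x"
  then have "\<forall>\<^sub>F t in at_right (0::real). False" using ev by eventually_elim simp
  then show False by simp
 qed
 then show ?thesis unfolding interior_angle_def Let_def a using alpha_pr[OF i] by simp
qed

text \<open>\<open>s\<close> selects at each corner the side with the interior on its left, so later
  arguments need no distinction between clockwise and counterclockwise polygons.\<close>

lemma orientation:
 obtains s where "!!i. i < k ==> {i, s i} \<in> C" "!!i. i < k ==> P.left i (s i) = polygon_interior k x"
  "!!i. i < k ==> interior_angle k x i = P.alpha i (s i)" "!!i. i < k ==> P.left i (P.rs.nx i (s i)) = outside PD"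
 using inside_cases
proof
 assume h: "polygon_interior k x = L & outside PD = R"
 show thesis by (rule that[of sc]) (use h C_iff left_sc left_pr angle_L nx_C in auto)
next
 assume h: "polygon_interior k x = R & outside PD = L"
 show thesis by (rule that[of pr]) (use h C_iff left_sc left_pr angle_R nx_C in auto)
qed

lemma PD_connected: "connected PD"
proof -
 have 0: "0 < k" using k3 by simp
 have "connected (\<Union>i\<in>{..m}. closed_segment (x i) (x (sc i)))" if "m < k" for m
  using that
 proof (induction m)
  case 0 then show ?case by simp
 next
  case (Suc m)
  then have m: "m < k" "sc m = Suc m" using sc_eq[of m] by auto
  have "x (sc m) \<in> closed_segment (x m) (x (sc m))" by simp
  then have "x (Suc m) \<in> (\<Union>i\<in>{..m}. closed_segment (x i) (x (sc i)))" using m by (intro UN_I[of m]) (simp_all only: atMost_iff order_refl)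
  moreover have "x (Suc m) \<in> closed_segment (x (Suc m)) (x (sc (Suc m)))" by (rule ends_in_segment)
  ultimately have "(\<Union>i\<in>{..m}. closed_segment (x i) (x (sc i))) \<inter> closed_segment (x (Suc m)) (x (sc (Suc m))) ~= {}" by blast
  from connected_Un[OF Suc.IH[OF m(1)] connected_segment(1) this]
  show ?case by (simp only: atMost_Suc UN_insert Un_commute)
 qed
 from this[of "k - 1"] have "connected (\<Union>i\<in>{..k - 1}. closed_segment (x i) (x (sc i)))" using 0 by simp
 moreover have "PD = (\<Union>i\<in>{..k - 1}. closed_segment (x i) (x (sc i)))"
 proof (intro equalityI subsetI)
  fix y assume "y \<in> PD"
  then obtain i j where ij: "{i, j} \<in> C" "y \<in> closed_segment (x i) (x j)" by (rule P.D_cases)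
  then have h: "i < k" "j = sc i | j = pr i" using C_iff by blast+
  have "\<exists>m<k. y \<in> closed_segment (x m) (x (sc m))"
  proof (cases "j = sc i")
   case True then show ?thesis using h ij by blast
  next
   case False
   then have "j < k" "sc j = i" using h sc_pr[OF h(1)] by auto
   then show ?thesis using ij(2) by (intro exI[of _ j]) (simp add: closed_segment_commute)
  qed
  then show "y \<in> (\<Union>i\<in>{..k - 1}. closed_segment (x i) (x (sc i)))" using 0 by (metis UN_I atMost_iff less_Suc_eq_le Suc_pred')
 next
  fix y assume "y \<in> (\<Union>i\<in>{..k - 1}. closed_segment (x i) (x (sc i)))"
  then obtain i where "i <= k - 1" and iy: "y \<in> closed_segment (x i) (x (sc i))" by blast
  then have i: "i < k" "y \<in> closed_segment (x i) (x (sc i))" using 0 by (linarith, blast)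
  then show "y \<in> PD" using P.seg_sub[of i "sc i"] C_iff by blast
 qed
 ultimately show ?thesis by simp
qed

lemma interior_connected_frontier: "connected (frontier (polygon_interior k x))"
 using inside_cases LR_comp(1,2) connected_frontier_component_complement[OF PD_connected] by metis

lemma frontier_interior: "frontier (polygon_interior k x) <= PD"
 unfolding polygon_interior_def by (rule frontier_inside_subset[OF P.D_closed])

text \<open>Extreme points of the hull are corners, and a corner with interior angle at least pi is
  not extreme. With fewer than three extreme points all corners would lie on one segment.\<close>

lemma three_convex:
 assumes gp: "!!i j l. i < k ==> j < k ==> l < k ==> i ~= j ==> j ~= l ==> i ~= l ==> cr (x j - x i) (x l - x i) ~= 0"
 shows "3 <= card {i. i < k & interior_angle k x i < pi}"
proof -
 let ?H = "convex hull (x ` {..<k})"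
 let ?T = "{y. y extreme_point_of ?H}"
 obtain s where s: "!!i. i < k ==> {i, s i} \<in> C" "!!i. i < k ==> P.left i (s i) = polygon_interior k x"
  "!!i. i < k ==> interior_angle k x i = P.alpha i (s i)" using orientation by metis
 have "- ?H <= outside PD" by (rule outside_subset_convex[OF convex_convex_hull P.D_hull])
 then have inH: "polygon_interior k x <= ?H" unfolding polygon_interior_def inside_outside by blast
 have conv: "interior_angle k x i < pi" if i: "i < k" and ext: "x i extreme_point_of ?H" for i
 proof (rule ccontr)
  assume "\<not> interior_angle k x i < pi"
  then have ge: "P.alpha i (s i) >= pi" using s(3)[OF i] by simp
  note e = s(1)[OF i]
  let ?n = "P.rs.nx i (s i)"
  have en: "{i, ?n} \<in> C" by (rule P.rs.nx_edge[OF e])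
  let ?d = "x (s i) - x i"
  have "P.alpha i (s i) ~= pi"
  proof
   assume "P.alpha i (s i) = pi"
   then have "x ?n - x i = of_real (norm (x ?n - x i) / norm ?d) * cis pi * ?d"
    using ccw_polar(3)[OF P.dir0[OF e] P.dir0[OF en]] unfolding P.alpha_def by simp
   then have "x ?n - x i = of_real (- (norm (x ?n - x i) / norm ?d)) * ?d" by simp
   then have "cr ?d (x ?n - x i) = 0" by (metis cr_scale(2) cr_self mult_zero_right)
   moreover have "s i ~= ?n" using e i nx_C[OF i] C_iff[of i "s i"] sc_pr[OF i] by metis
   ultimately show False using gp[of i "s i" ?n] i P.edgeD[OF e] P.edgeD[OF en] by auto
  qed
  then have gt: "P.alpha i (s i) > pi" using ge by simp
  obtain r where r: "r > 0" "!!\<rho> \<theta>. 0 < \<rho> ==> \<rho> < r ==> 0 < \<theta> ==> \<theta> < P.alpha i (s i) ==> P.pol i (s i) \<rho> \<theta> \<in> P.left i (s i)"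
   using P.sector_left[OF e] by blast
  \<comment> \<open>An angle chosen so that \<theta> and \<theta> + pi both lie inside the sector:
    the corner is then the midpoint of two points of the interior.\<close>
  define \<theta> where "\<theta> = (P.alpha i (s i) - pi) / 2"
  have th: "0 < \<theta>" "\<theta> + pi < P.alpha i (s i)" "\<theta> < P.alpha i (s i)"
  proof -
   have "0 < P.alpha i (s i)" using P.alpha_bounds[OF e] by blast
   then show "0 < \<theta>" "\<theta> + pi < P.alpha i (s i)" "\<theta> < P.alpha i (s i)"
    using gt by (simp_all add: \<theta>_def field_simps add_pos_pos)
  qed
  let ?a = "P.pol i (s i) (r / 2) \<theta>" and ?b = "P.pol i (s i) (r / 2) (\<theta> + pi)"
  have "?a \<in> ?H" "?b \<in> ?H" using r(2)[of "r / 2" \<theta>] r(2)[of "r / 2" "\<theta> + pi"] add_pos_pos[OF th(1) pi_gt_zero] r(1) th s(2)[OF i] inH by auto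
  moreover have "x i \<in> open_segment ?a ?b"
  proof -
   have c: "cis (\<theta> + pi) = - cis \<theta>" by (simp add: complex_eq_iff)
   have "midpoint ?a ?b = x i" unfolding c by (simp add: midpoint_def scaleR_conv_of_real)
   moreover have "?a ~= ?b" unfolding c using r(1) P.dir0[OF e] by auto
   ultimately show ?thesis using midpoint_in_open_segment by metis
  qed
  ultimately show False using ext unfolding extreme_point_of_def by blast
 qed
 have sub: "?T <= x ` {i. i < k & interior_angle k x i < pi}"
 proof
  fix y assume y: "y \<in> ?T"
  then have "y \<in> x ` {..<k}" using extreme_point_of_convex_hull by blast
  then obtain i where "i < k" "y = x i" by auto
  then show "y \<in> x ` {i. i < k & interior_angle k x i < pi}" using conv y by blast
 qed
 then have finT: "finite ?T" by (rule finite_subset) simp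
 have "3 <= card ?T"
 proof (rule ccontr)
  assume "\<not> 3 <= card ?T"
  then consider "card ?T = 0" | "card ?T = 1" | "card ?T = 2" by linarith
  then have "\<exists>a b. ?T <= {a, b}"
  proof cases
   case 1 then show ?thesis using finT by simp
  next
   case 2 then show ?thesis using card_1_singletonE by (metis insertI1 singletonD subsetI)
  next
   case 3 then show ?thesis using card_2_iff by (metis order_refl)
  qed
  then obtain a b where "?T <= {a, b}" by blast
  then have "convex hull ?T <= closed_segment a b" unfolding segment_convex_hull by (rule hull_mono)
  moreover have "?H = convex hull ?T"
   by (rule Krein_Milman_Minkowski) (simp_all add: finite_imp_compact_convex_hull)
  ultimately have "x i \<in> closed_segment a b" if "i < k" for i using that hull_inc[of "x i" "x ` {..<k}" convex] by blast
  then have "cr (x 1 - x 0) (x 2 - x 0) = 0" using seg_collinear[of "x 0" a b "x 1" "x 2"] k3 by simp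
  then show False using gp[of 0 1 2] k3 by simp
 qed
 also have "card ?T <= card (x ` {i. i < k & interior_angle k x i < pi})" by (rule card_mono[OF _ sub]) simp
 also have "\<dots> <= card {i. i < k & interior_angle k x i < pi}" by (rule card_image_le) simp
 finally show ?thesis .
qed

end

text \<open>Every convex sector of the drawing inside \<open>F\<close> sits at a corner of the
  polygon with the same interior angle. Corner and direction determine the sector, so there are no
  more of them than convex corners.\<close>

lemma (in drawn) convex_sectors_pseudo_triangle:
 assumes F: "pseudo_triangle F"
 shows "card {d \<in> csec. left (fst d) (snd d) = F} <= 3"
proof -
 obtain k x where kx: "simple_polygon k x" "F = polygon_interior k x" "card {i. i < k & interior_angle k x i < pi} = 3"
  using F unfolding pseudo_triangle_def by blast
 interpret Q: polygon k x by unfold_locales (rule kx(1))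
 obtain s where s: "!!i. i < k ==> {i, s i} \<in> cycle_edges k" "!!i. i < k ==> Q.P.left i (s i) = polygon_interior k x"
  "!!i. i < k ==> interior_angle k x i = Q.P.alpha i (s i)" "!!i. i < k ==> Q.P.left i (Q.P.rs.nx i (s i)) = outside Q.PD"
  using Q.orientation by blast
 let ?I = "{i. i < k & interior_angle k x i < pi}"
 let ?S = "{d \<in> csec. left (fst d) (snd d) = F}"
 have main: "\<exists>i\<in>?I. p (fst d) = x i & (\<exists>c>0. p (snd d) - p (fst d) = of_real c * (x (s i) - x i))" if d: "d \<in> ?S" for d
 proof -
  obtain v j where dvj: "d = (v, j)" by (cases d)
  have e: "{v, j} \<in> E" and a: "alpha v j < pi" and lF: "left v j = F"
   using d dvj by (auto simp: csec_def darts_iff)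
  let ?k = "rs.nx v j"
  have ek: "{v, ?k} \<in> E" "{?k, v} \<in> E" using rs.nx_edge[OF e] by (simp_all add: insert_commute)
  let ?u = "p j - p v" and ?w = "p ?k - p v"
  have fF: "frontier F <= Q.PD" using Q.frontier_interior kx(2) by simp
  have s1: "seg v j <= Q.PD" using left_seg_closure[OF e] lF fF by simp
  have s2: "seg v ?k <= Q.PD" using left_seg_closure[OF ek(2)] left_nx[OF e] lF fF by (simp add: closed_segment_commute)
  have on: "p v + of_real t * (p l - p v) \<in> seg v l" if "0 < t" "t <= 1" for t l
   using that by (auto simp: closed_segment_def scaleR_conv_of_real algebra_simps intro!: exI[of _ t])
  define c where "c = norm ?w / norm ?u"
  have c: "c > 0" "?w = of_real c * cis (alpha v j) * ?u" "0 < alpha v j"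
   using ccw_polar[OF dir0[OF e] dir0[OF ek(1)]] dir0[OF e] dir0[OF ek(1)] by (simp_all add: c_def alpha_def)
  have pvD: "p v \<in> Q.PD" using s1 by auto
  show ?thesis
  proof (cases "p v \<in> x ` {..<k}")
   case True
   then obtain i where i: "i < k" "p v = x i" by auto
   obtain r where r: "r > 0" "!!y. y \<in> ball (x i) r \<inter> Q.PD ==> y ~= x i ==> \<exists>l c. {i, l} \<in> cycle_edges k & 0 < c & y = x i + of_real c * (x l - x i)"
    using Q.P.near_vertex[of i] i(1) by auto
   have ray: "\<exists>m b. {i, m} \<in> cycle_edges k & 0 < b & p l - p v = of_real b * (x m - x i)"
    if sl: "seg v l <= Q.PD" and l: "{v, l} \<in> E" for l
   proof -
    obtain t where t: "t > 0" "t <= 1" "p v + of_real t * (p l - p v) \<in> ball (x i) r"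
     using small_step[of "ball (x i) r" "p v" "p l - p v"] i(2) r(1) by auto
    have "p v + of_real t * (p l - p v) \<in> ball (x i) r \<inter> Q.PD" using t on[OF t(1,2)] sl by blast
    moreover have "p v + of_real t * (p l - p v) ~= x i" using t(1) dir0[OF l] i(2) by simp
    ultimately obtain m b where m: "{i, m} \<in> cycle_edges k" "0 < b" "p v + of_real t * (p l - p v) = x i + of_real b * (x m - x i)"
     using r(2) by blast
    then have "of_real t * (p l - p v) = of_real b * (x m - x i)" using i(2) by simp
    then have "p l - p v = of_real (b / t) * (x m - x i)" using t(1) by (simp add: field_simps)
    then show ?thesis using m t(1) by (intro exI[of _ m] exI[of _ "b / t"]) simp
   qed
   obtain m b where m: "{i, m} \<in> cycle_edges k" "0 < b" "?u = of_real b * (x m - x i)" using ray[OF s1 e] by blast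
   obtain m' b' where m': "{i, m'} \<in> cycle_edges k" "0 < b'" "?w = of_real b' * (x m' - x i)" using ray[OF s2 ek(1)] by blast
   let ?y = "x m - x i"
   have y0: "?y ~= 0" using Q.P.dir0[OF m(1)] .
   have "of_real b' * (x m' - x i) = of_real c * cis (alpha v j) * (of_real b * ?y)" using m'(3) c(2) m(3) by simp
   then have w: "x m' - x i = of_real (c * b / b') * cis (alpha v j) * ?y" using m'(2) by (simp add: field_simps)
   then have ccw: "ccw_angle ?y (x m' - x i) = alpha v j" using ccw_unique[OF y0, of "c * b / b'" "alpha v j"] c m(2) m'(2) a pi_gt_zero by simp
   have ne: "m' ~= m"
   proof
    assume "m' = m"
    moreover have "ccw_angle ?y ?y = 2 * pi" using y0 Arg2pi_of_real[of 1] by (simp add: ccw_angle_def)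
    ultimately show False using ccw a pi_gt_zero by simp
   qed
   have nm: "Q.P.rs.nx i m = m'" using m(1) m'(1) ne Q.nx_C[OF i(1)] Q.C_iff by metis
   have al: "Q.P.alpha i m = alpha v j" using ccw by (simp add: Q.P.alpha_def nm)
   \<comment> \<open>Otherwise the sector at the corner would open to the outside of the
     polygon.\<close>
   have "m = s i"
   proof (rule ccontr)
    assume "m ~= s i"
    then have "m = Q.P.rs.nx i (s i)" using m(1) s(1)[OF i(1)] Q.nx_C[OF i(1)] Q.C_iff by metis
    then have out: "Q.P.left i m = outside Q.PD" using s(4)[OF i(1)] by simp
    obtain r1 where r1: "r1 > 0" "!!\<rho> \<theta>. 0 < \<rho> ==> \<rho> < r1 ==> 0 < \<theta> ==> \<theta> < alpha v j ==> pol v j \<rho> \<theta> \<in> left v j"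
     using sector_left[OF e] by blast
    obtain r2 where r2: "r2 > 0" "!!\<rho> \<theta>. 0 < \<rho> ==> \<rho> < r2 ==> 0 < \<theta> ==> \<theta> < alpha v j ==> Q.P.pol i m \<rho> \<theta> \<in> Q.P.left i m"
     using Q.P.sector_left[OF m(1)] al by auto
    define \<rho> where "\<rho> = min (r1 / 2) (r2 / (2 * b))"
    have rho: "0 < \<rho>" "\<rho> < r1" "\<rho> * b < r2"
    proof -
     show "0 < \<rho>" "\<rho> < r1" using r1(1) r2(1) m(2) by (auto simp: \<rho>_def)
     have "\<rho> * b <= r2 / (2 * b) * b" using m(2) by (intro mult_right_mono) (auto simp: \<rho>_def)
     also have "\<dots> < r2" using m(2) r2(1) by simp
     finally show "\<rho> * b < r2" .
    qed
    have "pol v j \<rho> (alpha v j / 2) \<in> F" using r1(2)[of \<rho> "alpha v j / 2"] rho c(3) lF by simp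
    moreover have "pol v j \<rho> (alpha v j / 2) = Q.P.pol i m (\<rho> * b) (alpha v j / 2)" using m(3) i(2) by (simp add: mult_ac)
    moreover have "Q.P.pol i m (\<rho> * b) (alpha v j / 2) \<in> outside Q.PD" using r2(2)[of "\<rho> * b" "alpha v j / 2"] rho m(2) c(3) out by simp
    moreover have "F \<inter> outside Q.PD = {}" unfolding kx(2) polygon_interior_def by (rule inside_Int_outside)
    ultimately show False by (metis IntI empty_iff)
   qed
   then have "interior_angle k x i < pi" using s(3)[OF i(1)] al a by simp
   then show ?thesis using i m \<open>m = s i\<close> dvj by auto
  next
   \<comment> \<open>In the interior of a side both edges of the sector would run along that side,
     so its angle could not lie strictly between 0 and pi.\<close>
   case False
   obtain i l where il: "{i, l} \<in> cycle_edges k" "p v \<in> Q.P.kite i l" using Q.P.D_kite[OF pvD False] by blast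
   have para: "\<exists>b::real. p m - p v = of_real b * (x l - x i)" if sl: "seg v m <= Q.PD" for m
   proof -
    obtain t where t: "t > 0" "t <= 1" "p v + of_real t * (p m - p v) \<in> Q.P.kite i l"
     using small_step[OF Q.P.kite_open il(2)] by blast
    have on_seg: "y \<in> closed_segment (x i) (x l)" if "y \<in> Q.P.kite i l" "y \<in> Q.PD" for y
     using that Q.P.kite_sub[OF il(1)] Q.P.left_sub by blast
    have y: "p v + of_real t * (p m - p v) \<in> closed_segment (x i) (x l)" using on_seg[OF t(3)] on[OF t(1,2)] sl by blast
    obtain b1 where b1: "p v + of_real t * (p m - p v) = x i + of_real b1 * (x l - x i)" using Q.P.seg_points[OF y] by blast
    obtain b2 where b2: "p v = x i + of_real b2 * (x l - x i)" using Q.P.seg_points[OF on_seg[OF il(2) pvD]] by blast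
    have "of_real t * (p m - p v) = (p v + of_real t * (p m - p v)) - p v" by simp
    also have "\<dots> = (x i + of_real b1 * (x l - x i)) - (x i + of_real b2 * (x l - x i))" by (subst b1, subst b2) (rule refl)
    also have "\<dots> = of_real (b1 - b2) * (x l - x i)" by (simp add: algebra_simps)
    finally have "p m - p v = of_real ((b1 - b2) / t) * (x l - x i)" using t(1) by (simp add: field_simps)
    then show ?thesis by blast
   qed
   obtain b b' :: real where b: "?u = of_real b * (x l - x i)" "?w = of_real b' * (x l - x i)" using para[OF s1] para[OF s2] by blast
   have "cr ?u ?w = 0" unfolding b by (simp only: cr_scale cr_self mult_zero_right)
   moreover have "cr y (of_real c * cis \<theta> * y) = c * sin \<theta> * (norm y)\<^sup>2" for y \<theta>
    by (simp add: cr_def power2_norm_eq_inner inner_complex_def algebra_simps)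
   moreover have "sin (alpha v j) > 0" using c(3) a by (intro sin_gt_zero) auto
   ultimately show ?thesis using c(1,2) dir0[OF e] by simp
  qed
 qed
 then obtain g where g: "\<forall>d\<in>?S. g d \<in> ?I & p (fst d) = x (g d) & (\<exists>c>0. p (snd d) - p (fst d) = of_real c * (x (s (g d)) - x (g d)))"
  using bchoice[of ?S "%d i. i \<in> ?I & p (fst d) = x i & (\<exists>c>0. p (snd d) - p (fst d) = of_real c * (x (s i) - x i))"] by blast
 have "inj_on g ?S"
 proof (rule inj_onI)
  fix d d' assume d: "d \<in> ?S" "d' \<in> ?S" "g d = g d'"
  have e: "{fst d, snd d} \<in> E" "{fst d', snd d'} \<in> E" using d by (simp_all add: csec_def darts_iff)
  note gd = bspec[OF g d(1)] and gd' = bspec[OF g d(2)]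
  have "p (fst d) = p (fst d')" using gd gd' d(3) by simp
  then have f: "fst d = fst d'" using inj edgeD[OF e(1)] edgeD[OF e(2)] by blast
  obtain c where c0: "c > 0" "p (snd d) - p (fst d) = of_real c * (x (s (g d)) - x (g d))" using gd by blast
  obtain c' where "c' > 0" "p (snd d') - p (fst d') = of_real c' * (x (s (g d')) - x (g d'))" using gd' by blast
  then have c1: "c' > 0" "p (snd d') - p (fst d) = of_real c' * (x (s (g d)) - x (g d))" unfolding f d(3) by blast+
  note c = c0 c1
  have "p (snd d') - p (fst d) = of_real (c' / c) * (p (snd d) - p (fst d))" using c by simp
  then have "snd d' = snd d" using same_dir[OF e(1), of "snd d'" "c' / c"] e(2) f c by simp
  then show "d = d'" using f by (simp add: prod_eq_iff)
 qed
 moreover have "g ` ?S <= ?I" using g by blast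
 ultimately have "card ?S <= card ?I" by (intro card_inj_on_le) auto
 then show ?thesis using kx(3) by simp
qed

section \<open>Pointed pseudo-triangulations\<close>

context drawn
begin

lemma D_mem: "e \<in> E ==> convex hull (p ` e) <= D"
 by (auto simp: drawing_def)

text \<open>The outside is connected and unbounded, so in order to meet the hull it would have to
  cross its frontier, which is drawn.\<close>

lemma outside_hull:
 assumes fr: "frontier (convex hull (p ` V)) <= D"
 shows "outside D = - (convex hull (p ` V))"
proof -
 let ?H = "convex hull (p ` V)"
 have bd: "bounded D" using D_compact compact_imp_bounded by blast
 have "- ?H <= outside D" by (rule outside_subset_convex[OF convex_convex_hull D_hull])
 moreover have "outside D \<inter> ?H = {}"
 proof (rule ccontr)
  assume ne: "outside D \<inter> ?H ~= {}"
  have "bounded ?H" by (rule finite_imp_bounded_convex_hull) (simp add: finV)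
  then have "outside D - ?H ~= {}" using outside_unbounded bounded_subset by blast
  then have "outside D \<inter> frontier ?H ~= {}" using connected_Int_frontier[OF connected_outside[OF bd] ne] by simp
  then show False using fr outside_no_overlap[of D] by blast
 qed
 ultimately show ?thesis by blast
qed

lemma frontier_hull_connected: "connected (frontier (convex hull (p ` V)))"
 by (rule connected_frontier_simple)
  (simp_all add: convex_connected connected_complement_bounded_convex finite_imp_bounded_convex_hull finV)

text \<open>The bisector of a convex sector starts out inside the triangle spanned by its two edges,
  hence inside the hull, whereas an unbounded face is the complement of the hull.\<close>

lemma convex_sector_bounded:
 assumes fr: "frontier (convex hull (p ` V)) <= D" and e: "{v, j} \<in> E" and a: "alpha v j < pi"
 shows "bounded (left v j)"
proof (rule ccontr)
 assume "\<not> bounded (left v j)"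
 then have out: "left v j = - (convex hull (p ` V))" using outer_left[OF e] outside_hull[OF fr] by simp
 let ?k = "rs.nx v j"
 have ek: "{v, ?k} \<in> E" by (rule rs.nx_edge[OF e])
 let ?u = "p j - p v" and ?w = "p ?k - p v" and ?t = "alpha v j / 2"
 define c where "c = norm ?w / norm ?u"
 have c: "c > 0" "?w = of_real c * cis (alpha v j) * ?u" and a0: "0 < alpha v j"
  using ccw_polar[OF dir0[OF e] dir0[OF ek]] dir0[OF e] dir0[OF ek] by (simp_all add: c_def alpha_def)
 have C: "cos ?t > 0" using a a0 by (intro cos_gt_zero_pi) auto
 obtain r where r: "r > 0" "!!\<rho> \<theta>. 0 < \<rho> ==> \<rho> < r ==> 0 < \<theta> ==> \<theta> < alpha v j ==> pol v j \<rho> \<theta> \<in> left v j"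
  using sector_left[OF e] by blast
 \<comment> \<open>The second bound makes the point on the bisector, which has coefficients
   \<open>x\<close> and \<open>x / c\<close> along the two edges, a convex combination of the three
   vertices.\<close>
 define \<rho> where "\<rho> = min (r / 2) (2 * cos ?t / (1 + 1 / c))"
 define x where "x = \<rho> / (2 * cos ?t)"
 have c1: "1 + 1 / c > 0" using c(1) by (simp add: add_pos_pos)
 have rho: "0 < \<rho>" "\<rho> < r" "\<rho> <= 2 * cos ?t / (1 + 1 / c)" using r(1) C c1 by (auto simp: \<rho>_def)
 have x: "x > 0" "x + x / c <= 1"
 proof -
  show "x > 0" using rho(1) C by (simp add: x_def)
  have "\<rho> * (1 + 1 / c) <= 2 * cos ?t" using rho(3) c1 by (simp add: pos_le_divide_eq)
  then have "x * (1 + 1 / c) <= 1" using C by (simp add: x_def pos_divide_le_eq)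
  then show "x + x / c <= 1" by (simp add: distrib_left)
 qed
 have "1 + cis (alpha v j) = 2 * of_real (cos ?t) * cis ?t"
 proof -
  have "cis ?t * cis ?t = cis (alpha v j)" by (simp add: cis_mult)
  moreover have "cis ?t * cis (- ?t) = 1" by (simp add: cis_mult)
  moreover have "cis ?t + cis (- ?t) = 2 * of_real (cos ?t)" by (simp add: complex_eq_iff)
  ultimately show ?thesis by (metis add.commute distrib_left mult.commute)
 qed
 then have "of_real \<rho> * cis ?t = of_real x * (1 + cis (alpha v j))" using C by (simp add: x_def)
 then have "of_real \<rho> * cis ?t * ?u = of_real x * ?u + of_real x * (cis (alpha v j) * ?u)" by (simp add: algebra_simps)
 moreover have "cis (alpha v j) * ?u = of_real (1 / c) * ?w" using c by simp
 ultimately have "of_real \<rho> * cis ?t * ?u = of_real x * ?u + of_real x * (of_real (1 / c) * ?w)" by (simp only:)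
 then have y: "pol v j \<rho> ?t = p v + x *\<^sub>R (p j - p v) + (x / c) *\<^sub>R (p ?k - p v)" by (simp add: scaleR_conv_of_real)
 have "pol v j \<rho> ?t \<in> convex hull {p v, p j, p ?k}"
  unfolding convex_hull_3_alt y using x c(1) by (intro CollectI exI[of _ x] exI[of _ "x / c"]) simp
 moreover have "convex hull {p v, p j, p ?k} <= convex hull (p ` V)"
  by (rule hull_mono) (use edgeD[OF e] edgeD[OF ek] in auto)
 moreover have "pol v j \<rho> ?t \<in> left v j" using r(2) rho a0 by simp
 ultimately show False using out by blast
qed

end

text \<open>Sparsity and the upper bound on \<open>card E\<close> come from stress-freeness. For the
  lower bound the convex sectors lie in interior faces, at most three in each, so
  \<open>2 * card E - card V <= 3 * (card E + 1 - card V)\<close>.\<close>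

theorem pointed_pseudo_triangulation_laman:
 assumes sg: "simple_graph V E" and ppt: "pointed_pseudo_triangulation V E p"
 shows "laman V E"
proof -
 interpret sgraph V E using sg by unfold_locales (auto simp: simple_graph_def)
 have n: "2 <= card V" using sg by (simp add: simple_graph_def)
 have pa: "pointed_at E p v" if "v \<in> V" for v using ppt that by (simp add: pointed_pseudo_triangulation_def)
 have nce: "noncrossing_embedding V E p" and hull: "(\<Union>e\<in>outer_edges V E p. convex hull (p ` e)) = frontier (convex hull (p ` V))"
  and tri: "!!F. F \<in> interior_faces V E p ==> pseudo_triangle F"
  using ppt by (simp_all add: pointed_pseudo_triangulation_def pseudo_triangulation_def)
 interpret drawn V E p
 proof unfold_locales
  fix v assume "v \<in> V"
  then show "nbrs E v ~= {}" using pa[of v] by (auto simp: pointed_at_def consecutive_at_def nbrs_def)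
 qed (rule nce)
 have V: "V ~= {}" using n by auto
 have pt: "ptd E p v" if "v \<in> V" for v using pa[OF that] alpha_ptd unfolding pointed_iff by blast
 have sf: "stress_free V E p" by (rule pointed_stress_free[OF pt])
 have inj: "inj_on p V" using nce by (simp add: noncrossing_embedding_def)
 have sp: "card (induced E W) + 3 <= 2 * card W" if "W <= V" "2 <= card W" for W
  by (rule stress_free_sparse[OF sf inj that])
 have "induced E V = E" using edge_sub by (auto simp: induced_def)
 then have up: "card E + 3 <= 2 * card V" using sp[of V] n by simp
 have fr: "frontier (convex hull (p ` V)) <= D"
  unfolding hull[symmetric] using D_mem by (auto simp: outer_edges_def)
 \<comment> \<open>Interior faces are polygon interiors with connected frontier; the edges along the
   unbounded face lie in the frontier of the hull, which is connected too.\<close>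
 have con: "conn V E"
 proof (rule connI)
  fix v j assume e: "{v, j} \<in> E"
  show "\<exists>C. connected C & C <= D & (\<forall>k l. {k, l} \<in> E --> left k l = left v j --> seg k l <= C)"
  proof (cases "bounded (left v j)")
   case True
   then have "pseudo_triangle (left v j)" using tri e interior_left by blast
   then obtain k x where kx: "simple_polygon k x" "left v j = polygon_interior k x" unfolding pseudo_triangle_def by blast
   then interpret Q: polygon k x by unfold_locales
   have "connected (frontier (left v j))" using Q.interior_connected_frontier kx(2) by simp
   moreover have "frontier (left v j) <= D" by (rule frontier_of_components_closed_complement[OF D_closed left_component[OF e]])
   moreover have "seg k l <= frontier (left v j)" if "{k, l} \<in> E" "left k l = left v j" for k l
    using left_seg_closure[OF that(1)] that(2) by simp
   ultimately show ?thesis by blast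
  next
   case False
   have "seg k l <= frontier (convex hull (p ` V))" if kl: "{k, l} \<in> E" "left k l = left v j" for k l
   proof -
    have "left k l = outer_face V E p" using outer_left[OF e False] kl(2) by (simp add: outer_face_def)
    then have "convex hull (p ` {k, l}) <= frontier (outer_face V E p)" unfolding segment_2 using left_seg_closure[OF kl(1)] by simp
    then have "{k, l} \<in> outer_edges V E p" using kl(1) by (simp add: outer_edges_def)
    then have "convex hull (p ` {k, l}) <= frontier (convex hull (p ` V))" unfolding hull[symmetric] by blast
    then show ?thesis unfolding segment_2 .
   qed
   then show ?thesis using frontier_hull_connected fr by blast
  qed
 qed
 let ?I = "interior_faces V E p"
 let ?S = "%F. {d \<in> csec. left (fst d) (snd d) = F}"
 have fI: "finite ?I" by (rule fin_interior[OF V])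
 have "csec <= (\<Union>F\<in>?I. ?S F)"
 proof
  fix d assume d: "d \<in> csec"
  then have e: "{fst d, snd d} \<in> E" "alpha (fst d) (snd d) < pi" by (simp_all add: csec_def darts_iff)
  have "left (fst d) (snd d) \<in> ?I" using convex_sector_bounded[OF fr e] interior_left[OF e(1)] by blast
  then show "d \<in> (\<Union>F\<in>?I. ?S F)" using d by blast
 qed
 moreover have fS: "finite (\<Union>F\<in>?I. ?S F)" using fI by (auto simp: csec_def)
 ultimately have "card csec <= card (\<Union>F\<in>?I. ?S F)" by (intro card_mono)
 also have "\<dots> <= (\<Sum>F\<in>?I. card (?S F))" by (rule card_UN_le[OF fI])
 also have "\<dots> <= of_nat (card ?I) * 3" by (rule sum_bounded_above) (use convex_sectors_pseudo_triangle tri in blast)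
 finally have "card csec <= card ?I * 3" by simp
 then have "card E + 3 = 2 * card V" using card_csec[OF pt] faces_le[OF V con] up by linarith
 then show ?thesis unfolding laman_def using sp n unfolding induced_def by (metis (no_types, lifting) add_diff_cancel_right' diff_add_inverse2 le_diff_conv2 add_leD2 diff_le_mono)
qed

section \<open>Pointed drawings of Laman graphs\<close>

lemma (in lgraph) not_isolated:
 assumes v: "v \<in> V" shows "nbrs E v ~= {}"
proof -
 have "{v} ~= V" using card_V by auto
 then have "\<exists>x\<in>{v}. \<exists>y\<in>V - {v}. {x, y} \<in> E" using connected[unfolded conn_def, rule_format, of "{v}"] v by simp
 then show ?thesis by (auto simp: nbrs_def)
qed

text \<open>General position makes edges with a common endpoint meet only there, since their
  directions are not parallel.\<close>

lemma (in lgraph) drawn_genpos: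
 assumes gp: "genpos V p" and nc: "ncross E p"
 shows "drawn V E p"
proof unfold_locales
 have meet: "closed_segment (p v) (p j) \<inter> closed_segment (p v) (p l) <= {p v}"
  if "{v, j} \<in> E" "{v, l} \<in> E" "j ~= l" for v j l
 proof
  fix y assume y: "y \<in> closed_segment (p v) (p j) \<inter> closed_segment (p v) (p l)"
  obtain a :: real where a: "y = p v + of_real a * (p j - p v)" using y
   by (auto simp: closed_segment_def scaleR_conv_of_real algebra_simps)
  obtain b :: real where b: "y = p v + of_real b * (p l - p v)" using y
   by (auto simp: closed_segment_def scaleR_conv_of_real algebra_simps)
  have "of_real a * (p j - p v) = of_real b * (p l - p v)" using a b by (metis add_left_imp_eq)
  then have "cr (p j - p v) (of_real b * (p l - p v)) = cr (p j - p v) (of_real a * (p j - p v))" by simp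
  then have "b * cr (p j - p v) (p l - p v) = 0" by (simp add: cr_scale)
  moreover have "cr (p j - p v) (p l - p v) ~= 0"
   using genposD[OF gp, of v j l] edgeD that by (auto simp: orient_def)
  ultimately show "y \<in> {p v}" using b by simp
 qed
 have "convex hull (p ` e) \<inter> convex hull (p ` f) = p ` (e \<inter> f)" if ef: "e \<in> E" "f \<in> E" "e ~= f" for e f
 proof (cases "e \<inter> f = {}")
  case True
  then show ?thesis using nc ef unfolding ncross_def by auto
 next
  case False
  then obtain v where v: "v \<in> e" "v \<in> f" by blast
  obtain j where j: "e = {v, j}" using edge_ex[OF ef(1)] v(1) by (metis insert_commute insertE singletonD)
  obtain l where l: "f = {v, l}" using edge_ex[OF ef(2)] v(2) by (metis insert_commute insertE singletonD)
  have jl: "j ~= l" using ef(3) j l by auto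
  then have A: "e \<inter> f = {v}" using edgeD[of v j] edgeD[of v l] ef j l by auto
  have B: "closed_segment (p v) (p j) \<inter> closed_segment (p v) (p l) = {p v}" using meet[of v j l] ef j l jl by auto
  show ?thesis unfolding A unfolding j l segment_2 B by simp
 qed
 then show "noncrossing_embedding V E p" using gp by (simp add: noncrossing_embedding_def genpos_def)
qed (rule not_isolated)

text \<open>A unit of flow from \<open>s\<close> to \<open>t\<close> in place of a path: the set of
  vertices \<open>t\<close> that can be reached is closed under edges.\<close>

lemma (in sgraph) unit_flow:
 assumes con: "conn V E" and s: "s \<in> V" and t: "t \<in> V"
 shows "\<exists>\<omega> :: 'a => 'a => real. (\<forall>v j. \<omega> j v = - \<omega> v j) &
  (\<forall>v\<in>V. (\<Sum>j\<in>nbrs E v. \<omega> v j) = (if v = s then 1 else 0) - (if v = t then 1 else 0))" (is "?P t")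
proof -
 define K where "K = {t \<in> V. ?P t}"
 have sK: "s \<in> K" unfolding K_def using s by (auto intro!: exI[of _ "%_ _. 0"])
 have "K = V"
 proof (rule ccontr)
  assume "K ~= V"
  moreover have "K <= V" unfolding K_def by (rule Collect_subset)
  moreover have "K ~= {}" using sK by (metis empty_iff)
  ultimately have "\<exists>x\<in>K. \<exists>y\<in>V - K. {x, y} \<in> E" using con[unfolded conn_def, rule_format, of K] by blast
  then obtain x y where xy: "x \<in> K" "y \<in> V - K" "{x, y} \<in> E" by blast
  have ne: "x ~= y" using edgeD[OF xy(3)] by blast
  obtain \<omega> :: "'a => 'a => real" where w: "\<forall>v j. \<omega> j v = - \<omega> v j"
   "\<forall>v\<in>V. (\<Sum>j\<in>nbrs E v. \<omega> v j) = (if v = s then 1 else 0) - (if v = x then 1 else 0)" using xy(1) unfolding K_def by blast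
  define \<eta> :: "'a => 'a => real" where "\<eta> v j = (if v = x & j = y then 1 else 0) - (if v = y & j = x then 1 else 0)" for v j
  have "(\<Sum>j\<in>nbrs E v. \<eta> v j) = (if v = x then 1 else 0) - (if v = y then 1 else 0)" for v
  proof -
   have "(\<Sum>j\<in>nbrs E v. \<eta> v j) = (\<Sum>j\<in>nbrs E v. if j = y then (if v = x then 1 else 0) else 0) - (\<Sum>j\<in>nbrs E v. if j = x then (if v = y then 1 else 0) else 0)"
    unfolding \<eta>_def sum_subtractf[symmetric] by (rule sum.cong) auto
   also have "\<dots> = (if v = x then 1 else 0) - (if v = y then 1 else 0)"
    using xy(3) ne by (simp add: mem_nbrs insert_commute)
   finally show ?thesis .
  qed
  then have A: "\<forall>v\<in>V. (\<Sum>j\<in>nbrs E v. \<omega> v j + \<eta> v j) = (if v = s then 1 else 0) - (if v = y then 1 else 0)"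
   using w(2) by (simp add: sum.distrib)
  have B: "\<forall>v j. \<omega> j v + \<eta> j v = - (\<omega> v j + \<eta> v j)"
  proof (intro allI)
   fix v j show "\<omega> j v + \<eta> j v = - (\<omega> v j + \<eta> v j)" using w(1)[rule_format, of v j] by (simp add: \<eta>_def conj_commute)
  qed
  have "?P y" by (rule exI[of _ "%v j. \<omega> v j + \<eta> v j"], rule conjI[OF B A])
  then have "y \<in> K" unfolding K_def using xy(2) by (intro CollectI conjI) blast+
  then show False using xy(2) by blast
 qed
 then have "t \<in> K" using t by simp
 then show ?thesis unfolding K_def by (elim CollectE conjE)
qed

locale pointed_drawing = drawn V E p + lgraph V E for V :: "'a set" and E and p +
 assumes gp: "genpos V p" and pt: "!!v. v \<in> V ==> ptd E p v"
begin

lemma orient_ne: "i \<in> V ==> j \<in> V ==> k \<in> V ==> i ~= j ==> j ~= k ==> i ~= k ==> cr (p j - p i) (p k - p i) ~= 0"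
 using genposD[OF gp] unfolding orient_def .

lemma V_ne: "V ~= {}"
 using card_V by auto

text \<open>A path from \<open>a\<close> to \<open>b\<close> avoiding \<open>w\<close>, closed up through \<open>w\<close>, separates the two sectors.\<close>
lemma sectors_separated:
 assumes n: "3 <= card V" and e: "{w, a} \<in> E" "{w, b} \<in> E" and ne: "a ~= b"
 shows "left w a ~= left w b"
proof
 assume eq: "left w a = left w b"
 have wV: "w \<in> V" "a \<in> V - {w}" "b \<in> V - {w}" using edgeD[OF e(1)] edgeD[OF e(2)] by auto
 let ?X = "V - {w}"
 interpret X: sgraph ?X "induced E ?X" by (rule sgraph_induced) blast
 obtain \<omega> :: "'a => 'a => real" where w: "!!v j. \<omega> j v = - \<omega> v j"
  "!!v. v \<in> ?X ==> (\<Sum>j\<in>nbrs (induced E ?X) v. \<omega> v j) = (if v = a then 1 else 0) - (if v = b then 1 else 0)"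
  using X.unit_flow[OF conn_remove[OF wV(1) n] wV(2,3)] by blast
 \<comment> \<open>The unit flow from \<open>a\<close> to \<open>b\<close> that avoids
   \<open>w\<close> is closed up by one unit from \<open>w\<close> to \<open>a\<close> and one unit
   from \<open>b\<close> back to \<open>w\<close>.\<close>
 define \<phi> :: "'a => 'a => real" where "\<phi> v j = (if v = w then (if j = a then 1 else 0) - (if j = b then 1 else 0)
  else if j = w then (if v = b then 1 else 0) - (if v = a then 1 else 0) else \<omega> v j)" for v j
 have fl: "flow V E \<phi>" unfolding flow_def
 proof (intro conjI allI impI ballI)
  fix v j assume "{v, j} \<in> E"
  then show "\<phi> j v = - \<phi> v j" using w(1)[of v j] edgeD[of v j] wV by (auto simp: \<phi>_def)
 next
  fix v assume v: "v \<in> V"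
  show "(\<Sum>j\<in>nbrs E v. \<phi> v j) = 0"
  proof (cases "v = w")
   case True
   then have "(\<Sum>j\<in>nbrs E v. \<phi> v j) = (\<Sum>j\<in>nbrs E w. if j = a then 1 else 0) - (\<Sum>j\<in>nbrs E w. if j = b then 1 else 0)"
    by (simp add: \<phi>_def sum_subtractf)
   then show ?thesis using e by (simp add: mem_nbrs)
  next
   case False
   then have vX: "v \<in> ?X" using v by simp
   have nb: "nbrs (induced E ?X) v = nbrs E v - {w}" unfolding induced_nbrs[OF vX] using nbrs_sub by blast
   have s1: "(\<Sum>j\<in>nbrs E v - {w}. \<phi> v j) = (if v = a then 1 else 0) - (if v = b then 1 else 0)"
    unfolding w(2)[OF vX, symmetric] nb by (rule sum.cong) (use False in "auto simp: \<phi>_def")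
   show ?thesis
   proof (cases "w \<in> nbrs E v")
    case True
    then show ?thesis using s1 False by (simp add: sum.remove[of _ w] \<phi>_def)
   next
    case nw: False
    then have "v ~= a" "v ~= b" using e by (auto simp: mem_nbrs insert_commute)
    then show ?thesis using s1 nw by simp
   qed
  qed
 qed
 define g where "g j = winding V E p \<phi> (base w j)" for j
 have step: "g (rs.nx w j) - g j = \<phi> w (rs.nx w j)" if "j \<in> nbrs E w" for j
 proof -
  have j: "{w, j} \<in> E" using that by (simp add: mem_nbrs)
  have k: "{w, rs.nx w j} \<in> E" "{rs.nx w j, w} \<in> E" using rs.nx_edge[OF j] by (simp_all add: insert_commute)
  have "base (rs.nx w j) w \<in> left w j" using base_left[OF k(2)] left_nx[OF j] by simp
  then have "winding V E p \<phi> (base (rs.nx w j) w) = g j" unfolding g_def using winding_left[OF fl j _ base_left[OF j]] by blast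
  then show ?thesis using winding_left_jump[OF fl k(1)] by (simp add: g_def)
 qed
 obtain B where B: "\<forall>j\<in>nbrs E w. g j = B + (\<Sum>l | l \<in> nbrs E w & dang w l <= dang w j. \<phi> w l)"
  using rs.cyc.prefix_sum[of w g "\<phi> w"] step by blast
 have S: "(\<Sum>l | l \<in> nbrs E w & dang w l <= dang w j. \<phi> w l) = (if dang w a <= dang w j then 1 else 0) - (if dang w b <= dang w j then 1 else 0)" for j
 proof -
  have "(\<Sum>l | l \<in> nbrs E w & dang w l <= dang w j. \<phi> w l) =
   (\<Sum>l | l \<in> nbrs E w & dang w l <= dang w j. if l = a then 1 else 0) - (\<Sum>l | l \<in> nbrs E w & dang w l <= dang w j. if l = b then 1 else 0)"
   by (simp add: \<phi>_def sum_subtractf)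
  moreover have "(\<Sum>l | l \<in> nbrs E w & dang w l <= dang w j. if l = z then 1 else 0) = (if dang w z <= dang w j then 1 else (0::real))"
   if "z \<in> nbrs E w" for z using that by (simp add: sum.delta)
  moreover have "a \<in> nbrs E w" "b \<in> nbrs E w" using e by (simp_all add: mem_nbrs)
  ultimately show ?thesis by simp
 qed
 have ab: "a \<in> nbrs E w" "b \<in> nbrs E w" using e by (simp_all add: mem_nbrs)
 \<comment> \<open>The potentials after \<open>a\<close> and after \<open>b\<close> differ by
   exactly one unit, in either order of the two angles.\<close>
 have "g a = B + (1 - (if dang w b <= dang w a then 1 else 0))" "g b = B + ((if dang w a <= dang w b then 1 else 0) - 1)"
  using B[rule_format, OF ab(1)] B[rule_format, OF ab(2)] unfolding S by simp_all
 moreover have "dang w a ~= dang w b" using rs.ang_inj[of w] ab ne by (auto simp: inj_on_def)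
 ultimately have "g a ~= g b" by auto
 moreover have "g a = g b" unfolding g_def
  by (rule winding_left[OF fl e(1) base_left[OF e(1)]]) (use base_left[OF e(2)] eq in simp)
 ultimately show False by blast
qed

text \<open>Different sectors at a vertex lie in different faces, so the orbit of a dart visits each
  vertex once and traces a simple polygon whose right side \<open>Q.R\<close> contains the face. Any
  part of the drawing inside \<open>Q.R\<close> would be linked to the polygon by connectedness, but
  all further edges at the polygon start out into \<open>Q.L\<close>.\<close>

lemma face_polygon:
 assumes n: "3 <= card V" and e0: "{v0, j0} \<in> E" and bF: "bounded (left v0 j0)"
 shows "\<exists>k x. simple_polygon k x & left v0 j0 = polygon_interior k x & 3 <= card {i. i < k & interior_angle k x i < pi} &
  card {i. i < k & interior_angle k x i < pi} <= card {d \<in> csec. left (fst d) (snd d) = left v0 j0}"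
proof -
 define d0 where "d0 = (v0, j0)"
 define F where "F = left v0 j0"
 have d0: "d0 \<in> darts E" using e0 by (simp add: d0_def mem_darts)
 obtain k where k: "k > 0" "(fstep E dang ^^ k) d0 = d0" "inj_on (%i. (fstep E dang ^^ i) d0) {..<k}"
  "face E dang d0 = (%i. (fstep E dang ^^ i) d0) ` {..<k}" using rs.face_period[OF d0] by blast
 define dd where "dd i = (fstep E dang ^^ i) d0" for i
 define vv where "vv i = fst (dd i)" for i
 have dE: "dd i \<in> darts E" for i unfolding dd_def by (rule rs.fstep_pow_darts[OF d0])
 have dS: "dd (Suc i) = fstep E dang (dd i)" for i by (simp add: dd_def)
 have dl: "left (fst (dd i)) (snd (dd i)) = F" for i
 proof (induction i)
  case 0 then show ?case by (simp add: dd_def d0_def F_def)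
 next
  case (Suc i)
  then show ?case unfolding dS using left_fstep[OF dE] by simp
 qed
 have injd: "inj_on dd {..<k}" using k(3) by (simp add: dd_def[abs_def])
 have "card (face E dang d0) = k" unfolding k(4) using card_image[OF k(3)] by simp
 then have k3: "3 <= k" using rs.face_small(1)[OF degree_ge_2[OF _ n] e0] by (simp add: d0_def)
 have injv: "inj_on vv {..<k}"
 proof (rule inj_onI, rule ccontr)
  fix i i' assume i: "i \<in> {..<k}" "i' \<in> {..<k}" "vv i = vv i'" "i ~= i'"
  then have "dd i ~= dd i'" using injd by (auto simp: inj_on_def)
  then have "snd (dd i) ~= snd (dd i')" using i(3) by (auto simp: vv_def prod_eq_iff)
  moreover have "{vv i, snd (dd i)} \<in> E" "{vv i, snd (dd i')} \<in> E" using dE[of i] dE[of i'] i(3) by (simp_all add: vv_def darts_iff)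
  ultimately have "left (vv i) (snd (dd i)) ~= left (vv i) (snd (dd i'))" using sectors_separated[OF n] by blast
  then show False using dl[of i] dl[of i'] i(3) by (simp add: vv_def)
 qed
 let ?sc = "%i. (i + 1) mod k" and ?pr = "%i. (i + k - 1) mod k"
 have dsc: "dd (?sc i) = dd (Suc i)" if "i < k" for i
 proof (cases "i + 1 = k")
  case True
  then show ?thesis using k(2) by (simp add: dd_def)
 next
  case False
  then show ?thesis using that by simp
 qed
 have step: "vv (?sc i) = rs.nx (vv i) (snd (dd i))" "snd (dd (?sc i)) = vv i" if "i < k" for i
 proof -
  have "fstep E dang (dd i) = (rs.nx (vv i) (snd (dd i)), vv i)"
   using rs.fstep_eq[of "fst (dd i)" "snd (dd i)"] dE[of i] by (simp add: darts_iff vv_def)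
  then have "dd (?sc i) = (rs.nx (vv i) (snd (dd i)), vv i)" using dsc[OF that] dS[of i] by simp
  then show "vv (?sc i) = rs.nx (vv i) (snd (dd i))" "snd (dd (?sc i)) = vv i" by (simp_all add: vv_def)
 qed
 have edge: "{vv i, vv (?sc i)} \<in> E" if "i < k" for i
  using dE[of "?sc i"] step(2)[OF that] by (simp add: darts_iff vv_def insert_commute)
 have vV: "vv i \<in> V" for i using dE[of i] edgeD by (auto simp: darts_iff vv_def)
 define x where "x i = p (vv i)" for i
 have pinj: "inj_on p V" using inj by (auto simp: inj_on_def)
 have simple: "simple_polygon k x"
  unfolding simple_polygon_def noncrossing_embedding_def
 proof (intro conjI ballI impI k3)
  show "inj_on x {..<k}" using injv inj vV by (auto simp: inj_on_def x_def)
  fix e f assume ef: "e \<in> cycle_edges k" "f \<in> cycle_edges k" "e ~= f"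
  have sub: "e <= {..<k}" "f <= {..<k}" using ef k(1) by (auto simp: cycle_edges_def)
  have E: "vv ` e \<in> E" if e: "e \<in> cycle_edges k" for e
  proof -
   obtain i where "i < k" "e = {i, ?sc i}" using e by (auto simp: cycle_edges_def)
   then show ?thesis using edge[of i] by simp
  qed
  have ne: "vv ` e ~= vv ` f" using inj_on_image_eq_iff[OF injv sub] ef(3) by simp
  have all: "\<forall>e\<in>E. \<forall>f\<in>E. e ~= f --> convex hull (p ` e) \<inter> convex hull (p ` f) = p ` (e \<inter> f)"
   using nce unfolding noncrossing_embedding_def by blast
  have im: "x ` A = p ` vv ` A" for A by (simp add: x_def[abs_def] image_image)
  show "convex hull (x ` e) \<inter> convex hull (x ` f) = x ` (e \<inter> f)"
   unfolding im inj_on_image_Int[OF injv sub] by (rule all[rule_format, OF E[OF ef(1)] E[OF ef(2)] ne])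
 qed
 interpret Q: polygon k x by unfold_locales (rule simple)
 have spr: "snd (dd i) = vv (?pr i)" "vv (?sc i) = rs.nx (vv i) (vv (?pr i))" "{vv i, vv (?pr i)} \<in> E" if i: "i < k" for i
 proof -
  show 1: "snd (dd i) = vv (?pr i)" using step(2)[OF Q.sc_pr(2)[OF i]] Q.sc_pr(3)[OF i] by simp
  show "vv (?sc i) = rs.nx (vv i) (vv (?pr i))" using step(1)[OF i] 1 by simp
  show "{vv i, vv (?pr i)} \<in> E" using dE[of i] 1 by (simp add: darts_iff vv_def)
 qed
 have al: "Q.P.alpha i (?pr i) = alpha (vv i) (vv (?pr i))" if i: "i < k" for i
  unfolding Q.P.alpha_def alpha_def Q.nx_C[OF i] spr(2)[OF i, symmetric] x_def ..
 have PDD: "Q.PD <= D"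
 proof
  fix y assume "y \<in> Q.PD"
  then obtain i j where ij: "{i, j} \<in> cycle_edges k" "y \<in> closed_segment (x i) (x j)" by (rule Q.P.D_cases)
  then have "i < k" "j = ?sc i | j = ?pr i" using Q.C_iff by blast+
  then have "{vv i, vv j} \<in> E" using edge spr(3) by blast
  then show "y \<in> D" using seg_sub ij(2) unfolding x_def by blast
 qed
 have lF: "left (vv i) (vv (?pr i)) = F" if "i < k" for i using dl[of i] spr(1)[OF that] by (simp add: vv_def)
 have eC: "{i, ?sc i} \<in> cycle_edges k" "{i, ?pr i} \<in> cycle_edges k" if "i < k" for i using Q.C_iff that by blast+
 have FR: "F <= Q.R" "F \<inter> Q.R ~= {}"
 proof -
  have 0: "0 < k" by fact
  obtain r1 where r1: "r1 > 0" "!!\<rho> \<theta>. 0 < \<rho> ==> \<rho> < r1 ==> 0 < \<theta> ==> \<theta> < alpha (vv 0) (vv (?pr 0)) ==> pol (vv 0) (vv (?pr 0)) \<rho> \<theta> \<in> left (vv 0) (vv (?pr 0))"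
   using sector_left[OF spr(3)[OF 0]] by blast
  obtain r2 where r2: "r2 > 0" "!!\<rho> \<theta>. 0 < \<rho> ==> \<rho> < r2 ==> 0 < \<theta> ==> \<theta> < alpha (vv 0) (vv (?pr 0)) ==> Q.P.pol 0 (?pr 0) \<rho> \<theta> \<in> Q.P.left 0 (?pr 0)"
   using Q.P.sector_left[OF eC(2)[OF 0]] unfolding al[OF 0] by blast
  define \<rho> where "\<rho> = min r1 r2 / 2"
  have "0 < \<rho>" "\<rho> < r1" "\<rho> < r2" using r1(1) r2(1) by (auto simp: \<rho>_def)
  moreover have "0 < alpha (vv 0) (vv (?pr 0))" using alpha_bounds[OF spr(3)[OF 0]] by blast
  ultimately have "pol (vv 0) (vv (?pr 0)) \<rho> (alpha (vv 0) (vv (?pr 0)) / 2) \<in> F"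
   "Q.P.pol 0 (?pr 0) \<rho> (alpha (vv 0) (vv (?pr 0)) / 2) \<in> Q.R"
   using r1(2)[of \<rho> "alpha (vv 0) (vv (?pr 0)) / 2"] r2(2)[of \<rho> "alpha (vv 0) (vv (?pr 0)) / 2"] lF[OF 0] Q.left_pr[OF 0] by auto
  then show ne: "F \<inter> Q.R ~= {}" unfolding x_def by blast
  have "F <= - Q.PD" using left_sub PDD unfolding F_def by blast
  then show "F <= Q.R" using components_maximal[OF Q.LR_comp(2) _ _ ] left_connected ne unfolding F_def by (metis Int_commute)
 qed
 \<comment> \<open>By \<open>alpha_le\<close> such an edge lies beyond the sector of the face,
   measured from the previous side, hence in the complementary sector of the polygon, which belongs
   to \<open>Q.L\<close>.\<close>
 have other: "\<exists>r>0. \<forall>t. 0 < t --> t < r --> p (vv i) + of_real t * (p a - p (vv i)) \<in> Q.L"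
  if i: "i < k" and a: "{vv i, a} \<in> E" "a ~= vv (?sc i)" "a ~= vv (?pr i)" for i a
 proof -
  let ?u' = "p (vv (?pr i)) - p (vv i)" and ?u = "p (vv (?sc i)) - p (vv i)" and ?da = "p a - p (vv i)"
  note e' = spr(3)[OF i] and e = edge[OF i]
  define \<phi> where "\<phi> = ccw_angle ?u' ?da"
  define \<beta> where "\<beta> = alpha (vv i) (vv (?pr i))"
  define c where "c = norm ?da / norm ?u'"
  define c' where "c' = norm ?u / norm ?u'"
  have c: "c > 0" "?da = of_real c * cis \<phi> * ?u'"
   using ccw_polar(3)[OF dir0[OF e'] dir0[OF a(1)]] dir0[OF e'] dir0[OF a(1)] by (simp_all add: c_def \<phi>_def)
  have b: "\<beta> = ccw_angle ?u' ?u" unfolding \<beta>_def alpha_def spr(2)[OF i, symmetric] ..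
  have c': "c' > 0" using dir0[OF e'] dir0[OF e] by (simp add: c'_def)
  have cu: "?u = of_real c' * cis \<beta> * ?u'" unfolding b c'_def by (rule ccw_polar(3)[OF dir0[OF e'] dir0[OF e]])
  have lt: "\<phi> < 2 * pi" unfolding \<phi>_def by (rule ccw_less[OF e' a(1,3)])
  have ge: "\<beta> <= \<phi>" unfolding \<phi>_def \<beta>_def by (rule alpha_le[OF e' a(1)])
  have "cis (\<phi> - \<beta>) * cis \<beta> = cis \<phi>" by (simp add: cis_mult)
  moreover have "of_real (c / c') * of_real c' = (of_real c :: complex)" using c' by simp
  ultimately have "of_real (c / c') * cis (\<phi> - \<beta>) * (of_real c' * cis \<beta> * ?u') = of_real c * cis \<phi> * ?u'"
   by (metis mult.assoc mult.left_commute)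
  then have da: "?da = of_real (c / c') * cis (\<phi> - \<beta>) * ?u" using c(2) cu by metis
  have "\<phi> ~= \<beta>"
  proof
   assume "\<phi> = \<beta>"
   then have "?da = of_real (c / c') * ?u" using da by simp
   then show False using same_dir[OF e a(1), of "c / c'"] c(1) c' a(2) by simp
  qed
  then have th: "0 < \<phi> - \<beta>" using ge by simp
  have "Q.P.alpha i (?sc i) = 2 * pi - \<beta>" using Q.alpha_pr[OF i] al[OF i] by (simp add: \<beta>_def)
  then have th2: "\<phi> - \<beta> < Q.P.alpha i (?sc i)" using lt by simp
  obtain r where r: "r > 0" "!!\<rho> \<theta>. 0 < \<rho> ==> \<rho> < r ==> 0 < \<theta> ==> \<theta> < Q.P.alpha i (?sc i) ==> Q.P.pol i (?sc i) \<rho> \<theta> \<in> Q.P.left i (?sc i)"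
   using Q.P.sector_left[OF eC(1)[OF i]] by blast
  have "p (vv i) + of_real t * ?da \<in> Q.L" if t: "0 < t" "t < r * c' / c" for t
  proof -
   have "t * c / c' < r" using t(2) c(1) c' by (simp add: field_simps)
   then have "Q.P.pol i (?sc i) (t * c / c') (\<phi> - \<beta>) \<in> Q.L" using r(2)[of "t * c / c'" "\<phi> - \<beta>"] t(1) c(1) c' th th2 Q.left_sc[OF i] by simp
   moreover have "Q.P.pol i (?sc i) (t * c / c') (\<phi> - \<beta>) = p (vv i) + of_real t * ?da" unfolding da by (simp add: x_def mult_ac)
   ultimately show ?thesis by simp
  qed
  then show ?thesis using r(1) c(1) c' by (intro exI[of _ "r * c' / c"]) simp
 qed
 define In where "In = vv ` {..<k}"
 have inPD: "p w \<in> Q.PD" if "w \<in> In" for w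
  using that Q.P.vertex_D by (auto simp: In_def x_def)
 have key: "a ~: In & b ~: In & seg a b <= Q.R" if ab: "{a, b} \<in> E" and y: "y \<in> seg a b" "y \<in> Q.R" for a b y
 proof -
  have yPD: "y ~: Q.PD" using y(2) Q.LR_comp(4) by blast
  have np: "{a, b} ~= {vv i, vv (?sc i)}" if i: "i < k" for i
  proof
   assume eq: "{a, b} = {vv i, vv (?sc i)}"
   have "seg a b = convex hull (p ` {vv i, vv (?sc i)})" unfolding eq[symmetric] segment_2 ..
   then have "seg a b = closed_segment (x i) (x (?sc i))" unfolding segment_2 x_def .
   then show False using Q.P.seg_sub[OF eC(1)[OF i]] yPD y(1) by blast
  qed
  \<comment> \<open>The edge without its endpoints on the polygon is connected and misses the
    polygon, so it stays on one side.\<close>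
  define T where "T = seg a b - p ` ({a, b} \<inter> In)"
  have TPD: "T <= - Q.PD"
  proof (rule ccontr)
   assume "\<not> T <= - Q.PD"
   then obtain z where z: "z \<in> seg a b" "z ~: p ` ({a, b} \<inter> In)" "z \<in> Q.PD" by (auto simp: T_def)
   obtain i j where ij: "{i, j} \<in> cycle_edges k" "z \<in> closed_segment (x i) (x j)" using z(3) by (rule Q.P.D_cases)
   have i: "i < k" "j = ?sc i | j = ?pr i" using Q.C_iff ij(1) by blast+
   have jk: "j < k" using i Q.sc_pr(1,2)[OF i(1)] by blast
   have E: "{vv i, vv j} \<in> E" using i edge spr(3) by blast
   have ne: "{a, b} ~= {vv i, vv j}"
   proof (cases "j = ?sc i")
    case True then show ?thesis using np[OF i(1)] by simp
   next
    case False
    then have "?sc j = i" using i(2) Q.sc_pr(3)[OF i(1)] by simp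
    then show ?thesis using np[OF jk] by (simp add: insert_commute)
   qed
   have "z \<in> p ` ({a, b} \<inter> {vv i, vv j})" using seg_inter[OF ab E ne] z(1) ij(2) unfolding x_def by blast
   moreover have "{vv i, vv j} <= In" using i(1) jk by (auto simp: In_def)
   ultimately show False using z(2) by blast
  qed
  have pab: "p a ~= p b" by (rule edge_p[OF ab])
  have oT: "open_segment (p a) (p b) <= T"
  proof -
   have "p ` ({a, b} \<inter> In) <= {p a, p b}" by blast
   then show ?thesis unfolding T_def open_segment_def by blast
  qed
  have cT: "connected T"
  proof (rule connected_intermediate_closure[OF _ oT])
   show "connected (open_segment (p a) (p b))" by (intro convex_connected convex_open_segment)
   show "T <= closure (open_segment (p a) (p b))" using pab by (auto simp: T_def closure_open_segment)
  qed
  have "p ` ({a, b} \<inter> In) <= Q.PD" using inPD by blast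
  then have yT: "y \<in> T" using y(1) yPD by (auto simp: T_def)
  have "T \<inter> Q.R ~= {}" using yT y(2) by blast
  then have TR: "T <= Q.R" using components_maximal[OF Q.LR_comp(2) cT TPD] by blast
  have nin: "w ~: In" if wz: "{w, z} \<in> E" "{w, z} = {a, b}" for w z
  proof
   assume "w \<in> In"
   then obtain i where i: "i < k" "w = vv i" by (auto simp: In_def)
   have "z ~= vv (?sc i)" using np[OF i(1)] wz(2) i(2) by auto
   moreover have "z ~= vv (?pr i)"
   proof
    assume "z = vv (?pr i)"
    then have "{a, b} = {vv (?pr i), vv (?sc (?pr i))}" using wz(2) i Q.sc_pr(3)[OF i(1)] by (simp add: insert_commute)
    then show False using np[OF Q.sc_pr(2)[OF i(1)]] by blast
   qed
   ultimately obtain r where r: "r > 0" "!!t. 0 < t ==> t < r ==> p w + of_real t * (p z - p w) \<in> Q.L"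
    using other[OF i(1)] wz(1) i(2) by blast
   define t where "t = min (r / 2) (1 / 2)"
   have t: "0 < t" "t < r" "t < 1" using r(1) by (auto simp: t_def)
   have pwz: "p w ~= p z" by (rule edge_p[OF wz(1)])
   have "p w + of_real t * (p z - p w) \<in> open_segment (p w) (p z)"
    unfolding in_segment(2) using pwz t by (intro conjI exI[of _ t]) (auto simp: scaleR_conv_of_real algebra_simps)
   moreover have "open_segment (p w) (p z) = open_segment (p a) (p b)" using wz(2) by (auto simp: doubleton_eq_iff open_segment_commute)
   ultimately have "p w + of_real t * (p z - p w) \<in> Q.R" using oT TR by blast
   then show False using r(2)[OF t(1,2)] Q.LR_comp(3) by blast
  qed
  have "a ~: In" "b ~: In" using nin[OF ab refl] nin[of b a] ab by (auto simp: insert_commute)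
  moreover from this have "T = seg a b" by (auto simp: T_def)
  ultimately show ?thesis using TR by simp
 qed
 \<comment> \<open>The vertices inside \<open>Q.R\<close> would form a nonempty proper set of
   vertices that no edge leaves.\<close>
 have RD: "Q.R \<inter> D = {}"
 proof (rule ccontr)
  assume "Q.R \<inter> D ~= {}"
  then obtain y where y: "y \<in> Q.R" "y \<in> D" by blast
  obtain a b where ab: "{a, b} \<in> E" "y \<in> seg a b" using y(2) by (rule D_cases)
  define K where "K = {w \<in> V. p w \<in> Q.R}"
  have "p a \<in> seg a b" by simp
  then have "a \<in> K" using key[OF ab y(1)] edgeD[OF ab(1)] by (auto simp: K_def)
  moreover have "vv 0 ~: K"
  proof -
   have "p (vv 0) \<in> Q.PD" using inPD[of "vv 0"] k(1) by (auto simp: In_def)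
   then show ?thesis using Q.LR_comp(4) by (auto simp: K_def)
  qed
  moreover have "K <= V" by (auto simp: K_def)
  ultimately obtain w z where wz: "w \<in> K" "z \<in> V - K" "{w, z} \<in> E" using connected vV unfolding conn_def by blast
  have "p w \<in> seg w z" "p w \<in> Q.R" using wz(1) by (auto simp: K_def)
  then have "seg w z <= Q.R" using key[OF wz(3)] by blast
  then have "p z \<in> Q.R" by auto
  then show False using wz(2) by (auto simp: K_def)
 qed
 have "Q.R <= F"
 proof -
  have "F \<in> components (- D)" unfolding F_def by (rule left_component[OF e0])
  moreover have "connected Q.R" by (rule in_components_connected[OF Q.LR_comp(2)])
  moreover have "Q.R <= - D" using RD by blast
  ultimately show ?thesis using components_maximal FR(2) by blast
 qed
 then have FRe: "F = Q.R" using FR(1) by blast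
 have "\<not> bounded (outside Q.PD)" using unbounded_outside[OF Q.bounded_PD] .
 then have int: "polygon_interior k x = Q.R" using Q.inside_cases bF FRe unfolding F_def by metis
 have ang: "interior_angle k x i = alpha (vv i) (vv (?pr i))" if "i < k" for i
  using Q.angle_R[OF that int] al[OF that] by simp
 have three: "3 <= card {i. i < k & interior_angle k x i < pi}"
 proof (rule Q.three_convex)
  fix i j l assume "i < k" "j < k" "l < k" "i ~= j" "j ~= l" "i ~= l"
  then have "vv i ~= vv j" "vv j ~= vv l" "vv i ~= vv l" using injv by (auto simp: inj_on_def)
  then show "cr (x j - x i) (x l - x i) ~= 0" unfolding x_def using orient_ne vV by blast
 qed
 have "card {i. i < k & interior_angle k x i < pi} <= card {d \<in> csec. left (fst d) (snd d) = F}"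
 proof (rule card_inj_on_le)
  show "inj_on dd {i. i < k & interior_angle k x i < pi}" by (rule inj_on_subset[OF injd]) auto
  show "dd ` {i. i < k & interior_angle k x i < pi} <= {d \<in> csec. left (fst d) (snd d) = F}"
  proof
   fix d assume "d \<in> dd ` {i. i < k & interior_angle k x i < pi}"
   then obtain i where i: "i < k" "interior_angle k x i < pi" "d = dd i" by blast
   have "alpha (fst d) (snd d) < pi" using ang[OF i(1)] i spr(1)[OF i(1)] by (simp add: vv_def)
   then show "d \<in> {d \<in> csec. left (fst d) (snd d) = F}" using dE[of i] dl[of i] i(3) by (simp add: csec_def)
  qed
  show "finite {d \<in> csec. left (fst d) (snd d) = F}" by (simp add: csec_def)
 qed
 then show ?thesis using simple int FRe three unfolding F_def by blast
qed

lemma interior_pseudo_triangles: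
 assumes F: "F \<in> interior_faces V E p"
 shows "pseudo_triangle F"
proof -
 let ?I = "interior_faces V E p"
 let ?S = "%F. {d \<in> csec. left (fst d) (snd d) = F}"
 have fI: "finite ?I" by (rule fin_interior[OF V_ne])
 have n: "3 <= card V"
 proof (rule ccontr)
  assume "\<not> 3 <= card V"
  then have "card ?I = 0" using faces_le[OF V_ne connected] card_E card_V by linarith
  then show False using fI F by simp
 qed
 have poly: "\<exists>k x. simple_polygon k x & G = polygon_interior k x & 3 <= card {i. i < k & interior_angle k x i < pi} &
  card {i. i < k & interior_angle k x i < pi} <= card (?S G)" if G: "G \<in> ?I" for G
 proof -
  obtain v j where vj: "{v, j} \<in> E" "G = left v j" using comp_left[OF V_ne] G unfolding interior_faces_def by blast
  have "bounded (left v j)" using G vj by (simp add: interior_faces_def)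
  from face_polygon[OF n vj(1) this] show ?thesis unfolding vj(2) .
 qed
 have ge: "3 <= card (?S G)" if "G \<in> ?I" for G using poly[OF that] by (meson le_trans)
 have "(\<Sum>G\<in>?I. card (?S G)) = card (\<Union>G\<in>?I. ?S G)"
  by (rule card_UN_disjoint[symmetric]) (use fI in "auto simp: csec_def")
 also have "\<dots> <= card csec" by (rule card_mono) (auto simp: csec_def)
 finally have le: "(\<Sum>G\<in>?I. card (?S G)) <= 3 * card ?I"
  using card_csec[OF pt] faces_ge[OF V_ne] card_E by linarith
 have "card (?S F) = 3"
 proof (rule ccontr)
  assume "card (?S F) ~= 3"
  then have "3 < card (?S F)" using ge[OF F] by simp
  then have "(\<Sum>G\<in>?I. 3) < (\<Sum>G\<in>?I. card (?S G))"
   using ge F by (intro sum_strict_mono_ex1[OF fI]) auto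
  then show False using le by simp
 qed
 then show ?thesis using poly[OF F] unfolding pseudo_triangle_def by (metis le_antisym)
qed

text \<open>Adding a missing hull edge would keep the drawing non-crossing and pointed, hence stress-free,
 but with too many edges.\<close>
lemma hull_edge:
 assumes ab: "a \<in> V" "b \<in> V" "a ~= b" and side: "!!l. l \<in> V ==> l ~= a ==> l ~= b ==> cr (p b - p a) (p l - p a) > 0"
 shows "{a, b} \<in> E"
proof (rule ccontr)
 assume new: "{a, b} ~: E"
 define E' where "E' = insert {a, b} E"
 define d where "d = p b - p a"
 interpret E': sgraph V E'
  by unfold_locales (use finV ab edge_sub edge_card in "auto simp: E'_def")
 \<comment> \<open>Edges missing both \<open>a\<close> and \<open>b\<close> lie strictly to the left
   of the line through these points, so the new edge does not cross them.\<close>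
 have pos: "cr d (z - p a) > 0" if z: "z \<in> convex hull (p ` f)" and f: "f \<in> E" "f \<inter> {a, b} = {}" for z f
 proof -
  obtain k l where kl: "f = {k, l}" using edge_ex[OF f(1)] by metis
  have kl': "cr d (p k - p a) > 0" "cr d (p l - p a) > 0" using side[of k] side[of l] edge_sub[OF f(1)] f(2) kl by (auto simp: d_def)
  obtain u where u: "0 <= u" "u <= 1" "z = (1 - u) *\<^sub>R p k + u *\<^sub>R p l"
   using z unfolding kl segment_2 by (auto simp: closed_segment_def)
  have "cr d (z - p a) = (1 - u) * cr d (p k - p a) + u * cr d (p l - p a)"
   unfolding u(3) by (simp add: cr_add cr_diff cr_scaleR algebra_simps)
  moreover have "0 < (1 - u) * cr d (p k - p a) + u * cr d (p l - p a)"
   using u(1,2) kl' by (cases "u = 0") (auto intro!: add_nonneg_pos)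
  ultimately show ?thesis by simp
 qed
 have zero: "cr d (z - p a) = 0" if z: "z \<in> convex hull (p ` {a, b})" for z
 proof -
  obtain u where "z = (1 - u) *\<^sub>R p a + u *\<^sub>R p b" using z unfolding segment_2 by (auto simp: closed_segment_def)
  then have "z - p a = of_real u * d" by (simp add: d_def scaleR_conv_of_real algebra_simps)
  then show ?thesis by (simp add: cr_scale)
 qed
 have nc0: "convex hull (p ` e) \<inter> convex hull (p ` f) = {}" if "e \<in> E" "f \<in> E" "e \<inter> f = {}" for e f
 proof -
  have "e ~= f" using that edge_card[OF that(1)] by auto
  then show ?thesis using nce that unfolding noncrossing_embedding_def by (metis image_empty)
 qed
 have "noncrossing_embedding V E' p"
 proof -
  have ends: "convex hull (p ` {a, b}) \<inter> convex hull (p ` f) = p ` ({a, b} \<inter> f)" if f: "f \<in> E" for f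
  proof (cases "f \<inter> {a, b} = {}")
   case True
   then have "convex hull (p ` {a, b}) \<inter> convex hull (p ` f) = {}" using pos[OF _ f True] zero by fastforce
   then show ?thesis using True by (simp add: Int_commute)
  next
   case False
   obtain v where v: "v \<in> f" "v \<in> {a, b}" using False by blast
   obtain l where l: "f = {v, l}" using edge_ex[OF f] v(1) by (metis insert_commute insertE singletonD)
   have lV: "l \<in> V" "l ~= v" using edgeD[of v l] f l by auto
   have lab: "l ~: {a, b}" using v(2) lV(2) f l new by (auto simp: insert_commute)
   have "z = p v" if z: "z \<in> convex hull (p ` {a, b})" "z \<in> convex hull (p ` f)" for z
   proof -
    obtain u where u: "z = (1 - u) *\<^sub>R p v + u *\<^sub>R p l" using z(2) unfolding l segment_2 by (auto simp: closed_segment_def)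
    have "cr d (z - p a) = (1 - u) * cr d (p v - p a) + u * cr d (p l - p a)"
     unfolding u by (simp add: cr_add cr_diff cr_scaleR algebra_simps)
    moreover have "cr d (p v - p a) = 0" using v(2) by (auto simp: d_def cr_def)
    ultimately have "u * cr d (p l - p a) = 0" using zero[OF z(1)] by simp
    moreover have "cr d (p l - p a) > 0" using side lV lab by (simp add: d_def)
    ultimately show "z = p v" using u by simp
   qed
   moreover have "p v \<in> convex hull (p ` {a, b})" "p v \<in> convex hull (p ` f)" using v by (auto intro: hull_inc)
   ultimately have "convex hull (p ` {a, b}) \<inter> convex hull (p ` f) = {p v}" by blast
   moreover have "{a, b} \<inter> f = {v}" using l lab v(2) by auto
   ultimately show ?thesis by simp
  qed
  have old: "\<forall>e\<in>E. \<forall>f\<in>E. e ~= f --> convex hull (p ` e) \<inter> convex hull (p ` f) = p ` (e \<inter> f)"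
   using nce unfolding noncrossing_embedding_def by blast
  have N: "convex hull (p ` e) \<inter> convex hull (p ` f) = p ` (e \<inter> f)" if ef: "e \<in> E'" "f \<in> E'" "e ~= f" for e f
  proof -
   consider "e \<in> E" "f \<in> E" | "e = {a, b}" "f \<in> E" | "e \<in> E" "f = {a, b}" using ef by (auto simp: E'_def)
   then show ?thesis
   proof cases
    case 1 then show ?thesis using old ef(3) by blast
   next
    case 2 then show ?thesis using ends by blast
   next
    case 3 then show ?thesis using ends[OF 3(1)] by (simp only: Int_commute)
   qed
  qed
  have "\<forall>e\<in>E'. \<forall>f\<in>E'. e ~= f --> convex hull (p ` e) \<inter> convex hull (p ` f) = p ` (e \<inter> f)"
   by (intro ballI impI N)
  moreover have "inj_on p V" using gp by (simp add: genpos_def)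
  ultimately show ?thesis unfolding noncrossing_embedding_def by (rule conjI[rotated])
 qed
 then interpret D': drawn V E' p
 proof unfold_locales
  fix v assume "v \<in> V"
  then show "nbrs E' v ~= {}" using non_isolated[of v] by (auto simp: nbrs_def E'_def)
 qed
 have inn: "u \<bullet> (\<i> * d) = cr d u" for u by (simp add: inner_complex_def cr_def)
 \<comment> \<open>At an endpoint the inner normal of the hull edge is positive on all edges but the
   new one, on which it vanishes; tilting it slightly towards the other endpoint makes all products
   positive.\<close>
 have end_ptd: "ptd E' p v" if v: "v = a & w = b | v = b & w = a" for v w
 proof -
  have vV: "v \<in> V" "w \<in> V" "v ~= w" using ab v by auto
  have cv: "cr d (p l - p v) = cr d (p l - p a)" for l using v by (auto simp: d_def cr_def algebra_simps)
  have "\<forall>\<^sub>F \<epsilon> in at_right (0::real). \<forall>l\<in>V - {a, b}. cr d (p l - p v) + \<epsilon> * ((p l - p v) \<bullet> (p w - p v)) > 0"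
  proof (rule eventually_ball_finite)
   show "finite (V - {a, b})" using finV by simp
   show "\<forall>l\<in>V - {a, b}. \<forall>\<^sub>F \<epsilon> in at_right 0. 0 < cr d (p l - p v) + \<epsilon> * ((p l - p v) \<bullet> (p w - p v))"
   proof
    fix l assume l: "l \<in> V - {a, b}"
    have "((%\<epsilon>. cr d (p l - p v) + \<epsilon> * ((p l - p v) \<bullet> (p w - p v))) \<longlongrightarrow> cr d (p l - p v) + 0 * ((p l - p v) \<bullet> (p w - p v))) (at_right 0)"
     by (intro tendsto_add tendsto_mult tendsto_const tendsto_ident_at)
    then show "\<forall>\<^sub>F \<epsilon> in at_right 0. 0 < cr d (p l - p v) + \<epsilon> * ((p l - p v) \<bullet> (p w - p v))"
     by (rule order_tendstoD) (use side l cv in "simp add: d_def")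
   qed
  qed
  then have "\<forall>\<^sub>F \<epsilon> in at_right (0::real). 0 < \<epsilon> & (\<forall>l\<in>V - {a, b}. cr d (p l - p v) + \<epsilon> * ((p l - p v) \<bullet> (p w - p v)) > 0)"
   using eventually_at_right_less[of "0::real"] by eventually_elim simp
  then obtain \<epsilon> where ep: "0 < \<epsilon>" "\<forall>l\<in>V - {a, b}. cr d (p l - p v) + \<epsilon> * ((p l - p v) \<bullet> (p w - p v)) > 0"
   using eventually_happens'[OF trivial_limit_at_right_real] by blast
  have "(p l - p v) \<bullet> (\<i> * d + \<epsilon> *\<^sub>R (p w - p v)) > 0" if l: "l \<in> nbrs E' v" for l
  proof -
   have lV: "l \<in> V" "l ~= v" using E'.edgeD[of v l] l by (auto simp: mem_nbrs)
   have eq: "(p l - p v) \<bullet> (\<i> * d + \<epsilon> *\<^sub>R (p w - p v)) = cr d (p l - p v) + \<epsilon> * ((p l - p v) \<bullet> (p w - p v))"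
    by (simp add: inner_add_right inn)
   show ?thesis
   proof (cases "l = w")
    case True
    have "cr d (p w - p v) = 0" using v by (auto simp: d_def cr_def algebra_simps)
    moreover have "p w ~= p v" using inj vV by blast
    ultimately show ?thesis unfolding eq using True ep(1) by simp
   next
    case False
    then have "l \<in> V - {a, b}" using lV v by auto
    then show ?thesis unfolding eq using ep(2) by blast
   qed
  qed
  then show ?thesis unfolding ptd_def by blast
 qed
 have "ptd E' p v" if vV: "v \<in> V" for v
 proof -
  consider "v = a" | "v = b" | "v ~= a" "v ~= b" by blast
  then show ?thesis
  proof cases
   case 1 then show ?thesis using end_ptd[of v b] by blast
  next
   case 2 then show ?thesis using end_ptd[of v a] by blast
  next
   case 3
   then have "nbrs E' v = nbrs E v" by (auto simp: nbrs_def E'_def doubleton_eq_iff)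
   then show ?thesis using pt[OF vV] by (simp add: ptd_def)
  qed
 qed
 then have "stress_free V E' p" by (rule D'.pointed_stress_free)
 then have "card E' + 3 <= 2 * card V" by (rule E'.stress_free_card[OF _ ab(1,2)]) (use inj ab in blast)
 moreover have "card E' = card E + 1" using new finE by (simp add: E'_def)
 ultimately show False using card_E by simp
qed

lemma support:
 assumes x: "x \<in> frontier (convex hull (p ` V))"
 shows "\<exists>m. m ~= 0 & (\<forall>y\<in>convex hull (p ` V). m \<bullet> x <= m \<bullet> y)"
proof -
 let ?H = "convex hull (p ` V)"
 have cl: "closed ?H" by (intro compact_imp_closed finite_imp_compact_convex_hull) (simp add: finV)
 have xH: "x \<in> ?H" "x ~: interior ?H" using x cl by (auto simp: frontier_def)
 show ?thesis
 proof (cases "interior ?H = {}")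
  case True
  then obtain m c where "m ~= 0" "?H <= {x. m \<bullet> x = c}" using empty_interior_subset_hyperplane[OF convex_convex_hull] by metis
  then have "m \<bullet> y = c" if "y \<in> ?H" for y using that by blast
  then show ?thesis using \<open>m ~= 0\<close> xH(1) by (intro exI[of _ m]) simp
 next
  case False
  then have "x ~: rel_interior ?H" using rel_interior_nonempty_interior xH(2) by blast
  then obtain m where "m ~= 0" "!!y. y \<in> closure ?H ==> m \<bullet> x <= m \<bullet> y"
   using supporting_hyperplane_relative_frontier[OF convex_convex_hull, of x "p ` V"] xH(1) closure_subset by (metis subsetD)
  then show ?thesis using closure_subset by blast
 qed
qed

text \<open>A supporting line at \<open>x\<close> cuts out the hull of the points on it, by general
  position one or two points. Two points are ordered so that the rest lies on the left; a single
  point is \<open>x\<close> itself, and an angularly extremal second vertex is chosen.\<close>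

lemma frontier_hull_edge:
 assumes x: "x \<in> frontier (convex hull (p ` V))"
 shows "\<exists>a b. a \<in> V & b \<in> V & a ~= b & x \<in> seg a b & (\<forall>l\<in>V - {a, b}. cr (p b - p a) (p l - p a) > 0)"
proof -
 let ?H = "convex hull (p ` V)"
 have cl: "closed ?H" by (intro compact_imp_closed finite_imp_compact_convex_hull) (simp add: finV)
 have xH: "x \<in> ?H" using x cl by (auto simp: frontier_def)
 obtain m where m: "m ~= 0" "!!y. y \<in> ?H ==> m \<bullet> x <= m \<bullet> y" using support[OF x] by blast
 have "(?H \<inter> {y. m \<bullet> y = m \<bullet> x}) face_of ?H"
  by (rule face_of_Int_supporting_hyperplane_ge[OF convex_convex_hull]) (use m(2) in auto)
 then obtain S where S: "S <= p ` V" "?H \<inter> {y. m \<bullet> y = m \<bullet> x} = convex hull S"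
  using face_of_convex_hull_subset[OF finite_imp_compact[OF finite_imageI[OF finV]]] by metis
 have xS: "x \<in> convex hull S" using S(2) xH by blast
 then have "S ~= {}" by auto
 then obtain a where a: "a \<in> V" "p a \<in> S" using S(1) by blast
 have onS: "m \<bullet> y = m \<bullet> x" if "y \<in> S" for y using S(2) hull_inc[OF that, of convex] by blast
 have pm: "m \<bullet> x <= m \<bullet> p l" if "l \<in> V" for l using m(2) that by (simp add: hull_inc)
 show ?thesis
 proof (cases "\<exists>b\<in>V. b ~= a & m \<bullet> p b = m \<bullet> x")
  case True
  then obtain b where b: "b \<in> V" "b ~= a" "m \<bullet> p b = m \<bullet> x" by blast
  let ?d = "p b - p a"
  have ma: "m \<bullet> p a = m \<bullet> x" by (rule onS[OF a(2)])
  then have md: "m \<bullet> ?d = 0" using b(3) by (simp add: inner_diff_right)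
  have d0: "?d ~= 0" using inj a(1) b by fastforce
  have id: "cr ?d u * (m \<bullet> m) = cr ?d m * (m \<bullet> u)" for u
  proof -
   have "cr ?d u * (m \<bullet> m) - cr ?d m * (m \<bullet> u) = - (m \<bullet> ?d) * cr u m" by (simp add: cr_def inner_complex_def algebra_simps)
   then show ?thesis using md by simp
  qed
  have m2: "m \<bullet> m > 0" using m(1) by simp
  have pos: "m \<bullet> (p l - p a) > 0" if l: "l \<in> V - {a, b}" for l
  proof -
   have "m \<bullet> (p l - p a) >= 0" using pm[of l] l ma by (simp add: inner_diff_right)
   moreover have "m \<bullet> (p l - p a) ~= 0"
   proof
    assume "m \<bullet> (p l - p a) = 0"
    then have "cr ?d (p l - p a) = 0" using id[of "p l - p a"] m2 by simp
    then show False using orient_ne[of a b l] a(1) b l by auto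
   qed
   ultimately show ?thesis by simp
  qed
  have "S <= {p a, p b}"
  proof
   fix y assume y: "y \<in> S"
   then obtain l where l: "l \<in> V" "y = p l" using S(1) by blast
   show "y \<in> {p a, p b}"
   proof (rule ccontr)
    assume "y ~: {p a, p b}"
    then have "m \<bullet> (p l - p a) > 0" using pos[of l] l by auto
    then show False using onS[OF y] l ma by (simp add: inner_diff_right)
   qed
  qed
  then have xs: "x \<in> seg a b" unfolding segment_convex_hull using xS hull_mono by blast
  have sgn: "cr ?d (p l - p a) = cr ?d m * (m \<bullet> (p l - p a)) / (m \<bullet> m)" for l using id[of "p l - p a"] m2 by (simp add: field_simps)
  have "cr ?d m ~= 0"
  proof
   assume z: "cr ?d m = 0"
   have "cr ?d (\<i> * ?d) * (m \<bullet> m) = 0" using id[of "\<i> * ?d"] z by simp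
   moreover have "cr ?d (\<i> * ?d) = ?d \<bullet> ?d" by (simp add: cr_def inner_complex_def algebra_simps)
   ultimately show False using m2 d0 by simp
  qed
  then consider "cr ?d m > 0" | "cr ?d m < 0" by linarith
  then show ?thesis
  proof cases
   case 1
   then have "\<forall>l\<in>V - {a, b}. cr (p b - p a) (p l - p a) > 0" unfolding sgn using pos m2 by simp
   then show ?thesis using a b xs by blast
  next
   case 2
   have "cr (p a - p b) (p l - p b) = - cr ?d (p l - p a)" for l by (simp add: cr_def algebra_simps)
   moreover have "cr ?d (p l - p a) < 0" if "l \<in> V - {b, a}" for l
    unfolding sgn using 2 pos[of l] m2 that by (auto simp: divide_neg_pos mult_neg_pos)
   ultimately have "\<forall>l\<in>V - {b, a}. cr (p a - p b) (p l - p b) > 0" by simp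
   then show ?thesis using a b xs by (metis closed_segment_commute)
  qed
 next
  case False
  have ma: "m \<bullet> p a = m \<bullet> x" by (rule onS[OF a(2)])
  have pos: "m \<bullet> (p l - p a) > 0" if "l \<in> V" "l ~= a" for l
  proof -
   have "m \<bullet> p l ~= m \<bullet> x" using False that by blast
   then show ?thesis using pm[OF that(1)] ma by (simp add: inner_diff_right)
  qed
  have "S <= {p a}"
  proof
   fix y assume y: "y \<in> S"
   then obtain l where l: "l \<in> V" "y = p l" using S(1) by blast
   show "y \<in> {p a}"
   proof (rule ccontr)
    assume "y ~: {p a}"
    then have "l ~= a" using l by auto
    then show False using False onS[OF y] l by blast
   qed
  qed
  then have "x \<in> convex hull {p a}" using xS hull_mono by blast
  then have xa: "x = p a" by simp
  \<comment> \<open>The tangent of the angle of \<open>p l - p a\<close> against the inner normal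
    \<open>m\<close>. The vertex with the smallest value is the one with all others on the
    left.\<close>
  define q where "q l = cr m (p l - p a) / (m \<bullet> (p l - p a))" for l
  have "V - {a} ~= {}"
  proof
   assume "V - {a} = {}"
   then have "V <= {a}" by blast
   then have "card V <= 1" using card_mono[of "{a}" V] by simp
   then show False using card_V by simp
  qed
  then obtain j where j: "j \<in> V - {a}" "!!l. l \<in> V - {a} ==> q j <= q l"
   using arg_min_if_finite(1)[of "V - {a}" q] arg_min_least[of "V - {a}" _ q] finV by (metis finite_Diff)
  have "cr (p j - p a) (p l - p a) > 0" if l: "l \<in> V - {a, j}" for l
  proof -
   let ?u = "p j - p a" and ?w = "p l - p a"
   have pu: "m \<bullet> ?u > 0" "m \<bullet> ?w > 0" using pos j(1) l by auto
   have "cr ?u ?w * (m \<bullet> m) = (m \<bullet> ?u) * cr m ?w - (m \<bullet> ?w) * cr m ?u" by (simp add: cr_def inner_complex_def algebra_simps)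
   moreover have "cr m ?u * (m \<bullet> ?w) <= cr m ?w * (m \<bullet> ?u)"
    using j(2)[of l] l pu by (simp add: q_def frac_le_eq divide_le_eq pos_divide_le_eq pos_le_divide_eq field_simps)
   ultimately have "cr ?u ?w * (m \<bullet> m) >= 0" by (simp add: mult.commute)
   moreover have "m \<bullet> m > 0" using m(1) by simp
   ultimately have "cr ?u ?w >= 0" by (metis mult_neg_pos not_le)
   moreover have "cr ?u ?w ~= 0" using orient_ne[of a j l] a(1) j(1) l by auto
   ultimately show ?thesis by simp
  qed
  then show ?thesis using a(1) j(1) xa by (intro exI[of _ a] exI[of _ j]) auto
 qed
qed

theorem pointed_pseudo_triangulation: "pointed_pseudo_triangulation V E p"
proof -
 let ?H = "convex hull (p ` V)"
 have cl: "closed ?H" by (intro compact_imp_closed finite_imp_compact_convex_hull) (simp add: finV)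
 \<comment> \<open>The hull edge found at \<open>x\<close> belongs to the graph by
   \<open>hull_edge\<close>; its supporting half-plane shows that it lies entirely in the
   frontier.\<close>
 have edges: "\<exists>a b. {a, b} \<in> E & x \<in> seg a b & seg a b <= frontier ?H" if x: "x \<in> frontier ?H" for x
 proof -
  obtain a b where ab: "a \<in> V" "b \<in> V" "a ~= b" "x \<in> seg a b" "\<forall>l\<in>V - {a, b}. cr (p b - p a) (p l - p a) > 0"
   using frontier_hull_edge[OF x] by blast
  have E: "{a, b} \<in> E" by (rule hull_edge[OF ab(1-3)]) (use ab(5) in blast)
  let ?m = "\<i> * (p b - p a)"
  have mc: "?m \<bullet> u = cr (p b - p a) u" for u by (simp add: inner_complex_def cr_def algebra_simps)
  have m0: "?m ~= 0" using dir0[OF E] by simp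
  have "p ` V <= {y. ?m \<bullet> y >= ?m \<bullet> p a}"
  proof
   fix y assume "y \<in> p ` V"
   then obtain l where l: "l \<in> V" "y = p l" by blast
   have "0 <= cr (p b - p a) (p l - p a)"
   proof (cases "l \<in> {a, b}")
    case True
    then show ?thesis by (auto simp: cr_def)
   next
    case False
    then show ?thesis using ab(5) l(1) by (simp add: less_imp_le)
   qed
   then have "?m \<bullet> (p l - p a) >= 0" unfolding mc .
   then show "y \<in> {y. ?m \<bullet> y >= ?m \<bullet> p a}" using l(2) by (simp add: inner_diff_right)
  qed
  then have "?H <= {y. ?m \<bullet> y >= ?m \<bullet> p a}" by (rule hull_minimal) (rule convex_halfspace_ge)
  then have int: "interior ?H <= {y. ?m \<bullet> y > ?m \<bullet> p a}" using interior_mono interior_halfspace_ge[OF m0] by metis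
  have "seg a b <= frontier ?H"
  proof
   fix y assume y: "y \<in> seg a b"
   obtain c where "y = p a + of_real c * (p b - p a)" using seg_points[OF y] by blast
   then have "?m \<bullet> (y - p a) = 0" unfolding mc by (simp add: cr_scale)
   then have "y ~: interior ?H" using int by (auto simp: inner_diff_right)
   moreover have "y \<in> ?H" using y seg_sub[OF E] D_hull by blast
   ultimately show "y \<in> frontier ?H" using cl by (simp add: frontier_def)
  qed
  then show ?thesis using E ab(4) by blast
 qed
 then have fr: "frontier ?H <= D" using seg_sub by blast
 have out: "frontier (outer_face V E p) = frontier ?H"
  unfolding outer_face_def outside_hull[OF fr] by (rule frontier_complement)
 have "(\<Union>e\<in>outer_edges V E p. convex hull (p ` e)) = frontier ?H"
 proof (intro equalityI subsetI)
  fix x assume "x \<in> frontier ?H"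
  then obtain a b where ab: "{a, b} \<in> E" "x \<in> seg a b" "seg a b <= frontier ?H" using edges by blast
  then show "x \<in> (\<Union>e\<in>outer_edges V E p. convex hull (p ` e))"
   by (intro UN_I[of "{a, b}"]) (simp_all only: outer_edges_def mem_Collect_eq segment_2 out)
 qed (auto simp: outer_edges_def out)
 moreover have "pointed_at E p v" if "v \<in> V" for v using ptd_alpha[OF that pt[OF that]] unfolding pointed_iff .
 ultimately show ?thesis
  unfolding pointed_pseudo_triangulation_def pseudo_triangulation_def
  using nce interior_pseudo_triangles by blast
qed

end

theorem corollary1p2:
  fixes V :: "'a set" and E :: "'a set set"
  assumes "simple_graph V E" and "planar_graph V E"
  shows "(laman V E \<longleftrightarrow> generically_minimally_rigid V E) \<and>
         (generically_minimally_rigid V E \<longleftrightarrow> (\<exists>p. pointed_pseudo_triangulation V E p))"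
proof -
 interpret sgraph V E using assms(1) by unfold_locales (auto simp: simple_graph_def)
 have n: "2 <= card V" using assms(1) by (simp add: simple_graph_def)
 have "generically_minimally_rigid V E & (\<exists>p. pointed_pseudo_triangulation V E p)" if lam: "laman V E"
 proof -
  interpret lgraph V E using lam lgraph_iff[OF assms(1)] by blast
  obtain p0 where p0: "noncrossing_embedding V E p0" using assms(2) by (auto simp: planar_graph_def)
  interpret D0: drawn V E p0 by unfold_locales (use p0 not_isolated in auto)
  \<comment> \<open>Of the given drawing only its rotation system is retained; the pointed drawing
    is built anew from it.\<close>
  have "lrot V E D0.dang" by (intro lrot.intro lrot_axioms.intro D0.rsys_dang lgraph_axioms D0.planar_dang)
  then obtain p where "good V E D0.dang p" using pointed_embedding by blast
  then have g: "genpos V p" "ncross E p" "!!v. v \<in> V ==> ptd E p v" by (auto simp: good_def)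
  interpret D: drawn V E p by (rule drawn_genpos[OF g(1,2)])
  interpret P: pointed_drawing V E p by unfold_locales (use g in auto)
  have "stress_free V E p" by (rule D.pointed_stress_free[OF g(3)])
  then have "generically_minimally_rigid V E" by (rule generically_minimally_rigidI[OF _ card_E n])
  then show ?thesis using P.pointed_pseudo_triangulation by blast
 qed
 moreover have "laman V E" if "generically_minimally_rigid V E" by (rule generically_minimally_rigid_laman[OF that n])
 moreover have "laman V E" if "pointed_pseudo_triangulation V E p" for p by (rule pointed_pseudo_triangulation_laman[OF assms(1) that])
 ultimately show ?thesis by blast
qed

end
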